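(* (Di Francesco's 2004 conjecture.) Let $\Lambda$ be a dihedral domain with reference side, $N$ the number of black external edges, and $\mathrm{Sym}=\frac1N\sum_{k=0}^{N-1}R^k$. Let \[ |\Psi_\Lambda(t)\rangle=\sum_{\phi\in \mathrm{Fpl}_b(\Lambda)} t^{h(\phi)-1}|\Pi_b(\phi)\rangle,\qquad |\Psi'_\Lambda(t)\rangle=\sum_{\phi\in \mathrm{Fpl}_+(\Lambda)} t^{h(\phi)-1}|\Pi_+(\phi)\rangle . \] Then $\mathrm{Sym}\,|\Psi'_\Lambda(t)\rangle=\mathrm{Sym}\,|\Psi_\Lambda(t)\rangle$.
   Context: Link patterns. For $N=2n$, $\mathcal{LP}(2n)$ is the set of non-crossing perfect matchings of $N$ points labelled $1,\dots,N$ counter-clockwise on the boundary of a disk. $\mathcal{LP}^*(N)$ is the set of punctured link patterns: for $N=2n$, non-crossing perfect matchings of $N$ boundary points of a punctured disk up to isotopy in the punctured disk; for $N=2n-1$, non-crossing perfect matchings of the $N$ boundary points together with the puncture. $\mathbb{C}^{\mathcal{LP}}$ has basis $|\pi\rangle$, and $R|\pi\rangle=|R\pi\rangle$ where $R\pi$ has arc $\{i+1,j+1\}$ (mod $N$) for each arc $\{i,j\}$ of $\pi$. Dihedral domains. Take integers $L_x,L_y\ge1$, $a_1,\dots,a_4\ge0$, at least one $a_i=0$, and $a_1=0$. Start from the $L_x\times L_y$ rectangle of vertices of the square grid, attach pendant edges (to degree-1 external vertices) so that every grid vertex has degree 4; call the corners $A_1$ (bottom-left), $A_2,A_3,A_4$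 counter-clockwise; remove from $A_i$ an $a_i\times a_i$ square of vertices (non-overlapping), and join the $2a_i$ dangling edges pairwise starting from the concave corner, so that all remaining grid vertices have degree 4 (first kind). A domain of the second kind subdivides, by one degree-2 vertex, an internal edge of a first-kind domain whose two adjacent faces have at most 3 sides. Embed in a disk with external vertices on the boundary; there are $2N$ external edges, $N=L_x+L_y-\sum a_i$, labelled $1,\dots,2N$ counter-clockwise, edge $1$ being the downward pendant edge at corner vertex $A_1$. $\mathcal{LP}(\Lambda)$ is $\mathcal{LP}^*(N)$ with puncture at the degree-2 vertex (second kind), $\mathcal{LP}^*(N)$ with puncture in the face with at most 2 sides if a first-kind domain has one, and $\mathcal{LP}(N)$ otherwise. FPLs. An FPL is a black/white edge colouring with two black and two white edges at each degree-4 vertex, one of each at each degree-2 vertex, and external edges $1,\dots,2N$ alternating in colour. $\mathrm{Fpl}_+(\Lambda)$ (resp. $\mathrm{Fpl}_-(\Lambda)$): external edge 1 is black (resp. white). For a black external edge $v$, $\Pi(\phi,v)\in\mathcal{LP}(\Lambda)$ is the pairing induced by the black paths, with black external edges $v,v+2,\dots$ (mod $2N$) relabelled $1,\dots,N$; $\Pi_+(\phi)=\Pi(\phi,1)$ for $\phi\in\mathrm{Fpl}_+$. Refinement position. The reference side is the sequence of vertices $v_1,\dots,v_L$ where $v_j$ is the endpoint of external edge $j$, from $A_1$ to the next vertex carrying two external edges. At $v_j$ name its edges, counter-clockwise from external edge $j$, down, right, up, left; the tile is of type $c$ if the black edges are $\{$down,up$\}$ or $\{$left,right$\}$. Each FPL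 has exactly one $c$-tile on the reference side, at $v_{h(\phi)}$; $h(\phi)$ is the refinement position. $\mathrm{Fpl}_b(\Lambda)$ consists of FPLs whose external edge $h(\phi)$ is black, and $\Pi_b(\phi)=\Pi(\phi,h(\phi))$. *)

theory Defs
  imports
    Complex_Main
    "HOL-Library.Product_Plus"
    "HOL-Library.While_Combinator"
    "HOL-Library.Disjoint_Sets"
begin

section \<open>Link patterns\<close>

text \<open>
  A pattern of an even number of points in the punctured disk is stored as its set of arcs, where
  an arc with end points \<open>i\<close> and \<open>j\<close> is written \<open>(i, j)\<close> if the region cut off by the arc and the
  boundary interval running counter-clockwise from \<open>i\<close> to \<open>j\<close> does not contain the puncture.
  Together with the end points this fixes the isotopy class of the arc in the punctured disk.
  For an odd number of points \<open>None\<close> is the puncture; since the disk may be turned around the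
  puncture, the isotopy class carries no information beyond the matching.
\<close>

datatype link_pattern =
    Disk "nat set set"
  | Punctured_Even "(nat \<times> nat) set"
  | Punctured_Odd "nat option set set"

definition perfect_matching :: "'a set \<Rightarrow> 'a set set \<Rightarrow> bool" where
  "perfect_matching S M \<longleftrightarrow> partition_on S M \<and> (\<forall>e\<in>M. card e = 2)"

definition noncrossing :: "nat set set \<Rightarrow> bool" where
  "noncrossing M \<longleftrightarrow>
     \<not> (\<exists>i j k l. {i, j} \<in> M \<and> {k, l} \<in> M \<and> i < k \<and> k < j \<and> j < l)"

definition LP :: "nat \<Rightarrow> link_pattern set" where
  "LP N = {Disk M | M. perfect_matching {1..N} M \<and> noncrossing M}"

definition ccw_interval :: "nat \<Rightarrow> nat \<times> nat \<Rightarrow> nat set" where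
  "ccw_interval N = (\<lambda>(i, j). if i < j then {i..j} else {i..N} \<union> {1..j})"

text \<open>
  In the even case the puncture-free regions of two disjoint arcs are nested or disjoint.
  In the odd case any non-crossing family of arcs leaves room for the strand to the puncture.
\<close>

definition LP_punctured :: "nat \<Rightarrow> link_pattern set" where
  "LP_punctured N =
     (if even N then
        {Punctured_Even D | D.
           perfect_matching {1..N} ((\<lambda>(i, j). {i, j}) ` D) \<and>
           (\<forall>(i, j)\<in>D. (j, i) \<notin> D) \<and>
           (\<forall>p\<in>D. \<forall>q\<in>D.
              ccw_interval N p \<subseteq> ccw_interval N q \<or>
              ccw_interval N q \<subseteq> ccw_interval N p \<or>
              ccw_interval N p \<inter> ccw_interval N q = {})}
      else
        {Punctured_Odd M | M.
           perfect_matching (insert None (Some ` {1..N})) M \<and>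
           noncrossing {e. Some ` e \<in> M}})"

definition rot_label :: "nat \<Rightarrow> nat \<Rightarrow> nat" where
  "rot_label N i = i mod N + 1"

fun rot_pattern :: "nat \<Rightarrow> link_pattern \<Rightarrow> link_pattern" where
  "rot_pattern N (Disk M) = Disk ((`) (rot_label N) ` M)"
| "rot_pattern N (Punctured_Even D) = Punctured_Even (map_prod (rot_label N) (rot_label N) ` D)"
| "rot_pattern N (Punctured_Odd M) = Punctured_Odd ((`) (map_option (rot_label N)) ` M)"


section \<open>Plane graphs in the disk\<close>

text \<open>
  A graph embedded in the disk is given by its half-edges: \<open>mate\<close> exchanges the two halves of an
  edge, \<open>ccw\<close> sends a half-edge to the next one counter-clockwise around its vertex, and \<open>ext j\<close>
  is the half of the external edge \<open>j\<close> (\<open>1 \<le> j \<le> 2 * nblack\<close>) at its degree-1 vertex on the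
  boundary of the disk.  \<open>Half p d\<close> leaves the lattice point \<open>p\<close> in direction \<open>d\<close>; \<open>Mid p d\<close> is the
  half at the degree-2 vertex facing \<open>Half p d\<close>.
\<close>

datatype half = Half "int \<times> int" "int \<times> int" | Mid "int \<times> int" "int \<times> int"

text \<open>A puncture \<open>In_Face h\<close> lies in the face on the right of \<open>h\<close>, directed away from its vertex.\<close>

datatype puncture = Unpunctured | In_Face half | At_Vertex half

record fpl_domain =
  half_edges :: "half set"
  ccw :: "half \<Rightarrow> half"
  mate :: "half \<Rightarrow> half"
  nblack :: nat
  ext :: "nat \<Rightarrow> half"
  puncture :: puncture

definition vertex_of :: "fpl_domain \<Rightarrow> half \<Rightarrow> half set" where
  "vertex_of \<Lambda> h = range (\<lambda>n. (ccw \<Lambda> ^^ n) h)"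

definition edge_of :: "fpl_domain \<Rightarrow> half \<Rightarrow> half set" where
  "edge_of \<Lambda> h = {h, mate \<Lambda> h}"

definition ext_halves :: "fpl_domain \<Rightarrow> half set" where
  "ext_halves \<Lambda> = ext \<Lambda> ` {1..2 * nblack \<Lambda>}"

text \<open>
  The face on the right of \<open>h\<close>, as the set of half-edges having it on their right; its number of
  sides is the cardinality.  The faces touching the boundary of the disk all fall into the
  single orbit that contains the external half-edges, and are not inner.
\<close>

definition face_of :: "fpl_domain \<Rightarrow> half \<Rightarrow> half set" where
  "face_of \<Lambda> h = range (\<lambda>n. ((ccw \<Lambda> \<circ> mate \<Lambda>) ^^ n) h)"

definition inner_face :: "fpl_domain \<Rightarrow> half set \<Rightarrow> bool" where
  "inner_face \<Lambda> F \<longleftrightarrow> F \<inter> ext_halves \<Lambda> = {}"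


section \<open>Dihedral domains\<close>

definition rectangle :: "int \<Rightarrow> int \<Rightarrow> (int \<times> int) set" where
  "rectangle Lx Ly = {1..Lx} \<times> {1..Ly}"

definition corner_square :: "int \<Rightarrow> int \<Rightarrow> (nat \<Rightarrow> int) \<Rightarrow> nat \<Rightarrow> (int \<times> int) set" where
  "corner_square Lx Ly a i =
     (if i = 1 then {1..a 1} \<times> {1..a 1}
      else if i = 2 then {Lx - a 2 + 1..Lx} \<times> {1..a 2}
      else if i = 3 then {Lx - a 3 + 1..Lx} \<times> {Ly - a 3 + 1..Ly}
      else {1..a 4} \<times> {Ly - a 4 + 1..Ly})"

definition removed :: "int \<Rightarrow> int \<Rightarrow> (nat \<Rightarrow> int) \<Rightarrow> (int \<times> int) set" where
  "removed Lx Ly a = (\<Union>i\<in>{1..4}. corner_square Lx Ly a i)"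

definition grid :: "int \<Rightarrow> int \<Rightarrow> (nat \<Rightarrow> int) \<Rightarrow> (int \<times> int) set" where
  "grid Lx Ly a = rectangle Lx Ly - removed Lx Ly a"

definition dihedral_params :: "int \<Rightarrow> int \<Rightarrow> (nat \<Rightarrow> int) \<Rightarrow> bool" where
  "dihedral_params Lx Ly a \<longleftrightarrow>
     1 \<le> Lx \<and> 1 \<le> Ly \<and> (\<forall>i\<in>{1..4}. 0 \<le> a i \<and> a i \<le> min Lx Ly) \<and> a 1 = 0 \<and>
     (\<forall>i\<in>{1..4}. \<forall>j\<in>{1..4}. i \<noteq> j \<longrightarrow>
        corner_square Lx Ly a i \<inter> corner_square Lx Ly a j = {}) \<and>
     (1, 1) \<in> grid Lx Ly a"

text \<open>
  Joining of dangling edges: an edge that dangles into a removed square is continued straight on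
  up to the diagonal of the square through its concave corner, and is reflected there.  So the
  \<open>k\<close>-th dangling edge on one side, counted from the concave corner, is joined to the \<open>k\<close>-th one on
  the other side, and if two removed squares touch, the joinings are concatenated.
\<close>

definition reflect :: "int \<Rightarrow> int \<Rightarrow> (nat \<Rightarrow> int) \<Rightarrow> int \<times> int \<Rightarrow> int \<times> int \<Rightarrow> int \<times> int" where
  "reflect Lx Ly a p d =
     (let (x, y) = p; (u, v) = d in
      if p \<in> corner_square Lx Ly a 1 \<and> x = y \<or>
         p \<in> corner_square Lx Ly a 3 \<and> Lx - x = Ly - y
      then (- v, - u)
      else if p \<in> corner_square Lx Ly a 2 \<and> Lx - x = y - 1 \<or>
              p \<in> corner_square Lx Ly a 4 \<and> x - 1 = Ly - y
      then (v, u)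
      else (u, v))"

definition strand ::
    "int \<Rightarrow> int \<Rightarrow> (nat \<Rightarrow> int) \<Rightarrow> (int \<times> int) \<times> (int \<times> int) \<Rightarrow> (int \<times> int) \<times> (int \<times> int)" where
  "strand Lx Ly a =
     while (\<lambda>(p, d). p \<in> removed Lx Ly a)
           (\<lambda>(p, d). let e = reflect Lx Ly a p d in (p + e, e))"

fun first_mate :: "int \<Rightarrow> int \<Rightarrow> (nat \<Rightarrow> int) \<Rightarrow> half \<Rightarrow> half" where
  "first_mate Lx Ly a (Half p d) = (let (q, e) = strand Lx Ly a (p + d, d) in Half q (- e))"
| "first_mate Lx Ly a (Mid p d) = Mid p d"

fun first_ccw :: "int \<Rightarrow> int \<Rightarrow> (nat \<Rightarrow> int) \<Rightarrow> half \<Rightarrow> half" where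
  "first_ccw Lx Ly a (Half p (u, v)) =
     (if p \<in> grid Lx Ly a then Half p (- v, u) else Half p (u, v))"
| "first_ccw Lx Ly a (Mid p d) = Mid p d"

definition grid_halves :: "int \<Rightarrow> int \<Rightarrow> (nat \<Rightarrow> int) \<Rightarrow> half set" where
  "grid_halves Lx Ly a =
     {Half p d | p d. p \<in> grid Lx Ly a \<and> d \<in> {(0, -1), (1, 0), (0, 1), (-1, 0)}}"

text \<open>The pendant edges of the full rectangle, counter-clockwise from the bottom-left corner.\<close>

definition rectangle_pendants :: "int \<Rightarrow> int \<Rightarrow> half list" where
  "rectangle_pendants Lx Ly =
     map (\<lambda>x. Half (x, 0) (0, 1)) [1..Lx] @
     map (\<lambda>y. Half (Lx + 1, y) (-1, 0)) [1..Ly] @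
     map (\<lambda>x. Half (x, Ly + 1) (0, -1)) (rev [1..Lx]) @
     map (\<lambda>y. Half (0, y) (1, 0)) (rev [1..Ly])"

text \<open>Those leading to a remaining vertex; the pendant edges of removed vertices are dropped.\<close>

definition pendants :: "int \<Rightarrow> int \<Rightarrow> (nat \<Rightarrow> int) \<Rightarrow> half list" where
  "pendants Lx Ly a =
     filter (\<lambda>h. first_mate Lx Ly a h \<in> grid_halves Lx Ly a) (rectangle_pendants Lx Ly)"

definition first_kind_map :: "int \<Rightarrow> int \<Rightarrow> (nat \<Rightarrow> int) \<Rightarrow> fpl_domain" where
  "first_kind_map Lx Ly a =
     \<lparr>half_edges = grid_halves Lx Ly a \<union> set (pendants Lx Ly a),
      ccw = first_ccw Lx Ly a,
      mate = first_mate Lx Ly a,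
      nblack = nat (Lx + Ly - (\<Sum>i=1..4. a i)),
      ext = (\<lambda>j. pendants Lx Ly a ! (j - 1)),
      puncture = Unpunctured\<rparr>"

definition small_face_halves :: "fpl_domain \<Rightarrow> half set" where
  "small_face_halves \<Lambda> =
     {h \<in> half_edges \<Lambda>. inner_face \<Lambda> (face_of \<Lambda> h) \<and> card (face_of \<Lambda> h) \<le> 2}"

definition first_kind :: "int \<Rightarrow> int \<Rightarrow> (nat \<Rightarrow> int) \<Rightarrow> fpl_domain" where
  "first_kind Lx Ly a =
     (let \<Lambda> = first_kind_map Lx Ly a; S = small_face_halves \<Lambda>
      in \<Lambda>\<lparr>puncture := (if S = {} then Unpunctured else In_Face (SOME h. h \<in> S))\<rparr>)"

fun mid :: "half \<Rightarrow> half" where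
  "mid (Half p d) = Mid p d"
| "mid (Mid p d) = Mid p d"

definition subdivide :: "fpl_domain \<Rightarrow> half \<Rightarrow> fpl_domain" where
  "subdivide \<Lambda> h =
     (let g = mate \<Lambda> h in
      \<Lambda>\<lparr>half_edges := half_edges \<Lambda> \<union> {mid h, mid g},
        ccw := (ccw \<Lambda>)(mid h := mid g, mid g := mid h),
        mate := (mate \<Lambda>)(h := mid h, mid h := h, g := mid g, mid g := g),
        puncture := At_Vertex (mid h)\<rparr>)"

inductive dihedral_domain :: "fpl_domain \<Rightarrow> bool" where
  first: "dihedral_params Lx Ly a \<Longrightarrow> dihedral_domain (first_kind Lx Ly a)"
| second: "\<lbrakk>dihedral_params Lx Ly a; \<Lambda> = first_kind Lx Ly a; h \<in> half_edges \<Lambda>;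
            \<forall>g\<in>edge_of \<Lambda> h. inner_face \<Lambda> (face_of \<Lambda> g) \<and> card (face_of \<Lambda> g) \<le> 3\<rbrakk>
           \<Longrightarrow> dihedral_domain (subdivide \<Lambda> h)"

definition LP_domain :: "fpl_domain \<Rightarrow> link_pattern set" where
  "LP_domain \<Lambda> =
     (if puncture \<Lambda> = Unpunctured then LP (nblack \<Lambda>) else LP_punctured (nblack \<Lambda>))"


section \<open>Fully-packed loop configurations\<close>

definition next_ext :: "fpl_domain \<Rightarrow> nat \<Rightarrow> nat" where
  "next_ext \<Lambda> j = j mod (2 * nblack \<Lambda>) + 1"

text \<open>A colouring is identified with its set \<open>B\<close> of black edges.\<close>

definition black_at :: "fpl_domain \<Rightarrow> half set set \<Rightarrow> half \<Rightarrow> half set" where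
  "black_at \<Lambda> B h = {g \<in> vertex_of \<Lambda> h. edge_of \<Lambda> g \<in> B}"

definition black_ext :: "fpl_domain \<Rightarrow> half set set \<Rightarrow> nat \<Rightarrow> bool" where
  "black_ext \<Lambda> B j \<longleftrightarrow> edge_of \<Lambda> (ext \<Lambda> j) \<in> B"

definition Fpl :: "fpl_domain \<Rightarrow> half set set set" where
  "Fpl \<Lambda> =
     {B. B \<subseteq> edge_of \<Lambda> ` half_edges \<Lambda> \<and>
         (\<forall>h\<in>half_edges \<Lambda>.
            (card (vertex_of \<Lambda> h) = 4 \<longrightarrow> card (black_at \<Lambda> B h) = 2) \<and>
            (card (vertex_of \<Lambda> h) = 2 \<longrightarrow> card (black_at \<Lambda> B h) = 1)) \<and>
         (\<forall>j\<in>{1..2 * nblack \<Lambda>}. black_ext \<Lambda> B (next_ext \<Lambda> j) \<longleftrightarrow> \<not> black_ext \<Lambda> B j)}"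

definition black_step :: "fpl_domain \<Rightarrow> half set set \<Rightarrow> (half \<times> half) set" where
  "black_step \<Lambda> B =
     {(h, g). h \<in> half_edges \<Lambda> \<and> edge_of \<Lambda> h \<in> B \<and> (g = mate \<Lambda> h \<or> g \<in> black_at \<Lambda> B h)}"

definition black_path :: "fpl_domain \<Rightarrow> half set set \<Rightarrow> half \<Rightarrow> half set" where
  "black_path \<Lambda> B h = (black_step \<Lambda> B)\<^sup>* `` {h}"

text \<open>
  \<open>region \<Lambda> C h\<close> is the connected component of the complement in the disk of the path with
  half-edges \<open>C\<close> that lies immediately to the right of \<open>h\<close>.  It is obtained by walking along a face,
  without passing around a vertex on the boundary of the disk, and by crossing edges not in \<open>C\<close>;
  again \<open>g\<close> stands for the face on its right.
\<close>

definition region_step :: "fpl_domain \<Rightarrow> half set \<Rightarrow> (half \<times> half) set" where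
  "region_step \<Lambda> C =
     {(g, ccw \<Lambda> (mate \<Lambda> g)) | g. g \<in> half_edges \<Lambda> \<and> mate \<Lambda> g \<notin> ext_halves \<Lambda>} \<union>
     {(g, mate \<Lambda> g) | g. g \<in> half_edges \<Lambda> - C}"

definition region :: "fpl_domain \<Rightarrow> half set \<Rightarrow> half \<Rightarrow> half set" where
  "region \<Lambda> C h = (region_step \<Lambda> C \<union> (region_step \<Lambda> C)\<inverse>)\<^sup>* `` {h}"

text \<open>
  The external half-edge with new label \<open>k\<close> when \<open>v, v + 2, \<dots>\<close> are relabelled \<open>1, \<dots>, N\<close>.
\<close>

definition relabelled :: "fpl_domain \<Rightarrow> nat \<Rightarrow> nat \<Rightarrow> half" where
  "relabelled \<Lambda> v k = ext \<Lambda> ((v - 1 + 2 * (k - 1)) mod (2 * nblack \<Lambda>) + 1)"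

definition linked_labels :: "fpl_domain \<Rightarrow> half set set \<Rightarrow> nat \<Rightarrow> (nat \<times> nat) set" where
  "linked_labels \<Lambda> B v =
     {(k, l). k \<in> {1..nblack \<Lambda>} \<and> l \<in> {1..nblack \<Lambda>} \<and> k \<noteq> l \<and>
              relabelled \<Lambda> v l \<in> black_path \<Lambda> B (relabelled \<Lambda> v k)}"

text \<open>
  Looking inwards from the external vertex labelled \<open>k\<close>, the boundary interval going
  counter-clockwise from \<open>k\<close> is on the right.  A domain with a puncture in a face (resp. at a
  degree-2 vertex) has configurations only if \<open>N\<close> is even (resp. odd).
\<close>

definition link_pattern_of :: "fpl_domain \<Rightarrow> half set set \<Rightarrow> nat \<Rightarrow> link_pattern" where
  "link_pattern_of \<Lambda> B v =
     (let P = (\<lambda>k. black_path \<Lambda> B (relabelled \<Lambda> v k)) in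
      case puncture \<Lambda> of
        Unpunctured \<Rightarrow> Disk {{k, l} | k l. (k, l) \<in> linked_labels \<Lambda> B v}
      | In_Face p \<Rightarrow>
          Punctured_Even {(k, l) \<in> linked_labels \<Lambda> B v.
                            p \<notin> region \<Lambda> (P k) (relabelled \<Lambda> v k)}
      | At_Vertex p \<Rightarrow>
          Punctured_Odd ({{Some k, Some l} | k l. (k, l) \<in> linked_labels \<Lambda> B v} \<union>
                         {{Some k, None} | k. k \<in> {1..nblack \<Lambda>} \<and> P k \<inter> vertex_of \<Lambda> p \<noteq> {}}))"


section \<open>Refinement position\<close>

text \<open>
  The reference side ends at the first corner, i.e. at the first vertex where two cyclically
  consecutive external edges \<open>j\<close> and \<open>j + 1\<close> leave as neighbours.
\<close>

definition side_length :: "fpl_domain \<Rightarrow> nat" where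
  "side_length \<Lambda> =
     (LEAST j. 1 \<le> j \<and> ccw \<Lambda> (mate \<Lambda> (ext \<Lambda> j)) = mate \<Lambda> (ext \<Lambda> (next_ext \<Lambda> j)))"

definition c_tile :: "fpl_domain \<Rightarrow> half set set \<Rightarrow> nat \<Rightarrow> bool" where
  "c_tile \<Lambda> B j \<longleftrightarrow>
     (let down = mate \<Lambda> (ext \<Lambda> j); right = ccw \<Lambda> down; up = ccw \<Lambda> right; left = ccw \<Lambda> up
      in black_at \<Lambda> B down = {down, up} \<or> black_at \<Lambda> B down = {left, right})"

definition refinement_pos :: "fpl_domain \<Rightarrow> half set set \<Rightarrow> nat" where
  "refinement_pos \<Lambda> B = (THE j. j \<in> {1..side_length \<Lambda>} \<and> c_tile \<Lambda> B j)"

definition Fpl_plus :: "fpl_domain \<Rightarrow> half set set set" where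
  "Fpl_plus \<Lambda> = {B \<in> Fpl \<Lambda>. black_ext \<Lambda> B 1}"

definition Pi_plus :: "fpl_domain \<Rightarrow> half set set \<Rightarrow> link_pattern" where
  "Pi_plus \<Lambda> B = link_pattern_of \<Lambda> B 1"

definition Fpl_b :: "fpl_domain \<Rightarrow> half set set set" where
  "Fpl_b \<Lambda> = {B \<in> Fpl \<Lambda>. black_ext \<Lambda> B (refinement_pos \<Lambda> B)}"

definition Pi_b :: "fpl_domain \<Rightarrow> half set set \<Rightarrow> link_pattern" where
  "Pi_b \<Lambda> B = link_pattern_of \<Lambda> B (refinement_pos \<Lambda> B)"


section \<open>Vectors indexed by link patterns\<close>

definition ket :: "link_pattern \<Rightarrow> link_pattern \<Rightarrow> complex" where
  "ket \<pi> = (\<lambda>\<sigma>. if \<sigma> = \<pi> then 1 else 0)"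

definition rot_op :: "fpl_domain \<Rightarrow> (link_pattern \<Rightarrow> complex) \<Rightarrow> link_pattern \<Rightarrow> complex" where
  "rot_op \<Lambda> \<psi> = (\<lambda>\<sigma>. \<Sum>\<pi>\<in>LP_domain \<Lambda>. \<psi> \<pi> * ket (rot_pattern (nblack \<Lambda>) \<pi>) \<sigma>)"

definition Sym :: "fpl_domain \<Rightarrow> (link_pattern \<Rightarrow> complex) \<Rightarrow> link_pattern \<Rightarrow> complex" where
  "Sym \<Lambda> \<psi> = (\<lambda>\<sigma>. 1 / of_nat (nblack \<Lambda>) * (\<Sum>k<nblack \<Lambda>. (rot_op \<Lambda> ^^ k) \<psi> \<sigma>))"

definition Psi :: "fpl_domain \<Rightarrow> complex \<Rightarrow> link_pattern \<Rightarrow> complex" where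
  "Psi \<Lambda> t = (\<lambda>\<sigma>. \<Sum>B\<in>Fpl_b \<Lambda>. t ^ (refinement_pos \<Lambda> B - 1) * ket (Pi_b \<Lambda> B) \<sigma>)"

definition Psi' :: "fpl_domain \<Rightarrow> complex \<Rightarrow> link_pattern \<Rightarrow> complex" where
  "Psi' \<Lambda> t = (\<lambda>\<sigma>. \<Sum>B\<in>Fpl_plus \<Lambda>. t ^ (refinement_pos \<Lambda> B - 1) * ket (Pi_plus \<Lambda> B) \<sigma>)"

end

theory Submission imports Defs begin

text \<open>
  The proof is Wieland's gyration, run on one of the two parity classes of faces.  The half-edges of a
  dihedral domain are two-coloured so that every face is monochromatic and neighbouring faces differ;
  faces have at most four sides once the external vertices are joined along the boundary.
  Complementing the edges of each face of the class that contains the boundary faces next to the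
  black external edges \<open>j\<close> and \<open>j + 1\<close>, except for inner faces whose edges alternate in colour, is a
  bijection of the FPLs that moves the link pattern on by one external edge.

  It moves the refinement position by at most one: a position \<open>h\<close> with white external edge becomes
  either position \<open>h\<close> with black edge or position \<open>h + 1\<close> with white edge, and a position with black
  edge becomes \<open>h\<close> with white edge or \<open>h - 1\<close> with black edge.  Summing a quantity that is constant
  under gyration, induction on \<open>h\<close> shows that the two colours contribute equally for each \<open>h\<close>.  The
  two sides of the theorem differ only in which colour is chosen at even \<open>h\<close>.

  For the geometry, the strands crossing the removed squares are followed cell by cell: each removed
  cell keeps exactly two live directions, and two parallel neighbouring strands stay neighbours until
  they bound a common face.
\<close>

text \<open>Four is the largest number of sides for which a face whose colours do not alternate has
  its black sides in one run, so that it carries at most one path piece; with five sides two pieces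
  may occur. This is why an edge may be subdivided only between faces of at most three sides. All
  external edges flip under gyration, so the acting class changes each time and patterns are
  compared only up to the choice of the first black edge. \<open>Sym\<close> removes this choice,
  but \<open>rot_op\<close> sums over \<open>LP_domain\<close> and annihilates every other ket: one
  has to prove that each pattern read off really is a non-crossing, possibly punctured, pattern.
  Only this calls for topology, in the form of two properties of the map: connectedness, and the
  fact that an edge set of even degree at all inner vertices bounds a set of faces. Paths and
  regions are not followed step by step during a gyration. They are tested by Boolean functions on
  half-edges that are constant on them, and gyration transforms these functions explicitly.\<close>

definition prev_ext :: "fpl_domain \<Rightarrow> nat \<Rightarrow> nat" where
  "prev_ext \<Lambda> j = (if j = 1 then 2 * nblack \<Lambda> else j - 1)"

text \<open>External vertices are closed up along the boundary of the disk, so that the boundary faces become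
  face orbits as well.\<close>

definition turn :: "fpl_domain \<Rightarrow> half \<Rightarrow> half" where
  "turn \<Lambda> h =
     (if h \<in> ext_halves \<Lambda> then ext \<Lambda> (prev_ext \<Lambda> (inv_into {1..2 * nblack \<Lambda>} (ext \<Lambda>) h))
      else ccw \<Lambda> h)"

definition face_step :: "fpl_domain \<Rightarrow> half \<Rightarrow> half" where
  "face_step \<Lambda> h = turn \<Lambda> (mate \<Lambda> h)"

text \<open>The order of \<open>ccw\<close> at \<open>h\<close> divides 4 but not 2, hence is
  exactly 4; likewise it is exactly 2 for \<open>bivalent\<close>.\<close>

definition quartic :: "fpl_domain \<Rightarrow> half \<Rightarrow> bool" where
  "quartic \<Lambda> h \<longleftrightarrow>
     ccw \<Lambda> (ccw \<Lambda> (ccw \<Lambda> (ccw \<Lambda> h))) = h \<and> ccw \<Lambda> (ccw \<Lambda> h) \<noteq> h"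

definition bivalent :: "fpl_domain \<Rightarrow> half \<Rightarrow> bool" where
  "bivalent \<Lambda> h \<longleftrightarrow> ccw \<Lambda> (ccw \<Lambda> h) = h \<and> ccw \<Lambda> h \<noteq> h"

text \<open>\<open>C\<close> is the boundary of the set of faces \<open>\<chi>\<close>, where \<open>\<chi> h\<close> refers to the face on the right of \<open>h\<close>.\<close>

definition bounds :: "fpl_domain \<Rightarrow> half set \<Rightarrow> (half \<Rightarrow> bool) \<Rightarrow> bool" where
  "bounds \<Lambda> C \<chi> \<longleftrightarrow>
     (\<forall>h\<in>half_edges \<Lambda>. mate \<Lambda> h \<notin> ext_halves \<Lambda> \<longrightarrow> \<chi> (ccw \<Lambda> (mate \<Lambda> h)) = \<chi> h) \<and>
     (\<forall>h\<in>half_edges \<Lambda>. \<chi> (mate \<Lambda> h) \<noteq> \<chi> h \<longleftrightarrow> h \<in> C)"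

text \<open>Twice \<open>face_step\<close> being the identity covers faces of one and of two sides
  alike. In the vertex case \<open>p\<close> and \<open>ccw \<Lambda> p\<close> are the only inner
  half-edges exempt from degree 4.\<close>

definition puncture_ok :: "fpl_domain \<Rightarrow> bool" where
  "puncture_ok \<Lambda> \<longleftrightarrow>
     (case puncture \<Lambda> of
        Unpunctured \<Rightarrow> \<forall>h\<in>half_edges \<Lambda> - ext_halves \<Lambda>. quartic \<Lambda> h
      | In_Face p \<Rightarrow>
          (\<forall>h\<in>half_edges \<Lambda> - ext_halves \<Lambda>. quartic \<Lambda> h) \<and> p \<in> half_edges \<Lambda> \<and>
          face_step \<Lambda> (face_step \<Lambda> p) = p \<and> p \<notin> ext_halves \<Lambda> \<and> face_step \<Lambda> p \<notin> ext_halves \<Lambda>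
      | At_Vertex p \<Rightarrow>
          p \<in> half_edges \<Lambda> - ext_halves \<Lambda> \<and> bivalent \<Lambda> p \<and>
          (\<forall>h\<in>half_edges \<Lambda> - ext_halves \<Lambda>. h \<notin> {p, ccw \<Lambda> p} \<longrightarrow> quartic \<Lambda> h))"

text \<open>Exactly two of the four values hold. The grouping into pairs matches the two opposite
  corners of a vertex that belong to faces of one parity.\<close>

definition two_of :: "bool \<Rightarrow> bool \<Rightarrow> bool \<Rightarrow> bool \<Rightarrow> bool" where
  "two_of p q r s \<longleftrightarrow> (if p = q then r = s \<and> r \<noteq> p else r \<noteq> s)"

section \<open>Vertex rules and abstract plane domains\<close>

lemma card_filter: "finite A \<Longrightarrow> card {g \<in> A. P g} = (\<Sum>g\<in>A. if P g then 1 else 0)"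
  by (simp add: sum.inter_filter[symmetric])

lemma card_filter_four:
  assumes "distinct [w, x, y, z]"
  shows "card {g \<in> {w, x, y, z}. P g} = 2 \<longleftrightarrow> two_of (P w) (P x) (P y) (P z)"
  using assms unfolding card_filter[OF finite.insertI[OF finite.insertI[OF finite.insertI[OF
        finite.insertI[OF finite.emptyI]]]]]
  by (cases "P w"; cases "P x"; cases "P y"; cases "P z") (simp_all add: two_of_def)

lemma card_filter_two:
  assumes "x \<noteq> y"
  shows "card {g \<in> {x, y}. P g} = 1 \<longleftrightarrow> P x \<noteq> P y"
  using assms unfolding card_filter[OF finite.insertI[OF finite.insertI[OF finite.emptyI]]]
  by (cases "P x"; cases "P y") simp_all

text \<open>All that gyration needs of a domain; \<open>par\<close> is the colour of the face on the
  right. \<open>boundary_face\<close> says that two consecutive external edges bound, with the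
  boundary of the disk, a face with at most one further edge. \<open>planar\<close> is a
  combinatorial Jordan curve theorem; it asks for no parity at external vertices, so a path between
  two of them counts as closed along the boundary.\<close>

locale plane_domain =
  fixes \<Lambda> :: fpl_domain and par :: "half \<Rightarrow> bool"
  assumes finite_halves: "finite (half_edges \<Lambda>)"
    and mate_in: "h \<in> half_edges \<Lambda> \<Longrightarrow> mate \<Lambda> h \<in> half_edges \<Lambda>"
    and mate_mate: "h \<in> half_edges \<Lambda> \<Longrightarrow> mate \<Lambda> (mate \<Lambda> h) = h"
    and ccw_in: "h \<in> half_edges \<Lambda> \<Longrightarrow> ccw \<Lambda> h \<in> half_edges \<Lambda>"
    and nblack_pos: "1 \<le> nblack \<Lambda>"
    and ext_in: "j \<in> {1..2 * nblack \<Lambda>} \<Longrightarrow> ext \<Lambda> j \<in> half_edges \<Lambda>"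
    and inj_ext: "inj_on (ext \<Lambda>) {1..2 * nblack \<Lambda>}"
    and ccw_ext: "h \<in> ext_halves \<Lambda> \<Longrightarrow> ccw \<Lambda> h = h"
    and quartic_mate_ext: "h \<in> ext_halves \<Lambda> \<Longrightarrow> quartic \<Lambda> (mate \<Lambda> h)"
    and degree: "h \<in> half_edges \<Lambda> - ext_halves \<Lambda> \<Longrightarrow> quartic \<Lambda> h \<or> bivalent \<Lambda> h"
    and par_mate: "h \<in> half_edges \<Lambda> \<Longrightarrow> par (mate \<Lambda> h) \<longleftrightarrow> \<not> par h"
    and par_ccw: "h \<in> half_edges \<Lambda> - ext_halves \<Lambda> \<Longrightarrow> par (ccw \<Lambda> h) \<longleftrightarrow> \<not> par h"
    and boundary_face: "j \<in> {1..2 * nblack \<Lambda>} \<Longrightarrow>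
          ccw \<Lambda> (mate \<Lambda> (ext \<Lambda> j)) = mate \<Lambda> (ext \<Lambda> (next_ext \<Lambda> j)) \<or>
          ccw \<Lambda> (mate \<Lambda> (ccw \<Lambda> (mate \<Lambda> (ext \<Lambda> j)))) = mate \<Lambda> (ext \<Lambda> (next_ext \<Lambda> j))"
    and face_period: "h \<in> half_edges \<Lambda> \<Longrightarrow> \<exists>n\<in>{1..4}. (face_step \<Lambda> ^^ n) h = h"
    and corner: "ccw \<Lambda> (mate \<Lambda> (ext \<Lambda> (2 * nblack \<Lambda>))) = mate \<Lambda> (ext \<Lambda> 1)"
    and connected: "\<lbrakk>\<And>h. h \<in> half_edges \<Lambda> \<Longrightarrow> \<chi> (mate \<Lambda> h) = \<chi> h \<and> \<chi> (ccw \<Lambda> h) = (\<chi> h :: bool);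
          h \<in> half_edges \<Lambda>; g \<in> half_edges \<Lambda>\<rbrakk> \<Longrightarrow> \<chi> g = \<chi> h"
    and planar: "\<lbrakk>C \<subseteq> half_edges \<Lambda>; \<And>h. h \<in> C \<Longrightarrow> mate \<Lambda> h \<in> C;
          \<And>h. h \<in> half_edges \<Lambda> - ext_halves \<Lambda> \<Longrightarrow> even (card (C \<inter> vertex_of \<Lambda> h))\<rbrakk>
          \<Longrightarrow> \<exists>\<chi>. bounds \<Lambda> C \<chi>"
    and puncture_ok: "puncture_ok \<Lambda>"
begin

abbreviation "H \<equiv> half_edges \<Lambda>"
abbreviation "X \<equiv> ext_halves \<Lambda>"
abbreviation "N \<equiv> nblack \<Lambda>"
abbreviation "J \<equiv> {1..2 * nblack \<Lambda>}"
abbreviation "m \<equiv> mate \<Lambda>"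
abbreviation "c \<equiv> ccw \<Lambda>"
abbreviation "e \<equiv> ext \<Lambda>"
abbreviation "f \<equiv> face_step \<Lambda>"
abbreviation "nx \<equiv> next_ext \<Lambda>"
abbreviation "orb h \<equiv> range (\<lambda>n. (face_step \<Lambda> ^^ n) h)"

lemma nx_in: "nx j \<in> J"
  using nblack_pos by (auto simp: next_ext_def Suc_le_eq)

lemma prev_nx: "j \<in> J \<Longrightarrow> prev_ext \<Lambda> (nx j) = j"
  by (cases "j = 2 * N") (auto simp: next_ext_def prev_ext_def)

lemma nx_prev: "j \<in> J \<Longrightarrow> nx (prev_ext \<Lambda> j) = j"
  by (auto simp: next_ext_def prev_ext_def)

lemma prev_in: "j \<in> J \<Longrightarrow> prev_ext \<Lambda> j \<in> J"
  using nblack_pos by (auto simp: prev_ext_def)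

lemma e_inX: "j \<in> J \<Longrightarrow> e j \<in> X"
  by (auto simp: ext_halves_def)

lemma XE: assumes "h \<in> X" obtains j where "j \<in> J" "h = e (nx j)"
  using assms nx_prev prev_in by (metis ext_halves_def imageE)

lemma X_sub: "h \<in> X \<Longrightarrow> h \<in> H"
  using ext_in by (auto simp: ext_halves_def)

lemma e_eq: "i \<in> J \<Longrightarrow> j \<in> J \<Longrightarrow> e i = e j \<longleftrightarrow> i = j"
  by (rule inj_on_eq_iff[OF inj_ext])

lemma turn_ext: "j \<in> J \<Longrightarrow> turn \<Lambda> (e (nx j)) = e j"
  using inv_into_f_f[OF inj_ext nx_in[of j]] e_inX[OF nx_in[of j]] prev_nx unfolding turn_def by simp

lemma turn_inner: "h \<notin> X \<Longrightarrow> turn \<Lambda> h = c h"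
  by (simp add: turn_def)

lemma ccw_notX: assumes "h \<in> H" "h \<notin> X" shows "c h \<notin> X"
proof
  assume "c h \<in> X"
  then have "c (c h) = c h" by (rule ccw_ext)
  with degree[of h] assms show False
    using \<open>c h \<in> X\<close> by (auto simp: quartic_def bivalent_def)
qed

lemma mate_X: assumes "h \<in> X" shows "m h \<notin> X"
proof
  assume "m h \<in> X"
  then have "c (m h) = m h" by (rule ccw_ext)
  then show False using quartic_mate_ext[OF assms] by (simp add: quartic_def)
qed

lemma turn_in: "h \<in> H \<Longrightarrow> turn \<Lambda> h \<in> H"
  by (metis XE turn_ext turn_inner ccw_in ext_in)

lemma f_in: "h \<in> H \<Longrightarrow> f h \<in> H"
  by (simp add: face_step_def turn_in mate_in)

lemma f_inner: "m h \<notin> X \<Longrightarrow> f h = c (m h)"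
  by (simp add: face_step_def turn_inner)

lemma f_mate: "h \<in> H \<Longrightarrow> h \<notin> X \<Longrightarrow> f (m h) = c h"
  by (simp add: f_inner mate_mate)

lemma f_ext: "j \<in> J \<Longrightarrow> f (m (e (nx j))) = e j"
  using mate_mate[OF ext_in[OF nx_in]] turn_ext unfolding face_step_def by simp

text \<open>Closed up along the boundary, the face between two consecutive external edges is a
  2-cycle of \<open>face_step\<close> at a corner of the domain and a 3-cycle along a side.\<close>

lemma boundary_cases:
  assumes "j \<in> J"
  obtains (two) "c (m (e j)) = m (e (nx j))" "f (e j) = m (e (nx j))" "f (f (e j)) = e j"
  | (three) "c (m (c (m (e j)))) = m (e (nx j))" "c (m (e j)) = f (e j)"
      "f (f (e j)) = m (e (nx j))" "f (f (f (e j))) = e j" "m (f (e j)) \<notin> X"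
proof (cases "c (m (e j)) = m (e (nx j))")
  case True
  have "m (e j) \<notin> X" using assms e_inX mate_X by blast
  then have "f (e j) = m (e (nx j))" using True by (simp add: f_inner)
  then show ?thesis using two True assms f_ext by simp
next
  case False
  have notX: "m (e j) \<notin> X" using assms e_inX mate_X by blast
  have eq: "c (m (c (m (e j)))) = m (e (nx j))" using boundary_face[OF assms] False by simp
  have "m (c (m (e j))) \<notin> X"
  proof
    assume *: "m (c (m (e j))) \<in> X"
    then have "m (e (nx j)) \<in> X" using eq ccw_ext by metis
    then show False using mate_X e_inX nx_in by blast
  qed
  moreover have 1: "f (e j) = c (m (e j))" by (rule f_inner[OF notX])
  ultimately have 2: "f (f (e j)) = m (e (nx j))" using eq f_inner by simp
  then have 3: "f (f (f (e j))) = e j" using f_ext[OF assms] by simp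
  show ?thesis
    using three[OF eq 1[symmetric] 2 3] \<open>m (c (m (e j))) \<notin> X\<close> unfolding 1 .
qed

text \<open>The face between two consecutive external edges is monochromatic, and one more reversal
  of an edge leads to the next external vertex. Hence \<open>turn\<close> flips the parity at
  external vertices as \<open>ccw\<close> does elsewhere, and boundary faces become monochromatic
  orbits.\<close>

lemma par_f_ext: assumes "j \<in> J" shows "par (e (nx j)) \<longleftrightarrow> \<not> par (e j)"
proof -
  have 1: "m (e j) \<in> H" "m (e j) \<notin> X" "e (nx j) \<in> H"
    using assms ext_in mate_in e_inX mate_X nx_in by blast+
  then have *: "par (c (m (e j))) = par (e j)"
    using par_ccw par_mate assms ext_in by auto
  from assms show ?thesis
  proof (cases rule: boundary_cases)
    case two
    then show ?thesis using * 1 par_mate by metis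
  next
    case three
    have "par (c (m (c (m (e j))))) = par (c (m (e j)))"
      using three 1 par_ccw par_mate ccw_in mate_in by (metis DiffI)
    then show ?thesis using three * 1 par_mate by metis
  qed
qed

lemma par_turn: "h \<in> H \<Longrightarrow> par (turn \<Lambda> h) \<longleftrightarrow> \<not> par h"
proof (cases "h \<in> X")
  case True
  then obtain j where "j \<in> J" "h = e (nx j)" by (rule XE)
  then show ?thesis using turn_ext par_f_ext by simp
next
  case False
  assume "h \<in> H"
  then show ?thesis using False par_ccw by (simp add: turn_inner)
qed

lemma par_f: "h \<in> H \<Longrightarrow> par (f h) = par h"
  by (simp add: face_step_def par_turn par_mate mate_in)

lemma orb_in: "h \<in> H \<Longrightarrow> x \<in> orb h \<Longrightarrow> x \<in> H"
proof -
  assume "h \<in> H"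
  then have "(f ^^ n) h \<in> H" for n by (induction n) (auto simp: f_in)
  then show "x \<in> orb h \<Longrightarrow> x \<in> H" by auto
qed

lemma orb_par: "h \<in> H \<Longrightarrow> x \<in> orb h \<Longrightarrow> par x = par h"
proof -
  assume h: "h \<in> H"
  have "par ((f ^^ n) h) = par h" for n
    by (induction n) (use h orb_in par_f in auto)
  then show "x \<in> orb h \<Longrightarrow> par x = par h" by auto
qed

lemma orb_self: "h \<in> orb h"
  by (metis funpow_0 rangeI)

lemma orb_f: assumes "h \<in> H" shows "orb (f h) = orb h"
proof
  show "orb (f h) \<subseteq> orb h"
  proof
    fix x assume "x \<in> orb (f h)"
    then obtain k where "x = (f ^^ k) (f h)" by auto
    then have "x = (f ^^ Suc k) h" by (simp add: funpow_swap1)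
    then show "x \<in> orb h" by blast
  qed
  obtain n where n: "n \<in> {1..4}" "(f ^^ n) h = h" using face_period assms by blast
  show "orb h \<subseteq> orb (f h)"
  proof
    fix x assume "x \<in> orb h"
    then obtain k where k: "x = (f ^^ k) h" by auto
    have "x = (f ^^ (k + n)) h" using k n by (simp add: funpow_add)
    moreover have "k + n = Suc (k + n - 1)" using n by simp
    ultimately have "x = (f ^^ Suc (k + n - 1)) h" by simp
    then have "x = (f ^^ (k + n - 1)) (f h)" by (simp add: funpow_swap1)
    then show "x \<in> orb (f h)" by blast
  qed
qed

lemma orb_eq: assumes "h \<in> H" "x \<in> orb h" shows "orb x = orb h"
proof -
  have "orb ((f ^^ n) h) = orb h" for n
    by (induction n) (use assms orb_f orb_in in auto)
  then show ?thesis using assms by auto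
qed

lemma orb_period:
  assumes "(f ^^ n) h = h" "n > 0"
  shows "orb h = (\<lambda>k. (f ^^ k) h) ` {..<n}"
proof
  show "orb h \<subseteq> (\<lambda>k. (f ^^ k) h) ` {..<n}"
  proof
    fix x assume "x \<in> orb h"
    then obtain k where "x = (f ^^ k) h" by auto
    then have "x = (f ^^ (k mod n)) h" using funpow_mod_eq[OF assms(1)] by metis
    then show "x \<in> (\<lambda>k. (f ^^ k) h) ` {..<n}" using assms(2) by auto
  qed
qed auto

lemma orb_cases:
  assumes "h \<in> H"
  obtains "orb h = {h}" "f h = h"
  | "orb h = {h, f h}" "f (f h) = h"
  | "orb h = {h, f h, f (f h)}" "f (f (f h)) = h"
  | "orb h = {h, f h, f (f h), f (f (f h))}" "f (f (f (f h))) = h"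
proof -
  obtain n where n: "n \<in> {1..4}" "(f ^^ n) h = h" using face_period assms by blast
  consider "n = 1" | "n = 2" | "n = 3" | "n = 4" using n by force
  then show thesis
  proof cases
    case 1
    then have "f h = h" using n by simp
    moreover have "orb h = {h}" using orb_period[OF n(2)] 1 by (simp add: lessThan_Suc)
    ultimately show ?thesis using that by blast
  next
    case 2
    then have "f (f h) = h" using n by (simp add: numeral_2_eq_2)
    moreover have "orb h = {h, f h}" using orb_period[OF n(2)] 2
      by (simp add: numeral_2_eq_2 lessThan_Suc insert_commute)
    ultimately show ?thesis using that by blast
  next
    case 3
    then have "f (f (f h)) = h" using n by (simp add: numeral_3_eq_3)
    moreover have "orb h = {h, f h, f (f h)}" using orb_period[OF n(2)] 3
      by (simp add: numeral_3_eq_3 lessThan_Suc insert_commute)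
    ultimately show ?thesis using that by blast
  next
    case 4
    then have "f (f (f (f h))) = h" using n by (simp add: eval_nat_numeral)
    moreover have "orb h = {h, f h, f (f h), f (f (f h))}" using orb_period[OF n(2)] 4
      by (simp add: eval_nat_numeral lessThan_Suc insert_commute)
    ultimately show ?thesis using that by blast
  qed
qed

section \<open>Vertices as orbits of \<open>ccw\<close>\<close>

lemma vertex_quartic:
  assumes "quartic \<Lambda> h"
  shows "vertex_of \<Lambda> h = {h, c h, c (c h), c (c (c h))}" "distinct [h, c h, c (c h), c (c (c h))]"
proof -
  have 4: "(c ^^ 4) h = h" using assms by (simp add: quartic_def eval_nat_numeral)
  have "(c ^^ n) h \<in> (\<lambda>n. (c ^^ n) h) ` {0, 1, 2, 3}" for n
  proof -
    have "n mod 4 \<in> {0, 1, 2, 3}" by auto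
    then show ?thesis using funpow_mod_eq[OF 4, of n] by (metis imageI)
  qed
  then have "vertex_of \<Lambda> h = (\<lambda>n. (c ^^ n) h) ` {0, 1, 2, 3}" unfolding vertex_of_def by blast
  then show "vertex_of \<Lambda> h = {h, c h, c (c h), c (c (c h))}" by (simp add: eval_nat_numeral)
  show "distinct [h, c h, c (c h), c (c (c h))]" using assms by (auto simp: quartic_def)
qed

lemma vertex_bivalent:
  assumes "bivalent \<Lambda> h"
  shows "vertex_of \<Lambda> h = {h, c h}"
proof -
  have 2: "(c ^^ 2) h = h" using assms by (simp add: bivalent_def eval_nat_numeral)
  have "(c ^^ n) h \<in> (\<lambda>n. (c ^^ n) h) ` {0, 1}" for n
  proof -
    have "n mod 2 \<in> {0, 1}" by auto
    then show ?thesis using funpow_mod_eq[OF 2, of n] by (metis imageI)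
  qed
  then have "vertex_of \<Lambda> h = (\<lambda>n. (c ^^ n) h) ` {0, 1}" unfolding vertex_of_def by blast
  then show ?thesis by simp
qed

lemma vertex_ext: "h \<in> X \<Longrightarrow> vertex_of \<Lambda> h = {h}"
proof -
  assume "h \<in> X"
  then have "(c ^^ n) h = h" for n by (induction n) (auto simp: ccw_ext)
  then show ?thesis by (auto simp: vertex_of_def)
qed

lemma vertex_in: assumes "h \<in> H" "g \<in> vertex_of \<Lambda> h" shows "g \<in> H"
proof -
  have "(c ^^ n) h \<in> H" for n by (induction n) (use assms ccw_in in auto)
  then show ?thesis using assms by (auto simp: vertex_of_def)
qed

lemma vertex_self: "h \<in> vertex_of \<Lambda> h"
  unfolding vertex_of_def by (metis funpow_0 rangeI)

lemma vertex_period: assumes "h \<in> H" obtains n where "n > 0" "(c ^^ n) h = h"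
proof -
  consider "h \<in> X" | "quartic \<Lambda> h" | "bivalent \<Lambda> h" using degree assms by blast
  then show ?thesis
  proof cases
    case 1 then show ?thesis using that[of 1] by (simp add: ccw_ext)
  next
    case 2 then show ?thesis using that[of 4] by (simp add: quartic_def eval_nat_numeral)
  next
    case 3 then show ?thesis using that[of 2] by (simp add: bivalent_def eval_nat_numeral)
  qed
qed

lemma vertex_eq: assumes "h \<in> H" "g \<in> vertex_of \<Lambda> h" shows "vertex_of \<Lambda> g = vertex_of \<Lambda> h"
proof -
  obtain k where k: "g = (c ^^ k) h" using assms by (auto simp: vertex_of_def)
  obtain n where n: "n > 0" "(c ^^ n) h = h" using vertex_period assms by blast
  have "(c ^^ (n * k)) h = h" using funpow_mod_eq[OF n(2), of "n * k"] by simp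
  moreover have "n * k = (n * k - k) + k" using n by (cases n) auto
  ultimately have "(c ^^ (n * k - k)) g = h" using k by (metis funpow_add comp_apply)
  then have h: "h = (c ^^ (n * k - k)) g" by simp
  have sub: "vertex_of \<Lambda> ((c ^^ i) x) \<subseteq> vertex_of \<Lambda> x" for i x
    unfolding vertex_of_def
  proof
    fix y assume "y \<in> range (\<lambda>n. (c ^^ n) ((c ^^ i) x))"
    then obtain l where "y = (c ^^ l) ((c ^^ i) x)" by blast
    then have "y = (c ^^ (l + i)) x" by (simp add: funpow_add)
    then show "y \<in> range (\<lambda>n. (c ^^ n) x)" by blast
  qed
  have "vertex_of \<Lambda> g \<subseteq> vertex_of \<Lambda> h" using sub[of k h] unfolding k[symmetric] .
  moreover have "vertex_of \<Lambda> h \<subseteq> vertex_of \<Lambda> g"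
    using sub[of "n * k - k" g] unfolding h[symmetric] .
  ultimately show ?thesis by (rule subset_antisym)
qed

section \<open>FPLs as Boolean functions on half-edges\<close>

definition fpl :: "(half \<Rightarrow> bool) \<Rightarrow> bool" where
  "fpl b \<longleftrightarrow> (\<forall>h. b h \<longrightarrow> h \<in> H) \<and> (\<forall>h\<in>H. b (m h) = b h) \<and>
     (\<forall>h\<in>H. h \<notin> X \<longrightarrow>
        (quartic \<Lambda> h \<longrightarrow> two_of (b h) (b (c h)) (b (c (c h))) (b (c (c (c h))))) \<and>
        (bivalent \<Lambda> h \<longrightarrow> b (c h) = (\<not> b h))) \<and>
     (\<forall>j\<in>J. b (e (nx j)) = (\<not> b (e j)))"

definition edges_of :: "(half \<Rightarrow> bool) \<Rightarrow> half set set" where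
  "edges_of b = edge_of \<Lambda> ` {h \<in> H. b h}"

definition is_black :: "half set set \<Rightarrow> half \<Rightarrow> bool" where
  "is_black B h \<longleftrightarrow> edge_of \<Lambda> h \<in> B"

lemma fplD:
  assumes "fpl b"
  shows "b h \<Longrightarrow> h \<in> H" "h \<in> H \<Longrightarrow> b (m h) = b h"
    "h \<in> H \<Longrightarrow> h \<notin> X \<Longrightarrow> quartic \<Lambda> h \<Longrightarrow> two_of (b h) (b (c h)) (b (c (c h))) (b (c (c (c h))))"
    "h \<in> H \<Longrightarrow> h \<notin> X \<Longrightarrow> bivalent \<Lambda> h \<Longrightarrow> b (c h) = (\<not> b h)"
    "j \<in> J \<Longrightarrow> b (e (nx j)) = (\<not> b (e j))"
  using assms unfolding fpl_def by blast+

lemma edge_mate: "h \<in> H \<Longrightarrow> edge_of \<Lambda> (m h) = edge_of \<Lambda> h"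
  by (auto simp: edge_of_def mate_mate)

lemma edge_eq: assumes "edge_of \<Lambda> h = edge_of \<Lambda> g" "g \<in> H" shows "h = g \<or> h = m g"
  using assms by (auto simp: edge_of_def)

lemma blk_edges_of:
  assumes "\<And>h. b h \<Longrightarrow> h \<in> H" "\<And>h. h \<in> H \<Longrightarrow> b (m h) = b h"
  shows "is_black (edges_of b) = b"
proof
  fix h
  show "is_black (edges_of b) h = b h"
  proof
    assume "is_black (edges_of b) h"
    then obtain g where "g \<in> H" "b g" "edge_of \<Lambda> h = edge_of \<Lambda> g"
      by (auto simp: is_black_def edges_of_def)
    then show "b h" using edge_eq assms by metis
  next
    assume "b h"
    then show "is_black (edges_of b) h" using assms by (auto simp: is_black_def edges_of_def)
  qed
qed

lemma vertex_condition:
  assumes "h \<in> H"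
  shows "(card (vertex_of \<Lambda> h) = 4 \<longrightarrow> card (black_at \<Lambda> B h) = 2) \<and>
      (card (vertex_of \<Lambda> h) = 2 \<longrightarrow> card (black_at \<Lambda> B h) = 1) \<longleftrightarrow>
    (h \<notin> X \<longrightarrow>
        (quartic \<Lambda> h \<longrightarrow> two_of (is_black B h) (is_black B (c h)) (is_black B (c (c h))) (is_black B (c (c (c h))))) \<and>
        (bivalent \<Lambda> h \<longrightarrow> is_black B (c h) = (\<not> is_black B h)))"
proof -
  have ba: "black_at \<Lambda> B h = {g \<in> vertex_of \<Lambda> h. is_black B g}" by (simp add: black_at_def is_black_def)
  consider "h \<in> X" | "h \<notin> X" "quartic \<Lambda> h" | "h \<notin> X" "bivalent \<Lambda> h" using degree assms by blast
  then show ?thesis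
  proof cases
    case 1 then show ?thesis by (simp add: vertex_ext)
  next
    case 2
    have "\<not> bivalent \<Lambda> h" using 2 by (simp add: quartic_def bivalent_def)
    moreover have "card (vertex_of \<Lambda> h) = 4"
      using vertex_quartic[OF 2(2)] by simp
    moreover have "card (black_at \<Lambda> B h) = 2 \<longleftrightarrow>
        two_of (is_black B h) (is_black B (c h)) (is_black B (c (c h))) (is_black B (c (c (c h))))"
      unfolding ba vertex_quartic(1)[OF 2(2)] by (rule card_filter_four[OF vertex_quartic(2)[OF 2(2)]])
    ultimately show ?thesis using 2 by simp
  next
    case 3
    have "h \<noteq> c h" using 3 by (auto simp: bivalent_def)
    have "\<not> quartic \<Lambda> h" using 3 by (simp add: quartic_def bivalent_def)
    moreover have "card (vertex_of \<Lambda> h) = 2"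
      using vertex_bivalent[OF 3(2)] \<open>h \<noteq> c h\<close> by simp
    moreover have "card (black_at \<Lambda> B h) = 1 \<longleftrightarrow> is_black B h \<noteq> is_black B (c h)"
      unfolding ba vertex_bivalent[OF 3(2)] by (rule card_filter_two[OF \<open>h \<noteq> c h\<close>])
    ultimately show ?thesis using 3 by auto
  qed
qed

lemma Fpl_iff: "B \<in> Fpl \<Lambda> \<longleftrightarrow> B \<subseteq> edge_of \<Lambda> ` H \<and> fpl (is_black B)"
proof -
  have 1: "\<forall>h. is_black B h \<longrightarrow> h \<in> H" if sub: "B \<subseteq> edge_of \<Lambda> ` H"
  proof (intro allI impI)
    fix h assume "is_black B h"
    then obtain g where "g \<in> H" "edge_of \<Lambda> h = edge_of \<Lambda> g" using sub unfolding is_black_def by blast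
    then show "h \<in> H" using edge_eq mate_in by metis
  qed
  have 2: "\<forall>h\<in>H. is_black B (m h) = is_black B h" by (simp add: is_black_def edge_mate)
  have 3: "black_ext \<Lambda> B j = is_black B (e j)" for j by (simp add: black_ext_def is_black_def)
  have "B \<in> Fpl \<Lambda> \<longleftrightarrow> B \<subseteq> edge_of \<Lambda> ` H \<and>
     (\<forall>h\<in>H. h \<notin> X \<longrightarrow>
        (quartic \<Lambda> h \<longrightarrow> two_of (is_black B h) (is_black B (c h)) (is_black B (c (c h))) (is_black B (c (c (c h))))) \<and>
        (bivalent \<Lambda> h \<longrightarrow> is_black B (c h) = (\<not> is_black B h))) \<and>
     (\<forall>j\<in>J. is_black B (e (nx j)) = (\<not> is_black B (e j)))"
    unfolding Fpl_def mem_Collect_eq 3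
    by (intro conj_cong refl ball_cong vertex_condition) auto
  then show ?thesis unfolding fpl_def using 1 2 by blast
qed

lemma edges_of_blk: assumes "B \<subseteq> edge_of \<Lambda> ` H" shows "edges_of (is_black B) = B"
proof -
  have "{h \<in> H. is_black B h} = {h \<in> H. edge_of \<Lambda> h \<in> B}" by (simp add: is_black_def)
  then show ?thesis using assms by (auto simp: edges_of_def)
qed

lemma Fpl_edges_of: "fpl b \<Longrightarrow> edges_of b \<in> Fpl \<Lambda> \<and> is_black (edges_of b) = b"
  using blk_edges_of[of b] fplD[of b] Fpl_iff[of "edges_of b"] by (auto simp: edges_of_def)

section \<open>Gyration\<close>

text \<open>\<open>gyr q\<close> acts on the faces of parity \<open>q\<close>; a half-edge of the other parity is seen from the face across
  its edge.\<close>

definition frozen :: "(half \<Rightarrow> bool) \<Rightarrow> half \<Rightarrow> bool" where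
  "frozen b h \<longleftrightarrow> (\<forall>x\<in>orb h. b (f x) \<noteq> b x \<and> x \<notin> X)"

definition gyr :: "bool \<Rightarrow> (half \<Rightarrow> bool) \<Rightarrow> half \<Rightarrow> bool" where
  "gyr q b h \<longleftrightarrow> h \<in> H \<and> (b h \<longleftrightarrow> frozen b (if par h = q then h else m h))"

lemma frozen_orb: "h \<in> H \<Longrightarrow> x \<in> orb h \<Longrightarrow> frozen b x = frozen b h"
  unfolding frozen_def by (simp add: orb_eq)

lemma frozen_f: "h \<in> H \<Longrightarrow> frozen b (f h) = frozen b h"
  unfolding frozen_def by (simp add: orb_f)

lemma gyr_active: "h \<in> H \<Longrightarrow> par h = q \<Longrightarrow> gyr q b h \<longleftrightarrow> (b h \<longleftrightarrow> frozen b h)"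
  by (simp add: gyr_def)

lemma gyr_mate: "fpl b \<Longrightarrow> h \<in> H \<Longrightarrow> gyr q b (m h) = gyr q b h"
  using mate_in[of h] mate_mate[of h] par_mate[of h] fplD(2)[of b h] unfolding gyr_def by simp

text \<open>Complementing all sides of a face does not change which neighbouring sides differ, and
  no edge borders two faces of the same parity. Faces therefore keep their status, which is what
  makes \<open>gyr q\<close> an involution.\<close>

lemma frozen_gyr: assumes "h \<in> H" "par h = q" shows "frozen (gyr q b) h = frozen b h"
proof -
  have "(gyr q b (f x) \<noteq> gyr q b x) \<longleftrightarrow> (b (f x) \<noteq> b x)" if "x \<in> orb h" for x
  proof -
    have "x \<in> H" "f x \<in> H" "par x = q" "par (f x) = q"
      using that assms orb_in orb_par f_in par_f by blast+
    then show ?thesis by (auto simp: gyr_active frozen_f)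
  qed
  then show ?thesis unfolding frozen_def by blast
qed

lemma gyr_gyr: assumes "fpl b" shows "gyr q (gyr q b) = b"
proof
  fix h
  show "gyr q (gyr q b) h = b h"
  proof (cases "h \<in> H")
    case True
    let ?g = "if par h = q then h else m h"
    have g: "?g \<in> H" "par ?g = q" using True mate_in par_mate by auto
    have "frozen (gyr q b) ?g = frozen b ?g" using frozen_gyr[OF g] .
    then show ?thesis using True by (auto simp: gyr_def)
  next
    case False
    then show ?thesis using fplD(1)[OF assms] by (auto simp: gyr_def)
  qed
qed

text \<open>The corner between \<open>h\<close> and \<open>c h\<close> belongs to the face of
  \<open>m h\<close>. Its two edges are sides of that one face, hence kept together, with different
  colours, or complemented together.\<close>

lemma corner_gyr:
  assumes "fpl b" "h \<in> H" "h \<notin> X" "par (c h) = q"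
  shows "gyr q b h \<longleftrightarrow> (b h \<longleftrightarrow> frozen b (m h))" "gyr q b (c h) \<longleftrightarrow> (b (c h) \<longleftrightarrow> frozen b (m h))"
    "frozen b (m h) \<Longrightarrow> b (c h) \<noteq> b h" "par (m h) = q" "c h \<in> orb (m h)"
proof -
  have mh: "m h \<in> H" "f (m h) = c h" "c h \<in> H" using assms mate_in f_mate ccw_in by auto
  show p: "par (m h) = q" using assms mh par_f by metis
  show "gyr q b h \<longleftrightarrow> (b h \<longleftrightarrow> frozen b (m h))"
    using gyr_active[OF mh(1) p, of b] gyr_mate[OF assms(1,2)] fplD(2)[OF assms(1,2)] by simp
  show "gyr q b (c h) \<longleftrightarrow> (b (c h) \<longleftrightarrow> frozen b (m h))"
    using gyr_active[OF mh(3) assms(4)] frozen_f[OF mh(1)] mh(2) by simp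
  show "b (c h) \<noteq> b h" if "frozen b (m h)"
    using that orb_self[of "m h"] mh fplD(2)[OF assms(1,2)] unfolding frozen_def by metis
  show "c h \<in> orb (m h)" using mh(2) orb_f[OF mh(1)] orb_self by metis
qed

lemma quartic_ccw: "quartic \<Lambda> h \<Longrightarrow> quartic \<Lambda> (c h)"
  unfolding quartic_def by metis

lemma ext_not_frozen:
  assumes "j \<in> J" shows "\<not> frozen b (e j)" "\<not> frozen b (m (e (nx j)))" "m (e (nx j)) \<in> orb (e j)"
proof -
  show 1: "\<not> frozen b (e j)" using orb_self e_inX assms unfolding frozen_def by blast
  have "m (e (nx j)) \<in> H" "f (m (e (nx j))) = e j" using f_ext assms ext_in mate_in nx_in by auto
  then show "\<not> frozen b (m (e (nx j)))" "m (e (nx j)) \<in> orb (e j)"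
    using 1 frozen_f orb_f orb_self by metis+
qed

text \<open>Each external edge separates two boundary faces, one of each parity, and a boundary face
  is never frozen; so the edge flips for either choice of \<open>q\<close>.\<close>

lemma gyr_ext: assumes "fpl b" "j \<in> J" shows "gyr q b (e j) = (\<not> b (e j))"
proof -
  obtain i where i: "i \<in> J" "j = nx i" using nx_prev prev_in assms by metis
  have "\<not> frozen b (m (e j))" using ext_not_frozen(2) i by simp
  then show ?thesis using ext_not_frozen(1)[OF assms(2)] ext_in[OF assms(2)] by (simp add: gyr_def)
qed

text \<open>A vertex of degree 4 has two opposite corners in faces of parity \<open>q\<close>, which
  together use each edge once. A corner with one black edge keeps having one; if one corner is all
  black, the other is all white, neither face is frozen, and the corners exchange their roles. A
  vertex of degree 2 has a single such corner, with one black edge.\<close>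

lemma gyr_fpl: assumes b: "fpl b" shows "fpl (gyr q b)"
proof -
  let ?b = "gyr q b"
  have Q: "two_of (?b h) (?b (c h)) (?b (c (c h))) (?b (c (c (c h))))"
    if h: "h \<in> H" "h \<notin> X" "quartic \<Lambda> h" "par (c h) = q" for h
  proof -
    have 1: "c h \<in> H" "c h \<notin> X" "c (c h) \<in> H" "c (c h) \<notin> X" using h ccw_in ccw_notX by blast+
    then have 2: "par (c (c (c h))) = q" using h par_ccw ccw_in by (metis DiffI)
    show ?thesis
      using corner_gyr(1-3)[OF b h(1,2,4)] corner_gyr(1-3)[OF b 1(3,4) 2] fplD(3)[OF b h(1-3)]
      unfolding two_of_def by (smt (verit))
  qed
  have "two_of (?b h) (?b (c h)) (?b (c (c h))) (?b (c (c (c h))))"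
    if h: "h \<in> H" "h \<notin> X" "quartic \<Lambda> h" for h
  proof (cases "par (c h) = q")
    case True then show ?thesis using Q h by blast
  next
    case False
    have 1: "c h \<in> H" "c h \<notin> X" using h ccw_in ccw_notX by blast+
    then have "par (c (c h)) = q" using False par_ccw by simp
    from Q[OF 1 quartic_ccw[OF h(3)] this] show ?thesis
      using h(3) unfolding quartic_def two_of_def by (smt (verit))
  qed
  moreover have "?b (c h) = (\<not> ?b h)" if h: "h \<in> H" "h \<notin> X" "bivalent \<Lambda> h" for h
  proof (cases "par (c h) = q")
    case True
    then show ?thesis using corner_gyr(1,2)[OF b h(1,2)] fplD(4)[OF b h] by auto
  next
    case False
    have 1: "c h \<in> H" "c h \<notin> X" using h ccw_in ccw_notX by blast+
    then have p: "par (c (c h)) = q" using False par_ccw by simp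
    have "c (c h) = h" using h by (simp add: bivalent_def)
    then show ?thesis using corner_gyr(1,2)[OF b 1 p] fplD(4)[OF b h] by auto
  qed
  ultimately show ?thesis
    unfolding fpl_def
  proof (intro conjI ballI allI impI)
    fix h assume "?b h" then show "h \<in> H" by (simp add: gyr_def)
  next
    fix j assume "j \<in> J"
    then show "?b (e (nx j)) = (\<not> ?b (e j))"
      using gyr_ext[OF b nx_in] gyr_ext[OF b] fplD(5)[OF b] by simp
  qed (use gyr_mate[OF b] in blast)+
qed

text \<open>With at most four sides and two consecutive sides of equal colour, the black sides form
  one run, so agreement across consecutive black sides spreads to all of them. A boundary face has
  at most three sides, any two of which are consecutive.\<close>

lemma arc_const:
  assumes b: "fpl b" and g: "g \<in> H" "\<not> frozen b g"
    and step: "\<And>x. x \<in> orb g \<Longrightarrow> b x \<Longrightarrow> b (f x) \<Longrightarrow> \<mu> (f x) = \<mu> x"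
    and xy: "x \<in> orb g" "y \<in> orb g" "b x" "b y"
  shows "\<mu> x = (\<mu> y :: bool)"
proof (cases "orb g \<inter> X = {}")
  case False
  then obtain z where z: "z \<in> orb g" "z \<in> X" by blast
  from z(2) obtain i where i: "i \<in> J" "z = e (nx i)" by (rule XE)
  define j where "j = nx i"
  have j: "j \<in> J" "e j \<in> orb g" using nx_in i z unfolding j_def by blast+
  have o: "orb (e j) = orb g" "e j \<in> H" using orb_eq[OF g(1) j(2)] ext_in[OF j(1)] by blast+
  from j(1) show ?thesis
  proof (cases rule: boundary_cases)
    case two
    have "(f ^^ 2) (e j) = e j" using two by (simp add: eval_nat_numeral)
    then have "orb g = {e j, f (e j)}"
      using orb_period[of 2 "e j"] o by (simp add: eval_nat_numeral lessThan_Suc insert_commute)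
    then show ?thesis using xy step[of "e j"] by auto
  next
    case three
    obtain z where z: "z = f (f (e j))" "f z = e j" using three by blast
    obtain w where w: "w = f (e j)" "f w = z" using z by blast
    have "(f ^^ 3) (e j) = e j" using three by (simp add: eval_nat_numeral)
    then have orb: "orb g = {e j, w, z}"
      using orb_period[of 3 "e j"] o z w by (simp add: eval_nat_numeral lessThan_Suc insert_commute)
    show ?thesis
      using xy step[of "e j", unfolded w(1)[symmetric]] step[of w, unfolded w(2)]
        step[of z, unfolded z(2)] unfolding orb by auto
  qed
next
  case True
  \<comment> \<open>Two consecutive sides of equal colour; counted from them, even four sides leave
    no room for two separate black runs.\<close>
  then obtain x0 where x0: "x0 \<in> orb g" "b (f x0) = b x0" using g unfolding frozen_def by blast
  have o: "orb x0 = orb g" "x0 \<in> H" using orb_eq g x0 orb_in by blast+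
  from o(2) show ?thesis
  proof (cases rule: orb_cases)
    case 1
    then show ?thesis using xy o by auto
  next
    case 2
    then show ?thesis using xy step[of x0] o by auto
  next
    case 3
    obtain w where w: "w = f x0" by blast
    obtain z where z: "z = f w" "f z = x0" using w 3 by blast
    have orb: "orb g = {x0, w, z}" using 3 o z w by simp
    show ?thesis
      using xy step[of x0, unfolded w(1)[symmetric]] step[of w, unfolded z(1)[symmetric]]
        step[of z, unfolded z(2)] unfolding orb by auto
  next
    case 4
    obtain w where w: "w = f x0" by blast
    obtain z where z: "z = f w" by blast
    obtain u where u: "u = f z" "f u = x0" using w z 4 by blast
    have orb: "orb g = {x0, w, z, u}" using 4 o z w u by simp
    show ?thesis
      using x0(2) xy step[of x0, unfolded w(1)[symmetric]] step[of w, unfolded z(1)[symmetric]]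
        step[of z, unfolded u(1)[symmetric]] step[of u, unfolded u(2)] unfolding orb w[symmetric]
      by auto
  qed
qed

section \<open>Transport of path labels\<close>

text \<open>Boolean functions constant along black paths. Membership in a path is handled through
  all of them at once, so that gyration has to carry functions instead of sequences of
  edges.\<close>

definition lab_inv :: "(half \<Rightarrow> bool) \<Rightarrow> (half \<Rightarrow> bool) \<Rightarrow> bool" where
  "lab_inv b l \<longleftrightarrow>
     (\<forall>h\<in>H. b h \<longrightarrow> l (m h) = l h \<and> (\<forall>g\<in>vertex_of \<Lambda> h. b g \<longrightarrow> l g = l h))"

abbreviation path :: "(half \<Rightarrow> bool) \<Rightarrow> half \<Rightarrow> half set" where
  "path b h \<equiv> black_path \<Lambda> (edges_of b) h"

lemma step_iff: assumes "fpl b"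
  shows "(h, g) \<in> black_step \<Lambda> (edges_of b) \<longleftrightarrow>
    h \<in> H \<and> b h \<and> (g = m h \<or> g \<in> vertex_of \<Lambda> h \<and> b g)"
  using Fpl_edges_of[OF assms] unfolding black_step_def black_at_def is_black_def
  by (auto simp: fun_eq_iff)

text \<open>\<open>black_step\<close> is symmetric between black half-edges, so the path itself is
  an invariant labelling. Two black half-edges thus lie on one path exactly if no such labelling
  separates them.\<close>

lemma path_lab: assumes b: "fpl b" and h: "b h" shows "lab_inv b (\<lambda>x. x \<in> path b h)"
  unfolding lab_inv_def
proof (intro ballI impI conjI)
  let ?R = "black_step \<Lambda> (edges_of b)"
  have closed: "y \<in> path b h" if "x \<in> path b h" "(x, y) \<in> ?R" for x y
    using that unfolding black_path_def by (auto intro: rtrancl_into_rtrancl)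
  fix x assume x: "x \<in> H" "b x"
  have mx: "m x \<in> H" "b (m x)" "m (m x) = x" using x mate_in mate_mate fplD(2)[OF b] by auto
  have "(x, m x) \<in> ?R" "(m x, x) \<in> ?R" using x mx step_iff[OF b] by auto
  then show "(m x \<in> path b h) = (x \<in> path b h)" using closed by blast
  fix g assume g: "g \<in> vertex_of \<Lambda> x" "b g"
  have "g \<in> H" "x \<in> vertex_of \<Lambda> g" using vertex_in vertex_eq vertex_self g x by blast+
  then have "(x, g) \<in> ?R" "(g, x) \<in> ?R" using x g step_iff[OF b] by auto
  then show "(g \<in> path b h) = (x \<in> path b h)" using closed by blast
qed

lemma path_self: "h \<in> path b h"
  by (simp add: black_path_def)

lemma path_sub:
  assumes b: "fpl b" and h: "b h" and l: "lab_inv b l" and g: "g \<in> path b h"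
  shows "b g \<and> g \<in> H \<and> l g = l h"
proof -
  have "(h, g) \<in> (black_step \<Lambda> (edges_of b))\<^sup>*" using g by (simp add: black_path_def)
  then show ?thesis
  proof (induction rule: rtrancl_induct)
    case base then show ?case using h fplD(1)[OF b] by blast
  next
    case (step y z)
    then show ?case using l mate_in fplD(1,2)[OF b] unfolding step_iff[OF b] lab_inv_def by metis
  qed
qed

text \<open>A labelling of the black paths is carried through a gyration face by face: a non-frozen face
  carries at most one path piece before and after, with the same end points.\<close>

definition transport :: "bool \<Rightarrow> (half \<Rightarrow> bool) \<Rightarrow> (half \<Rightarrow> bool) \<Rightarrow> half \<Rightarrow> bool" where
  "transport q b l h = (let g = if par h = q then h else m h in
     if frozen b g then l g else (\<exists>x\<in>orb g. b x \<and> l x))"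

lemma transp_active:
  "par g = q \<Longrightarrow> transport q b l g = (if frozen b g then l g else (\<exists>x\<in>orb g. b x \<and> l x))"
  unfolding transport_def by simp

lemma transp_f:
  assumes "g \<in> H" "par g = q" "\<not> frozen b g" shows "transport q b l (f g) = transport q b l g"
  using transp_active[of g q b l] transp_active[of "f g" q b l] par_f[OF assms(1)]
    frozen_f[OF assms(1)] orb_f[OF assms(1)] assms(2,3) by simp

lemma transp_mate: "h \<in> H \<Longrightarrow> transport q b l (m h) = transport q b l h"
  by (simp add: transport_def par_mate mate_mate)

lemma lab_arc:
  assumes b: "fpl b" and l: "lab_inv b l" and g: "g \<in> H" "\<not> frozen b g"
    and xy: "x \<in> orb g" "y \<in> orb g" "b x" "b y"
  shows "l x = l y"
proof (rule arc_const[OF b g _ xy])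
  fix x assume x: "x \<in> orb g" "b x" "b (f x)"
  have xH: "x \<in> H" using orb_in g x by blast
  show "l (f x) = l x"
  proof (cases "m x \<in> X")
    \<comment> \<open>Here the two sides are external edges with consecutive numbers, which have
      opposite colours; the case is void.\<close>
    case True
    then obtain j where j: "j \<in> J" "m x = e (nx j)" by (rule XE)
    then have "f x = e j" using mate_mate[OF xH] f_ext by metis
    then show ?thesis using x fplD(2)[OF b xH] fplD(5)[OF b j(1)] j by simp
  next
    case False
    have "c (m x) \<in> vertex_of \<Lambda> (m x)" unfolding vertex_of_def by (rule range_eqI[of _ _ 1]) simp
    then show ?thesis using x xH l mate_in fplD(2)[OF b xH] f_inner[OF False]
      unfolding lab_inv_def by metis
  qed
qed

lemma transp_flip:
  assumes b: "fpl b" and l: "lab_inv b l" and g: "g \<in> H" "par g = q" "\<not> frozen b g"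
    and x: "x \<in> orb g" "b x"
  shows "transport q b l g = l x"
proof -
  have "transport q b l g = (\<exists>y\<in>orb g. b y \<and> l y)" using g unfolding transport_def by simp
  also have "\<dots> = l x" using lab_arc[OF b l g(1,3) _ x(1) _ x(2)] x by blast
  finally show ?thesis .
qed

text \<open>A corner with one black edge has one again. In a frozen face it is the same edge;
  otherwise the new edge receives the common label of the black sides of the face, among which is
  the old edge.\<close>

lemma transp_corner:
  assumes b: "fpl b" and l: "lab_inv b l" and h: "h \<in> H" "h \<notin> X" "par (c h) = q"
    and u: "u \<in> {h, c h}" "b u" and w: "w \<in> {h, c h}" "gyr q b w"
    and bw: "b (c h) \<noteq> b h"
  shows "transport q b l w = l u"
proof -
  note cg = corner_gyr[OF b h]
  have mh: "m h \<in> H" "c h \<in> H" "f (m h) = c h" using h mate_in ccw_in f_mate by auto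
  have fr: "frozen b (c h) = frozen b (m h)" using frozen_f mh by metis
  show ?thesis
  proof (cases "frozen b (m h)")
    case True
    then have "b w" using cg(1,2) w by auto
    then have "w = u" using u w bw by auto
    show ?thesis
    proof (cases "u = h")
      case True
      have "transport q b l (m h) = l (m h)"
        using cg(4) \<open>frozen b (m h)\<close> unfolding transport_def by simp
      moreover have "l (m h) = l h" using l u(2) True h(1) unfolding lab_inv_def by blast
      ultimately show ?thesis using transp_mate[OF h(1), of q b l] \<open>w = u\<close> True by simp
    next
      case False
      then have "u = c h" using u by simp
      then show ?thesis using fr \<open>frozen b (m h)\<close> h(3) unfolding transport_def \<open>w = u\<close> by simp
    qed
  next
    case False
    have tr: "transport q b l w = transport q b l (m h)"
    proof (cases "w = h")
      case True then show ?thesis using transp_mate h by simp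
    next
      case False
      then have "w = f (m h)" using w mh(3) by simp
      then show ?thesis using transp_f[OF mh(1) cg(4)] \<open>\<not> frozen b (m h)\<close> by simp
    qed
    define x where "x = (if u = h then m h else c h)"
    have x: "x \<in> orb (m h)" "b x" "l x = l u"
      using u cg(5) orb_self fplD(2)[OF b h(1)] l h(1) unfolding x_def lab_inv_def by auto
    show ?thesis using transp_flip[OF b l mh(1) cg(4) False x(1,2)] x(3) tr by simp
  qed
qed

lemma transp_same_corner:
  assumes b: "fpl b" and h: "h \<in> H" "h \<notin> X" "par (c h) = q"
    and "gyr q b h" "gyr q b (c h)"
  shows "transport q b l (c h) = transport q b l h"
proof -
  note cg = corner_gyr[OF b h]
  have mh: "m h \<in> H" "f (m h) = c h" using h mate_in f_mate by auto
  have nf: "\<not> frozen b (m h)" using cg(1-3) assms by blast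
  have "transport q b l (c h) = transport q b l (m h)"
    using transp_f[OF mh(1) cg(4) nf] mh(2) by simp
  then show ?thesis using transp_mate h by simp
qed

lemma transp_vertex:
  assumes b: "fpl b" and l: "lab_inv b l" and v: "v \<in> H" "v \<notin> X" "quartic \<Lambda> v" "par (c v) = q"
    and xy: "x \<in> vertex_of \<Lambda> v" "y \<in> vertex_of \<Lambda> v" "gyr q b x" "gyr q b y"
  shows "transport q b l x = transport q b l y"
proof -
  let ?w = "c (c v)"
  have 1: "c v \<in> H" "c v \<notin> X" "?w \<in> H" "?w \<notin> X" using v ccw_in ccw_notX by blast+
  then have 2: "par (c ?w) = q" using v par_ccw ccw_in by (metis DiffI)
  have vs: "vertex_of \<Lambda> v = {v, c v} \<union> {?w, c ?w}" using vertex_quartic[OF v(3)] by auto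
  have same: "transport q b l x = transport q b l y"
    if "h \<in> {v, ?w}" "x \<in> {h, c h}" "y \<in> {h, c h}" "gyr q b x" "gyr q b y" for h x y
    using that transp_same_corner[OF b v(1,2,4), of l] transp_same_corner[OF b 1(3,4) 2, of l] by auto
  \<comment> \<open>With the new black edges in different corners, each corner has one black edge
    now and had one before. The two old ones were joined at this vertex and so share a
    label.\<close>
  have diff: "transport q b l x = transport q b l y"
    if x: "x \<in> {v, c v}" "gyr q b x" and y: "y \<in> {?w, c ?w}" "gyr q b y" for x y
  proof -
    have two: "two_of (gyr q b v) (gyr q b (c v)) (gyr q b ?w) (gyr q b (c ?w))"
      by (rule fplD(3)[OF gyr_fpl[OF b] v(1-3)])
    have g1: "gyr q b v \<noteq> gyr q b (c v)" "gyr q b ?w \<noteq> gyr q b (c ?w)"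
      using two x y unfolding two_of_def by (auto split: if_splits)
    then have bw: "b (c v) \<noteq> b v" "b (c ?w) \<noteq> b ?w"
      using corner_gyr(1,2)[OF b v(1,2,4)] corner_gyr(1,2)[OF b 1(3,4) 2] by auto
    then obtain u u' where u: "u \<in> {v, c v}" "b u" "u' \<in> {?w, c ?w}" "b u'" by blast
    have "l u = l u'"
    proof -
      have "u \<in> vertex_of \<Lambda> v" "u' \<in> vertex_of \<Lambda> v" using vs u by auto
      then show ?thesis using l u vertex_in vertex_eq v(1) unfolding lab_inv_def by metis
    qed
    then show ?thesis
      using transp_corner[OF b l v(1,2,4) u(1,2) x bw(1)]
        transp_corner[OF b l 1(3,4) 2 u(3,4) y bw(2)] by simp
  qed
  consider "x \<in> {v, c v}" "y \<in> {v, c v}" | "x \<in> {v, c v}" "y \<in> {?w, c ?w}"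
    | "x \<in> {?w, c ?w}" "y \<in> {v, c v}" | "x \<in> {?w, c ?w}" "y \<in> {?w, c ?w}"
    using xy(1,2) unfolding vs by blast
  then show ?thesis
  proof cases
    case 1 then show ?thesis using same[of v x y] xy(3,4) by simp
  next
    case 2 then show ?thesis using diff xy(3,4) by blast
  next
    case 3 then show ?thesis using diff xy(3,4) by blast
  next
    case 4 then show ?thesis using same[of ?w x y] xy(3,4) by simp
  qed
qed

lemma transp_inv: assumes b: "fpl b" and l: "lab_inv b l" shows "lab_inv (gyr q b) (transport q b l)"
  unfolding lab_inv_def
proof (intro ballI impI conjI)
  fix h assume h: "h \<in> H" "gyr q b h"
  show "transport q b l (m h) = transport q b l h" using transp_mate h by blast
  fix g assume g: "g \<in> vertex_of \<Lambda> h" "gyr q b g"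
  consider "h \<in> X" | "h \<notin> X" "quartic \<Lambda> h" | "h \<notin> X" "bivalent \<Lambda> h" using degree h by blast
  then show "transport q b l g = transport q b l h"
  proof cases
    case 1 then show ?thesis using g vertex_ext by simp
  next
    case 2
    show ?thesis
    proof (cases "par (c h) = q")
      case True
      then show ?thesis using transp_vertex[OF b l h(1) 2 _ g(1) vertex_self g(2) h(2)] by blast
    next
      case False
      have ch: "c h \<in> H" "c h \<notin> X" using h 2 ccw_in ccw_notX by blast+
      then have p: "par (c (c h)) = q" using False par_ccw by simp
      have "c h \<in> vertex_of \<Lambda> h" unfolding vertex_of_def by (rule range_eqI[of _ _ 1]) simp
      then have "vertex_of \<Lambda> (c h) = vertex_of \<Lambda> h" using vertex_eq h by blast
      then show ?thesis
        using transp_vertex[OF b l ch quartic_ccw[OF 2(2)] p, of g h] g h vertex_self by simp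
    qed
  next
    case 3
    have "gyr q b (c h) = (\<not> gyr q b h)" by (rule fplD(4)[OF gyr_fpl[OF b] h(1) 3])
    then have "g = h" using g h vertex_bivalent[OF 3(2)] by auto
    then show ?thesis by simp
  qed
qed

text \<open>Both external edges are sides of the same non-frozen boundary face, whose label is that
  of its black sides: the end of the path slides along the boundary by one place.\<close>

lemma transp_ext:
  assumes b: "fpl b" and l: "lab_inv b l" and j: "j \<in> J" "par (e j) = q"
  shows "b (e j) \<Longrightarrow> transport q b l (e (nx j)) = l (e j)"
    "b (e (nx j)) \<Longrightarrow> transport q b l (e j) = l (e (nx j))"
proof -
  have H: "e j \<in> H" "e (nx j) \<in> H" "m (e (nx j)) \<in> H" using ext_in nx_in j mate_in by blast+
  note nf = ext_not_frozen(1,2)[OF j(1), of b] ext_not_frozen(3)[OF j(1)]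
  have "par (m (e (nx j))) = q" using par_mate par_f_ext[OF j(1)] H j by simp
  moreover have "e j \<in> orb (m (e (nx j)))" using orb_eq[OF H(1) nf(3)] orb_self by blast
  ultimately show "b (e j) \<Longrightarrow> transport q b l (e (nx j)) = l (e j)"
    using transp_flip[OF b l H(3) _ nf(2), of q "e j"] transp_mate[OF H(2), of q b l] by simp
  assume bk: "b (e (nx j))"
  then have "b (m (e (nx j)))" "l (m (e (nx j))) = l (e (nx j))"
    using fplD(2)[OF b H(2)] l H unfolding lab_inv_def by auto
  then show "transport q b l (e j) = l (e (nx j))"
    using transp_flip[OF b l H(1) j(2) nf(1,3)] by simp
qed

section \<open>Transport of link patterns\<close>

definition reg_inv :: "half set \<Rightarrow> (half \<Rightarrow> bool) \<Rightarrow> bool" where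
  "reg_inv C \<chi> \<longleftrightarrow>
     (\<forall>g\<in>H. (m g \<notin> X \<longrightarrow> \<chi> (c (m g)) = \<chi> g) \<and> (g \<notin> C \<longrightarrow> \<chi> (m g) = \<chi> g))"

lemma reg_inv_step: "reg_inv C \<chi> \<longleftrightarrow> (\<forall>(x, y)\<in>region_step \<Lambda> C. \<chi> y = \<chi> x)"
  unfolding reg_inv_def region_step_def by auto

text \<open>The region is itself the support of an invariant, being closed under steps in both
  directions. The universal form lets statements about regions be proved by transforming invariants
  instead of tracing walks over faces.\<close>

lemma region_iff: "g \<in> region \<Lambda> C h \<longleftrightarrow> (\<forall>\<chi>. reg_inv C \<chi> \<longrightarrow> \<chi> g = \<chi> h)"
proof
  let ?R = "region_step \<Lambda> C \<union> (region_step \<Lambda> C)\<inverse>"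
  assume "g \<in> region \<Lambda> C h"
  then have "(h, g) \<in> ?R\<^sup>*" by (simp add: region_def)
  then show "\<forall>\<chi>. reg_inv C \<chi> \<longrightarrow> \<chi> g = \<chi> h"
  proof (induction rule: rtrancl_induct)
    case (step y z)
    have "\<chi> z = \<chi> y" if "reg_inv C \<chi>" for \<chi>
      using step.hyps(2) that unfolding reg_inv_step by blast
    then show ?case using step.IH by metis
  qed simp
next
  let ?R = "region_step \<Lambda> C \<union> (region_step \<Lambda> C)\<inverse>"
  assume *: "\<forall>\<chi>. reg_inv C \<chi> \<longrightarrow> \<chi> g = \<chi> h"
  have "reg_inv C (\<lambda>x. (h, x) \<in> ?R\<^sup>*)"
    unfolding reg_inv_step
  proof clarify
    fix x y assume "(x, y) \<in> region_step \<Lambda> C"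
    then have "(x, y) \<in> ?R" "(y, x) \<in> ?R" by auto
    then show "((h, y) \<in> ?R\<^sup>*) = ((h, x) \<in> ?R\<^sup>*)" by (meson rtrancl.rtrancl_into_rtrancl)
  qed
  from *[rule_format, OF this] show "g \<in> region \<Lambda> C h" by (simp add: region_def)
qed

lemma path_transport:
  assumes b: "fpl b" and s: "b s" "gyr q b s'"
    and F: "\<And>l. lab_inv b l \<Longrightarrow> transport q b l s' = l s"
    and x: "x \<in> path (gyr q b) s'" "par x = q"
  shows "if frozen b x then x \<in> path b s else orb x \<inter> path b s \<noteq> {}"
proof -
  let ?l = "\<lambda>x. x \<in> path b s"
  have l: "lab_inv b ?l" by (rule path_lab[OF b s(1)])
  have "transport q b ?l x = transport q b ?l s'"
    using path_sub[OF gyr_fpl[OF b] s(2) transp_inv[OF b l] x(1)] by blast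
  also have "\<dots> = True" using F[OF l] path_self by simp
  finally show ?thesis using transp_active[OF x(2), of b ?l] by (auto split: if_splits)
qed

text \<open>Stated for both directions: as \<open>gyr q\<close> is an involution, the relation is
  then symmetric, and every implication about paths or regions also yields its converse.\<close>

definition linked_ends :: "bool \<Rightarrow> (half \<Rightarrow> bool) \<Rightarrow> half \<Rightarrow> half \<Rightarrow> bool" where
  "linked_ends q b s s' \<longleftrightarrow> b s \<and> gyr q b s' \<and>
     (\<forall>l. lab_inv b l \<longrightarrow> transport q b l s' = l s) \<and>
     (\<forall>l. lab_inv (gyr q b) l \<longrightarrow> transport q (gyr q b) l s = l s')"

lemma linked_ends_sym:
  assumes "fpl b" "linked_ends q b s s'" shows "linked_ends q (gyr q b) s' s"
  using assms gyr_gyr[OF assms(1), of q] unfolding linked_ends_def by simp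

lemma linked_ends_ext:
  assumes b: "fpl b" and j: "j \<in> J" "par (e j) = q" "b (e j)"
  shows "linked_ends q b (e j) (e (nx j))"
proof -
  have "gyr q b (e (nx j))" using gyr_ext[OF b nx_in] fplD(5)[OF b j(1)] j(3) by simp
  then show ?thesis
    unfolding linked_ends_def
    using j transp_ext(1)[OF b _ j(1,2)] transp_ext(2)[OF gyr_fpl[OF b] _ j(1,2)] by blast
qed

lemma path_arc:
  assumes b: "fpl b" and s: "b s" and g: "g \<in> H" "\<not> frozen b g" "orb g \<inter> path b s \<noteq> {}"
    and y: "y \<in> orb g"
  shows "y \<in> path b s \<longleftrightarrow> b y"
proof
  show "y \<in> path b s \<Longrightarrow> b y" using path_sub[OF b s path_lab[OF b s]] by blast
  obtain z where z: "z \<in> orb g" "z \<in> path b s" using g by blast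
  then have "b z" using path_sub[OF b s path_lab[OF b s]] by blast
  then show "b y \<Longrightarrow> y \<in> path b s" using lab_arc[OF b path_lab[OF b s] g(1,2) y z(1)] z by blast
qed

lemma linked_path_frozen:
  assumes b: "fpl b" and le: "linked_ends q b s s'" and x: "x \<in> H" "par x = q" "frozen b x"
  shows "x \<in> path (gyr q b) s' \<longleftrightarrow> x \<in> path b s"
proof -
  have 1: "x \<in> path b s" if "x \<in> path (gyr q b) s'"
    using path_transport[OF b _ _ _ that x(2), of s] le x(3) unfolding linked_ends_def by auto
  have "frozen (gyr q b) x" using frozen_gyr x by blast
  moreover have "linked_ends q (gyr q b) s' s" by (rule linked_ends_sym[OF b le])
  ultimately have "x \<in> path (gyr q b) s'" if "x \<in> path (gyr q (gyr q b)) s"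
    using path_transport[OF gyr_fpl[OF b] _ _ _ that x(2), of s'] unfolding linked_ends_def by auto
  then show ?thesis using 1 gyr_gyr[OF b] by auto
qed

lemma linked_path_meets:
  assumes b: "fpl b" and le: "linked_ends q b s s'" and x: "x \<in> H" "par x = q" "\<not> frozen b x"
  shows "orb x \<inter> path (gyr q b) s' \<noteq> {} \<longleftrightarrow> orb x \<inter> path b s \<noteq> {}"
proof -
  have 1: "orb x \<inter> path b s \<noteq> {}"
    if b: "fpl b" and le: "linked_ends q b s s'" and nf: "\<not> frozen b x"
      and y: "y \<in> orb x" "y \<in> path (gyr q b) s'" for y b s s'
  proof -
    have "par y = q" "\<not> frozen b y" "orb y = orb x"
      using orb_par[OF x(1) y(1)] frozen_orb[OF x(1) y(1)] orb_eq[OF x(1) y(1)] x(2) nf by simp_all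
    then show ?thesis
      using path_transport[OF b _ _ _ y(2), of s] le unfolding linked_ends_def by metis
  qed
  have nf: "\<not> frozen (gyr q b) x" using frozen_gyr x by blast
  show ?thesis
  proof
    assume "orb x \<inter> path (gyr q b) s' \<noteq> {}"
    then obtain y where "y \<in> orb x" "y \<in> path (gyr q b) s'" by blast
    then show "orb x \<inter> path b s \<noteq> {}" by (rule 1[OF b le x(3)])
  next
    assume "orb x \<inter> path b s \<noteq> {}"
    then obtain y where y: "y \<in> orb x" "y \<in> path b s" by blast
    show "orb x \<inter> path (gyr q b) s' \<noteq> {}"
      using 1[OF gyr_fpl[OF b] linked_ends_sym[OF b le] nf y(1)] y(2) gyr_gyr[OF b] by simp
  qed
qed

text \<open>The walk from one side to the other goes round the vertex the long way, across the two
  remaining edges.\<close>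

lemma white_corner:
  assumes r: "reg_inv C \<chi>" and h: "h \<in> H" "h \<notin> X" "quartic \<Lambda> h"
    and w: "c (c h) \<notin> C" "c (c (c h)) \<notin> C"
  shows "\<chi> h = \<chi> (m (c h))"
proof -
  have turn: "\<chi> (c y) = \<chi> (m y)" if "y \<in> H" "y \<notin> X" for y
    using r that mate_in mate_mate unfolding reg_inv_def by metis
  have cr: "\<chi> (m y) = \<chi> y" if "y \<in> H" "y \<notin> C" for y
    using r that unfolding reg_inv_def by metis
  have H: "c h \<in> H" "c h \<notin> X" "c (c h) \<in> H" "c (c h) \<notin> X" "c (c (c h)) \<in> H" "c (c (c h)) \<notin> X"
    using h ccw_in ccw_notX by blast+
  have "\<chi> h = \<chi> (c (c (c (c h))))" using h by (simp add: quartic_def)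
  also have "\<dots> = \<chi> (m (c (c (c h))))" by (rule turn[OF H(5,6)])
  also have "\<dots> = \<chi> (c (c (c h)))" by (rule cr[OF H(5) w(2)])
  also have "\<dots> = \<chi> (m (c (c h)))" by (rule turn[OF H(3,4)])
  also have "\<dots> = \<chi> (c (c h))" by (rule cr[OF H(3) w(1)])
  also have "\<dots> = \<chi> (m (c h))" by (rule turn[OF H(1,2)])
  finally show ?thesis .
qed

text \<open>Two consecutive black sides of a face exhaust the black edges at their common vertex, so
  the faces beyond them are connected around that vertex.\<close>

lemma arc_sides:
  assumes b: "fpl b" and r: "reg_inv C \<chi>" and C: "\<And>x. x \<in> C \<Longrightarrow> b x"
    and g: "g \<in> H" "\<not> frozen b g"
    and xy: "x \<in> orb g" "y \<in> orb g" "b x" "b y"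
  shows "\<chi> (m x) = \<chi> (m y)"
proof (rule arc_const[where \<mu> = "\<lambda>x. \<chi> (m x)", OF b g _ xy])
  fix x assume x: "x \<in> orb g" "b x" "b (f x)"
  have xH: "x \<in> H" using orb_in g x by blast
  have mx: "m x \<in> H" "b (m x)" using xH x mate_in fplD(2)[OF b] by auto
  show "\<chi> (m (f x)) = \<chi> (m x)"
  proof (cases "m x \<in> X")
    case True
    then obtain j where j: "j \<in> J" "m x = e (nx j)" by (rule XE)
    then have "f x = e j" using mate_mate[OF xH] f_ext by metis
    then show ?thesis using x fplD(2)[OF b xH] fplD(5)[OF b j(1)] j by simp
  next
    case False
    have fx: "f x = c (m x)" by (rule f_inner[OF False])
    have "\<not> bivalent \<Lambda> (m x)" using fplD(4)[OF b mx(1) False] mx x fx by auto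
    then have q: "quartic \<Lambda> (m x)" using degree mx False by blast
    have "two_of (b (m x)) (b (c (m x))) (b (c (c (m x)))) (b (c (c (c (m x)))))"
      by (rule fplD(3)[OF b mx(1) False q])
    then have "\<not> b (c (c (m x)))" "\<not> b (c (c (c (m x))))"
      using mx(2) x(3) unfolding fx two_of_def by auto
    then show ?thesis using white_corner[OF r mx(1) False q] C unfolding fx by metis
  qed
qed

text \<open>Gyration pulls the path across each non-frozen active face that it meets, so such a face
  changes sides: it receives the value found beyond the path, while all other faces keep
  theirs.\<close>

lemma region_transport:
  assumes b: "fpl b" and le: "linked_ends q b s s'" and r: "reg_inv (path b s) \<chi>"
  shows "\<exists>\<chi>'. reg_inv (path (gyr q b) s') \<chi>' \<and>
    (\<forall>g\<in>H. par g \<noteq> q \<longrightarrow> \<chi>' g = \<chi> g) \<and>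
    (\<forall>g\<in>H. par g = q \<longrightarrow> frozen b g \<or> orb g \<inter> path b s = {} \<longrightarrow> \<chi>' g = \<chi> g) \<and>
    (\<forall>g\<in>H. \<forall>y. par g = q \<longrightarrow> \<not> frozen b g \<longrightarrow> y \<in> orb g \<longrightarrow> y \<in> path b s \<longrightarrow>
       \<chi>' g = \<chi> (m y))"
proof -
  let ?C = "path b s" and ?C' = "path (gyr q b) s'"
  have s: "b s" "gyr q b s'" using le unfolding linked_ends_def by auto
  have Cb: "x \<in> ?C \<Longrightarrow> b x" "x \<in> ?C' \<Longrightarrow> gyr q b x" for x
    using path_sub[OF b s(1) path_lab[OF b s(1)]]
      path_sub[OF gyr_fpl[OF b] s(2) path_lab[OF gyr_fpl[OF b] s(2)]] by blast+
  define D where "D g \<longleftrightarrow> par g = q \<and> \<not> frozen b g \<and> orb g \<inter> ?C \<noteq> {}" for g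
  \<comment> \<open>By \<open>arc_sides\<close> the value does not depend on the side that is
    chosen.\<close>
  define \<chi>' where "\<chi>' g = (if D g then \<chi> (m (SOME y. y \<in> orb g \<inter> ?C)) else \<chi> g)" for g
  have D: "\<chi>' g = \<chi> (m y)" if "g \<in> H" "par g = q" "\<not> frozen b g" "y \<in> orb g" "y \<in> ?C" for g y
  proof -
    have Dg: "D g" using that unfolding D_def by blast
    have "(SOME y. y \<in> orb g \<inter> ?C) \<in> orb g \<inter> ?C" by (rule someI[of _ y]) (use that in blast)
    then show ?thesis
      using arc_sides[OF b r Cb(1) that(1,3) _ that(4)] that(5) Cb(1) Dg unfolding \<chi>'_def
      by (metis IntE)
  qed
  have D_f: "D (f g) = D g" if "g \<in> H" for g
    unfolding D_def using that par_f frozen_f orb_f by simp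
  have "reg_inv ?C' \<chi>'"
    unfolding reg_inv_def
  proof (intro ballI conjI impI)
    fix g assume g: "g \<in> H"
    show "\<chi>' (c (m g)) = \<chi>' g" if "m g \<notin> X"
    proof -
      have "c (m g) = f g" using f_inner that by simp
      then have "D (c (m g)) = D g" "orb (c (m g)) = orb g" using D_f orb_f g by auto
      then show ?thesis using r g that unfolding \<chi>'_def reg_inv_def by simp
    qed
    have cross: "\<chi>' (m g) = \<chi>' g" if g: "g \<in> H" "g \<notin> ?C'" "par g = q" for g
    proof -
      have "par (m g) \<noteq> q" using par_mate g by simp
      then have mg: "\<chi>' (m g) = \<chi> (m g)" unfolding \<chi>'_def D_def by simp
      show ?thesis
      proof (cases "D g")
        case True
        then have nf: "\<not> frozen b g" "orb g \<inter> ?C \<noteq> {}" by (auto simp: D_def)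
        have nf': "\<not> frozen (gyr q b) g" using frozen_gyr g nf by blast
        have meet': "orb g \<inter> ?C' \<noteq> {}" using linked_path_meets[OF b le g(1,3) nf(1)] nf(2) by blast
        \<comment> \<open>The new path meets this face but not in \<open>g\<close>, so
          \<open>g\<close> is white now, was black before, and lay on the old path; the new value of
          the face is the old one across \<open>g\<close>.\<close>
        have "\<not> gyr q b g"
          using path_arc[OF gyr_fpl[OF b] s(2) g(1) nf' meet' orb_self] g(2) by blast
        then have "b g" using gyr_active[OF g(1,3)] nf by blast
        then have "g \<in> ?C" using path_arc[OF b s(1) g(1) nf orb_self] by blast
        then show ?thesis using D[OF g(1,3) nf(1) orb_self] mg by simp
      next
        case False
        have "g \<notin> ?C"
        proof (cases "frozen b g")
          case True then show ?thesis using linked_path_frozen[OF b le g(1,3)] g(2) by blast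
        next
          case nf: False
          then show ?thesis using False g(3) orb_self unfolding D_def by blast
        qed
        then show ?thesis using r g False mg unfolding \<chi>'_def reg_inv_def by simp
      qed
    qed
    show "\<chi>' (m g) = \<chi>' g" if "g \<notin> ?C'"
    proof (cases "par g = q")
      case True then show ?thesis using cross g that by blast
    next
      case False
      have "gyr q b g \<Longrightarrow> m g \<in> ?C' \<longleftrightarrow> g \<in> ?C'"
        using path_lab[OF gyr_fpl[OF b] s(2)] g unfolding lab_inv_def by blast
      then have "m g \<notin> ?C'" using that Cb(2) gyr_mate[OF b g] by blast
      then show ?thesis using cross[of "m g"] g mate_in mate_mate par_mate False by auto
    qed
  qed
  moreover have "\<chi>' g = \<chi> g" if "par g \<noteq> q" for g using that unfolding \<chi>'_def D_def by simp
  moreover have "\<chi>' g = \<chi> g" if "par g = q" "frozen b g \<or> orb g \<inter> ?C = {}" for g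
    using that unfolding \<chi>'_def D_def by auto
  ultimately show ?thesis using D by (intro exI[of _ \<chi>'] conjI) auto
qed

text \<open>A face of at most two sides that is not frozen has sides of one colour. A path meeting
  it before and after would need black sides both times, but complementing turns all of them white;
  so the face of the puncture is never swept over. The premise \<open>ends\<close> isolates the
  comparison of the starting points, which differs for the two directions.\<close>

lemma region_puncture:
  assumes b: "fpl b" and le: "linked_ends q b s s'" and p: "p \<in> H" "f (f p) = p" "p \<notin> X" "f p \<notin> X"
    and ends: "\<And>\<chi> \<chi>'. reg_inv (path b s) \<chi> \<Longrightarrow>
      (\<And>g. g \<in> H \<Longrightarrow> par g \<noteq> q \<Longrightarrow> \<chi>' g = \<chi> g) \<Longrightarrow>
      (\<And>g y. g \<in> H \<Longrightarrow> par g = q \<Longrightarrow> \<not> frozen b g \<Longrightarrow> y \<in> orb g \<Longrightarrow> y \<in> path b s \<Longrightarrow>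
       \<chi>' g = \<chi> (m y)) \<Longrightarrow> \<chi>' s' = \<chi> s"
    and reg: "p \<in> region \<Lambda> (path (gyr q b) s') s'"
  shows "p \<in> region \<Lambda> (path b s) s"
  unfolding region_iff
proof (intro allI impI)
  fix \<chi> assume r: "reg_inv (path b s) \<chi>"
  have s: "b s" "gyr q b s'" using le unfolding linked_ends_def by auto
  obtain \<chi>' where r': "reg_inv (path (gyr q b) s') \<chi>'"
    and out: "\<forall>g\<in>H. par g \<noteq> q \<longrightarrow> \<chi>' g = \<chi> g"
    and same: "\<forall>g\<in>H. par g = q \<longrightarrow> frozen b g \<or> orb g \<inter> path b s = {} \<longrightarrow> \<chi>' g = \<chi> g"
    and flip: "\<forall>g\<in>H. \<forall>y. par g = q \<longrightarrow> \<not> frozen b g \<longrightarrow> y \<in> orb g \<longrightarrow> y \<in> path b s \<longrightarrow>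
       \<chi>' g = \<chi> (m y)"
    using region_transport[OF b le r] by (elim exE conjE)
  have "\<chi>' p = \<chi> p"
  proof (cases "par p = q \<and> \<not> frozen b p")
    case False then show ?thesis using out same p(1) by blast
  next
    case True
    have "(f ^^ 2) p = p" using p by (simp add: eval_nat_numeral)
    then have orb: "orb p = {p, f p}"
      using orb_period[of 2 p] by (simp add: eval_nat_numeral lessThan_Suc insert_commute)
    then have eq: "b (f p) = b p" using True p unfolding frozen_def by auto
    have fp: "f p \<in> H" "par (f p) = q" "\<not> frozen b (f p)" using True p f_in par_f frozen_f by auto
    have "orb p \<inter> path b s = {}"
    proof (rule ccontr)
      assume meet: "orb p \<inter> path b s \<noteq> {}"
      then have meet': "orb p \<inter> path (gyr q b) s' \<noteq> {}"
        using linked_path_meets[OF b le p(1)] True by blast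
      have "b p" using meet eq path_sub[OF b s(1) path_lab[OF b s(1)]] orb by auto
      moreover have "gyr q b p \<or> gyr q b (f p)"
        using meet' path_sub[OF gyr_fpl[OF b] s(2) path_lab[OF gyr_fpl[OF b] s(2)]] orb by auto
      ultimately show False using eq True gyr_active[OF p(1)] gyr_active[OF fp(1,2)] fp(3) by auto
    qed
    then show ?thesis using same p True by blast
  qed
  moreover have "\<chi>' s' = \<chi> s" using ends[OF r] out flip by blast
  moreover have "\<chi>' p = \<chi>' s'" using reg r' unfolding region_iff by blast
  ultimately show "\<chi> p = \<chi> s" by simp
qed

lemma region_ext:
  assumes b: "fpl b" and j: "j \<in> J" "par (e j) = q" "b (e j)"
    and p: "p \<in> H" "f (f p) = p" "p \<notin> X" "f p \<notin> X"
  shows "p \<in> region \<Lambda> (path (gyr q b) (e (nx j))) (e (nx j)) \<longleftrightarrow> p \<in> region \<Lambda> (path b (e j)) (e j)"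
proof
  have H: "e j \<in> H" "e (nx j) \<in> H" "m (e (nx j)) \<in> H" using ext_in nx_in j mate_in by blast+
  have le: "linked_ends q b (e j) (e (nx j))" by (rule linked_ends_ext[OF b j])
  have bn: "\<not> b (e (nx j))" "gyr q b (e (nx j))"
    using fplD(5)[OF b j(1)] gyr_ext[OF b nx_in] j by auto
  note nf = ext_not_frozen(3)[OF j(1)]
  show "p \<in> region \<Lambda> (path (gyr q b) (e (nx j))) (e (nx j)) \<Longrightarrow> p \<in> region \<Lambda> (path b (e j)) (e j)"
  proof (rule region_puncture[OF b le p])
    \<comment> \<open>\<open>e (nx j)\<close> has a face of the other parity on its right, where the
      invariant is unchanged; crossing this white edge leads into the boundary face of
      \<open>e j\<close>.\<close>
    fix \<chi> \<chi>' assume r: "reg_inv (path b (e j)) \<chi>" and out: "\<And>g. g \<in> H \<Longrightarrow> par g \<noteq> q \<Longrightarrow> \<chi>' g = \<chi> g"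
    have "\<chi>' (e (nx j)) = \<chi> (e (nx j))" using out H par_f_ext j by simp
    also have "\<dots> = \<chi> (m (e (nx j)))"
    proof -
      have "e (nx j) \<notin> path b (e j)" using bn(1) path_sub[OF b j(3) path_lab[OF b j(3)]] by blast
      then show ?thesis using r H unfolding reg_inv_def by metis
    qed
    also have "\<dots> = \<chi> (e j)"
    proof -
      have R: "\<chi> (c (m g)) = \<chi> g" if "g \<in> H" "m g \<notin> X" for g using r that unfolding reg_inv_def by blast
      have mX: "m (e j) \<notin> X" using mate_X e_inX j by blast
      from j(1) show ?thesis
      proof (cases rule: boundary_cases)
        case two then show ?thesis using R[OF H(1) mX] by simp
      next
        case three
        have "f (e j) \<in> H" using f_in H by blast
        then have "\<chi> (c (m (f (e j)))) = \<chi> (f (e j))" using R three by blast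
        moreover have "\<chi> (f (e j)) = \<chi> (e j)" using R[OF H(1) mX] three(2) by simp
        moreover have "c (m (f (e j))) = m (e (nx j))" using three(1,2) by simp
        ultimately show ?thesis by simp
      qed
    qed
    finally show "\<chi>' (e (nx j)) = \<chi> (e j)" .
  qed
  have g: "gyr q (gyr q b) = b" by (rule gyr_gyr[OF b])
  have "p \<in> region \<Lambda> (path (gyr q (gyr q b)) (e j)) (e j) \<Longrightarrow>
      p \<in> region \<Lambda> (path (gyr q b) (e (nx j))) (e (nx j))"
  proof (rule region_puncture[OF gyr_fpl[OF b] linked_ends_sym[OF b le] p])
    \<comment> \<open>Backwards, the boundary face of \<open>e j\<close> is itself swept over by the
      path ending at \<open>e (nx j)\<close>, so its new value is the old one beyond that
      edge.\<close>
    fix \<chi> \<chi>' assume "\<And>g y. g \<in> H \<Longrightarrow> par g = q \<Longrightarrow> \<not> frozen (gyr q b) g \<Longrightarrow> y \<in> orb g \<Longrightarrow>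
      y \<in> path (gyr q b) (e (nx j)) \<Longrightarrow> \<chi>' g = \<chi> (m y)"
    moreover have "m (e (nx j)) \<in> path (gyr q b) (e (nx j))"
      using path_lab[OF gyr_fpl[OF b] bn(2)] path_self H(2) bn(2) unfolding lab_inv_def by blast
    ultimately have "\<chi>' (e j) = \<chi> (m (m (e (nx j))))"
      using H(1) j(2) nf ext_not_frozen(1)[OF j(1)] by blast
    then show "\<chi>' (e j) = \<chi> (e (nx j))" using mate_mate H by simp
  qed
  then show "p \<in> region \<Lambda> (path b (e j)) (e j) \<Longrightarrow>
      p \<in> region \<Lambda> (path (gyr q b) (e (nx j))) (e (nx j))" unfolding g .
qed

lemma path_ext:
  assumes b: "fpl b" and i: "i \<in> J" "par (e i) = q" "b (e i)" and j: "j \<in> J" "par (e j) = q" "b (e j)"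
  shows "e (nx j) \<in> path (gyr q b) (e (nx i)) \<longleftrightarrow> e j \<in> path b (e i)"
proof -
  have li: "linked_ends q b (e i) (e (nx i))" and lj: "linked_ends q b (e j) (e (nx j))"
    using linked_ends_ext[OF b] i j by blast+
  have imp: "t \<in> path b s" if b: "fpl b" and l: "linked_ends q b s s'" "linked_ends q b t t'"
      and t: "t' \<in> path (gyr q b) s'" for b s s' t t'
  proof -
    have s: "b s" "gyr q b s'" using l unfolding linked_ends_def by auto
    let ?l = "\<lambda>x. x \<in> path b s"
    have inv: "lab_inv b ?l" by (rule path_lab[OF b s(1)])
    have "transport q b ?l t' = transport q b ?l s'"
      using path_sub[OF gyr_fpl[OF b] s(2) transp_inv[OF b inv] t] by blast
    then show ?thesis using l inv path_self unfolding linked_ends_def by simp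
  qed
  show ?thesis
    using imp[OF b li lj] imp[OF gyr_fpl[OF b] linked_ends_sym[OF b li] linked_ends_sym[OF b lj]]
      gyr_gyr[OF b] by auto
qed

lemma path_bivalent:
  assumes b: "fpl b" and j: "j \<in> J" "par (e j) = q" "b (e j)"
    and p: "p \<in> H" "p \<notin> X" "bivalent \<Lambda> p"
  shows "path (gyr q b) (e (nx j)) \<inter> vertex_of \<Lambda> p \<noteq> {} \<longleftrightarrow> path b (e j) \<inter> vertex_of \<Lambda> p \<noteq> {}"
proof -
  have cp: "c p \<in> H" "c p \<notin> X" "c (c p) = p" "c p \<noteq> p"
    using p ccw_in ccw_notX by (auto simp: bivalent_def)
  \<comment> \<open>Of the two corners at the degree-2 vertex, the one inside an active
    face.\<close>
  define h where "h = (if par (c p) = q then p else c p)"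
  have h: "h \<in> H" "h \<notin> X" "par (c h) = q" "vertex_of \<Lambda> p = {h, c h}" "bivalent \<Lambda> h"
    using p cp par_ccw[of p] par_ccw[of "c p"] vertex_bivalent[OF p(3)]
    unfolding h_def by (auto simp: bivalent_def)
  have imp: "path b s \<inter> {h, c h} \<noteq> {}"
    if b: "fpl b" and le: "linked_ends q b s s'" and meet: "path (gyr q b) s' \<inter> {h, c h} \<noteq> {}" for b s s'
  proof -
    have s: "b s" "gyr q b s'" using le unfolding linked_ends_def by auto
    obtain w where w: "w \<in> {h, c h}" "w \<in> path (gyr q b) s'" using meet by blast
    then have gw: "gyr q b w" using path_sub[OF gyr_fpl[OF b] s(2) path_lab[OF gyr_fpl[OF b] s(2)]] by blast
    have bw: "b (c h) \<noteq> b h" using fplD(4)[OF b h(1,2,5)] by simp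
    then obtain u where u: "u \<in> {h, c h}" "b u" by blast
    let ?l = "\<lambda>x. x \<in> path b s"
    have inv: "lab_inv b ?l" by (rule path_lab[OF b s(1)])
    have "?l u = transport q b ?l w" using transp_corner[OF b inv h(1-3) u w(1) gw bw] by simp
    also have "\<dots> = transport q b ?l s'"
      using path_sub[OF gyr_fpl[OF b] s(2) transp_inv[OF b inv] w(2)] by blast
    also have "\<dots> = True" using le inv path_self unfolding linked_ends_def by simp
    finally show ?thesis using u by blast
  qed
  have le: "linked_ends q b (e j) (e (nx j))" by (rule linked_ends_ext[OF b j])
  show ?thesis
    unfolding h(4)
    using imp[OF b le] imp[OF gyr_fpl[OF b] linked_ends_sym[OF b le]] gyr_gyr[OF b, of q] by auto
qed

definition idx :: "nat \<Rightarrow> nat \<Rightarrow> nat" where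
  "idx v k = (v - 1 + 2 * (k - 1)) mod (2 * N) + 1"

lemma idx_in: "idx v k \<in> J"
  using nblack_pos unfolding idx_def by (simp add: Suc_le_eq)

lemma relabelled_idx: "relabelled \<Lambda> v k = e (idx v k)"
  by (simp add: relabelled_def idx_def)

lemma nx_mod: "nx (x mod (2 * N) + 1) = (x + 1) mod (2 * N) + 1"
  unfolding next_ext_def by (simp add: mod_Suc_eq)

lemma idx_nx: assumes "v \<in> J" shows "idx (nx v) k = nx (idx v k)"
proof -
  have "nx (idx v k) = (v - 1 + 2 * (k - 1) + 1) mod (2 * N) + 1"
    unfolding idx_def by (rule nx_mod)
  also have "v - 1 + 2 * (k - 1) + 1 = v + 2 * (k - 1)" using assms by simp
  finally show ?thesis unfolding idx_def next_ext_def by (simp add: mod_add_left_eq)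
qed

lemma idx_Suc: assumes "k \<ge> 1" shows "idx v (k + 1) = nx (nx (idx v k))"
proof -
  have "nx (nx (idx v k)) = (v - 1 + 2 * (k - 1) + 1 + 1) mod (2 * N) + 1"
    unfolding idx_def by (simp only: nx_mod)
  moreover have "v - 1 + 2 * (k - 1) + 1 + 1 = v - 1 + 2 * (k + 1 - 1)" using assms by simp
  ultimately show ?thesis unfolding idx_def by (simp only:)
qed

lemma idx_one: "v \<in> J \<Longrightarrow> idx v 1 = v"
  unfolding idx_def by auto

lemma idx_black: assumes "fpl b" "v \<in> J" "k \<ge> 1" shows "b (e (idx v k)) = b (e v)"
  using assms(3)
proof (induction k rule: dec_induct)
  case base then show ?case using idx_one[OF assms(2)] by simp
next
  case (step k)
  then show ?case
    using idx_Suc[of k v] fplD(5)[OF assms(1)] idx_in nx_in by simp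
qed

lemma idx_par: assumes "v \<in> J" "k \<ge> 1" shows "par (e (idx v k)) = par (e v)"
  using assms(2)
proof (induction k rule: dec_induct)
  case base then show ?case using idx_one[OF assms(1)] by simp
next
  case (step k)
  then show ?case
    using idx_Suc[of k v] par_f_ext idx_in nx_in by simp
qed

text \<open>All path ends slide on by one external edge, and so does the first label; hence every
  label, every link and the position of the puncture stay the same.\<close>

lemma link_transport:
  assumes b: "fpl b" and v: "v \<in> J" "par (e v) = q" "b (e v)"
  shows "link_pattern_of \<Lambda> (edges_of (gyr q b)) (nx v) = link_pattern_of \<Lambda> (edges_of b) v"
proof -
  have k: "idx v k \<in> J" "par (e (idx v k)) = q" "b (e (idx v k))" if "k \<in> {1..N}" for k
    using that idx_in idx_par[OF v(1)] idx_black[OF b v(1)] v by auto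
  have "linked_labels \<Lambda> (edges_of (gyr q b)) (nx v) = linked_labels \<Lambda> (edges_of b) v"
    unfolding linked_labels_def relabelled_idx idx_nx[OF v(1)] using path_ext[OF b k k] by blast
  moreover have "{(k, l) \<in> linked_labels \<Lambda> (edges_of b) v.
        p \<notin> region \<Lambda> (path (gyr q b) (relabelled \<Lambda> (nx v) k)) (relabelled \<Lambda> (nx v) k)} =
      {(k, l) \<in> linked_labels \<Lambda> (edges_of b) v.
        p \<notin> region \<Lambda> (path b (relabelled \<Lambda> v k)) (relabelled \<Lambda> v k)}"
    if p: "puncture \<Lambda> = In_Face p" for p
  proof -
    have "p \<in> H" "f (f p) = p" "p \<notin> X" "f p \<notin> X" using puncture_ok p unfolding puncture_ok_def by auto
    then show ?thesis
      unfolding relabelled_idx idx_nx[OF v(1)] linked_labels_def using region_ext[OF b k] by auto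
  qed
  moreover have "{{Some k, None} | k. k \<in> {1..N} \<and>
        path (gyr q b) (relabelled \<Lambda> (nx v) k) \<inter> vertex_of \<Lambda> p \<noteq> {}} =
      {{Some k, None} | k. k \<in> {1..N} \<and> path b (relabelled \<Lambda> v k) \<inter> vertex_of \<Lambda> p \<noteq> {}}"
    if p: "puncture \<Lambda> = At_Vertex p" for p
  proof -
    have "p \<in> H" "p \<notin> X" "bivalent \<Lambda> p" using puncture_ok p unfolding puncture_ok_def by auto
    then show ?thesis
      unfolding relabelled_idx idx_nx[OF v(1)] using path_bivalent[OF b k] by blast
  qed
  ultimately show ?thesis
    unfolding link_pattern_of_def Let_def by (simp split: puncture.split)
qed

end

section \<open>Balancing the two colours at each position\<close>

lemma gyration_count:
  fixes S :: "'a \<Rightarrow> complex" and pos :: "'a \<Rightarrow> nat"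
  assumes fin: "finite A" and bij: "bij_betw G A A" and inv: "\<And>x. x \<in> A \<Longrightarrow> S (G x) = S x"
    and white: "\<And>x. x \<in> A \<Longrightarrow> \<not> w x \<Longrightarrow> pos (G x) = pos x \<and> w (G x) \<or> pos (G x) = pos x + 1 \<and> \<not> w (G x)"
    and black: "\<And>x. x \<in> A \<Longrightarrow> w x \<Longrightarrow> pos (G x) = pos x \<and> \<not> w (G x) \<or> pos (G x) + 1 = pos x \<and> w (G x)"
  shows "(\<Sum>x\<in>{x \<in> A. pos x = n \<and> \<not> w x}. S x) = (\<Sum>x\<in>{x \<in> A. pos x = n \<and> w x}. S x)"
proof -
  define I :: "bool \<Rightarrow> complex" where "I P = (if P then 1 else 0)" for P
  have filt: "(\<Sum>x\<in>{x \<in> A. P x}. S x) = (\<Sum>x\<in>A. I (P x) * S x)" for P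
    unfolding I_def sum.inter_filter[OF fin] by (rule sum.cong) auto
  have re: "(\<Sum>x\<in>A. I (P (G x)) * S x) = (\<Sum>x\<in>A. I (P x) * S x)" for P
  proof -
    have "(\<Sum>x\<in>A. I (P (G x)) * S x) = (\<Sum>x\<in>A. I (P (G x)) * S (G x))"
      using inv by simp
    also have "\<dots> = (\<Sum>x\<in>A. I (P x) * S x)"
      by (rule sum.reindex_bij_betw[OF bij, of "\<lambda>x. I (P x) * S x"])
    finally show ?thesis .
  qed
  \<comment> \<open>The weighted sum over \<open>pos \<le> n\<close> is preserved by
    \<open>G\<close>. Elements leave this range only from white at \<open>n\<close> and enter it
    only as black at \<open>n\<close>, which the bracket records; its two parts cancel after
    summation. This takes the place of an induction on \<open>n\<close>.\<close>
  have pt: "I (pos x = n \<and> \<not> w x) = I (pos (G x) = n \<and> w (G x)) + (I (pos x \<le> n) - I (pos (G x) \<le> n))"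
    if "x \<in> A" for x
    using white[OF that] black[OF that] unfolding I_def by (cases "w x") auto
  have "(\<Sum>x\<in>A. I (pos x = n \<and> \<not> w x) * S x) =
      (\<Sum>x\<in>A. I (pos (G x) = n \<and> w (G x)) * S x) +
      ((\<Sum>x\<in>A. I (pos x \<le> n) * S x) - (\<Sum>x\<in>A. I (pos (G x) \<le> n) * S x))"
    unfolding sum.distrib[symmetric] sum_subtractf[symmetric]
    by (rule sum.cong[OF refl]) (simp add: pt algebra_simps)
  also have "\<dots> = (\<Sum>x\<in>A. I (pos x = n \<and> w x) * S x)"
    using re[of "\<lambda>x. pos x \<le> n"] re[of "\<lambda>x. pos x = n \<and> w x"] by simp
  finally show ?thesis unfolding filt .
qed

context plane_domain begin

section \<open>The refinement position\<close>

abbreviation "L \<equiv> side_length \<Lambda>"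

lemma side_length:
  "1 \<le> L" "L \<le> 2 * N" "c (m (e L)) = m (e (nx L))"
  "1 \<le> j \<Longrightarrow> j < L \<Longrightarrow> c (m (e j)) \<noteq> m (e (nx j))"
proof -
  let ?P = "\<lambda>j. 1 \<le> j \<and> c (m (e j)) = m (e (nx j))"
  have P: "?P (2 * N)" using corner nblack_pos by (simp add: next_ext_def)
  have "?P L" unfolding side_length_def by (rule LeastI[of ?P, OF P])
  then show "1 \<le> L" "c (m (e L)) = m (e (nx L))" by auto
  show "L \<le> 2 * N" unfolding side_length_def by (rule Least_le[of ?P, OF P])
  show "1 \<le> j \<Longrightarrow> j < L \<Longrightarrow> c (m (e j)) \<noteq> m (e (nx j))"
    unfolding side_length_def using not_less_Least[of j ?P] by blast
qed

lemma side_J: "j \<in> {1..L} \<Longrightarrow> j \<in> J"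
  using side_length(2) by auto

lemma nx_side: "1 \<le> j \<Longrightarrow> j < L \<Longrightarrow> nx j = j + 1"
  using side_length(2) by (simp add: next_ext_def)

text \<open>\<open>f (e j)\<close> is the half, at the vertex of external edge \<open>j\<close>, of
  the edge along the side; seen from the next vertex this is the left edge.\<close>

lemma side_edge:
  assumes "1 \<le> j" "j < L"
  shows "c (m (e j)) = f (e j)" "c (c (c (m (e (j + 1))))) = m (f (e j))"
    "c (m (f (e j))) = m (e (j + 1))" "m (f (e j)) \<notin> X" "m (f (e j)) \<in> H"
proof -
  have j: "j \<in> J" using assms side_J by simp
  then have H: "m (f (e j)) \<in> H" using ext_in f_in mate_in by blast
  then show "m (f (e j)) \<in> H" .
  from j have A: "c (m (e j)) = f (e j) \<and> c (m (f (e j))) = m (e (j + 1)) \<and> m (f (e j)) \<notin> X"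
  proof (cases rule: boundary_cases)
    case two then show ?thesis using side_length(4)[OF assms] by simp
  next
    case three then show ?thesis using nx_side[OF assms] by simp
  qed
  then show "c (m (e j)) = f (e j)" "c (m (f (e j))) = m (e (j + 1))" "m (f (e j)) \<notin> X" by auto
  have "e (j + 1) \<in> X" using e_inX nx_in[of j] nx_side[OF assms] by simp
  then have q: "quartic \<Lambda> (m (e (j + 1)))" by (rule quartic_mate_ext)
  have "quartic \<Lambda> (m (f (e j)))"
  proof (rule ccontr)
    assume "\<not> quartic \<Lambda> (m (f (e j)))"
    then have "bivalent \<Lambda> (m (f (e j)))" using degree H A by blast
    then show False using q A unfolding bivalent_def quartic_def by metis
  qed
  then show "c (c (c (m (e (j + 1))))) = m (f (e j))" using A unfolding quartic_def by metis
qed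

text \<open>The two vertical edges decide the tile: if their colours agree, the vertex rule gives
  both horizontal edges the other colour.\<close>

definition straight :: "(half \<Rightarrow> bool) \<Rightarrow> nat \<Rightarrow> bool" where
  "straight b j \<longleftrightarrow> b (c (c (m (e j)))) = b (e j)"

lemma tile:
  assumes b: "fpl b" and j: "j \<in> J"
  shows "two_of (b (e j)) (b (c (m (e j)))) (b (c (c (m (e j))))) (b (c (c (c (m (e j))))))"
    "c_tile \<Lambda> (edges_of b) j \<longleftrightarrow> straight b j"
proof -
  let ?d = "m (e j)"
  have d: "?d \<in> H" "?d \<notin> X" "quartic \<Lambda> ?d" "b ?d = b (e j)"
    using j ext_in mate_in mate_X e_inX quartic_mate_ext fplD(2)[OF b] by blast+
  show two: "two_of (b (e j)) (b (c (m (e j)))) (b (c (c (m (e j))))) (b (c (c (c (m (e j))))))"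
    using fplD(3)[OF b d(1-3)] d(4) by simp
  note v = vertex_quartic[OF d(3)]
  have "black_at \<Lambda> (edges_of b) ?d = {g \<in> {?d, c ?d, c (c ?d), c (c (c ?d))}. b g}"
    using Fpl_edges_of[OF b] v(1) unfolding black_at_def is_black_def fun_eq_iff by auto
  then have "c_tile \<Lambda> (edges_of b) j \<longleftrightarrow>
      (b ?d \<and> \<not> b (c ?d) \<and> b (c (c ?d)) \<and> \<not> b (c (c (c ?d)))) \<or>
      (\<not> b ?d \<and> b (c ?d) \<and> \<not> b (c (c ?d)) \<and> b (c (c (c ?d))))"
    using v(2) unfolding c_tile_def Let_def by (simp add: set_eq_iff) (smt (verit))
  then show "c_tile \<Lambda> (edges_of b) j \<longleftrightarrow> straight b j"
    using two d(4) unfolding two_of_def straight_def by (auto split: if_splits)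
qed

text \<open>The right edge has the colour of the external edge. Along the side this holds strictly
  before the c-tile and fails from there on, so that the refinement position becomes a
  threshold.\<close>

definition before :: "(half \<Rightarrow> bool) \<Rightarrow> nat \<Rightarrow> bool" where
  "before b j \<longleftrightarrow> b (c (m (e j))) = b (e j)"

lemma before_last: assumes "fpl b" shows "\<not> before b L"
proof -
  have "L \<in> J" using side_J side_length by simp
  then have "b (m (e (nx L))) = (\<not> b (e L))"
    using fplD(2,5)[OF assms] ext_in nx_in by simp
  then show ?thesis using side_length(3) by (simp add: before_def)
qed

text \<open>At the corner the left edge is external edge \<open>2 * N\<close>, of the colour
  opposite to edge 1; the vertex behaves as if \<open>before\<close> held at a vertex 0.\<close>

lemma before_first: assumes "fpl b" shows "straight b 1 \<longleftrightarrow> \<not> before b 1"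
proof -
  have J: "1 \<in> J" "2 * N \<in> J" using nblack_pos by auto
  let ?z = "m (e (2 * N))"
  have "quartic \<Lambda> ?z" using quartic_mate_ext e_inX J by blast
  then have "c (c (c (m (e 1)))) = ?z" using corner unfolding quartic_def by metis
  moreover have "nx (2 * N) = 1" using nblack_pos by (simp add: next_ext_def)
  then have "b ?z = (\<not> b (e 1))" using fplD(2)[OF assms ext_in[OF J(2)]] fplD(5)[OF assms J(2)] by simp
  ultimately show ?thesis
    using tile(1)[OF assms J(1)] unfolding straight_def before_def two_of_def by (auto split: if_splits)
qed

text \<open>The left edge at a vertex is the right edge at the preceding one, while the external
  colours alternate; the vertex rule then propagates \<open>before\<close> backwards and forces a
  straight tile exactly where it stops.\<close>

lemma before_step:
  assumes b: "fpl b" and j: "1 \<le> j" "j < L"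
  shows "before b (j + 1) \<Longrightarrow> before b j" "straight b (j + 1) \<longleftrightarrow> before b j \<and> \<not> before b (j + 1)"
proof -
  have J: "j \<in> J" "j + 1 \<in> J" using side_J j by auto
  have "b (m (f (e j))) = b (f (e j))" using fplD(2)[OF b] f_in ext_in J by blast
  moreover have "b (e (j + 1)) = (\<not> b (e j))" using fplD(5)[OF b J(1)] nx_side[OF j] by simp
  ultimately have *: "b (c (c (c (m (e (j + 1)))))) = (before b j \<noteq> b (e (j + 1)))"
    using side_edge(1,2)[OF j] unfolding before_def by auto
  show "before b (j + 1) \<Longrightarrow> before b j" "straight b (j + 1) \<longleftrightarrow> before b j \<and> \<not> before b (j + 1)"
    using tile(1)[OF b J(2)] * unfolding straight_def before_def[of b "j + 1"] two_of_def
    by (auto split: if_splits)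
qed

definition refpos :: "(half \<Rightarrow> bool) \<Rightarrow> nat" where
  "refpos b = (LEAST j. 1 \<le> j \<and> \<not> before b j)"

lemma refpos:
  assumes b: "fpl b"
  shows "1 \<le> refpos b" "refpos b \<le> L" "\<And>j. j \<in> {1..L} \<Longrightarrow> before b j \<longleftrightarrow> j < refpos b"
    "\<And>j. j \<in> {1..L} \<Longrightarrow> straight b j \<longleftrightarrow> j = refpos b"
    "refinement_pos \<Lambda> (edges_of b) = refpos b"
proof -
  let ?P = "\<lambda>j. 1 \<le> j \<and> \<not> before b j"
  have P: "?P L" using before_last[OF b] side_length by simp
  have h: "?P (refpos b)" unfolding refpos_def by (rule LeastI[of ?P, OF P])
  show 1: "1 \<le> refpos b" using h by simp
  show 2: "refpos b \<le> L" unfolding refpos_def by (rule Least_le[of ?P, OF P])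
  have lt: "before b j" if "1 \<le> j" "j < refpos b" for j
    using not_less_Least[of j ?P] that unfolding refpos_def by blast
  have ge: "\<not> before b j" if "refpos b \<le> j" "j \<le> L" for j
    using that
  proof (induction j rule: dec_induct)
    case base then show ?case using h by simp
  next
    case (step n) then show ?case using before_step(1)[OF b, of n] 1 by auto
  qed
  show 3: "before b j \<longleftrightarrow> j < refpos b" if "j \<in> {1..L}" for j
    using lt[of j] ge[of j] that by force
  show 4: "straight b j \<longleftrightarrow> j = refpos b" if j: "j \<in> {1..L}" for j
  proof (cases "j = 1")
    case True
    then show ?thesis using before_first[OF b] 3[OF j] 1 by auto
  next
    case False
    then obtain i where i: "j = i + 1" "1 \<le> i" "i < L" using j by (cases j) auto
    then show ?thesis using before_step(2)[OF b i(2,3)] 3[of i] 3[of j] j by auto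
  qed
  show "refinement_pos \<Lambda> (edges_of b) = refpos b"
    unfolding refinement_pos_def
  proof (rule the_equality)
    show "refpos b \<in> {1..L} \<and> c_tile \<Lambda> (edges_of b) (refpos b)"
      using 1 2 4 tile(2)[OF b] side_J by auto
    show "j = refpos b" if "j \<in> {1..L} \<and> c_tile \<Lambda> (edges_of b) j" for j
      using that 4 tile(2)[OF b] side_J by blast
  qed
qed

text \<open>The parity of the boundary faces between \<open>j\<close> and \<open>j + 1\<close> for
  black \<open>j\<close>. It depends on the colouring and changes with each gyration, because edge 1
  flips.\<close>

definition active :: "(half \<Rightarrow> bool) \<Rightarrow> bool" where
  "active b \<longleftrightarrow> (par (e 1) \<longleftrightarrow> b (e 1))"

lemma active: assumes b: "fpl b" and j: "j \<in> J" shows "par (e j) = active b \<longleftrightarrow> b (e j)"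
proof -
  have "1 \<le> j" "j \<le> 2 * N" using j by auto
  then have "(par (e j) \<longleftrightarrow> b (e j)) = active b"
  proof (induction j rule: dec_induct)
    case base then show ?case by (simp add: active_def)
  next
    case (step n)
    then have "n \<in> J" "nx n = Suc n" by (auto simp: next_ext_def)
    then show ?case using step fplD(5)[OF b, of n] par_f_ext[of n] by auto
  qed
  then show ?thesis by auto
qed

text \<open>For black \<open>j\<close> the right edge is a side of the active boundary face and
  flips along with the external edge. For white \<open>j\<close> it flips with the face above it,
  unless that face is frozen; then its alternating colours make one of the two vertices on its lower
  side a c-tile.\<close>

lemma before_gyr:
  assumes b: "fpl b" and j: "1 \<le> j" "j < L"
  shows "before (gyr (active b) b) j \<noteq> before b j \<longrightarrow> \<not> b (e j) \<and> (j = refpos b \<or> j + 1 = refpos b)"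
proof -
  let ?q = "active b" let ?g = "f (e j)"
  have J: "j \<in> J" "j + 1 \<in> J" using side_J j by auto
  have H: "e j \<in> H" "?g \<in> H" "m ?g \<in> H" using ext_in f_in mate_in J by blast+
  have x': "gyr ?q b (e j) = (\<not> b (e j))" by (rule gyr_ext[OF b J(1)])
  have bf: "before b j \<longleftrightarrow> b ?g = b (e j)" "before (gyr ?q b) j \<longleftrightarrow> gyr ?q b ?g = (\<not> b (e j))"
    using side_edge(1)[OF j] x' unfolding before_def by auto
  show ?thesis
  proof (cases "b (e j)")
    case True
    then have p: "par ?g = ?q" using active[OF b J(1)] par_f H by simp
    have "\<not> frozen b ?g" using ext_not_frozen(1)[OF J(1)] frozen_f H by simp
    then show ?thesis using gyr_active[OF H(2) p, of b] bf by auto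
  next
    case False
    then have p: "par (m ?g) = ?q" using active[OF b J(1)] par_f par_mate H by auto
    have bm: "b (m ?g) = b ?g" "gyr ?q b ?g = gyr ?q b (m ?g)"
      using fplD(2)[OF b H(2)] gyr_mate[OF b H(2)] by auto
    show ?thesis
    proof (cases "frozen b (m ?g)")
      case fr: False
      then show ?thesis using gyr_active[OF H(3) p, of b] bf bm by auto
    next
      case True
      have gX: "?g \<notin> X"
        using side_edge(1)[OF j] ccw_notX mate_in mate_X e_inX J(1) H(1) by metis
      have "f (m ?g) = c ?g" by (rule f_mate[OF H(2) gX])
      then have up: "b (c ?g) \<noteq> b ?g" using True orb_self[of "m ?g"] bm unfolding frozen_def by metis
      let ?u = "c (c (m (e (j + 1))))"
      have d: "m (e (j + 1)) \<in> H" "m (e (j + 1)) \<notin> X" using J(2) ext_in mate_in mate_X e_inX by blast+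
      then have u: "?u \<in> H" "?u \<notin> X" using ccw_in ccw_notX by blast+
      have fu: "f (m ?u) = m ?g" using f_mate[OF u] side_edge(2)[OF j] by simp
      have mu: "m ?u \<in> H" using mate_in u by blast
      have "m ?u \<in> orb (m ?g)" using orb_f[OF mu] orb_self fu by metis
      then have "b (m ?g) \<noteq> b (m ?u)" using True fu unfolding frozen_def by metis
      then have up': "b ?u \<noteq> b ?g" using fplD(2)[OF b u(1)] bm by simp
      have s1: "straight b j \<longleftrightarrow> j = refpos b" "straight b (j + 1) \<longleftrightarrow> j + 1 = refpos b"
        using refpos(4)[OF b] j by auto
      have "b (e (j + 1)) = (\<not> b (e j))" using fplD(5)[OF b J(1)] nx_side[OF j] by simp
      \<comment> \<open>Both upward edges differ from the edge between the vertices and so agree,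
        whereas the two external edges differ.\<close>
      then have "straight b j \<or> straight b (j + 1)"
        using up up' side_edge(1)[OF j] unfolding straight_def by auto
      then show ?thesis using s1 False by blast
    qed
  qed
qed

lemma refpos_eqI:
  assumes b: "fpl b" and h: "h \<in> {1..L}" "\<not> before b h" "h \<ge> 2 \<Longrightarrow> before b (h - 1)"
  shows "refpos b = h"
proof -
  have "refpos b \<le> h" using refpos(3)[OF b h(1)] h(2) by simp
  moreover have "h \<le> refpos b"
  proof (cases "h \<ge> 2")
    case True
    then have "h - 1 \<in> {1..L}" using h by auto
    then show ?thesis using refpos(3)[OF b, of "h - 1"] h(3)[OF True] by linarith
  next
    case False then show ?thesis using refpos(1)[OF b] by simp
  qed
  ultimately show ?thesis by simp
qed

text \<open>\<open>before\<close> can change only at the refinement position and just before it, and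
  only at a white external edge. The two colours there differ, so from a black position the
  threshold can only drop by one, and from a white position only rise by one.\<close>

lemma refpos_gyr:
  assumes b: "fpl b"
  defines "b' \<equiv> gyr (active b) b"
  shows "if b (e (refpos b))
    then refpos b' = refpos b \<and> \<not> b' (e (refpos b')) \<or> refpos b' + 1 = refpos b \<and> b' (e (refpos b'))
    else refpos b' = refpos b \<and> b' (e (refpos b')) \<or> refpos b' = refpos b + 1 \<and> \<not> b' (e (refpos b'))"
proof -
  let ?h = "refpos b"
  have b': "fpl b'" unfolding b'_def by (rule gyr_fpl[OF b])
  note r = refpos(1-3)[OF b]
  have hJ: "?h \<in> J" using r side_J by simp
  have x': "b' (e j) = (\<not> b (e j))" if "j \<in> J" for j unfolding b'_def by (rule gyr_ext[OF b that])
  have nb': "b' (e (j + 1)) = (\<not> b' (e j))" if "1 \<le> j" "j < L" for j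
    using fplD(5)[OF b', of j] nx_side[OF that] side_J that by simp
  have nb: "b (e (j + 1)) = (\<not> b (e j))" if "1 \<le> j" "j < L" for j
    using fplD(5)[OF b, of j] nx_side[OF that] side_J that by simp
  have chg: "before b' j = before b j" if "1 \<le> j" "j < L" "b (e j) \<or> j \<noteq> ?h \<and> j + 1 \<noteq> ?h" for j
    using before_gyr[OF b that(1,2)] that(3) unfolding b'_def by blast
  have last: "\<not> before b' L" by (rule before_last[OF b'])
  show ?thesis
  proof (cases "b (e ?h)")
    case True
    have bh: "\<not> before b' ?h"
      using chg[of ?h] True r last by (cases "?h = L") auto
    show ?thesis
    proof (cases "?h \<ge> 2 \<longrightarrow> before b' (?h - 1)")
      case T: True
      then have "refpos b' = ?h" by (intro refpos_eqI[OF b']) (use r bh in auto)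
      then show ?thesis using True x' hJ by simp
    next
      case F: False
      define i where "i = ?h - 1"
      have i: "?h = i + 1" "1 \<le> i" "i < L" using F r unfolding i_def by auto
      have "before b' (i - 1)" if "i \<ge> 2"
      proof -
        have "before b' (i - 1) = before b (i - 1)" by (rule chg) (use that i in auto)
        moreover have "i - 1 \<in> {1..L}" "i - 1 < ?h" using that i by auto
        ultimately show ?thesis using r(3) by blast
      qed
      moreover have "\<not> before b' i" using F unfolding i_def by blast
      moreover have "i \<in> {1..L}" using i(2,3) by simp
      ultimately have "refpos b' = i" by (intro refpos_eqI[OF b'])
      then show ?thesis using True i nb'[OF i(2,3)] x' hJ by auto
    qed
  next
    case False
    have low: "before b' (?h - 1)" if "?h \<ge> 2"
    proof -
      have i: "1 \<le> ?h - 1" "?h - 1 < L" "?h - 1 + 1 = ?h" using that r by auto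
      have "b (e (?h - 1))" using nb[OF i(1,2)] i(3) False by simp
      then have "before b' (?h - 1) = before b (?h - 1)" using chg[OF i(1,2)] by blast
      then show ?thesis using r(3)[of "?h - 1"] i by auto
    qed
    show ?thesis
    proof (cases "before b' ?h")
      case F: False
      then have "refpos b' = ?h" by (intro refpos_eqI[OF b']) (use r low in auto)
      then show ?thesis using False x' hJ by simp
    next
      case T: True
      then have lt: "?h < L" using last r by (cases "?h = L") auto
      have "\<not> before b' (?h + 1)"
      proof (cases "?h + 1 = L")
        case True then show ?thesis using last by simp
      next
        case F: False
        then have "before b' (?h + 1) = before b (?h + 1)" using chg[of "?h + 1"] lt by auto
        then show ?thesis using r(3)[of "?h + 1"] lt by simp
      qed
      then have "refpos b' = ?h + 1" by (intro refpos_eqI[OF b']) (use lt T in auto)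
      then show ?thesis using False nb'[of ?h] r lt x' hJ by auto
    qed
  qed
qed

end

section \<open>Perfect matchings and arcs of a circle\<close>

lemma perfect_matching_partner:
  assumes "\<And>x. x \<in> A \<Longrightarrow> \<pi> x \<in> A \<and> \<pi> (\<pi> x) = x \<and> \<pi> x \<noteq> x"
  shows "perfect_matching A ((\<lambda>x. {x, \<pi> x}) ` A)"
  unfolding perfect_matching_def
proof (intro conjI ballI)
  show "partition_on A ((\<lambda>x. {x, \<pi> x}) ` A)"
  proof (rule partition_onI)
    show "\<Union> ((\<lambda>x. {x, \<pi> x}) ` A) = A" using assms by auto
    show "disjnt p q" if pq: "p \<in> (\<lambda>x. {x, \<pi> x}) ` A" "q \<in> (\<lambda>x. {x, \<pi> x}) ` A" "p \<noteq> q" for p q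
    proof -
      obtain x y where x: "x \<in> A" "p = {x, \<pi> x}" and y: "y \<in> A" "q = {y, \<pi> y}" using pq(1,2) by blast
      have "x \<noteq> y" using x(2) y(2) pq(3) by blast
      moreover have "\<pi> x \<noteq> y" "x \<noteq> \<pi> y"
        using x(2) y(2) pq(3) assms[OF x(1)] assms[OF y(1)] by (metis insert_commute)+
      moreover have "\<pi> x \<noteq> \<pi> y" using assms x y \<open>x \<noteq> y\<close> by metis
      ultimately show ?thesis unfolding disjnt_def x y by auto
    qed
    show "{} \<notin> (\<lambda>x. {x, \<pi> x}) ` A" by blast
  qed
  show "card p = 2" if "p \<in> (\<lambda>x. {x, \<pi> x}) ` A" for p
    using that assms by (auto simp: card_2_iff)
qed

lemma perfect_matching_even:
  assumes "perfect_matching A M" shows "even (card A)"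
proof -
  have p: "partition_on A M" "\<And>x. x \<in> M \<Longrightarrow> card x = 2"
    using assms by (auto simp: perfect_matching_def)
  have "finite x" if "x \<in> M" for x using p(2)[OF that] by (metis card.infinite zero_neq_numeral)
  then have "card (\<Union>M) = sum card M"
    using card_Union_disjoint[of M] p(1) by (simp add: partition_on_def disjoint_def pairwise_def disjnt_def)
  also have "\<dots> = 2 * card M" using p(2) by simp
  finally show ?thesis using p(1) by (simp add: partition_on_def)
qed

text \<open>Half-open, so that exchanging the ends gives the complement. This fits the faces to the
  right of external half-edges: the one at the first end already lies inside, the one at the second
  end outside.\<close>

definition arc :: "nat \<Rightarrow> nat \<Rightarrow> nat \<Rightarrow> nat set" where
  "arc n i j = (if i < j then {i..<j} else {i..n} \<union> {1..<j})"

text \<open>If neither chord separates the ends of the other, the closed intervals are nested,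
  disjoint, or cover the circle between them; the last hypothesis excludes the covering.\<close>

lemma arc_nested:
  assumes "i \<in> {1..n}" "j \<in> {1..n}" "k \<in> {1..n}" "l \<in> {1..n}"
    and "distinct [i, j, k, l]"
    and "k \<in> arc n i j \<longleftrightarrow> l \<in> arc n i j" "i \<in> arc n k l \<longleftrightarrow> j \<in> arc n k l"
    and "\<not> (k \<in> arc n i j \<and> i \<in> arc n k l)"
  shows "ccw_interval n (i, j) \<subseteq> ccw_interval n (k, l) \<or> ccw_interval n (k, l) \<subseteq> ccw_interval n (i, j) \<or>
    ccw_interval n (i, j) \<inter> ccw_interval n (k, l) = {}"
proof -
  consider "i < j" "k < l" | "i < j" "l < k" | "j < i" "k < l" | "j < i" "l < k"
    using assms(5) by fastforce
  then show ?thesis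
  proof cases
    case 1
    have "k \<in> arc n i j \<longleftrightarrow> i \<le> k \<and> k < j" "l \<in> arc n i j \<longleftrightarrow> i \<le> l \<and> l < j"
      "i \<in> arc n k l \<longleftrightarrow> k \<le> i \<and> i < l" "j \<in> arc n k l \<longleftrightarrow> k \<le> j \<and> j < l"
      using 1 by (simp_all add: arc_def)
    then have "(k \<le> i \<and> j \<le> l) \<or> (i \<le> k \<and> l \<le> j) \<or> j < k \<or> l < i"
      using assms(6-8) 1 by linarith
    then show ?thesis using 1 unfolding ccw_interval_def by fastforce
  next
    case 2
    have "k \<in> arc n i j \<longleftrightarrow> i \<le> k \<and> k < j" "l \<in> arc n i j \<longleftrightarrow> i \<le> l \<and> l < j"
      "i \<in> arc n k l \<longleftrightarrow> k \<le> i \<or> i < l" "j \<in> arc n k l \<longleftrightarrow> k \<le> j \<or> j < l"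
      using 2 assms(1-4) by (auto simp add: arc_def)
    then have "j \<le> l \<or> k \<le> i \<or> (l < i \<and> j < k)"
      using assms(6-8) 2 by linarith
    then show ?thesis using 2 assms(1-4) unfolding ccw_interval_def by fastforce
  next
    case 3
    have "k \<in> arc n i j \<longleftrightarrow> i \<le> k \<or> k < j" "l \<in> arc n i j \<longleftrightarrow> i \<le> l \<or> l < j"
      "i \<in> arc n k l \<longleftrightarrow> k \<le> i \<and> i < l" "j \<in> arc n k l \<longleftrightarrow> k \<le> j \<and> j < l"
      using 3 assms(1-4) by (auto simp add: arc_def)
    then have "l \<le> j \<or> i \<le> k \<or> (j < k \<and> l < i)"
      using assms(6-8) 3 by linarith
    then show ?thesis using 3 assms(1-4) unfolding ccw_interval_def by fastforce
  next
    case 4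
    have "k \<in> arc n i j \<longleftrightarrow> i \<le> k \<or> k < j" "l \<in> arc n i j \<longleftrightarrow> i \<le> l \<or> l < j"
      "i \<in> arc n k l \<longleftrightarrow> k \<le> i \<or> i < l" "j \<in> arc n k l \<longleftrightarrow> k \<le> j \<or> j < l"
      using 4 assms(1-4) by (auto simp add: arc_def)
    then have "(k \<le> i \<and> j \<le> l) \<or> (i \<le> k \<and> l \<le> j)"
      using assms(6-8) 4 by linarith
    then show ?thesis using 4 assms(1-4) unfolding ccw_interval_def by fastforce
  qed
qed

context plane_domain begin

section \<open>Black paths\<close>

definition ends :: "(half \<Rightarrow> bool) \<Rightarrow> half set" where
  "ends b = {x \<in> H. b x \<and> (x \<in> X \<or> bivalent \<Lambda> x)}"

definition other_black :: "(half \<Rightarrow> bool) \<Rightarrow> half \<Rightarrow> half" where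
  "other_black b h = (if b (c h) then c h else if b (c (c h)) then c (c h) else c (c (c h)))"

lemma other_black:
  assumes b: "fpl b" and h: "h \<in> H" "b h" "h \<notin> ends b"
  shows "other_black b h \<in> H" "b (other_black b h)" "other_black b h \<noteq> h" "other_black b (other_black b h) = h" "other_black b h \<notin> ends b"
    "h \<notin> X" "quartic \<Lambda> h" "{g \<in> vertex_of \<Lambda> h. b g} = {h, other_black b h}"
proof -
  show X: "h \<notin> X" and q: "quartic \<Lambda> h" using h degree by (auto simp: ends_def)
  have H: "c h \<in> H" "c h \<notin> X" "c (c h) \<in> H" "c (c h) \<notin> X" "c (c (c h)) \<in> H" "c (c (c h)) \<notin> X"
    using h X ccw_in ccw_notX by blast+
  note v = vertex_quartic[OF q]
  have two: "two_of (b h) (b (c h)) (b (c (c h))) (b (c (c (c h))))"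
    by (rule fplD(3)[OF b h(1) X q])
  have c4: "c (c (c (c h))) = h" using q by (simp add: quartic_def)
  show "other_black b h \<in> H" "b (other_black b h)" "other_black b h \<noteq> h"
    using H two h(2) v(2) unfolding other_black_def two_of_def by (auto split: if_splits)
  show "other_black b (other_black b h) = h" using two h(2) c4 unfolding other_black_def two_of_def by (auto split: if_splits)
  have qc: "quartic \<Lambda> (c h)" "quartic \<Lambda> (c (c h))" "quartic \<Lambda> (c (c (c h)))"
    using q quartic_ccw by blast+
  have "other_black b h \<notin> X" using H unfolding other_black_def by simp
  moreover have "quartic \<Lambda> (other_black b h)" using qc unfolding other_black_def by simp
  then have "\<not> bivalent \<Lambda> (other_black b h)" unfolding quartic_def bivalent_def by blast
  ultimately show "other_black b h \<notin> ends b" unfolding ends_def by blast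
  show "{g \<in> vertex_of \<Lambda> h. b g} = {h, other_black b h}"
    unfolding v(1) using two h(2) v(2) unfolding other_black_def two_of_def by (auto split: if_splits)
qed

lemma ends_vertex:
  assumes b: "fpl b" and h: "h \<in> ends b" and g: "g \<in> vertex_of \<Lambda> h" "b g"
  shows "g = h"
proof (cases "h \<in> X")
  case True then show ?thesis using vertex_ext g by simp
next
  case False
  then have "h \<in> H" "bivalent \<Lambda> h" "b h" using h by (auto simp: ends_def)
  then show ?thesis using g vertex_bivalent fplD(4)[OF b] False by auto
qed

text \<open>On either side of a path through a vertex there are only white edges to cross. Both
  half-edges point away from the vertex, so the right of one continues to the left of the
  other.\<close>

lemma sides:
  assumes b: "fpl b" and h: "h \<in> H" "b h" "h \<notin> ends b" and r: "reg_inv C \<chi>"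
    and C: "\<And>x. x \<in> C \<Longrightarrow> b x"
  shows "\<chi> (other_black b h) = \<chi> (m h)" "\<chi> (m (other_black b h)) = \<chi> h"
proof -
  note o = other_black[OF b h]
  have turn: "\<chi> (c y) = \<chi> (m y)" if "y \<in> H" "y \<notin> X" for y
    using r that mate_in mate_mate unfolding reg_inv_def by metis
  have cr: "\<chi> (m y) = \<chi> y" if "y \<in> H" "\<not> b y" for y
    using r that C unfolding reg_inv_def by metis
  have H: "c h \<in> H" "c h \<notin> X" "c (c h) \<in> H" "c (c h) \<notin> X" "c (c (c h)) \<in> H" "c (c (c h)) \<notin> X"
    using h(1) o(6) ccw_in ccw_notX by blast+
  note t = turn[OF h(1) o(6)] turn[OF H(1,2)] turn[OF H(3,4)] turn[OF H(5,6)]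
  have c4: "c (c (c (c h))) = h" using o(7) by (simp add: quartic_def)
  have two: "two_of (b h) (b (c h)) (b (c (c h))) (b (c (c (c h))))"
    by (rule fplD(3)[OF b h(1) o(6,7)])
  show "\<chi> (other_black b h) = \<chi> (m h)" "\<chi> (m (other_black b h)) = \<chi> h"
    using t cr[OF H(1)] cr[OF H(3)] cr[OF H(5)] c4 two h(2)
    unfolding other_black_def two_of_def by (auto split: if_splits)
qed

primrec walk :: "(half \<Rightarrow> bool) \<Rightarrow> half \<Rightarrow> nat \<Rightarrow> half" where
  "walk b s 0 = s"
| "walk b s (Suc n) = other_black b (m (walk b s n))"

text \<open>Following the path from \<open>s\<close> crosses edges and vertices alternately up to
  the other end. The sides are carried along, so each half-edge of the path has the two regions
  beside \<open>s\<close> on its two sides, in one order or the other.\<close>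

lemma path_ends:
  assumes b: "fpl b" and s: "s \<in> ends b"
  shows "\<exists>t. t \<in> path b s \<and> t \<noteq> s \<and> path b s \<inter> ends b = {s, t} \<and>
    (\<forall>x\<in>path b s.
       (\<forall>\<chi>. reg_inv (path b s) \<chi> \<longrightarrow> \<chi> x = \<chi> s \<and> \<chi> (m x) = \<chi> (m s)) \<or>
       (\<forall>\<chi>. reg_inv (path b s) \<chi> \<longrightarrow> \<chi> x = \<chi> (m s) \<and> \<chi> (m x) = \<chi> s)) \<and>
    (\<forall>\<chi>. reg_inv (path b s) \<chi> \<longrightarrow> \<chi> t = \<chi> (m s))"
proof -
  let ?w = "walk b s"
  have s': "s \<in> H" "b s" using s by (auto simp: ends_def)
  have mb: "m x \<in> H" "b (m x)" "m (m x) = x" "m x \<noteq> x" if "x \<in> H" "b x" for x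
    using that mate_in mate_mate fplD(2)[OF b] par_mate by metis+
  have good: "?w i \<in> H \<and> b (?w i) \<and> (i > 0 \<longrightarrow> ?w i \<notin> ends b)"
    if "\<And>k. k < i \<Longrightarrow> m (?w k) \<notin> ends b" for i
    using that
  proof (induction i)
    case 0 then show ?case using s' by simp
  next
    case (Suc i)
    then have IH: "?w i \<in> H" "b (?w i)" by simp_all
    then show ?case using other_black[OF b mb(1,2)[OF IH]] Suc.prems by simp
  qed
  have "\<exists>n. m (?w n) \<in> ends b"
  proof (rule ccontr)
    \<comment> \<open>The walk can be retraced, so a repetition in it would lead back to
      \<open>s\<close>; but no half-edge reached later is an end, while \<open>s\<close> is
      one.\<close>
    assume "\<nexists>n. m (?w n) \<in> ends b"
    then have none: "m (?w n) \<notin> ends b" for n by blast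
    have gd: "?w i \<in> H" "b (?w i)" for i using good none by blast+
    have bk: "?w i = ?w j" if "?w (Suc i) = ?w (Suc j)" for i j
      using that other_black(4)[OF b mb(1,2)[OF gd] none] mb(3)[OF gd] by (metis walk.simps(2))
    have "\<not> inj ?w"
      using finite_halves gd(1) by (metis finite_imageD finite_subset image_subsetI infinite_UNIV_nat)
    then obtain i j where ij: "?w i = ?w j" "i < j" unfolding inj_def by (metis nat_neq_iff)
    from ij have "\<exists>k>0. ?w 0 = ?w k"
    proof (induction i arbitrary: j)
      case 0 then show ?case by auto
    next
      case (Suc i)
      then obtain j' where "j = Suc j'" "i < j'" by (cases j) auto
      then show ?case using Suc bk by blast
    qed
    then obtain k where "k > 0" "?w k = s" by auto
    then show False using good[of k] none s by auto
  qed
  define n where "n = (LEAST n. m (?w n) \<in> ends b)"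
  have n: "m (?w n) \<in> ends b" "\<And>k. k < n \<Longrightarrow> m (?w k) \<notin> ends b"
    using \<open>\<exists>n. m (?w n) \<in> ends b\<close> LeastI_ex[of "\<lambda>n. m (?w n) \<in> ends b"]
      not_less_Least[of _ "\<lambda>n. m (?w n) \<in> ends b"] unfolding n_def by blast+
  have gd: "?w i \<in> H" "b (?w i)" "i > 0 \<Longrightarrow> ?w i \<notin> ends b" if "i \<le> n" for i
    using good[of i] n(2) that by auto
  have om: "other_black b (?w (Suc i)) = m (?w i)" if "i < n" for i
    using other_black(4)[OF b mb(1,2)[OF gd(1,2)] n(2)] that by simp
  define Z where "Z = ?w ` {..n} \<union> m ` ?w ` {..n}"
  define t where "t = m (?w n)"
  have Zb: "x \<in> H" "b x" if "x \<in> Z" for x using that gd mb unfolding Z_def by auto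
  have Zm: "m x \<in> Z" if "x \<in> Z" for x using that gd mb(3) unfolding Z_def by auto
  have Zo: "other_black b x \<in> Z" if x: "x \<in> Z" "x \<notin> ends b" for x
  proof -
    consider i where "i \<le> n" "x = ?w i" | i where "i \<le> n" "x = m (?w i)" using x unfolding Z_def by auto
    then show ?thesis
    proof cases
      case 1
      then obtain i' where "i = Suc i'" using x(2) s by (cases i) auto
      then show ?thesis using om[of i'] 1 unfolding Z_def by auto
    next
      case 2
      then have "i < n" using x(2) n(1) by (cases "i = n") auto
      then have "?w (Suc i) \<in> Z" unfolding Z_def by (intro UnI1 imageI) simp
      then show ?thesis using 2 by simp
    qed
  qed
  have Zv: "g \<in> Z" if "h \<in> Z" "g \<in> vertex_of \<Lambda> h" "b g" for h g
  proof (cases "h \<in> ends b")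
    case True then show ?thesis using ends_vertex[OF b] that by blast
  next
    case False
    then have "g \<in> {h, other_black b h}" using other_black(8)[OF b] Zb that by blast
    then show ?thesis using Zo that False by blast
  qed
  have "lab_inv b (\<lambda>x. x \<in> Z)"
    unfolding lab_inv_def
  proof (intro ballI impI conjI)
    fix h assume h: "h \<in> H" "b h"
    show "(m h \<in> Z) = (h \<in> Z)" using Zm mb(3)[OF h] by metis
    fix g assume g: "g \<in> vertex_of \<Lambda> h" "b g"
    then have "h \<in> vertex_of \<Lambda> g" using vertex_eq vertex_self h by blast
    then show "(g \<in> Z) = (h \<in> Z)" using Zv g h by blast
  qed
  moreover have "s \<in> Z" unfolding Z_def by (metis UnI1 atMost_iff image_eqI le0 walk.simps(1))
  ultimately have sub: "path b s \<subseteq> Z" using path_sub[OF b s'(2)] by blast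
  note lab = path_lab[OF b s'(2)]
  have wp: "?w i \<in> path b s \<and> m (?w i) \<in> path b s" if "i \<le> n" for i
    using that
  proof (induction i)
    case 0 then show ?case using lab s' path_self unfolding lab_inv_def by auto
  next
    case (Suc i)
    have 1: "m (?w i) \<in> path b s" "m (?w i) \<in> H" "b (m (?w i))" "m (?w i) \<notin> ends b"
      using Suc gd mb n(2) by auto
    then have "?w (Suc i) \<in> vertex_of \<Lambda> (m (?w i))" "b (?w (Suc i))" using other_black(8)[OF b 1(2-4)] by auto
    then have "?w (Suc i) \<in> path b s" using lab 1 unfolding lab_inv_def by blast
    then show ?case using lab gd(1,2)[OF Suc.prems] unfolding lab_inv_def by blast
  qed
  then have Zeq: "path b s = Z" using sub unfolding Z_def by auto
  have Cb: "x \<in> path b s \<Longrightarrow> b x" for x using Zeq Zb by blast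
  have side: "\<chi> (?w i) = \<chi> s \<and> \<chi> (m (?w i)) = \<chi> (m s)" if r: "reg_inv (path b s) \<chi>" and "i \<le> n" for \<chi> i
    using that(2)
  proof (induction i)
    case (Suc i)
    have 1: "m (?w i) \<in> H" "b (m (?w i))" "m (?w i) \<notin> ends b" "m (m (?w i)) = ?w i"
      using Suc gd mb n(2) by auto
    then show ?case using sides[OF b 1(1-3) r Cb] Suc by simp
  qed simp
  have T1: "t \<in> path b s" using wp unfolding t_def by blast
  have T2: "path b s \<inter> ends b = {s, t}"
  proof -
    have "x \<in> {s, t}" if xZ: "x \<in> Z" "x \<in> ends b" for x
    proof -
      consider i where "i \<le> n" "x = ?w i" | i where "i \<le> n" "x = m (?w i)" using xZ(1) unfolding Z_def by auto
      then show ?thesis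
      proof cases
        case 1
        then have "i = 0" using gd(3)[of i] xZ(2) by blast
        then show ?thesis using 1 by simp
      next
        case 2 then show ?thesis using n(2) xZ unfolding t_def by (cases "i = n") auto
      qed
    qed
    then show ?thesis using Zeq \<open>s \<in> Z\<close> s n(1) T1 unfolding t_def by blast
  qed
  \<comment> \<open>Otherwise the walk would be its own reversal, and its middle would be an edge
    whose halves coincide or a vertex left through the edge of entry.\<close>
  have T3: "t \<noteq> s"
  proof
    assume "t = s"
    then have base: "?w n = m (?w 0)" using mb(3)[OF gd(1,2)[of n]] unfolding t_def by simp
    have rev: "?w (n - i) = m (?w i)" if "i \<le> n" for i
      using that
    proof (induction i)
      case 0 then show ?case using base by simp
    next
      case (Suc i)
      then obtain l where l: "n - i = Suc l" "l < n" "n - Suc i = l" by (cases "n - i") auto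
      have "m (?w l) = other_black b (m (?w i))" using om[OF l(2)] Suc l by simp
      then have "m (?w l) = ?w (Suc i)" by simp
      moreover have "m (m (?w l)) = ?w l" by (rule mb(3)) (use gd(1,2)[of l] l in auto)
      ultimately show ?case using l(3) by metis
    qed
    show False
    proof (cases "even n")
      case True
      then have "n - n div 2 = n div 2" by auto
      then show False using rev[of "n div 2"] mb(4)[OF gd(1,2)[of "n div 2"]] by simp
    next
      case False
      then have d: "n - n div 2 = Suc (n div 2)" "n div 2 < n" by presburger+
      then have "other_black b (m (?w (n div 2))) = m (?w (n div 2))" using rev[of "n div 2"] by simp
      then show False using other_black(3)[OF b mb(1,2)[OF gd(1,2)] n(2)] d by (metis less_imp_le)
    qed
  qed
  have T4: "(\<forall>\<chi>. reg_inv (path b s) \<chi> \<longrightarrow> \<chi> x = \<chi> s \<and> \<chi> (m x) = \<chi> (m s)) \<or>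
       (\<forall>\<chi>. reg_inv (path b s) \<chi> \<longrightarrow> \<chi> x = \<chi> (m s) \<and> \<chi> (m x) = \<chi> s)" if xp: "x \<in> path b s" for x
  proof -
    consider i where "i \<le> n" "x = ?w i" | i where "i \<le> n" "x = m (?w i)" using xp Zeq unfolding Z_def by auto
    then show ?thesis
    proof cases
      case 1 then show ?thesis using side by blast
    next
      case 2 then show ?thesis using side mb(3)[OF gd(1,2)] by simp
    qed
  qed
  have T5: "\<chi> t = \<chi> (m s)" if "reg_inv (path b s) \<chi>" for \<chi>
    using side[OF that, of n] unfolding t_def by simp
  show ?thesis by (intro exI[of _ t] conjI ballI allI impI T1 T3 T2 T4 T5)
qed

lemma path_eq:
  assumes b: "fpl b" and s: "b s" and t: "t \<in> path b s" shows "path b t = path b s"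
proof -
  have bt: "b t" using path_sub[OF b s path_lab[OF b s] t] by blast
  have "s \<in> path b t" using path_sub[OF b s path_lab[OF b bt] t] path_self by blast
  then have "path b s \<subseteq> path b t" using path_sub[OF b s path_lab[OF b bt]] by blast
  moreover have "path b t \<subseteq> path b s" using path_sub[OF b bt path_lab[OF b s]] t by blast
  ultimately show ?thesis by blast
qed

lemma region_inv: "reg_inv C (\<lambda>x. x \<in> region \<Lambda> C h)"
  unfolding reg_inv_def[of C "\<lambda>x. x \<in> region \<Lambda> C h"]
proof (intro ballI conjI impI)
  have *: "(y \<in> region \<Lambda> C h) = (x \<in> region \<Lambda> C h)" if "\<And>\<chi>. reg_inv C \<chi> \<Longrightarrow> \<chi> y = \<chi> x" for x y
    using that unfolding region_iff by blast
  fix g assume g: "g \<in> H"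
  show "(c (m g) \<in> region \<Lambda> C h) = (g \<in> region \<Lambda> C h)" if "m g \<notin> X"
    using that g by (intro *) (simp add: reg_inv_def)
  show "(m g \<in> region \<Lambda> C h) = (g \<in> region \<Lambda> C h)" if "g \<notin> C"
    using that g by (intro *) (simp add: reg_inv_def)
qed

lemma bounds_reg_inv: "bounds \<Lambda> C \<chi> \<Longrightarrow> reg_inv C \<chi>"
  unfolding bounds_def reg_inv_def by blast

lemma reg_turn: "reg_inv C \<chi> \<Longrightarrow> y \<in> H \<Longrightarrow> y \<notin> X \<Longrightarrow> \<chi> (c y) = \<chi> (m y)"
  using mate_in mate_mate unfolding reg_inv_def by metis

text \<open>At every inner vertex the path uses both black edges or none. Its ends are external,
  where \<open>planar\<close> asks for no parity.\<close>

lemma path_bounds: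
  assumes b: "fpl b" and s: "s \<in> X" "b s" and t: "path b s \<inter> ends b = {s, t}" "t \<in> X"
  shows "\<exists>\<chi>. bounds \<Lambda> (path b s) \<chi>"
proof (rule planar)
  note lab = path_lab[OF b s(2)]
  have pb: "x \<in> path b s \<Longrightarrow> b x \<and> x \<in> H" for x using path_sub[OF b s(2) lab] by blast
  then show "path b s \<subseteq> H" by blast
  show "m h \<in> path b s" if "h \<in> path b s" for h using lab pb that unfolding lab_inv_def by blast
  show "even (card (path b s \<inter> vertex_of \<Lambda> h))" if h: "h \<in> H - X" for h
  proof (cases "path b s \<inter> vertex_of \<Lambda> h = {}")
    case True then show ?thesis by simp
  next
    case False
    then obtain x where x: "x \<in> path b s" "x \<in> vertex_of \<Lambda> h" by blast
    have xH: "x \<in> H" "b x" using pb x by auto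
    have v: "vertex_of \<Lambda> x = vertex_of \<Lambda> h" using vertex_eq h x by blast
    have xX: "x \<notin> X" using v vertex_ext vertex_self h by (metis DiffE singletonD)
    have "x \<notin> ends b"
    proof
      assume "x \<in> ends b"
      then have "x \<in> {s, t}" using x(1) unfolding t(1)[symmetric] by blast
      then show False using xX s t by blast
    qed
    note o = other_black[OF b xH this]
    have "path b s \<inter> vertex_of \<Lambda> x = {x, other_black b x}"
    proof -
      have "other_black b x \<in> vertex_of \<Lambda> x" using o(8) by blast
      then have "other_black b x \<in> path b s" using lab xH x o(2) unfolding lab_inv_def by blast
      then show ?thesis using o(8) x pb by blast
    qed
    then show ?thesis using o(3) v by simp
  qed
qed

lemma other_path:
  assumes b: "fpl b" and s: "b s" and r: "reg_inv (path b s) \<chi>"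
    and t: "t \<notin> path b s" "b t" and x: "x \<in> path b t"
  shows "x \<notin> path b s" "\<chi> x = \<chi> t"
proof -
  let ?C = "path b s"
  note lab = path_lab[OF b s]
  have pb: "y \<in> ?C \<Longrightarrow> b y \<and> y \<in> H" for y using path_sub[OF b s lab] by blast
  show x': "x \<notin> ?C" using path_sub[OF b t(2) lab x] t by blast
  \<comment> \<open>\<open>\<chi>\<close> alone may change along the path from \<open>s\<close>;
    conjoined with being off that path it is constant along every black path.\<close>
  have inv: "lab_inv b (\<lambda>y. y \<notin> ?C \<and> \<chi> y)"
    unfolding lab_inv_def
  proof (intro ballI impI conjI)
    fix h assume h: "h \<in> H" "b h"
    have mC: "m h \<in> ?C \<longleftrightarrow> h \<in> ?C" using lab h unfolding lab_inv_def by blast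
    then show "(m h \<notin> ?C \<and> \<chi> (m h)) = (h \<notin> ?C \<and> \<chi> h)" using r h unfolding reg_inv_def by blast
    fix g assume g: "g \<in> vertex_of \<Lambda> h" "b g"
    have gC: "g \<in> ?C \<longleftrightarrow> h \<in> ?C" using lab h g unfolding lab_inv_def by blast
    show "(g \<notin> ?C \<and> \<chi> g) = (h \<notin> ?C \<and> \<chi> h)"
    proof (cases "h \<in> ?C")
      case True then show ?thesis using gC by blast
    next
      case False
      have nv: "y \<notin> ?C" if "y \<in> vertex_of \<Lambda> h" for y
        using False lab h that pb unfolding lab_inv_def by blast
      have nvX: "y \<notin> X" if "y \<in> vertex_of \<Lambda> h" "h \<notin> X" for y
        using that vertex_eq[OF h(1) that(1)] vertex_ext vertex_self by (metis singletonD)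
      have st: "\<chi> (c y) = \<chi> y" if y: "y \<in> vertex_of \<Lambda> h" for y
      proof (cases "h \<in> X")
        case True then show ?thesis using y vertex_ext ccw_ext by simp
      next
        case hX: False
        have yH: "y \<in> H" using vertex_in h y by blast
        then have "\<chi> (c y) = \<chi> (m y)" using reg_turn[OF r] nvX[OF y hX] by blast
        also have "\<dots> = \<chi> y" using r yH nv[OF y] unfolding reg_inv_def by blast
        finally show ?thesis .
      qed
      have "\<chi> ((c ^^ n) h) = \<chi> h" for n
      proof (induction n)
        case (Suc n)
        have "(c ^^ n) h \<in> vertex_of \<Lambda> h" unfolding vertex_of_def by blast
        then show ?case using st Suc by simp
      qed simp
      then have "\<chi> g = \<chi> h" using g unfolding vertex_of_def by auto
      then show ?thesis using gC by blast
    qed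
  qed
  show "\<chi> x = \<chi> t" using path_sub[OF b t(2) inv x] x' t by blast
qed

lemma reg_boundary:
  assumes r: "reg_inv C \<chi>" and j: "j \<in> J" shows "\<chi> (m (e (nx j))) = \<chi> (e j)"
proof -
  have H: "e j \<in> H" using ext_in j by blast
  have R: "\<chi> (c (m g)) = \<chi> g" if "g \<in> H" "m g \<notin> X" for g using r that unfolding reg_inv_def by blast
  have mX: "m (e j) \<notin> X" using mate_X e_inX j by blast
  from j(1) show ?thesis
  proof (cases rule: boundary_cases)
    case two then show ?thesis using R[OF H(1) mX] by simp
  next
    case three
    have "f (e j) \<in> H" using f_in H by blast
    then have "\<chi> (c (m (f (e j)))) = \<chi> (f (e j))" using R three by blast
    moreover have "\<chi> (f (e j)) = \<chi> (e j)" using R[OF H(1) mX] three(2) by simp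
    moreover have "c (m (f (e j))) = m (e (nx j))" using three(1,2) by simp
    ultimately show ?thesis by simp
  qed
qed

lemma reg_ext_step:
  assumes r: "reg_inv C \<chi>" and j: "j \<in> J" "e (nx j) \<notin> C" shows "\<chi> (e (nx j)) = \<chi> (e j)"
  using reg_boundary[OF r j(1)] r j(2) ext_in[OF nx_in] unfolding reg_inv_def by metis

section \<open>Link patterns\<close>

abbreviation "K \<equiv> {1..nblack \<Lambda>}"

lemma idx_period: "idx v (k + N) = idx v k" if "k \<ge> 1"
proof -
  have "v - 1 + 2 * (k + N - 1) = v - 1 + 2 * (k - 1) + 2 * N" using that by simp
  then show ?thesis unfolding idx_def by (metis mod_add_self2)
qed

lemma idx_inj: assumes "k \<in> K" "l \<in> K" "idx v k = idx v l" shows "k = l"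
proof -
  have *: "k = l" if k: "k \<in> K" "l \<in> K" "idx v k = idx v l" "k \<le> l" for k l
  proof -
    have "(v - 1 + 2 * (l - 1)) mod (2 * N) = (v - 1 + 2 * (k - 1)) mod (2 * N)"
      using k(3) unfolding idx_def by simp
    then have "2 * N dvd (v - 1 + 2 * (l - 1)) - (v - 1 + 2 * (k - 1))"
      using k(4) by (subst mod_eq_dvd_iff_nat[symmetric]) auto
    moreover have "(v - 1 + 2 * (l - 1)) - (v - 1 + 2 * (k - 1)) = 2 * (l - k)" using k by auto
    ultimately have "N dvd l - k" by simp
    then show ?thesis using k by (auto dest: dvd_imp_le)
  qed
  show ?thesis using *[of k l] *[of l k] assms by (cases "k \<le> l") auto
qed

lemma idx_surj: assumes "fpl b" "v \<in> J" "b (e v)" "j \<in> J" "b (e j)" obtains k where "k \<in> K" "j = idx v k"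
proof -
  have par: "even (j + v)"
  proof -
    have *: "b (e i) \<longleftrightarrow> (b (e 1) \<longleftrightarrow> odd i)" if "i \<in> J" for i
    proof -
      have "1 \<le> i" "i \<le> 2 * N" using that by auto
      then show ?thesis
      proof (induction i rule: dec_induct)
        case base then show ?case by simp
      next
        case (step n)
        then have "n \<in> J" "nx n = Suc n" by (auto simp: next_ext_def)
        then show ?case using step fplD(5)[OF assms(1), of n] by auto
      qed
    qed
    show ?thesis using *[OF assms(2)] *[OF assms(4)] assms(3,5) by simp
  qed
  show ?thesis
  proof (cases "v \<le> j")
    case True
    have "(v - 1 + 2 * ((j - v) div 2)) = j - 1" using True par assms(2) by auto
    then have "j = idx v ((j - v) div 2 + 1)" using assms(4) unfolding idx_def by auto
    then show ?thesis using that[of "(j - v) div 2 + 1"] assms(2,4) by auto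
  next
    case False
    \<comment> \<open>One full turn is added so that the larger \<open>v\<close> can be subtracted
      in the natural numbers.\<close>
    have "(v - 1 + 2 * ((j + 2 * N - v) div 2)) = j - 1 + 2 * N" using False par assms(2,4) by auto
    moreover have "(j - 1 + 2 * N) mod (2 * N) = j - 1" using assms(4) by (subst mod_add_self2) auto
    ultimately have "idx v ((j + 2 * N - v) div 2 + 1) = j - 1 + 1"
      unfolding idx_def by (simp only: add_diff_cancel_right')
    then have "j = idx v ((j + 2 * N - v) div 2 + 1)" using assms(4) by simp
    then show ?thesis using that[of "(j + 2 * N - v) div 2 + 1"] assms(2,4) False by auto
  qed
qed

end

lemma rot_label_bij: assumes "n \<ge> 1" shows "bij_betw (rot_label n) {1..n} {1..n}"
proof -
  have "rot_label n ` {1..n} \<subseteq> {1..n}" using assms by (auto simp: rot_label_def Suc_le_eq)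
  moreover have "inj_on (rot_label n) {1..n}"
  proof (rule inj_onI)
    fix x y assume "x \<in> {1..n}" "y \<in> {1..n}" "rot_label n x = rot_label n y"
    then show "x = y" by (cases "x = n"; cases "y = n") (auto simp: rot_label_def)
  qed
  ultimately show ?thesis by (simp add: bij_betw_def endo_inj_surj)
qed

lemma noncrossing_subset: "A \<subseteq> B \<Longrightarrow> noncrossing B \<Longrightarrow> noncrossing A"
  unfolding noncrossing_def by blast

lemma finite_LP: "finite (LP n)"
proof -
  have "LP n \<subseteq> Disk ` Pow (Pow {1..n})"
    unfolding LP_def perfect_matching_def partition_on_def by auto
  then show ?thesis by (rule finite_subset) simp
qed

lemma finite_LP_punctured: "finite (LP_punctured n)"
proof (cases "even n")
  case True
  have "D \<subseteq> {1..n} \<times> {1..n}" if "perfect_matching {1..n} ((\<lambda>(i, j). {i, j}) ` D)" for D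
  proof -
    have "\<Union> ((\<lambda>(i, j). {i, j}) ` D) = {1..n}"
      using that unfolding perfect_matching_def partition_on_def by blast
    then show ?thesis by fastforce
  qed
  then have "LP_punctured n \<subseteq> Punctured_Even ` Pow ({1..n} \<times> {1..n})"
    using True unfolding LP_punctured_def by auto
  then show ?thesis by (rule finite_subset) simp
next
  case False
  have sub: "M \<in> Pow (Pow A)" if "perfect_matching A M" for A :: "nat option set" and M
    using that unfolding perfect_matching_def partition_on_def by blast
  have "LP_punctured n \<subseteq> Punctured_Odd ` Pow (Pow (insert None (Some ` {1..n})))"
  proof
    fix z assume "z \<in> LP_punctured n"
    then obtain M where M: "z = Punctured_Odd M" "perfect_matching (insert None (Some ` {1..n})) M"
      using False unfolding LP_punctured_def by auto
    show "z \<in> Punctured_Odd ` Pow (Pow (insert None (Some ` {1..n})))"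
      unfolding M(1) by (rule imageI[OF sub[OF M(2)]])
  qed
  then show ?thesis by (rule finite_subset) simp
qed

context plane_domain begin

context
  fixes b :: "half \<Rightarrow> bool" and v :: nat
  assumes b: "fpl b" and v: "v \<in> J" "b (e v)"
begin

abbreviation "x k \<equiv> e (idx v k)"
abbreviation "LL \<equiv> linked_labels \<Lambda> (edges_of b) v"

lemma LL_iff: "(k, l) \<in> LL \<longleftrightarrow> k \<in> K \<and> l \<in> K \<and> k \<noteq> l \<and> x l \<in> path b (x k)"
  unfolding linked_labels_def relabelled_idx by blast

lemma x_facts: assumes "k \<ge> 1" shows "x k \<in> X" "x k \<in> H" "b (x k)" "x k \<in> ends b"
  using idx_in e_inX ext_in idx_black[OF b v(1) assms] v(2) unfolding ends_def by auto

lemma x_facts': assumes "k \<in> K" shows "x k \<in> X" "x k \<in> H" "b (x k)" "x k \<in> ends b"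
  using x_facts[of k] assms by auto

lemma x_inj: "k \<in> K \<Longrightarrow> l \<in> K \<Longrightarrow> x k = x l \<longleftrightarrow> k = l"
  using idx_inj e_eq[OF idx_in idx_in] by blast

lemma LL_sym: assumes "(k, l) \<in> LL" shows "(l, k) \<in> LL" "path b (x l) = path b (x k)"
proof -
  have kl: "k \<in> K" "l \<in> K" "k \<noteq> l" "x l \<in> path b (x k)" using assms LL_iff by auto
  show eq: "path b (x l) = path b (x k)" by (rule path_eq[OF b x_facts'(3)[OF kl(1)] kl(4)])
  show "(l, k) \<in> LL" using kl eq path_self LL_iff by auto
qed

lemma LL_ends: assumes "(k, l) \<in> LL" shows "path b (x k) \<inter> ends b = {x k, x l}"
proof -
  have kl: "k \<in> K" "l \<in> K" "k \<noteq> l" "x l \<in> path b (x k)" using assms LL_iff by auto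
  obtain t where t: "path b (x k) \<inter> ends b = {x k, t}"
    using path_ends[OF b x_facts'(4)[OF kl(1)]] by (elim exE conjE) (rule that; assumption)
  have "x l \<in> {x k, t}" using kl x_facts'(4)[OF kl(2)] unfolding t[symmetric] by blast
  then have "x l = t" using x_inj kl by auto
  then show ?thesis using t by simp
qed

lemma LL_unique: assumes "(k, l) \<in> LL" "(k, l') \<in> LL" shows "l = l'"
proof -
  have "{x k, x l} = {x k, x l'}" using LL_ends[OF assms(1)] LL_ends[OF assms(2)] by simp
  then show ?thesis using assms x_inj unfolding LL_iff doubleton_eq_iff by auto
qed

lemma LL_ex:
  assumes k: "k \<in> K" and nb: "\<And>h. h \<in> path b (x k) \<Longrightarrow> \<not> bivalent \<Lambda> h"
  shows "\<exists>l. (k, l) \<in> LL"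
proof -
  obtain t where t: "t \<in> path b (x k)" "t \<noteq> x k" "path b (x k) \<inter> ends b = {x k, t}"
    using path_ends[OF b x_facts'(4)[OF k]] by (elim exE conjE) (rule that; assumption)
  have "t \<in> ends b" using t by blast
  then have "t \<in> X" "b t" using nb[OF t(1)] unfolding ends_def by auto
  then obtain i where "i \<in> J" "t = e (nx i)" by (elim XE)
  then obtain l where "l \<in> K" "nx i = idx v l" using idx_surj[OF b v nx_in] \<open>b t\<close> by metis
  then show ?thesis using t k \<open>t = e (nx i)\<close> LL_iff by (metis x_inj)
qed

lemma LL_bounds: assumes "(k, l) \<in> LL" shows "\<exists>\<chi>. bounds \<Lambda> (path b (x k)) \<chi>"
  using assms LL_iff x_facts' by (intro path_bounds[OF b _ _ LL_ends[OF assms]]) blast+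

lemma LL_end_side:
  assumes kl: "(k, l) \<in> LL" and r: "reg_inv (path b (x k)) \<chi>" shows "\<chi> (x l) = \<chi> (m (x k))"
proof -
  have k: "k \<in> K" "l \<in> K" "k \<noteq> l" using kl LL_iff by auto
  obtain t where t: "t \<noteq> x k" "path b (x k) \<inter> ends b = {x k, t}"
    "\<forall>\<chi>. reg_inv (path b (x k)) \<chi> \<longrightarrow> \<chi> t = \<chi> (m (x k))"
    using path_ends[OF b x_facts'(4)[OF k(1)]] by (elim exE conjE) (rule that; assumption)
  have "t = x l" using t(1,2) LL_ends[OF kl] by (metis doubleton_eq_iff)
  then show ?thesis using t(3) r by simp
qed

lemma LL_separates:
  assumes kl: "(k, l) \<in> LL" and bd: "bounds \<Lambda> (path b (x k)) \<chi>" shows "\<chi> (x l) \<noteq> \<chi> (x k)"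
proof -
  have k: "k \<in> K" using kl LL_iff by auto
  have "\<chi> (m (x k)) \<noteq> \<chi> (x k)" using bd x_facts'(2)[OF k] path_self unfolding bounds_def by blast
  then show ?thesis using LL_end_side[OF kl bounds_reg_inv[OF bd]] by simp
qed

text \<open>Along the boundary \<open>\<chi>\<close> changes only on crossing an external edge of
  the path, that is at \<open>i\<close> and at \<open>l\<close>. The face on the right of an
  external half-edge is the one counter-clockwise of it, so \<open>i\<close> belongs to the arc and
  \<open>l\<close> does not.\<close>

lemma arc_values:
  assumes il: "(i, l) \<in> LL" and bd: "bounds \<Lambda> (path b (x i)) \<chi>" and k: "k \<in> K"
  shows "\<chi> (x k) = \<chi> (x i) \<longleftrightarrow> k \<in> arc N i l"
proof -
  let ?C = "path b (x i)"
  note r = bounds_reg_inv[OF bd]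
  have iK: "i \<in> K" "l \<in> K" "i \<noteq> l" using il LL_iff by auto
  have Cb: "y \<in> ?C \<Longrightarrow> b y" for y
    using path_sub[OF b x_facts'(3)[OF iK(1)] path_lab[OF b x_facts'(3)[OF iK(1)]]] by blast
  have sep: "\<chi> (x l) \<noteq> \<chi> (x i)" by (rule LL_separates[OF il bd])
  have st: "\<chi> (x (a + 1)) = \<chi> (x a)" if a: "a \<ge> 1" "x (a + 1) \<noteq> x i" "x (a + 1) \<noteq> x l" for a
  proof -
    have w: "\<not> b (e (nx (idx v a)))" using fplD(5)[OF b idx_in] x_facts(3)[OF a(1)] by blast
    then have "\<chi> (e (nx (idx v a))) = \<chi> (x a)" using reg_ext_step[OF r idx_in] Cb by blast
    moreover have "x (a + 1) \<notin> ?C"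
    proof
      assume "x (a + 1) \<in> ?C"
      then have "x (a + 1) \<in> {x i, x l}" using x_facts(4)[of "a + 1"] unfolding LL_ends[OF il, symmetric] by simp
      then show False using a by blast
    qed
    then have "\<chi> (x (a + 1)) = \<chi> (e (nx (idx v a)))"
      using reg_ext_step[OF r nx_in] unfolding idx_Suc[OF a(1)] by blast
    ultimately show ?thesis by simp
  qed
  have seg: "\<chi> (x k) = \<chi> (x a)" if "1 \<le> a" "a \<le> k" "k \<le> N" "\<And>r. a < r \<Longrightarrow> r \<le> k \<Longrightarrow> r \<noteq> i \<and> r \<noteq> l" for a k
    using that(2,3,4)
  proof (induction k rule: dec_induct)
    case base then show ?case by simp
  next
    case (step n)
    have "n + 1 \<in> K" using step that(1) by simp
    moreover have "n + 1 \<noteq> i" "n + 1 \<noteq> l" using step.prems(2)[of "n + 1"] step.hyps by auto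
    ultimately have "\<chi> (x (n + 1)) = \<chi> (x n)" using st[of n] x_inj iK step that(1) by auto
    then show ?case using step by simp
  qed
  have wrap: "\<chi> (x 1) = \<chi> (x N)" if "i \<noteq> 1" "l \<noteq> 1"
  proof -
    have 1: "1 \<in> K" using nblack_pos by simp
    have "x (N + 1) = x 1" using idx_period[of 1 v] by (simp add: add.commute)
    moreover have "x 1 \<noteq> x i" "x 1 \<noteq> x l" using x_inj 1 iK that by auto
    ultimately show ?thesis using st[of N] nblack_pos by simp
  qed
  show ?thesis
  proof (cases "i < l")
    case True
    consider "k < i" | "i \<le> k" "k < l" | "l \<le> k" by linarith
    then show ?thesis
    proof cases
      case 1
      have "\<chi> (x k) = \<chi> (x 1)" by (rule seg) (use 1 k True in auto)
      also have "\<dots> = \<chi> (x N)" by (rule wrap) (use 1 k True in auto)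
      also have "\<dots> = \<chi> (x l)" by (rule seg) (use True iK in auto)
      finally show ?thesis using sep 1 True by (simp add: arc_def)
    next
      case 2
      have "\<chi> (x k) = \<chi> (x i)" by (rule seg) (use 2 k iK in auto)
      then show ?thesis using 2 True by (simp add: arc_def)
    next
      case 3
      have "\<chi> (x k) = \<chi> (x l)" by (rule seg) (use 3 k iK True in auto)
      then show ?thesis using sep 3 True by (simp add: arc_def)
    qed
  next
    case False
    consider "k < l" | "l \<le> k" "k < i" | "i \<le> k" by linarith
    then show ?thesis
    proof cases
      case 1
      have "\<chi> (x k) = \<chi> (x 1)" by (rule seg) (use 1 k False in auto)
      also have "\<dots> = \<chi> (x N)" by (rule wrap) (use 1 k False in auto)
      also have "\<dots> = \<chi> (x i)" by (rule seg) (use False iK in auto)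
      finally show ?thesis using 1 k False by (simp add: arc_def)
    next
      case 2
      have "\<chi> (x k) = \<chi> (x l)" by (rule seg) (use 2 k iK in auto)
      then show ?thesis using sep 2 False by (simp add: arc_def)
    next
      case 3
      have "\<chi> (x k) = \<chi> (x i)" by (rule seg) (use 3 k iK False in auto)
      then show ?thesis using 3 k False by (simp add: arc_def)
    qed
  qed
qed

lemma LL_other:
  assumes il: "(i, l) \<in> LL" and k: "k \<in> K" "k \<noteq> i" "k \<noteq> l"
  shows "x k \<notin> path b (x i)"
proof
  assume "x k \<in> path b (x i)"
  then have "x k \<in> {x i, x l}" using x_facts'(4)[OF k(1)] unfolding LL_ends[OF il, symmetric] by blast
  then show False using il k x_inj unfolding LL_iff by auto
qed

lemma LL_arc:
  assumes il: "(i, l) \<in> LL" and kr: "(k, r) \<in> LL" and ne: "k \<noteq> i" "k \<noteq> l"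
  shows "k \<in> arc N i l \<longleftrightarrow> r \<in> arc N i l"
proof -
  obtain \<chi> where bd: "bounds \<Lambda> (path b (x i)) \<chi>" using LL_bounds[OF il] by blast
  have K: "i \<in> K" "k \<in> K" "r \<in> K" "x r \<in> path b (x k)" using il kr LL_iff by auto
  have "\<chi> (x r) = \<chi> (x k)"
    by (rule other_path(2)[OF b x_facts'(3)[OF K(1)] bounds_reg_inv[OF bd] LL_other[OF il K(2) ne]
          x_facts'(3)[OF K(2)] K(4)])
  then show ?thesis using arc_values[OF il bd K(2)] arc_values[OF il bd K(3)] by simp
qed

lemma LL_noncrossing: "noncrossing {{k, l} | k l. (k, l) \<in> LL}"
  unfolding noncrossing_def
proof clarify
  fix i j k l p q p' q'
  assume o: "i < k" "k < j" "j < l" and "{i, j} = {p, q}" "(p, q) \<in> LL" "{k, l} = {p', q'}" "(p', q') \<in> LL"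
  then have 1: "(i, j) \<in> LL" "(k, l) \<in> LL" using LL_sym by (metis doubleton_eq_iff)+
  have "k \<in> arc N i j \<longleftrightarrow> l \<in> arc N i j" by (rule LL_arc[OF 1]) (use o in auto)
  then show False using o by (simp add: arc_def)
qed

definition partner :: "nat \<Rightarrow> nat" where
  "partner k = (THE l. (k, l) \<in> LL)"

lemma partner: "(k, l) \<in> LL \<Longrightarrow> partner k = l"
  unfolding partner_def using LL_unique by blast

lemma LL_partner_set:
  assumes "\<And>k. k \<in> A \<Longrightarrow> (k, partner k) \<in> LL" "\<And>k l. (k, l) \<in> LL \<Longrightarrow> k \<in> A"
  shows "{{k, l} | k l. (k, l) \<in> LL} = (\<lambda>k. {k, partner k}) ` A"
proof
  show "{{k, l} | k l. (k, l) \<in> LL} \<subseteq> (\<lambda>k. {k, partner k}) ` A"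
    using assms(2) partner by auto
  show "(\<lambda>k. {k, partner k}) ` A \<subseteq> {{k, l} | k l. (k, l) \<in> LL}" using assms(1) by blast
qed

lemma all_matched:
  assumes nb: "\<And>h. h \<in> H - X \<Longrightarrow> quartic \<Lambda> h" and k: "k \<in> K"
  shows "(k, partner k) \<in> LL"
proof -
  have "\<not> bivalent \<Lambda> h" if "h \<in> path b (x k)" for h
  proof
    assume border_index: "bivalent \<Lambda> h"
    have "h \<in> H" using path_sub[OF b x_facts'(3)[OF k] path_lab[OF b x_facts'(3)[OF k]] that] by blast
    moreover have "h \<notin> X" using border_index ccw_ext unfolding bivalent_def by metis
    ultimately have "quartic \<Lambda> h" using nb by blast
    then show False using border_index unfolding bivalent_def quartic_def by blast
  qed
  then obtain l where "(k, l) \<in> LL" using LL_ex[OF k] by blast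
  then show ?thesis using partner by simp
qed

lemma all_matched_perfect:
  assumes nb: "\<And>h. h \<in> H - X \<Longrightarrow> quartic \<Lambda> h"
  shows "perfect_matching K {{k, l} | k l. (k, l) \<in> LL}"
proof -
  have am: "(k, partner k) \<in> LL" if "k \<in> K" for k using all_matched[OF _ that] nb by blast
  have "{{k, l} | k l. (k, l) \<in> LL} = (\<lambda>k. {k, partner k}) ` K"
    by (rule LL_partner_set) (use am LL_iff in auto)
  moreover have "perfect_matching K ((\<lambda>k. {k, partner k}) ` K)"
  proof (rule perfect_matching_partner)
    fix k assume "k \<in> K"
    then have "(k, partner k) \<in> LL" by (rule am)
    then show "partner k \<in> K \<and> partner (partner k) = k \<and> partner k \<noteq> k"
      using LL_sym(1) partner LL_iff by auto
  qed
  ultimately show ?thesis by simp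
qed

text \<open>Both sides of every edge of the path lie in one of the two regions, so their union is
  closed under \<open>mate\<close> and \<open>ccw\<close> and is everything by
  connectedness.\<close>

lemma region_cover:
  assumes kl: "(k, l) \<in> LL" and p: "p \<in> H"
  shows "p \<in> region \<Lambda> (path b (x k)) (x k) \<or> p \<in> region \<Lambda> (path b (x k)) (x l)"
proof -
  let ?C = "path b (x k)"
  define Y where "Y y \<longleftrightarrow> y \<in> region \<Lambda> ?C (x k) \<or> y \<in> region \<Lambda> ?C (x l)" for y
  have k: "k \<in> K" using kl LL_iff by auto
  note r1 = region_inv[of ?C "x k"] and r2 = region_inv[of ?C "x l"]
  have self: "y \<in> region \<Lambda> C y" for y C by (simp add: region_iff)
  have Cb: "y \<in> ?C \<Longrightarrow> y \<in> H" for y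
    using path_sub[OF b x_facts'(3)[OF k] path_lab[OF b x_facts'(3)[OF k]]] by blast
  have mC: "Y y \<and> Y (m y)" if y: "y \<in> ?C" for y
  proof -
    have mk: "m (x k) \<in> region \<Lambda> ?C (x l)" using LL_end_side[OF kl] unfolding region_iff by metis
    obtain t where "\<forall>y\<in>?C.
       (\<forall>\<chi>. reg_inv ?C \<chi> \<longrightarrow> \<chi> y = \<chi> (x k) \<and> \<chi> (m y) = \<chi> (m (x k))) \<or>
       (\<forall>\<chi>. reg_inv ?C \<chi> \<longrightarrow> \<chi> y = \<chi> (m (x k)) \<and> \<chi> (m y) = \<chi> (x k))"
      using path_ends[OF b x_facts'(4)[OF k]] by (elim exE conjE) (rule that; assumption)
    from this[rule_format, OF y] show ?thesis
      using r1 r2 self[of "x k" ?C] mk unfolding Y_def by blast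
  qed
  have mY: "Y (m y) = Y y" if "y \<in> H" for y
  proof (cases "y \<in> ?C")
    case True then show ?thesis using mC by blast
  next
    case False
    then show ?thesis using r1 r2 that unfolding Y_def reg_inv_def by blast
  qed
  have cY: "Y (c y) = Y y" if "y \<in> H" for y
  proof (cases "y \<in> X")
    case True then show ?thesis using ccw_ext by simp
  next
    case False
    have "Y (c y) = Y (m y)" using reg_turn[OF r1 that False] reg_turn[OF r2 that False] unfolding Y_def by simp
    then show ?thesis using mY that by simp
  qed
  have "Y p = Y (x k)"
    by (rule connected[OF _ x_facts'(2)[OF k] p]) (use mY cY in blast)
  then show ?thesis using self unfolding Y_def by blast
qed

lemma region_unique:
  assumes kl: "(k, l) \<in> LL" and p: "p \<in> H"
  shows "p \<in> region \<Lambda> (path b (x k)) (x k) \<longleftrightarrow> p \<notin> region \<Lambda> (path b (x l)) (x l)"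
proof -
  obtain \<chi> where bd: "bounds \<Lambda> (path b (x k)) \<chi>" using LL_bounds[OF kl] by blast
  have "\<not> (p \<in> region \<Lambda> (path b (x k)) (x k) \<and> p \<in> region \<Lambda> (path b (x k)) (x l))"
    using LL_separates[OF kl bd] bounds_reg_inv[OF bd] unfolding region_iff by metis
  then show ?thesis using region_cover[OF kl p] LL_sym(2)[OF kl] by auto
qed

text \<open>If the arcs faced each other and covered the circle, each path would lie on the near
  side of the other. The points on the far side of both, among them \<open>p\<close>, would form a
  set bordered by neither path; by connectedness it would contain \<open>x i\<close> as
  well.\<close>

lemma arcs_not_covering:
  assumes ij: "(i, j) \<in> LL" "p \<notin> region \<Lambda> (path b (x i)) (x i)"
    and kl: "(k, l) \<in> LL" "p \<notin> region \<Lambda> (path b (x k)) (x k)"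
    and p: "p \<in> H" and ne: "k \<noteq> i" "k \<noteq> j"
  shows "\<not> (k \<in> arc N i j \<and> i \<in> arc N k l)"
proof
  assume cov: "k \<in> arc N i j \<and> i \<in> arc N k l"
  have K: "i \<in> K" "j \<in> K" "k \<in> K" "l \<in> K" using ij kl LL_iff by auto
  have ne': "i \<noteq> k" "i \<noteq> l" using ne LL_unique[OF LL_sym(1)[OF kl(1)]] LL_sym(1)[OF ij(1)] ij(1) by auto
  obtain \<chi> \<xi> where bd: "bounds \<Lambda> (path b (x i)) \<chi>" "bounds \<Lambda> (path b (x k)) \<xi>"
    using LL_bounds ij kl by blast
  note r = bounds_reg_inv[OF bd(1)] bounds_reg_inv[OF bd(2)]
  have \<chi>p: "\<chi> p \<noteq> \<chi> (x i)"
    using region_cover[OF ij(1) p] ij(2) r(1) LL_separates[OF ij(1) bd(1)] unfolding region_iff by metis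
  have \<xi>p: "\<xi> p \<noteq> \<xi> (x k)"
    using region_cover[OF kl(1) p] kl(2) r(2) LL_separates[OF kl(1) bd(2)] unfolding region_iff by metis
  have onk: "\<chi> y = \<chi> (x i)" if "y \<in> path b (x k)" for y
    using other_path(2)[OF b x_facts'(3)[OF K(1)] r(1) LL_other[OF ij(1) K(3) ne] x_facts'(3)[OF K(3)] that]
      arc_values[OF ij(1) bd(1) K(3)] cov by simp
  have oni: "\<xi> y = \<xi> (x k)" if "y \<in> path b (x i)" for y
    using other_path(2)[OF b x_facts'(3)[OF K(3)] r(2) LL_other[OF kl(1) K(1) ne'] x_facts'(3)[OF K(1)] that]
      arc_values[OF kl(1) bd(2) K(1)] cov by simp
  define Y where "Y y \<longleftrightarrow> \<chi> y \<noteq> \<chi> (x i) \<and> \<xi> y \<noteq> \<xi> (x k)" for y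
  have cl: "m y \<in> path b (x a) \<longleftrightarrow> y \<in> path b (x a)" if "y \<in> H" "a \<in> K" for y a
  proof -
    note lab = path_lab[OF b x_facts'(3)[OF that(2)]]
    have "z \<in> path b (x a) \<Longrightarrow> b z \<and> z \<in> H" for z using path_sub[OF b x_facts'(3)[OF that(2)] lab] by blast
    then show ?thesis using lab that(1) mate_mate unfolding lab_inv_def by metis
  qed
  have mY: "Y (m y) = Y y" if y: "y \<in> H" for y
  proof -
    consider "y \<in> path b (x i)" | "y \<in> path b (x k)" | "y \<notin> path b (x i)" "y \<notin> path b (x k)" by blast
    then show ?thesis
    proof cases
      case 1 then show ?thesis using oni cl[OF y K(1)] unfolding Y_def by metis
    next
      case 2 then show ?thesis using onk cl[OF y K(3)] unfolding Y_def by metis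
    next
      case 3 then show ?thesis using r y unfolding Y_def reg_inv_def by metis
    qed
  qed
  have cY: "Y (c y) = Y y" if "y \<in> H" for y
  proof (cases "y \<in> X")
    case True then show ?thesis using ccw_ext by simp
  next
    case False
    have "Y (c y) = Y (m y)"
      using reg_turn[OF r(1) that False] reg_turn[OF r(2) that False] unfolding Y_def by simp
    then show ?thesis using mY that by simp
  qed
  have "Y p = Y (x i)"
    by (rule connected[OF _ x_facts'(2)[OF K(1)] p]) (use mY cY in blast)
  then show False using \<chi>p \<xi>p unfolding Y_def by blast
qed

lemma link_in_LP_even:
  assumes p: "puncture \<Lambda> = In_Face p"
  shows "link_pattern_of \<Lambda> (edges_of b) v \<in> LP_domain \<Lambda>"
proof -
  have pk: "p \<in> H" "\<And>h. h \<in> H - X \<Longrightarrow> quartic \<Lambda> h" using puncture_ok p unfolding puncture_ok_def by auto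
  define D where "D = {(k, l) \<in> LL. p \<notin> region \<Lambda> (path b (x k)) (x k)}"
  have link: "link_pattern_of \<Lambda> (edges_of b) v = Punctured_Even D"
    unfolding link_pattern_of_def D_def relabelled_idx Let_def by (simp add: p)
  have D: "(k, l) \<in> D \<longleftrightarrow> (k, l) \<in> LL \<and> p \<notin> region \<Lambda> (path b (x k)) (x k)" for k l unfolding D_def by blast
  \<comment> \<open>Of the two orderings of a linked pair exactly one leaves the puncture outside
    its region, so \<open>D\<close> orients every arc once.\<close>
  have img: "(\<lambda>(i, j). {i, j}) ` D = {{k, l} | k l. (k, l) \<in> LL}"
  proof
    show "(\<lambda>(i, j). {i, j}) ` D \<subseteq> {{k, l} | k l. (k, l) \<in> LL}" unfolding D_def by auto
    show "{{k, l} | k l. (k, l) \<in> LL} \<subseteq> (\<lambda>(i, j). {i, j}) ` D"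
    proof clarify
      fix k l assume kl: "(k, l) \<in> LL"
      then have "(k, l) \<in> D \<or> (l, k) \<in> D" using region_unique[OF kl pk(1)] LL_sym(1)[OF kl] D by blast
      then show "{k, l} \<in> (\<lambda>(i, j). {i, j}) ` D" by (force simp: insert_commute)
    qed
  qed
  have pm: "perfect_matching K {{k, l} | k l. (k, l) \<in> LL}" by (rule all_matched_perfect[OF pk(2)])
  then have "even N" using perfect_matching_even by fastforce
  moreover have "\<forall>(i, j)\<in>D. (j, i) \<notin> D" using region_unique[OF _ pk(1)] D by blast
  moreover have "ccw_interval N r \<subseteq> ccw_interval N s \<or> ccw_interval N s \<subseteq> ccw_interval N r \<or>
      ccw_interval N r \<inter> ccw_interval N s = {}" if rs: "r \<in> D" "s \<in> D" for r s
  proof -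
    obtain i j k l where e: "r = (i, j)" "s = (k, l)" by (cases r; cases s) auto
    have ij: "(i, j) \<in> LL" "p \<notin> region \<Lambda> (path b (x i)) (x i)"
      and kl: "(k, l) \<in> LL" "p \<notin> region \<Lambda> (path b (x k)) (x k)" using rs D e by auto
    show ?thesis
    proof (cases "k = i \<or> k = j")
      case True
      then show ?thesis
      proof
        assume "k = i" then have "l = j" using LL_unique ij(1) kl(1) by blast
        then show ?thesis using \<open>k = i\<close> e by simp
      next
        assume "k = j"
        then show ?thesis using region_unique[OF ij(1) pk(1)] ij(2) kl(2) by blast
      qed
    next
      case False
      then have ne: "k \<noteq> i" "k \<noteq> j" by auto
      have ne': "l \<noteq> i" "l \<noteq> j"
        using ne LL_unique[OF LL_sym(1)[OF kl(1)]] LL_sym(1)[OF ij(1)] ij(1) by auto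
      have "i \<noteq> j" "k \<noteq> l" and K: "i \<in> K" "j \<in> K" "k \<in> K" "l \<in> K" using ij kl LL_iff by auto
      then have dist: "distinct [i, j, k, l]" using ne ne' by auto
      show ?thesis
        unfolding e
        by (rule arc_nested[OF K dist LL_arc[OF ij(1) kl(1) ne] LL_arc[OF kl(1) ij(1)]
              arcs_not_covering[OF ij kl pk(1) ne]]) (use ne ne' in auto)
    qed
  qed
  ultimately show ?thesis
    unfolding link LP_domain_def LP_punctured_def using pm img p by auto
qed

lemma link_in_LP_disk:
  assumes p: "puncture \<Lambda> = Unpunctured"
  shows "link_pattern_of \<Lambda> (edges_of b) v \<in> LP_domain \<Lambda>"
proof -
  have "\<And>h. h \<in> H - X \<Longrightarrow> quartic \<Lambda> h" using puncture_ok p unfolding puncture_ok_def by auto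
  then have "perfect_matching K {{k, l} | k l. (k, l) \<in> LL}" by (rule all_matched_perfect)
  moreover have "link_pattern_of \<Lambda> (edges_of b) v = Disk {{k, l} | k l. (k, l) \<in> LL}"
    unfolding link_pattern_of_def Let_def by (simp add: p)
  ultimately show ?thesis using p LL_noncrossing unfolding LP_domain_def LP_def by auto
qed

text \<open>Exactly one of the two half-edges at the degree-2 vertex is black. Its path has a second
  end, necessarily external, and the label of that end is matched with the puncture.\<close>

lemma link_in_LP_odd:
  assumes p: "puncture \<Lambda> = At_Vertex p"
  shows "link_pattern_of \<Lambda> (edges_of b) v \<in> LP_domain \<Lambda>"
proof -
  have pk: "p \<in> H" "p \<notin> X" "bivalent \<Lambda> p" "\<And>h. h \<in> H - X \<Longrightarrow> h \<notin> {p, c p} \<Longrightarrow> quartic \<Lambda> h"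
    using puncture_ok p unfolding puncture_ok_def by auto
  have vp: "vertex_of \<Lambda> p = {p, c p}" by (rule vertex_bivalent[OF pk(3)])
  have cp: "c p \<in> H" "c p \<notin> X" "c (c p) = p" "c p \<noteq> p"
    using pk ccw_in ccw_notX by (auto simp: bivalent_def)
  have bp: "b (c p) \<noteq> b p" using fplD(4)[OF b pk(1-3)] by simp
  then obtain u where u: "u \<in> {p, c p}" "b u" "\<And>z. z \<in> {p, c p} \<Longrightarrow> b z \<Longrightarrow> z = u" by blast
  have "bivalent \<Lambda> (c p)" using cp by (simp add: bivalent_def)
  then have uH: "u \<in> H" "u \<notin> X" "bivalent \<Lambda> u" using u(1) pk(1-3) cp(1,2) by auto
  then have "u \<in> ends b" using u(2) unfolding ends_def by blast
  note uH = uH this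
  have border_index: "h \<in> {p, c p}" if "h \<in> H" "bivalent \<Lambda> h" for h
  proof (rule ccontr)
    assume nh: "h \<notin> {p, c p}"
    have "h \<notin> X" using that(2) ccw_ext unfolding bivalent_def by metis
    then have "quartic \<Lambda> h" using pk(4) that(1) nh by blast
    then show False using that(2) unfolding bivalent_def quartic_def by blast
  qed
  have ends: "z \<in> X \<or> z = u" if "z \<in> ends b" for z
    using that border_index[of z] u(3) unfolding ends_def by blast
  obtain t where t: "t \<in> path b u" "t \<noteq> u" "path b u \<inter> ends b = {u, t}"
    using path_ends[OF b uH(4)] by (elim exE conjE) (rule that; assumption)
  have te: "t \<in> ends b" using t(3) by blast
  then have "t \<in> X" "b t" using ends t(2) by (auto simp: ends_def)
  then obtain i where "i \<in> J" "t = e (nx i)" by (elim XE)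
  then obtain k0 where k0: "k0 \<in> K" "t = x k0" using idx_surj[OF b v nx_in] \<open>b t\<close> by metis
  have pu: "path b (x k0) = path b u" using path_eq[OF b u(2)] t k0 by simp
  have meets: "path b (x k) \<inter> vertex_of \<Lambda> p \<noteq> {} \<longleftrightarrow> k = k0" if k: "k \<in> K" for k
  proof
    assume "path b (x k) \<inter> vertex_of \<Lambda> p \<noteq> {}"
    then obtain z where z: "z \<in> path b (x k)" "z \<in> {p, c p}" using vp by blast
    then have "b z" using path_sub[OF b x_facts'(3)[OF k] path_lab[OF b x_facts'(3)[OF k]]] by blast
    then have "u \<in> path b (x k)" using u(3) z by blast
    then have "path b (x k) = path b u" using path_eq[OF b x_facts'(3)[OF k]] by simp
    then have "x k \<in> {u, t}" using path_self[of "x k" b] x_facts'(4)[OF k] unfolding t(3)[symmetric] by blast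
    then show "k = k0" using x_facts'(1)[OF k] uH(2) x_inj[OF k k0(1)] k0 by auto
  next
    assume "k = k0"
    then have "u \<in> path b (x k)" using pu path_self by simp
    then show "path b (x k) \<inter> vertex_of \<Lambda> p \<noteq> {}" using vp u(1) by blast
  qed
  have m1: "(k, partner k) \<in> LL" if k: "k \<in> K" "k \<noteq> k0" for k
  proof -
    have "\<not> bivalent \<Lambda> h" if h: "h \<in> path b (x k)" for h
    proof
      assume "bivalent \<Lambda> h"
      moreover have "h \<in> H" using path_sub[OF b x_facts'(3)[OF k(1)] path_lab[OF b x_facts'(3)[OF k(1)]] h] by blast
      ultimately have "h \<in> vertex_of \<Lambda> p" using border_index vp by blast
      then show False using meets[OF k(1)] k(2) h by blast
    qed
    then obtain l where "(k, l) \<in> LL" using LL_ex[OF k(1)] by blast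
    then show ?thesis using partner by simp
  qed
  have m0: "(k0, l) \<notin> LL" for l
  proof
    assume "(k0, l) \<in> LL"
    then have l: "l \<in> K" "l \<noteq> k0" "x l \<in> path b u" using LL_iff pu by auto
    then have "x l \<in> {u, t}" using x_facts'(4)[OF l(1)] unfolding t(3)[symmetric] by blast
    then show False using x_facts'(1)[OF l(1)] uH(2) x_inj[OF l(1) k0(1)] k0 l(2) by auto
  qed
  \<comment> \<open>The partner map with the puncture \<open>None\<close> adjoined. As a
    fixed-point-free involution it yields the perfect matching, and counting its points shows that
    \<open>N\<close> is odd.\<close>
  define \<pi> where "\<pi> o' = (case o' of None \<Rightarrow> Some k0 | Some k \<Rightarrow> if k = k0 then None else Some (partner k))" for o'
  let ?A = "insert None (Some ` K)"
  let ?M = "{{Some k, Some l} | k l. (k, l) \<in> LL} \<union>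
    {{Some k, None} | k. k \<in> K \<and> path b (relabelled \<Lambda> v k) \<inter> vertex_of \<Lambda> p \<noteq> {}}"
  have link: "link_pattern_of \<Lambda> (edges_of b) v = Punctured_Odd ?M"
    unfolding link_pattern_of_def Let_def by (simp add: p)
  have M: "?M = {{Some k, Some l} | k l. (k, l) \<in> LL} \<union> {{Some k0, None}}"
  proof -
    have "{{Some k, None} | k. k \<in> K \<and> path b (relabelled \<Lambda> v k) \<inter> vertex_of \<Lambda> p \<noteq> {}} =
        (\<lambda>k. {Some k, None}) ` {k. k \<in> K \<and> path b (relabelled \<Lambda> v k) \<inter> vertex_of \<Lambda> p \<noteq> {}}"
      by blast
    also have "{k. k \<in> K \<and> path b (relabelled \<Lambda> v k) \<inter> vertex_of \<Lambda> p \<noteq> {}} = {k0}"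
      unfolding relabelled_idx using meets k0(1) by blast
    finally show ?thesis by (simp only: image_insert image_empty)
  qed
  have Mpi: "?M = (\<lambda>z. {z, \<pi> z}) ` ?A"
  proof -
    have \<pi>: "\<pi> None = Some k0" "\<pi> (Some k0) = None" "\<And>k. k \<in> K - {k0} \<Longrightarrow> \<pi> (Some k) = Some (partner k)"
      by (auto simp: \<pi>_def)
    have "?A = insert None (insert (Some k0) (Some ` (K - {k0})))" using k0(1) by blast
    then have "(\<lambda>z. {z, \<pi> z}) ` ?A =
        {{None, Some k0}, {Some k0, None}} \<union> (\<lambda>k. {Some k, \<pi> (Some k)}) ` (K - {k0})"
      using \<pi>(1,2) by (simp add: image_image)
    also have "(\<lambda>k. {Some k, \<pi> (Some k)}) ` (K - {k0}) = (\<lambda>k. {Some k, Some (partner k)}) ` (K - {k0})"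
      by (rule image_cong[OF refl]) (simp only: \<pi>(3))
    also have "(\<lambda>k. {Some k, Some (partner k)}) ` (K - {k0}) = {{Some k, Some l} | k l. (k, l) \<in> LL}"
    proof
      show "(\<lambda>k. {Some k, Some (partner k)}) ` (K - {k0}) \<subseteq> {{Some k, Some l} | k l. (k, l) \<in> LL}"
        using m1 by blast
      show "{{Some k, Some l} | k l. (k, l) \<in> LL} \<subseteq> (\<lambda>k. {Some k, Some (partner k)}) ` (K - {k0})"
      proof clarify
        fix k l assume kl: "(k, l) \<in> LL"
        then have "k \<in> K - {k0}" "l = partner k" using m0 LL_iff partner by auto
        then show "{Some k, Some l} \<in> (\<lambda>k. {Some k, Some (partner k)}) ` (K - {k0})" by blast
      qed
    qed
    finally show ?thesis unfolding M by (simp only: insert_commute[of None] insert_absorb2 Un_commute)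
  qed
  have pm: "perfect_matching ?A ?M"
    unfolding Mpi
  proof (rule perfect_matching_partner)
    fix z assume "z \<in> ?A"
    then consider "z = None" | "z = Some k0" | k where "z = Some k" "k \<in> K" "k \<noteq> k0" by blast
    then show "\<pi> z \<in> ?A \<and> \<pi> (\<pi> z) = z \<and> \<pi> z \<noteq> z"
    proof cases
      case 3
      have kl: "(k, partner k) \<in> LL" using m1 3 by blast
      then have "(partner k, k) \<in> LL" by (rule LL_sym(1))
      then have "partner k \<noteq> k0" "partner (partner k) = k" using m0 partner by auto
      then show ?thesis using 3 kl LL_iff by (auto simp: \<pi>_def)
    qed (use k0 in \<open>auto simp: \<pi>_def\<close>)
  qed
  have "card ?A = N + 1" by (simp add: card_image)
  then have odd: "odd N" using perfect_matching_even[OF pm] by simp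
  have "{s. Some ` s \<in> ?M} \<subseteq> {{k, l} | k l. (k, l) \<in> LL}"
  proof
    fix s assume "s \<in> {s. Some ` s \<in> ?M}"
    then have "Some ` s \<in> {{Some k, Some l} | k l. (k, l) \<in> LL} \<union> {{Some k0, None}}" unfolding M by blast
    moreover have "Some ` s \<noteq> {Some k0, None}" by blast
    ultimately obtain k l where "(k, l) \<in> LL" "Some ` s = {Some k, Some l}" by blast
    then have "Some ` s = Some ` {k, l}" by simp
    then have "s = {k, l}" by (metis inj_Some inj_image_eq_iff)
    then show "s \<in> {{k, l} | k l. (k, l) \<in> LL}" using \<open>(k, l) \<in> LL\<close> by blast
  qed
  then have "noncrossing {s. Some ` s \<in> ?M}" by (rule noncrossing_subset[OF _ LL_noncrossing])
  then show ?thesis unfolding link LP_domain_def LP_punctured_def using pm odd p by auto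
qed

lemma link_in_LP: "link_pattern_of \<Lambda> (edges_of b) v \<in> LP_domain \<Lambda>"
  using link_in_LP_disk link_in_LP_even link_in_LP_odd by (cases "puncture \<Lambda>") auto

end

section \<open>Rotation and symmetrisation\<close>

lemma relabelled_rot:
  assumes v: "v \<in> J" and k: "k \<in> K"
  shows "relabelled \<Lambda> (nx (nx v)) k = relabelled \<Lambda> v (rot_label N k)"
proof -
  have "idx (nx (nx v)) k = idx v (k + 1)"
    using idx_nx[OF nx_in] idx_nx[OF v] idx_Suc[of k v] k by simp
  also have "\<dots> = idx v (rot_label N k)"
  proof (cases "k = N")
    case True
    then show ?thesis using idx_period[of 1 v] by (simp add: rot_label_def add.commute)
  next
    case False then show ?thesis using k by (simp add: rot_label_def)
  qed
  finally show ?thesis unfolding relabelled_idx by simp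
qed

text \<open>Two external edges make one black label: starting two edges later renumbers
  \<open>k + 1\<close> as \<open>k\<close>, and \<open>rot_pattern\<close> undoes this.\<close>

lemma link_rot:
  assumes v: "v \<in> J"
  shows "rot_pattern N (link_pattern_of \<Lambda> B (nx (nx v))) = link_pattern_of \<Lambda> B v"
proof -
  let ?w = "nx (nx v)" and ?\<rho> = "rot_label N"
  let ?L = "linked_labels \<Lambda> B"
  have bij: "bij_betw ?\<rho> K K" by (rule rot_label_bij[OF nblack_pos])
  have inK: "?\<rho> k \<in> K" if "k \<in> K" for k using bij_betwE[OF bij] that by blast
  have surj: "\<exists>k'\<in>K. k = ?\<rho> k'" if "k \<in> K" for k using bij that unfolding bij_betw_def by blast
  have inj: "?\<rho> k = ?\<rho> l \<longleftrightarrow> k = l" if "k \<in> K" "l \<in> K" for k l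
    using inj_on_eq_iff[OF bij_betw_imp_inj_on[OF bij] that] .
  note rel = relabelled_rot[OF v]
  have LK: "k \<in> K" "l \<in> K" if "(k, l) \<in> ?L u" for k l u using that unfolding linked_labels_def by auto
  have L: "(?\<rho> k, ?\<rho> l) \<in> ?L v \<longleftrightarrow> (k, l) \<in> ?L ?w" if "k \<in> K" "l \<in> K" for k l
    using that inK inj rel unfolding linked_labels_def by auto
  have Lv: "\<exists>k' l'. k = ?\<rho> k' \<and> l = ?\<rho> l' \<and> (k', l') \<in> ?L ?w" if "(k, l) \<in> ?L v" for k l
    using surj[OF LK(1)[OF that]] surj[OF LK(2)[OF that]] L that by blast
  have Lw: "(?\<rho> k, ?\<rho> l) \<in> ?L v" if "(k, l) \<in> ?L ?w" for k l using L LK[OF that] that by blast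
  let ?P = "\<lambda>u k. black_path \<Lambda> B (relabelled \<Lambda> u k)"
  show ?thesis
  proof (cases "puncture \<Lambda>")
    case Unpunctured
    have "(`) ?\<rho> ` {{k, l} | k l. (k, l) \<in> ?L ?w} = {{k, l} | k l. (k, l) \<in> ?L v}"
    proof (intro equalityI subsetI)
      fix s assume "s \<in> (`) ?\<rho> ` {{k, l} | k l. (k, l) \<in> ?L ?w}"
      then obtain k l where "s = {?\<rho> k, ?\<rho> l}" "(k, l) \<in> ?L ?w" by auto
      then show "s \<in> {{k, l} | k l. (k, l) \<in> ?L v}" using Lw by blast
    next
      fix s assume "s \<in> {{k, l} | k l. (k, l) \<in> ?L v}"
      then obtain k l where "s = {?\<rho> k, ?\<rho> l}" "(k, l) \<in> ?L ?w" using Lv by blast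
      then have "s = ?\<rho> ` {k, l}" "{k, l} \<in> {{k, l} | k l. (k, l) \<in> ?L ?w}" by auto
      then show "s \<in> (`) ?\<rho> ` {{k, l} | k l. (k, l) \<in> ?L ?w}" by (rule image_eqI)
    qed
    then show ?thesis using Unpunctured unfolding link_pattern_of_def Let_def by simp
  next
    case (In_Face p)
    let ?D = "\<lambda>u. {(k, l) \<in> ?L u. p \<notin> region \<Lambda> (?P u k) (relabelled \<Lambda> u k)}"
    have "map_prod ?\<rho> ?\<rho> ` ?D ?w = ?D v"
    proof (intro equalityI subsetI)
      fix s assume "s \<in> map_prod ?\<rho> ?\<rho> ` ?D ?w"
      then obtain k l where kl: "s = (?\<rho> k, ?\<rho> l)" "(k, l) \<in> ?L ?w"
        "p \<notin> region \<Lambda> (?P ?w k) (relabelled \<Lambda> ?w k)" by auto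
      then show "s \<in> ?D v" using Lw rel[OF LK(1)[OF kl(2)]] by simp
    next
      fix s assume "s \<in> ?D v"
      then obtain k l where s: "s = (k, l)" "(k, l) \<in> ?L v"
        "p \<notin> region \<Lambda> (?P v k) (relabelled \<Lambda> v k)" by auto
      obtain k' l' where kl: "k = ?\<rho> k'" "l = ?\<rho> l'" "(k', l') \<in> ?L ?w" using Lv[OF s(2)] by blast
      have "(k', l') \<in> ?D ?w" using kl s(3) rel[OF LK(1)[OF kl(3)]] by simp
      moreover have "s = map_prod ?\<rho> ?\<rho> (k', l')" using s kl by simp
      ultimately show "s \<in> map_prod ?\<rho> ?\<rho> ` ?D ?w" by blast
    qed
    then show ?thesis using In_Face unfolding link_pattern_of_def Let_def by simp
  next
    case (At_Vertex p)
    let ?O = "map_option ?\<rho>"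
    let ?A = "\<lambda>u. {{Some k, Some l} | k l. (k, l) \<in> ?L u}"
    let ?B = "\<lambda>u. {{Some k, None} | k. k \<in> K \<and> ?P u k \<inter> vertex_of \<Lambda> p \<noteq> {}}"
    have "(`) ?O ` ?A ?w = ?A v"
    proof (intro equalityI subsetI)
      fix s assume "s \<in> (`) ?O ` ?A ?w"
      then obtain k l where "s = {Some (?\<rho> k), Some (?\<rho> l)}" "(k, l) \<in> ?L ?w" by auto
      then show "s \<in> ?A v" using Lw by blast
    next
      fix s assume "s \<in> ?A v"
      then obtain k l where "s = {Some (?\<rho> k), Some (?\<rho> l)}" "(k, l) \<in> ?L ?w" using Lv by blast
      then have "s = ?O ` {Some k, Some l}" "{Some k, Some l} \<in> ?A ?w" by auto
      then show "s \<in> (`) ?O ` ?A ?w" by (rule image_eqI)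
    qed
    moreover have "(`) ?O ` ?B ?w = ?B v"
    proof (intro equalityI subsetI)
      fix s assume "s \<in> (`) ?O ` ?B ?w"
      then obtain k where k: "s = ?O ` {Some k, None}" "k \<in> K" "?P ?w k \<inter> vertex_of \<Lambda> p \<noteq> {}" by blast
      have "?P v (?\<rho> k) \<inter> vertex_of \<Lambda> p \<noteq> {}" using k(3) rel[OF k(2)] by simp
      moreover have "s = {Some (?\<rho> k), None}" using k(1) by simp
      ultimately show "s \<in> ?B v" using inK[OF k(2)] by blast
    next
      fix s assume "s \<in> ?B v"
      then obtain k where s: "s = {Some k, None}" "k \<in> K" "?P v k \<inter> vertex_of \<Lambda> p \<noteq> {}" by blast
      obtain k' where k': "k' \<in> K" "k = ?\<rho> k'" using surj[OF s(2)] by blast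
      have "?P ?w k' \<inter> vertex_of \<Lambda> p \<noteq> {}" using s(3) rel[OF k'(1)] k'(2) by simp
      then have "{Some k', None} \<in> ?B ?w" using k'(1) by blast
      moreover have "s = ?O ` {Some k', None}" using s k' by simp
      ultimately show "s \<in> (`) ?O ` ?B ?w" by (rule rev_image_eqI)
    qed
    ultimately show ?thesis using At_Vertex unfolding link_pattern_of_def Let_def by (simp add: image_Un)
  qed
qed

lemma finite_LP_domain: "finite (LP_domain \<Lambda>)"
  unfolding LP_domain_def using finite_LP finite_LP_punctured by simp

text \<open>\<open>rot_op\<close> sums over \<open>LP_domain\<close> and would annihilate any other
  ket; here it matters that all link patterns of FPLs belong to it.\<close>

lemma rot_op_ket:
  assumes "\<pi> \<in> LP_domain \<Lambda>" shows "rot_op \<Lambda> (ket \<pi>) = ket (rot_pattern N \<pi>)"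
proof
  fix \<sigma>
  have "rot_op \<Lambda> (ket \<pi>) \<sigma> = (\<Sum>\<tau>\<in>LP_domain \<Lambda>. if \<tau> = \<pi> then ket (rot_pattern N \<tau>) \<sigma> else 0)"
    unfolding rot_op_def by (rule sum.cong) (auto simp: ket_def)
  then show "rot_op \<Lambda> (ket \<pi>) \<sigma> = ket (rot_pattern N \<pi>) \<sigma>"
    using assms finite_LP_domain by simp
qed

lemma rot_op_sum:
  "rot_op \<Lambda> (\<lambda>\<sigma>. \<Sum>i\<in>I. a i * \<psi> i \<sigma>) = (\<lambda>\<sigma>. \<Sum>i\<in>I. a i * rot_op \<Lambda> (\<psi> i) \<sigma>)"
proof
  fix \<sigma>
  have "rot_op \<Lambda> (\<lambda>\<sigma>. \<Sum>i\<in>I. a i * \<psi> i \<sigma>) \<sigma> =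
      (\<Sum>\<pi>\<in>LP_domain \<Lambda>. \<Sum>i\<in>I. a i * (\<psi> i \<pi> * ket (rot_pattern N \<pi>) \<sigma>))"
    unfolding rot_op_def by (simp add: sum_distrib_right mult.assoc)
  also have "\<dots> = (\<Sum>i\<in>I. \<Sum>\<pi>\<in>LP_domain \<Lambda>. a i * (\<psi> i \<pi> * ket (rot_pattern N \<pi>) \<sigma>))"
    by (rule sum.swap)
  also have "\<dots> = (\<Sum>i\<in>I. a i * rot_op \<Lambda> (\<psi> i) \<sigma>)"
    unfolding rot_op_def by (simp add: sum_distrib_left)
  finally show "rot_op \<Lambda> (\<lambda>\<sigma>. \<Sum>i\<in>I. a i * \<psi> i \<sigma>) \<sigma> = (\<Sum>i\<in>I. a i * rot_op \<Lambda> (\<psi> i) \<sigma>)" .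
qed

lemma rot_op_pow_sum:
  "(rot_op \<Lambda> ^^ k) (\<lambda>\<sigma>. \<Sum>i\<in>I. a i * \<psi> i \<sigma>) = (\<lambda>\<sigma>. \<Sum>i\<in>I. a i * (rot_op \<Lambda> ^^ k) (\<psi> i) \<sigma>)"
  by (induction k) (simp_all add: rot_op_sum)

lemma Sym_sum:
  "Sym \<Lambda> (\<lambda>\<sigma>. \<Sum>i\<in>I. a i * \<psi> i \<sigma>) \<sigma> = (\<Sum>i\<in>I. a i * Sym \<Lambda> (\<psi> i) \<sigma>)"
proof -
  have "(\<Sum>k<N. \<Sum>i\<in>I. a i * (rot_op \<Lambda> ^^ k) (\<psi> i) \<sigma>) = (\<Sum>i\<in>I. \<Sum>k<N. a i * (rot_op \<Lambda> ^^ k) (\<psi> i) \<sigma>)"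
    by (rule sum.swap)
  then show ?thesis
    unfolding Sym_def rot_op_pow_sum by (simp add: sum_distrib_left mult.left_commute)
qed

text \<open>The rotation of a pattern, seen on the external edge from which it is read; its
  \<open>N\<close>-th power is the identity.\<close>

definition back2 :: "nat \<Rightarrow> nat" where
  "back2 v = prev_ext \<Lambda> (prev_ext \<Lambda> v)"

lemma back2: assumes "v \<in> J" shows "back2 v \<in> J" "nx (nx (back2 v)) = v"
  using assms prev_in nx_prev unfolding back2_def by auto

lemma back2_black: assumes "fpl b" "v \<in> J" shows "b (e (back2 v)) = b (e v)"
  using fplD(5)[OF assms(1) nx_in, of "back2 v"] fplD(5)[OF assms(1) back2(1)[OF assms(2)]] back2(2)[OF assms(2)]
  by simp

lemma back2_pow_in: "v \<in> J \<Longrightarrow> (back2 ^^ k) v \<in> J"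
  by (induction k) (use back2 in auto)

lemma nx_pow: "v \<in> J \<Longrightarrow> (nx ^^ k) v = (v - 1 + k) mod (2 * N) + 1"
proof (induction k)
  case 0 then show ?case by auto
next
  case (Suc k)
  then show ?case using nx_mod[of "v - 1 + k"] by simp
qed

lemma back2_period: assumes "v \<in> J" shows "(back2 ^^ N) v = v"
proof -
  have "(nx ^^ (2 * k)) ((back2 ^^ k) v) = v" for k
  proof (induction k)
    case (Suc k)
    have "(nx ^^ (2 * Suc k)) ((back2 ^^ Suc k) v) = (nx ^^ (2 * k)) (nx (nx (back2 ((back2 ^^ k) v))))"
      by (simp add: funpow_swap1)
    then show ?case using back2(2)[OF back2_pow_in[OF assms]] Suc by simp
  qed simp
  from this[of N] show ?thesis using nx_pow[OF back2_pow_in[OF assms], of "2 * N" N] back2_pow_in[OF assms, of N]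
    by auto
qed

text \<open>The average over the rotations runs through a full period of \<open>back2\<close>, so
  moving the start by one step only permutes the summands cyclically.\<close>

lemma Sym_link_back:
  assumes b: "fpl b" and v: "v \<in> J" "b (e v)"
  shows "Sym \<Lambda> (ket (link_pattern_of \<Lambda> (edges_of b) (back2 v))) =
    Sym \<Lambda> (ket (link_pattern_of \<Lambda> (edges_of b) v))"
proof
  fix \<sigma>
  let ?l = "link_pattern_of \<Lambda> (edges_of b)"
  have pw: "(rot_op \<Lambda> ^^ k) (ket (?l v)) = ket (?l ((back2 ^^ k) v))" if v: "v \<in> J" "b (e v)" for k v
  proof (induction k)
    case (Suc k)
    let ?u = "(back2 ^^ k) v"
    have u: "?u \<in> J" by (rule back2_pow_in[OF v(1)])
    have "b (e ((back2 ^^ k) v))" by (induction k) (use v back2_black[OF b back2_pow_in[OF v(1)]] in auto)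
    then have "?l ?u \<in> LP_domain \<Lambda>" using link_in_LP[OF b u] by blast
    then have "rot_op \<Lambda> (ket (?l ?u)) = ket (rot_pattern N (?l ?u))" by (rule rot_op_ket)
    also have "rot_pattern N (?l ?u) = ?l (back2 ?u)"
      using link_rot[OF back2(1)[OF u], of "edges_of b"] back2(2)[OF u] by simp
    finally show ?case using Suc by simp
  qed simp
  let ?g = "\<lambda>k. ket (?l ((back2 ^^ k) v)) \<sigma>"
  have "(\<Sum>k<N. ?g (Suc k)) + ?g 0 = (\<Sum>k<Suc N. ?g k)"
    by (subst sum.lessThan_Suc_shift) simp
  also have "\<dots> = (\<Sum>k<N. ?g k) + ?g N" by simp
  finally have "(\<Sum>k<N. ?g (Suc k)) = (\<Sum>k<N. ?g k)" using back2_period[OF v(1)] by simp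
  moreover have "(rot_op \<Lambda> ^^ k) (ket (?l (back2 v))) \<sigma> = ?g (Suc k)" for k
    using pw[OF back2(1)[OF v(1)]] back2_black[OF b v(1)] v(2) by (simp add: funpow_swap1)
  moreover have "(rot_op \<Lambda> ^^ k) (ket (?l v)) \<sigma> = ?g k" for k using pw[OF v] by simp
  ultimately show "Sym \<Lambda> (ket (?l (back2 v))) \<sigma> = Sym \<Lambda> (ket (?l v)) \<sigma>" unfolding Sym_def by simp
qed

lemma black_parity: assumes "fpl b" "i \<in> J" shows "b (e i) \<longleftrightarrow> (b (e 1) \<longleftrightarrow> odd i)"
proof -
  have "1 \<le> i" "i \<le> 2 * N" using assms(2) by auto
  then show ?thesis
  proof (induction i rule: dec_induct)
    case base then show ?case by simp
  next
    case (step n)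
    then have "n \<in> J" "nx n = Suc n" by (auto simp: next_ext_def)
    then show ?case using step fplD(5)[OF assms(1), of n] by auto
  qed
qed

text \<open>The black external edges have numbers of one parity and are linked by steps of two, so
  every start can be brought to 1 or 2.\<close>

lemma Sym_link_eq:
  assumes b: "fpl b" and u: "u \<in> J" "b (e u)" and v: "v \<in> J" "b (e v)"
  shows "Sym \<Lambda> (ket (link_pattern_of \<Lambda> (edges_of b) u)) = Sym \<Lambda> (ket (link_pattern_of \<Lambda> (edges_of b) v))"
proof -
  let ?S = "\<lambda>v. Sym \<Lambda> (ket (link_pattern_of \<Lambda> (edges_of b) v))"
  have *: "?S v = ?S (if odd v then 1 else 2)" if "v \<in> J" "b (e v)" for v
    using that
  proof (induction v rule: less_induct)
    case (less v)
    show ?case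
    proof (cases "v \<le> 2")
      case True
      then have "v = 1 \<or> v = 2" using less.prems by auto
      then show ?thesis by auto
    next
      case False
      then have bk: "back2 v = v - 2" "v - 2 < v" unfolding back2_def prev_ext_def by auto
      have "?S (v - 2) = ?S v" using Sym_link_back[OF b less.prems] bk by simp
      moreover have "?S (v - 2) = ?S (if odd (v - 2) then 1 else 2)"
        using less.IH[of "v - 2"] bk back2(1)[OF less.prems(1)] back2_black[OF b less.prems(1)] less.prems(2) by simp
      ultimately show ?thesis using False by simp
    qed
  qed
  have "odd u = odd v" using black_parity[OF b u(1)] black_parity[OF b v(1)] u v by auto
  then show ?thesis using *[OF u] *[OF v] by simp
qed

section \<open>The gyration argument\<close>

definition gyrate :: "half set set \<Rightarrow> half set set" where
  "gyrate B = edges_of (gyr (active (is_black B)) (is_black B))"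

definition start :: "half set set \<Rightarrow> nat" where
  "start B = (if is_black B (e 1) then 1 else 2)"

lemma FplD: assumes "B \<in> Fpl \<Lambda>" shows "fpl (is_black B)" "edges_of (is_black B) = B"
  using assms Fpl_iff edges_of_blk by auto

lemma gyrate: assumes "B \<in> Fpl \<Lambda>" shows "gyrate B \<in> Fpl \<Lambda>" "is_black (gyrate B) = gyr (active (is_black B)) (is_black B)"
  using Fpl_edges_of[OF gyr_fpl[OF FplD(1)[OF assms]]] unfolding gyrate_def by auto

lemma finite_Fpl: "finite (Fpl \<Lambda>)"
proof (rule finite_subset)
  show "Fpl \<Lambda> \<subseteq> Pow (edge_of \<Lambda> ` H)" using Fpl_iff by blast
  show "finite (Pow (edge_of \<Lambda> ` H))" using finite_halves by simp
qed

text \<open>The active class varies with the configuration, so \<open>gyrate\<close> is not simply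
  an involution. But edge 1 always flips, so the image determines its former colour, hence the class
  that acted, and \<open>gyr\<close> for that class recovers the configuration.\<close>

lemma gyrate_bij: "bij_betw gyrate (Fpl \<Lambda>) (Fpl \<Lambda>)"
proof -
  have "inj_on gyrate (Fpl \<Lambda>)"
  proof (rule inj_onI)
    fix B B' assume B: "B \<in> Fpl \<Lambda>" "B' \<in> Fpl \<Lambda>" "gyrate B = gyrate B'"
    note f = FplD(1)[OF B(1)] FplD(1)[OF B(2)]
    have 1: "1 \<in> J" using nblack_pos by simp
    have eq: "gyr (active (is_black B)) (is_black B) = gyr (active (is_black B')) (is_black B')"
      using gyrate(2)[OF B(1)] gyrate(2)[OF B(2)] B(3) by simp
    then have "is_black B (e 1) = is_black B' (e 1)" using gyr_ext[OF f(1) 1] gyr_ext[OF f(2) 1] by metis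
    then have q: "active (is_black B) = active (is_black B')" by (simp add: active_def)
    have "is_black B = gyr (active (is_black B)) (gyr (active (is_black B)) (is_black B))" using gyr_gyr[OF f(1)] by simp
    also have "\<dots> = gyr (active (is_black B')) (gyr (active (is_black B')) (is_black B'))" using eq q by simp
    also have "\<dots> = is_black B'" by (rule gyr_gyr[OF f(2)])
    finally show "B = B'" using FplD(2)[OF B(1)] FplD(2)[OF B(2)] by metis
  qed
  moreover have "gyrate ` Fpl \<Lambda> \<subseteq> Fpl \<Lambda>" using gyrate(1) by blast
  ultimately show ?thesis using finite_Fpl by (simp add: bij_betw_def endo_inj_surj)
qed

lemma start: assumes "B \<in> Fpl \<Lambda>" shows "start B \<in> J" "is_black B (e (start B))"
proof -
  have 1: "1 \<in> J" "nx 1 = 2" using nblack_pos by (auto simp: next_ext_def)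
  show "start B \<in> J" using nblack_pos by (auto simp: start_def)
  show "is_black B (e (start B))" using fplD(5)[OF FplD(1)[OF assms] 1(1)] 1(2) by (simp add: start_def)
qed

lemma symmetrised_refinement: "Sym \<Lambda> (Psi' \<Lambda> t) = Sym \<Lambda> (Psi \<Lambda> t)"
proof
  fix \<sigma>
  let ?F = "Fpl \<Lambda>"
  define S where "S B = Sym \<Lambda> (ket (link_pattern_of \<Lambda> B (start B))) \<sigma>" for B
  define h where "h B = refpos (is_black B)" for B
  define w where "w B = is_black B (e (h B))" for B
  have S: "Sym \<Lambda> (ket (link_pattern_of \<Lambda> B v)) \<sigma> = S B" if "B \<in> ?F" "v \<in> J" "is_black B (e v)" for B v
    using Sym_link_eq[OF FplD(1)[OF that(1)] that(2,3) start[OF that(1)]] FplD(2)[OF that(1)] unfolding S_def by simp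
  have h: "refinement_pos \<Lambda> B = h B" "h B \<in> {1..L}" "h B \<in> J" if "B \<in> ?F" for B
    using refpos(1,2,5)[OF FplD(1)[OF that]] FplD(2)[OF that] side_J unfolding h_def by auto
  have count: "(\<Sum>B\<in>{B \<in> ?F. h B = n \<and> \<not> w B}. S B) = (\<Sum>B\<in>{B \<in> ?F. h B = n \<and> w B}. S B)" for n
  proof (rule gyration_count[OF finite_Fpl gyrate_bij])
    fix B assume B: "B \<in> ?F"
    note f = FplD(1)[OF B] and g = gyrate[OF B]
    \<comment> \<open>The pattern of \<open>B\<close> from its start is that of the image from the
      next edge. That edge need not be the canonical start of the image, but \<open>Sym\<close>
      forgets the difference.\<close>
    show "S (gyrate B) = S B"
    proof -
      let ?v = "start B"
      have v: "?v \<in> J" "is_black B (e ?v)" by (rule start[OF B])+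
      have p: "par (e ?v) = active (is_black B)" using active[OF f v(1)] v(2) by simp
      have "link_pattern_of \<Lambda> (gyrate B) (nx ?v) = link_pattern_of \<Lambda> B ?v"
        using link_transport[OF f v(1) p v(2)] FplD(2)[OF B] unfolding gyrate_def by simp
      moreover have "is_black (gyrate B) (e (nx ?v))"
        using gyr_ext[OF f nx_in] fplD(5)[OF f v(1)] v(2) g(2) by simp
      ultimately show ?thesis using S[OF g(1) nx_in[of ?v]] S[OF B v] by simp
    qed
    show "h (gyrate B) = h B \<and> w (gyrate B) \<or> h (gyrate B) = h B + 1 \<and> \<not> w (gyrate B)" if "\<not> w B"
      using refpos_gyr[OF f] that unfolding h_def w_def g(2) by simp
    show "h (gyrate B) = h B \<and> \<not> w (gyrate B) \<or> h (gyrate B) + 1 = h B \<and> w (gyrate B)" if "w B"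
      using refpos_gyr[OF f] that unfolding h_def w_def g(2) by simp
  qed
  have by_pos: "(\<Sum>B\<in>{B \<in> ?F. P B}. t ^ (h B - 1) * S B) =
      (\<Sum>n\<in>{1..L}. t ^ (n - 1) * (\<Sum>B\<in>{B \<in> ?F. h B = n \<and> P B}. S B))" for P
  proof -
    have "(\<Sum>B\<in>{B \<in> ?F. P B}. t ^ (h B - 1) * S B) =
        (\<Sum>n\<in>{1..L}. \<Sum>B\<in>{B \<in> {B \<in> ?F. P B}. h B = n}. t ^ (h B - 1) * S B)"
      by (rule sum.group[symmetric]) (use finite_Fpl h(2) in auto)
    also have "\<dots> = (\<Sum>n\<in>{1..L}. t ^ (n - 1) * (\<Sum>B\<in>{B \<in> ?F. h B = n \<and> P B}. S B))"
    proof (rule sum.cong[OF refl])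
      fix n
      have "{B \<in> {B \<in> ?F. P B}. h B = n} = {B \<in> ?F. h B = n \<and> P B}" by blast
      then show "(\<Sum>B\<in>{B \<in> {B \<in> ?F. P B}. h B = n}. t ^ (h B - 1) * S B) =
          t ^ (n - 1) * (\<Sum>B\<in>{B \<in> ?F. h B = n \<and> P B}. S B)"
        by (simp add: sum_distrib_left)
    qed
    finally show ?thesis .
  qed
  have be: "black_ext \<Lambda> B j = is_black B (e j)" for B j by (simp add: black_ext_def is_black_def)
  have "Sym \<Lambda> (Psi' \<Lambda> t) \<sigma> =
      (\<Sum>B\<in>Fpl_plus \<Lambda>. t ^ (refinement_pos \<Lambda> B - 1) * Sym \<Lambda> (ket (Pi_plus \<Lambda> B)) \<sigma>)"
    unfolding Psi'_def by (rule Sym_sum)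
  also have "\<dots> = (\<Sum>B\<in>{B \<in> ?F. is_black B (e 1)}. t ^ (h B - 1) * S B)"
  proof (rule sum.cong)
    show "Fpl_plus \<Lambda> = {B \<in> ?F. is_black B (e 1)}" unfolding Fpl_plus_def be ..
    fix B assume "B \<in> {B \<in> ?F. is_black B (e 1)}"
    then show "t ^ (refinement_pos \<Lambda> B - 1) * Sym \<Lambda> (ket (Pi_plus \<Lambda> B)) \<sigma> = t ^ (h B - 1) * S B"
      using S[of B 1] h(1) nblack_pos unfolding Pi_plus_def by simp
  qed
  also have "\<dots> = (\<Sum>n\<in>{1..L}. t ^ (n - 1) * (\<Sum>B\<in>{B \<in> ?F. h B = n \<and> is_black B (e 1)}. S B))"
    by (rule by_pos)
  also have "\<dots> = (\<Sum>n\<in>{1..L}. t ^ (n - 1) * (\<Sum>B\<in>{B \<in> ?F. h B = n \<and> w B}. S B))"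
  proof (rule sum.cong[OF refl])
    fix n
    have "{B \<in> ?F. h B = n \<and> is_black B (e 1)} =
        (if odd n then {B \<in> ?F. h B = n \<and> w B} else {B \<in> ?F. h B = n \<and> \<not> w B})"
      using black_parity[OF FplD(1) h(3)] unfolding w_def by auto
    then show "t ^ (n - 1) * (\<Sum>B\<in>{B \<in> ?F. h B = n \<and> is_black B (e 1)}. S B) =
        t ^ (n - 1) * (\<Sum>B\<in>{B \<in> ?F. h B = n \<and> w B}. S B)"
      using count[of n] by simp
  qed
  also have "\<dots> = (\<Sum>B\<in>{B \<in> ?F. w B}. t ^ (h B - 1) * S B)" by (rule by_pos[symmetric])
  also have "\<dots> = (\<Sum>B\<in>Fpl_b \<Lambda>. t ^ (refinement_pos \<Lambda> B - 1) * Sym \<Lambda> (ket (Pi_b \<Lambda> B)) \<sigma>)"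
  proof (rule sum.cong)
    show "{B \<in> ?F. w B} = Fpl_b \<Lambda>" unfolding Fpl_b_def be w_def using h(1) by auto
    fix B assume "B \<in> Fpl_b \<Lambda>"
    then have B: "B \<in> ?F" "w B" unfolding Fpl_b_def be w_def using h(1) by auto
    then show "t ^ (h B - 1) * S B = t ^ (refinement_pos \<Lambda> B - 1) * Sym \<Lambda> (ket (Pi_b \<Lambda> B)) \<sigma>"
      using S[OF B(1) h(3)[OF B(1)]] h(1)[OF B(1)] unfolding Pi_b_def w_def by simp
  qed
  also have "\<dots> = Sym \<Lambda> (Psi \<Lambda> t) \<sigma>" unfolding Psi_def by (rule Sym_sum[symmetric])
  finally show "Sym \<Lambda> (Psi' \<Lambda> t) \<sigma> = Sym \<Lambda> (Psi \<Lambda> t) \<sigma>" .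
qed

end

section \<open>Lattice directions and the removed squares\<close>

definition dirs :: "(int \<times> int) set" where
  "dirs = {(0, -1), (1, 0), (0, 1), (-1, 0)}"

text \<open>Clockwise quarter turn, the direction to the right of \<open>d\<close>; around a vertex
  \<open>ccw\<close> therefore acts as \<open>- rot d\<close>.\<close>

definition rot :: "int \<times> int \<Rightarrow> int \<times> int" where
  "rot d = (snd d, - fst d)"

lemma dirs_cases:
  assumes "d \<in> dirs"
  obtains "d = (0, -1)" | "d = (1, 0)" | "d = (0, 1)" | "d = (-1, 0)"
  using assms by (auto simp: dirs_def)

lemma rot_simps [simp]: "rot (rot d) = - d" "rot (- d) = - rot d" "rot (u, v) = (v, - u)"
  by (auto simp: rot_def prod_eq_iff)

lemma dirs_rot: "d \<in> dirs \<Longrightarrow> rot d \<in> dirs" "d \<in> dirs \<Longrightarrow> - d \<in> dirs"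
  by (auto simp: dirs_def)

lemma dirs_four: "d \<in> dirs \<Longrightarrow> dirs = {d, - d, rot d, - rot d}"
  by (auto simp: dirs_def)

lemma dirs_distinct: "d \<in> dirs \<Longrightarrow> distinct [d, - d, rot d, - rot d]"
  by (auto simp: dirs_def)

locale dihedral =
  fixes Lx Ly :: int and a :: "nat \<Rightarrow> int"
  assumes params: "dihedral_params Lx Ly a"
begin

definition in2 where "in2 x y \<longleftrightarrow> Lx - a 2 + 1 \<le> x \<and> x \<le> Lx \<and> 1 \<le> y \<and> y \<le> a 2"
definition in3 where "in3 x y \<longleftrightarrow> Lx - a 3 + 1 \<le> x \<and> x \<le> Lx \<and> Ly - a 3 + 1 \<le> y \<and> y \<le> Ly"
definition in4 where "in4 x y \<longleftrightarrow> 1 \<le> x \<and> x \<le> a 4 \<and> Ly - a 4 + 1 \<le> y \<and> y \<le> Ly"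

definition sq :: "nat \<Rightarrow> int \<times> int \<Rightarrow> bool" where
  "sq i p \<longleftrightarrow> (let (x, y) = p in if i = 2 then in2 x y else if i = 3 then in3 x y else in4 x y)"

abbreviation "Rm \<equiv> removed Lx Ly a"
abbreviation "R \<equiv> rectangle Lx Ly"
abbreviation "Gd \<equiv> grid Lx Ly a"

lemma R_iff: "(x, y) \<in> R \<longleftrightarrow> 1 \<le> x \<and> x \<le> Lx \<and> 1 \<le> y \<and> y \<le> Ly"
  by (auto simp: rectangle_def)

lemma a1: "a 1 = 0"
  using params by (auto simp: dihedral_params_def)

lemma corner_iff:
  "(x, y) \<notin> corner_square Lx Ly a 1"
  "(x, y) \<in> corner_square Lx Ly a 2 \<longleftrightarrow> in2 x y"
  "(x, y) \<in> corner_square Lx Ly a 3 \<longleftrightarrow> in3 x y"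
  "(x, y) \<in> corner_square Lx Ly a 4 \<longleftrightarrow> in4 x y"
  using a1 by (auto simp: corner_square_def in2_def in3_def in4_def)

lemma Rm_iff: "(x, y) \<in> Rm \<longleftrightarrow> in2 x y \<or> in3 x y \<or> in4 x y"
proof -
  have "{1..4} = {1, 2, 3, 4 :: nat}" by auto
  then show ?thesis unfolding removed_def by (auto simp: corner_iff[simplified])
qed

text \<open>Linear form of the conditions on the parameters. An overlap of two squares shows at a
  single cell, such as the upper right corner of square 2 for squares 2 and 3, and the presence of
  \<open>(1, 1)\<close> keeps each square from filling the rectangle.\<close>

lemma bounds_a:
  "1 \<le> Lx" "1 \<le> Ly" "0 \<le> a 2" "0 \<le> a 3" "0 \<le> a 4"
  "a 2 < Lx" "a 2 \<le> Ly" "a 3 \<le> Lx" "a 3 \<le> Ly" "a 4 \<le> Lx" "a 4 < Ly"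
  "a 3 < Lx \<or> a 3 < Ly" "a 2 + a 3 \<le> Ly" "a 3 + a 4 \<le> Lx" "a 2 + a 4 \<le> Lx \<or> a 2 + a 4 \<le> Ly"
proof -
  have P: "1 \<le> Lx" "1 \<le> Ly" "\<And>i. i \<in> {1..4} \<Longrightarrow> 0 \<le> a i \<and> a i \<le> min Lx Ly"
    "\<And>i j. i \<in> {1..4} \<Longrightarrow> j \<in> {1..4} \<Longrightarrow> i \<noteq> j \<Longrightarrow> corner_square Lx Ly a i \<inter> corner_square Lx Ly a j = {}"
    "(1, 1) \<in> Gd"
    using params unfolding dihedral_params_def by blast+
  show 1: "1 \<le> Lx" "1 \<le> Ly" by (rule P)+
  show 2: "0 \<le> a 2" "0 \<le> a 3" "0 \<le> a 4" "a 2 \<le> Ly" "a 3 \<le> Lx" "a 3 \<le> Ly" "a 4 \<le> Lx"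
    using P(3)[of 2] P(3)[of 3] P(3)[of 4] by auto
  have 3: "a 2 \<le> Lx" "a 4 \<le> Ly" using P(3)[of 2] P(3)[of 4] by auto
  have g: "\<not> in2 1 1" "\<not> in3 1 1" "\<not> in4 1 1" using P(5) Rm_iff[of 1 1] unfolding grid_def by blast+
  show "a 2 < Lx" "a 4 < Ly" "a 3 < Lx \<or> a 3 < Ly"
    using g 1 2 3 unfolding in2_def in3_def in4_def by linarith+
  have d: "\<not> (in2 x y \<and> in3 x y)" "\<not> (in3 x y \<and> in4 x y)" "\<not> (in2 x y \<and> in4 x y)" for x y
    using P(4)[of 2 3, simplified] P(4)[of 3 4, simplified] P(4)[of 2 4, simplified] corner_iff(2-4)
    by (metis IntI empty_iff)+
  show "a 2 + a 3 \<le> Ly"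
    using d(1)[of Lx "a 2"] 1 2 unfolding in2_def in3_def by linarith
  show "a 3 + a 4 \<le> Lx"
    using d(2)[of "a 4" Ly] 1 2 unfolding in4_def in3_def by linarith
  show "a 2 + a 4 \<le> Lx \<or> a 2 + a 4 \<le> Ly"
    using d(3)[of "a 4" "a 2"] 1 2 3 unfolding in4_def in2_def by linarith
qed

lemma in_R: "in2 x y \<Longrightarrow> (x, y) \<in> R" "in3 x y \<Longrightarrow> (x, y) \<in> R" "in4 x y \<Longrightarrow> (x, y) \<in> R"
  using bounds_a unfolding in2_def in3_def in4_def R_iff by linarith+

lemma in_disjoint: "in2 x y \<Longrightarrow> \<not> in3 x y" "in3 x y \<Longrightarrow> \<not> in4 x y" "in2 x y \<Longrightarrow> \<not> in4 x y"
  using bounds_a unfolding in2_def in3_def in4_def by linarith+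

lemma Rm_R: "p \<in> Rm \<Longrightarrow> p \<in> R"
  by (cases p) (auto simp: Rm_iff in_R)

lemma Gd_iff: "p \<in> Gd \<longleftrightarrow> p \<in> R \<and> p \<notin> Rm"
  by (auto simp: grid_def)

text \<open>The directions in which an edge of the full rectangle at a removed cell belongs to a joined edge.  The
  diagonal through the concave corner is where the strands turn.\<close>

definition opn :: "int \<times> int \<Rightarrow> int \<times> int \<Rightarrow> bool" where
  "opn p d \<longleftrightarrow> (let (x, y) = p; (u, v) = d in
     if in2 x y then u = -1 \<and> x + y \<le> Lx + 1 \<or> u = 1 \<and> x + y < Lx + 1 \<or>
       v = 1 \<and> x + y \<ge> Lx + 1 \<or> v = -1 \<and> x + y > Lx + 1
     else if in3 x y then u = -1 \<and> x - y \<le> Lx - Ly \<or> u = 1 \<and> x - y < Lx - Ly \<or>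
       v = -1 \<and> x - y \<ge> Lx - Ly \<or> v = 1 \<and> x - y > Lx - Ly
     else if in4 x y then u = 1 \<and> x + y \<ge> Ly + 1 \<or> u = -1 \<and> x + y > Ly + 1 \<or>
       v = -1 \<and> x + y \<le> Ly + 1 \<or> v = 1 \<and> x + y < Ly + 1
     else True)"

abbreviation "rfl \<equiv> reflect Lx Ly a"

lemma refl_eq:
  "rfl (x, y) (u, v) =
     (if in3 x y \<and> Lx - x = Ly - y then (- v, - u)
      else if in2 x y \<and> Lx - x = y - 1 \<or> in4 x y \<and> x - 1 = Ly - y then (v, u) else (u, v))"
  unfolding reflect_def by (simp add: corner_iff[simplified])

lemma refl_dirs: assumes "d \<in> dirs" shows "rfl p d \<in> dirs"
proof -
  obtain x y where p: "p = (x, y)" by (cases p)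
  from assms show ?thesis unfolding p by (cases rule: dirs_cases) (simp_all add: refl_eq dirs_def)
qed

lemma refl_back: "rfl p (- rfl p d) = - d"
  by (cases p; cases d) (auto simp: refl_eq)

lemma opn_nonrem: "p \<notin> Rm \<Longrightarrow> opn p d"
  by (cases p; cases d) (auto simp: opn_def Rm_iff)

lemma opn_refl:
  assumes "p \<in> Rm" "d \<in> dirs" "opn p (- d)"
  shows "opn p (rfl p d)" "rfl p d \<noteq> - d" "d' \<in> dirs \<Longrightarrow> opn p d' \<longleftrightarrow> d' = - d \<or> d' = rfl p d"
proof -
  obtain x y where p: "p = (x, y)" by (cases p)
  have in3: "in2 x y \<or> in3 x y \<or> in4 x y" using assms(1) p Rm_iff by blast
  have *: "opn p (rfl p d) \<and> rfl p d \<noteq> - d \<and>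
      (\<forall>d'\<in>{(0, -1), (1, 0), (0, 1), (-1, 0)}. opn p d' \<longleftrightarrow> d' = - d \<or> d' = rfl p d)"
    using in3 assms(3)
  proof (elim disjE)
    assume i: "in2 x y"
    note n = in_disjoint(1,3)[OF i]
    from assms(2) show ?thesis using i n assms(3) unfolding p
      by (cases rule: dirs_cases) (auto simp: opn_def refl_eq)
  next
    assume i: "in3 x y"
    have n: "\<not> in2 x y" "\<not> in4 x y" using i in_disjoint by blast+
    from assms(2) show ?thesis using i n assms(3) unfolding p
      by (cases rule: dirs_cases) (auto simp: opn_def refl_eq)
  next
    assume i: "in4 x y"
    have n: "\<not> in2 x y" "\<not> in3 x y" using i in_disjoint by blast+
    from assms(2) show ?thesis using i n assms(3) unfolding p
      by (cases rule: dirs_cases) (auto simp: opn_def refl_eq)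
  qed
  then show "opn p (rfl p d)" "rfl p d \<noteq> - d" by auto
  show "d' \<in> dirs \<Longrightarrow> opn p d' \<longleftrightarrow> d' = - d \<or> d' = rfl p d" using * unfolding dirs_def by blast
qed

text \<open>The sides of a square that face into the rectangle are where dangling edges enter, and
  those are all joined; dead directions occur only inside a square or at the border of the
  rectangle.\<close>

lemma opn_side:
  assumes "p \<in> Rm" "d \<in> dirs" "p + d \<in> R"
    "\<not> (\<exists>i\<in>{2, 3, 4}. sq i p \<and> sq i (p + d))"
  shows "opn p d"
proof -
  obtain x y where p: "p = (x, y)" by (cases p)
  have in3: "in2 x y \<or> in3 x y \<or> in4 x y" using assms(1) p Rm_iff by blast
  have n: "\<not> (in2 x y \<and> in2 (x + fst d) (y + snd d))" "\<not> (in3 x y \<and> in3 (x + fst d) (y + snd d))"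
    "\<not> (in4 x y \<and> in4 (x + fst d) (y + snd d))" "(x + fst d, y + snd d) \<in> R"
    using assms(3,4) unfolding p by (cases d; simp add: sq_def)+
  show ?thesis using in3
  proof (elim disjE)
    assume i: "in2 x y"
    from assms(2) show ?thesis using i n(1,4) bounds_a(6-7) unfolding p
      by (cases rule: dirs_cases) (simp_all add: opn_def, simp_all add: in2_def R_iff)
  next
    assume i: "in3 x y"
    have "\<not> in2 x y" using i in_disjoint by blast
    with assms(2) show ?thesis using i n(2,4) bounds_a(8-9) unfolding p
      by (cases rule: dirs_cases) (simp_all add: opn_def, simp_all add: in3_def R_iff)
  next
    assume i: "in4 x y"
    have "\<not> in2 x y" "\<not> in3 x y" using i in_disjoint by blast+
    with assms(2) show ?thesis using i n(3,4) bounds_a(10-11) unfolding p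
      by (cases rule: dirs_cases) (simp_all add: opn_def, simp_all add: in4_def R_iff)
  qed
qed

lemma opn_same:
  assumes "d \<in> dirs" "i \<in> {2, 3, 4}" "sq i p" "sq i (p + d)"
  shows "opn p d \<longleftrightarrow> opn (p + d) (- d)"
proof -
  obtain x y where p: "p = (x, y)" by (cases p)
  obtain u v where d: "d = (u, v)" by (cases d)
  consider "in2 x y" "in2 (x + u) (y + v)" | "in3 x y" "in3 (x + u) (y + v)" | "in4 x y" "in4 (x + u) (y + v)"
    using assms(2-4) unfolding p d by (auto simp: sq_def split: if_splits)
  then show ?thesis
  proof cases
    case 1
    from assms(1) show ?thesis using 1 unfolding p d[symmetric]
      by (cases rule: dirs_cases) (auto simp: opn_def d)
  next
    case 2
    have n: "\<not> in2 x y" "\<not> in2 (x + u) (y + v)" using 2 in_disjoint by blast+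
    from assms(1) show ?thesis using 2 n unfolding p d[symmetric]
      by (cases rule: dirs_cases) (auto simp: opn_def d)
  next
    case 3
    have n: "\<not> in2 x y" "\<not> in2 (x + u) (y + v)" "\<not> in3 x y" "\<not> in3 (x + u) (y + v)" using 3 in_disjoint by blast+
    from assms(1) show ?thesis using 3 n unfolding p d[symmetric]
      by (cases rule: dirs_cases) (auto simp: opn_def d)
  qed
qed

lemma sq_Rm: "sq i p \<Longrightarrow> p \<in> Rm"
  by (cases p) (auto simp: sq_def Rm_iff split: if_splits)

lemma Rm_sq: assumes "p \<in> Rm" obtains i where "i \<in> {2, 3, 4}" "sq i p"
proof -
  obtain x y where p: "p = (x, y)" by (cases p)
  have "in2 x y \<or> in3 x y \<or> in4 x y" using assms p Rm_iff by blast
  then show thesis using that[of 2] that[of 3] that[of 4] unfolding p by (auto simp: sq_def)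
qed

text \<open>Inside a square both cells judge their common edge alike; across a side of a square the
  edge is live from either cell.\<close>

lemma opn_sym:
  assumes "d \<in> dirs" "p \<in> R" "p + d \<in> R" "opn p d"
  shows "opn (p + d) (- d)"
proof (cases "p + d \<in> Rm")
  case False then show ?thesis by (rule opn_nonrem)
next
  case True
  show ?thesis
  proof (cases "\<exists>i\<in>{2, 3, 4}. sq i p \<and> sq i (p + d)")
    case True then show ?thesis using opn_same[OF assms(1)] assms(4) by blast
  next
    case False
    then show ?thesis
      using opn_side[OF True dirs_rot(2)[OF assms(1)]] assms(2) by (auto simp: add.assoc)
  qed
qed

text \<open>The two live directions of \<open>p\<close> put it on the diagonal of its square and
  leave a single possible \<open>d\<close>. In a left turn the right-hand neighbour runs on the
  outside: one cell straight on, the turn, one more cell straight on, and the strands are parallel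
  again.\<close>

lemma bend_left:
  assumes "d \<in> dirs" "p \<in> Rm" "p + rot d \<in> R" "opn p (- d)" "opn p (- rot d)" "opn (p + rot d) (- d)"
  shows "p + rot d \<in> Rm" "rfl (p + rot d) d = d" "p + rot d + d \<in> Rm" "rfl (p + rot d + d) d = - rot d"
    "p + d \<in> Rm" "rfl (p + d) (- rot d) = - rot d"
proof -
  obtain x y where p: "p = (x, y)" by (cases p)
  have in3: "in2 x y \<or> in3 x y \<or> in4 x y" using assms(2) p Rm_iff by blast
  have *: "p + rot d \<in> Rm \<and> rfl (p + rot d) d = d \<and> p + rot d + d \<in> Rm \<and> rfl (p + rot d + d) d = - rot d \<and>
    p + d \<in> Rm \<and> rfl (p + d) (- rot d) = - rot d"
    using in3
  proof (elim disjE)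
    assume i: "in2 x y"
    have k: "d = (1, 0)" "x + y = Lx + 1"
      using assms(1,4,5) i unfolding p by (auto simp: dirs_def opn_def)
    have "1 \<le> y - 1" using assms(3) unfolding p k by (simp add: R_iff)
    then have j: "in2 x (y - 1)" "in2 (x + 1) (y - 1)" "in2 (x + 1) y"
      using i k(2) unfolding in2_def by linarith+
    show ?thesis using j in_disjoint(1,3)[OF j(1)] in_disjoint(1,3)[OF j(2)] in_disjoint(1,3)[OF j(3)] k(2)
      unfolding p k(1) by (simp add: refl_eq Rm_iff)
  next
    assume i: "in3 x y"
    have n: "\<not> in2 x y" "\<not> in4 x y" using i in_disjoint by blast+
    have k: "d = (0, 1)" "x - y = Lx - Ly"
      using assms(1,4,5) i n unfolding p by (auto simp: dirs_def opn_def)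
    have "x + 1 \<le> Lx" using assms(3) unfolding p k by (simp add: R_iff)
    then have j: "in3 (x + 1) y" "in3 (x + 1) (y + 1)" "in3 x (y + 1)"
      using i k(2) unfolding in3_def by linarith+
    then have "\<not> in2 (x + 1) y" "\<not> in4 (x + 1) y" "\<not> in2 (x + 1) (y + 1)" "\<not> in4 (x + 1) (y + 1)"
      "\<not> in2 x (y + 1)" "\<not> in4 x (y + 1)" using in_disjoint by blast+
    then show ?thesis using j k(2) unfolding p k(1) by (simp add: refl_eq Rm_iff)
  next
    assume i: "in4 x y"
    have n: "\<not> in2 x y" "\<not> in3 x y" using i in_disjoint by blast+
    have k: "d = (-1, 0)" "x + y = Ly + 1"
      using assms(1,4,5) i n unfolding p by (auto simp: dirs_def opn_def)
    have "y + 1 \<le> Ly" using assms(3) unfolding p k by (simp add: R_iff)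
    then have j: "in4 x (y + 1)" "in4 (x - 1) (y + 1)" "in4 (x - 1) y"
      using i k(2) unfolding in4_def by linarith+
    then have "\<not> in2 x (y + 1)" "\<not> in3 x (y + 1)" "\<not> in2 (x - 1) (y + 1)" "\<not> in3 (x - 1) (y + 1)"
      "\<not> in2 (x - 1) y" "\<not> in3 (x - 1) y" using in_disjoint by blast+
    then show ?thesis using j k(2) unfolding p k(1) by (simp add: refl_eq Rm_iff)
  qed
  then show "p + rot d \<in> Rm" "rfl (p + rot d) d = d" "p + rot d + d \<in> Rm" "rfl (p + rot d + d) d = - rot d"
    "p + d \<in> Rm" "rfl (p + d) (- rot d) = - rot d" by auto
qed

text \<open>Mirror image: in a right turn the left-hand neighbour runs on the outside.\<close>

lemma bend_right:
  assumes "d \<in> dirs" "p \<in> Rm" "p - rot d \<in> R" "opn p (- d)" "opn p (rot d)" "opn (p - rot d) (- d)"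
  shows "p - rot d \<in> Rm" "rfl (p - rot d) d = d" "p - rot d + d \<in> Rm" "rfl (p - rot d + d) d = rot d"
    "p + d \<in> Rm" "rfl (p + d) (rot d) = rot d"
proof -
  obtain x y where p: "p = (x, y)" by (cases p)
  have in3: "in2 x y \<or> in3 x y \<or> in4 x y" using assms(2) p Rm_iff by blast
  have *: "p - rot d \<in> Rm \<and> rfl (p - rot d) d = d \<and> p - rot d + d \<in> Rm \<and> rfl (p - rot d + d) d = rot d \<and>
    p + d \<in> Rm \<and> rfl (p + d) (rot d) = rot d"
    using in3
  proof (elim disjE)
    assume i: "in2 x y"
    have k: "d = (0, -1)" "x + y = Lx + 1"
      using assms(1,4,5) i unfolding p by (auto simp: dirs_def opn_def)
    have "x + 1 \<le> Lx" using assms(3) unfolding p k by (simp add: R_iff)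
    then have j: "in2 (x + 1) y" "in2 (x + 1) (y - 1)" "in2 x (y - 1)"
      using i k(2) unfolding in2_def by linarith+
    show ?thesis using j in_disjoint(1,3)[OF j(1)] in_disjoint(1,3)[OF j(2)] in_disjoint(1,3)[OF j(3)] k(2)
      unfolding p k(1) by (simp add: refl_eq Rm_iff)
  next
    assume i: "in3 x y"
    have n: "\<not> in2 x y" "\<not> in4 x y" using i in_disjoint by blast+
    have k: "d = (1, 0)" "x - y = Lx - Ly"
      using assms(1,4,5) i n unfolding p by (auto simp: dirs_def opn_def)
    have "y + 1 \<le> Ly" using assms(3) unfolding p k by (simp add: R_iff)
    then have j: "in3 x (y + 1)" "in3 (x + 1) (y + 1)" "in3 (x + 1) y"
      using i k(2) unfolding in3_def by linarith+
    then have "\<not> in2 (x + 1) y" "\<not> in4 (x + 1) y" "\<not> in2 (x + 1) (y + 1)" "\<not> in4 (x + 1) (y + 1)"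
      "\<not> in2 x (y + 1)" "\<not> in4 x (y + 1)" using in_disjoint by blast+
    then show ?thesis using j k(2) unfolding p k(1) by (simp add: refl_eq Rm_iff)
  next
    assume i: "in4 x y"
    have n: "\<not> in2 x y" "\<not> in3 x y" using i in_disjoint by blast+
    have k: "d = (0, 1)" "x + y = Ly + 1"
      using assms(1,4,5) i n unfolding p by (auto simp: dirs_def opn_def)
    have "1 \<le> x - 1" using assms(3) unfolding p k by (simp add: R_iff)
    then have j: "in4 (x - 1) y" "in4 (x - 1) (y + 1)" "in4 x (y + 1)"
      using i k(2) unfolding in4_def by linarith+
    then have "\<not> in2 x (y + 1)" "\<not> in3 x (y + 1)" "\<not> in2 (x - 1) (y + 1)" "\<not> in3 (x - 1) (y + 1)"
      "\<not> in2 (x - 1) y" "\<not> in3 (x - 1) y" using in_disjoint by blast+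
    then show ?thesis using j k(2) unfolding p k(1) by (simp add: refl_eq Rm_iff)
  qed
  then show "p - rot d \<in> Rm" "rfl (p - rot d) d = d" "p - rot d + d \<in> Rm" "rfl (p - rot d + d) d = rot d"
    "p + d \<in> Rm" "rfl (p + d) (rot d) = rot d" by auto
qed

text \<open>The turning cell lies on the diagonal, and the outside of the turn faces the corner of
  the rectangle; if the rectangle ends there, the cell is that corner.\<close>

lemma bend_corner:
  assumes "d \<in> dirs" "p \<in> Rm" "opn p (- d)" "opn p (- rot d)" "p + rot d \<notin> R"
  shows "p + d \<notin> R"
proof -
  obtain x y where p: "p = (x, y)" by (cases p)
  have in3: "in2 x y \<or> in3 x y \<or> in4 x y" using assms(2) p Rm_iff by blast
  show ?thesis using in3
  proof (elim disjE)
    assume i: "in2 x y"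
    have k: "d = (1, 0)" "x + y = Lx + 1"
      using assms(1,3,4) i unfolding p by (auto simp: dirs_def opn_def)
    then show ?thesis using assms(5) i in_R(1)[OF i] unfolding p by (auto simp: R_iff)
  next
    assume i: "in3 x y"
    have n: "\<not> in2 x y" "\<not> in4 x y" using i in_disjoint by blast+
    have k: "d = (0, 1)" "x - y = Lx - Ly"
      using assms(1,3,4) i n unfolding p by (auto simp: dirs_def opn_def)
    then show ?thesis using assms(5) i in_R(2)[OF i] unfolding p by (auto simp: R_iff)
  next
    assume i: "in4 x y"
    have n: "\<not> in2 x y" "\<not> in3 x y" using i in_disjoint by blast+
    have k: "d = (-1, 0)" "x + y = Ly + 1"
      using assms(1,3,4) i n unfolding p by (auto simp: dirs_def opn_def)
    then show ?thesis using assms(5) i in_R(3)[OF i] unfolding p by (auto simp: R_iff)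
  qed
qed

lemma R_parallel:
  assumes "d \<in> dirs" "p \<in> R" "p + rot d \<in> R" shows "p + d \<in> R \<longleftrightarrow> p + rot d + d \<in> R"
proof -
  obtain x y where p: "p = (x, y)" by (cases p)
  from assms(1) show ?thesis using assms(2,3) unfolding p by (cases rule: dirs_cases) (auto simp: R_iff)
qed

lemma sq_product:
  assumes "d \<in> dirs" "sq i (p + d)" "sq i (p + rot d)" shows "sq i p"
proof -
  obtain x y where p: "p = (x, y)" by (cases p)
  from assms(1) show ?thesis using assms(2,3) unfolding p
    by (cases rule: dirs_cases) (auto simp: sq_def in2_def in3_def in4_def split: if_splits)
qed

section \<open>Strands\<close>

abbreviation "mt \<equiv> first_mate Lx Ly a"

definition T :: "(int \<times> int) \<times> (int \<times> int) \<Rightarrow> (int \<times> int) \<times> (int \<times> int)" where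
  "T s = (fst s + rfl (fst s) (snd s), rfl (fst s) (snd s))"

lemma T_simp [simp]: "T (p, d) = (p + rfl p d, rfl p d)"
  by (simp add: T_def)

lemma strand_unfold: "strand Lx Ly a (p, d) = (if p \<in> Rm then strand Lx Ly a (T (p, d)) else (p, d))"
  unfolding strand_def by (subst while_unfold) (simp add: Let_def)

text \<open>The edge starting with \<open>h\<close> enters the cell \<open>p\<close> in direction \<open>d\<close>.\<close>

inductive lies :: "half \<Rightarrow> (int \<times> int) \<times> (int \<times> int) \<Rightarrow> bool" where
  start: "q \<notin> Rm \<Longrightarrow> d \<in> dirs \<Longrightarrow> lies (Half q d) (q + d, d)"
| step: "lies h (p, d) \<Longrightarrow> p \<in> Rm \<Longrightarrow> lies h (p + rfl p d, rfl p d)"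

lemma lies_dirs: "lies h s \<Longrightarrow> snd s \<in> dirs"
  by (induction rule: lies.induct) (auto simp: refl_dirs)

lemma lies_strand: "lies h s \<Longrightarrow> mt h = (let (q, e) = strand Lx Ly a s in Half q (- e))"
proof (induction rule: lies.induct)
  case (step h p d)
  have "strand Lx Ly a (p, d) = strand Lx Ly a (p + rfl p d, rfl p d)"
    using strand_unfold[of p d] step(2) by (metis T_simp)
  then show ?case using step.IH by metis
qed simp

lemma lies_mate: "lies h (p, d) \<Longrightarrow> p \<notin> Rm \<Longrightarrow> mt h = Half p (- d)"
proof -
  assume "lies h (p, d)" "p \<notin> Rm"
  moreover from this have "strand Lx Ly a (p, d) = (p, d)" using strand_unfold[of p d] by metis
  ultimately show ?thesis using lies_strand[of h "(p, d)"] by simp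
qed

lemma refl_inj: "rfl p d = rfl p d' \<Longrightarrow> d = d'"
  by (metis refl_back minus_equation_iff)

lemma lies_inv:
  "lies h (p, d) \<Longrightarrow> h = Half (p - d) d \<and> p - d \<notin> Rm \<or>
     (\<exists>d0. lies h (p - d, d0) \<and> p - d \<in> Rm \<and> rfl (p - d) d0 = d)"
  by (erule lies.cases) auto

text \<open>Reflections are reversible, so strands cannot merge: a segment determines the half-edge
  it came from.\<close>

lemma lies_det: "lies h s \<Longrightarrow> lies h' s \<Longrightarrow> h = h'"
proof (induction arbitrary: h' rule: lies.induct)
  case (start q d)
  then show ?case using lies_inv[OF start(3)] by simp
next
  case (step h p d)
  then obtain d0 where "lies h' (p, d0)" "rfl p d0 = rfl p d" using lies_inv[OF step(4)] by auto
  then show ?case using step.IH refl_inj by metis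
qed

lemma T_inj: "T s = T s' \<Longrightarrow> s = s'"
  by (cases s; cases s') (auto dest: refl_inj)

lemma finite_Rm: "finite Rm"
proof (rule finite_subset)
  show "Rm \<subseteq> R" using Rm_R by blast
  show "finite R" by (simp add: rectangle_def)
qed

text \<open>There are finitely many states and \<open>T\<close> is injective, so a strand that never
  left would return to its initial state; but the cell before that state is not removed.\<close>

lemma T_exit:
  assumes "q \<notin> Rm" "d \<in> dirs"
  shows "\<exists>n. fst ((T ^^ n) (q + d, d)) \<notin> Rm"
proof (rule ccontr)
  let ?s = "\<lambda>n. (T ^^ n) (q + d, d)"
  assume "\<nexists>n. fst (?s n) \<notin> Rm"
  then have rm: "fst (?s n) \<in> Rm" for n by blast
  have dr: "snd (?s n) \<in> dirs" for n
    by (induction n) (use assms refl_dirs in \<open>auto simp: T_def\<close>)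
  have "range ?s \<subseteq> Rm \<times> dirs" by (rule image_subsetI) (simp add: mem_Times_iff rm dr)
  moreover have "finite (Rm \<times> dirs)" using finite_Rm by (simp add: dirs_def)
  ultimately have "finite (range ?s)" by (rule finite_subset)
  then have "\<not> inj ?s" using finite_imageD by auto
  then obtain i j where ij: "i < j" "?s i = ?s j" unfolding inj_def by (metis nat_neq_iff)
  have "\<exists>k. ?s (Suc k) = ?s 0" using ij
  proof (induction i arbitrary: j)
    case 0
    then obtain k where "j = Suc k" by (cases j) auto
    then show ?case using 0 by metis
  next
    case (Suc i)
    then obtain j' where "j = Suc j'" "i < j'" by (cases j) auto
    then show ?case using Suc T_inj[of "?s i" "?s j'"] by simp
  qed
  then obtain k where "T (?s k) = (q + d, d)" by auto
  then have "fst (?s k) = q" unfolding T_def by auto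
  then show False using rm[of k] assms by simp
qed

lemma lies_exit: "lies h s \<Longrightarrow> \<exists>n. fst ((T ^^ n) s) \<notin> Rm"
proof (induction rule: lies.induct)
  case (start q d) then show ?case by (rule T_exit)
next
  case (step h p d)
  then obtain n where n: "fst ((T ^^ n) (p, d)) \<notin> Rm" by blast
  then obtain k where "n = Suc k" using step by (cases n) auto
  then have "(T ^^ n) (p, d) = (T ^^ k) (p + rfl p d, rfl p d)" by (simp add: funpow_swap1)
  then show ?case using n by metis
qed

text \<open>Induction from the far end of the strand back to its start, whereas the rules of
  \<open>lies\<close> run forwards.\<close>

lemma lies_induct [consumes 1, case_names exit pass]:
  assumes "lies h s"
    and ex: "\<And>p d. lies h (p, d) \<Longrightarrow> p \<notin> Rm \<Longrightarrow> P (p, d)"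
    and pa: "\<And>p d. lies h (p, d) \<Longrightarrow> p \<in> Rm \<Longrightarrow> lies h (p + rfl p d, rfl p d) \<Longrightarrow>
      P (p + rfl p d, rfl p d) \<Longrightarrow> P (p, d)"
  shows "P s"
proof -
  obtain n where "fst ((T ^^ n) s) \<notin> Rm" using lies_exit[OF assms(1)] by blast
  then show ?thesis using assms(1)
  proof (induction n arbitrary: s)
    case 0 then show ?case using ex by (cases s) auto
  next
    case (Suc n)
    obtain p d where s: "s = (p, d)" by (cases s)
    show ?case
    proof (cases "p \<in> Rm")
      case True
      have "lies h (p + rfl p d, rfl p d)" using lies.step Suc s True by blast
      moreover have "P (p + rfl p d, rfl p d)"
        by (rule Suc.IH) (use Suc.prems s calculation in \<open>auto simp: funpow_swap1\<close>)
      ultimately show ?thesis using pa Suc.prems s True by blast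
    next
      case False then show ?thesis using ex Suc.prems s by blast
    qed
  qed
qed

lemma lies_end: assumes "lies h s" obtains p d where "lies h (p, d)" "p \<notin> Rm" "d \<in> dirs" "mt h = Half p (- d)"
proof -
  have "\<exists>p d. lies h (p, d) \<and> p \<notin> Rm" using assms by (induction rule: lies_induct) blast+
  then show thesis using that lies_mate lies_dirs by (metis snd_conv)
qed

lemma lies_mate_rev: assumes "lies h (p, d)" shows "lies (mt h) (p - d, - d)"
proof -
  from assms have "lies (mt h) (fst (p, d) - snd (p, d), - snd (p, d))"
  proof (induction rule: lies_induct)
    case (exit p d)
    have "lies (Half p (- d)) (p + - d, - d)"
      using exit(2) lies_dirs[OF exit(1)] dirs_rot(2) by (intro lies.start) simp_all
    then show ?case unfolding lies_mate[OF exit] by simp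
  next
    case (pass p d)
    have "lies (mt h) (p, - rfl p d)" using pass(4) by simp
    from lies.step[OF this pass(2)] show ?case unfolding refl_back by simp
  qed
  then show ?thesis by simp
qed

lemma mate_half:
  assumes "q \<notin> Rm" "d \<in> dirs"
  obtains p e where "lies (Half q d) (p, e)" "p \<notin> Rm" "e \<in> dirs" "mt (Half q d) = Half p (- e)"
    "mt (Half p (- e)) = Half q d" "lies (Half p (- e)) (q, - d)"
proof -
  have st: "lies (Half q d) (q + d, d)" using assms by (rule lies.start)
  obtain p e where pe: "lies (Half q d) (p, e)" "p \<notin> Rm" "e \<in> dirs" "mt (Half q d) = Half p (- e)"
    by (rule lies_end[OF st])
  have "lies (Half p (- e)) (q, - d)" using lies_mate_rev[OF st] pe(4) by simp
  moreover from lies_mate[OF this assms(1)] have "mt (Half p (- e)) = Half q d" by simp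
  ultimately show thesis using that[OF pe] by blast
qed

lemma lies_before: "lies h (p, d) \<Longrightarrow> h = Half (p - d) d \<and> p - d \<notin> Rm \<or> p - d \<in> Rm"
  by (erule lies.cases) auto

text \<open>Asked only at the cell entered at the start; the pairing of the two live directions in
  each removed cell carries it along the whole strand.\<close>

definition live :: "half \<Rightarrow> bool" where
  "live h \<longleftrightarrow> (\<exists>q d. h = Half q d \<and> q \<notin> Rm \<and> d \<in> dirs \<and> opn (q + d) (- d))"

lemma lies_live: "lies h s \<Longrightarrow> live h \<Longrightarrow> opn (fst s) (- snd s) \<and> opn (fst s - snd s) (snd s)"
proof (induction rule: lies.induct)
  case (start q d)
  then show ?case using opn_nonrem unfolding live_def by auto
next
  case (step h p d)
  have o: "opn p (- d)" "d \<in> dirs" using step.IH[OF step(4)] lies_dirs[OF step(1)] by simp_all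
  have r: "rfl p d \<in> dirs" "opn p (rfl p d)" using refl_dirs o opn_refl(1)[OF step(2) o(2,1)] by auto
  have "opn (p + rfl p d) (- rfl p d)"
  proof (cases "p + rfl p d \<in> R")
    case True then show ?thesis using opn_sym[OF r(1) Rm_R[OF step(2)]] r(2) by blast
  next
    case False then show ?thesis using Rm_R opn_nonrem by blast
  qed
  then show ?case using r by simp
qed

lemma grid_live: assumes "q \<in> Gd" "d \<in> dirs" shows "live (Half q d)"
proof -
  have q: "q \<in> R" "q \<notin> Rm" using assms Gd_iff by auto
  have "opn (q + d) (- d)"
  proof (cases "q + d \<in> R")
    case True then show ?thesis using opn_sym[OF assms(2) q(1) True] opn_nonrem[OF q(2)] by blast
  next
    case False then show ?thesis using Rm_R opn_nonrem by blast
  qed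
  then show ?thesis using q assms unfolding live_def by blast
qed

lemma grid_halves_iff: "Half q d \<in> grid_halves Lx Ly a \<longleftrightarrow> q \<in> Gd \<and> d \<in> dirs"
  by (cases q) (auto simp: grid_halves_def dirs_def)

section \<open>Parity\<close>

text \<open>Chessboard colour of the lattice cell on the right. A half-edge at a subdividing vertex
  gets the colour opposite to that of the half it faces.\<close>

fun hpar :: "half \<Rightarrow> bool" where
  "hpar (Half (x, y) (u, v)) = even (x + y + u)"
| "hpar (Mid (x, y) (u, v)) = odd (x + y + u)"

text \<open>The parity of a strand inside the square at corner \<open>i\<close>; it depends only on the row (column) of a
  horizontal (vertical) segment.\<close>

definition sqpar :: "nat \<Rightarrow> int \<times> int \<Rightarrow> int \<times> int \<Rightarrow> bool" where
  "sqpar i p d = (let (x, y) = p; (u, v) = d in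
     even (if i = 2 then (if u = 1 then Lx - a 2 + y else if u = -1 then Lx - a 2 + y + 1
         else if v = 1 then x + a 2 + 1 else x + a 2)
       else if i = 3 then (if u = 1 then Lx - a 3 + y else if u = -1 then Lx - a 3 + y + 1
         else if v = 1 then x + Ly - a 3 + 1 else x + Ly - a 3)
       else (if u = 1 then a 4 + y else if u = -1 then a 4 + y + 1
         else if v = 1 then x + Ly - a 4 + 1 else x + Ly - a 4)))"

text \<open>The value of \<open>hpar\<close> at the half-edge at \<open>p\<close> that points back
  along the strand.\<close>

definition outpar :: "int \<times> int \<Rightarrow> int \<times> int \<Rightarrow> bool" where
  "outpar p d = even (fst p + snd p + fst d)"

text \<open>Constant along a live strand, even one that passes through touching squares: after the
  first step it is the opposite of \<open>hpar\<close> at the start, at the end it is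
  \<open>hpar\<close> of the mate.\<close>

definition strand_parity :: "(int \<times> int) \<times> (int \<times> int) \<Rightarrow> bool" where
  "strand_parity s = (if sq 2 (fst s) then sqpar 2 (fst s) (snd s) else if sq 3 (fst s) then sqpar 3 (fst s) (snd s)
     else if sq 4 (fst s) then sqpar 4 (fst s) (snd s) else outpar (fst s) (snd s))"

lemma sq_fst_snd:
  "sq 2 p = in2 (fst p) (snd p)" "sq 3 p = in3 (fst p) (snd p)" "sq 4 p = in4 (fst p) (snd p)"
  by (cases p; simp add: sq_def)+

lemma sq_disjoint: "sq 3 p \<Longrightarrow> \<not> sq 2 p" "sq 4 p \<Longrightarrow> \<not> sq 2 p" "sq 4 p \<Longrightarrow> \<not> sq 3 p"
  unfolding sq_fst_snd using in_disjoint by metis+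

lemma nu_sq: assumes "sq i p" "i \<in> {2, 3, 4}" shows "strand_parity (p, d) = sqpar i p d"
proof -
  consider "i = 2" | "i = 3" | "i = 4" using assms(2) by blast
  then show ?thesis
  proof cases
    case 1 then show ?thesis using assms(1) by (simp add: strand_parity_def)
  next
    case 2 then show ?thesis using assms(1) sq_disjoint(1) by (simp add: strand_parity_def)
  next
    case 3 then show ?thesis using assms(1) sq_disjoint(2,3) by (simp add: strand_parity_def)
  qed
qed

lemma nu_out: assumes "p \<notin> Rm" shows "strand_parity (p, d) = outpar p d"
proof -
  have "\<not> sq 2 p" "\<not> sq 3 p" "\<not> sq 4 p" using assms sq_Rm by blast+
  then show ?thesis unfolding strand_parity_def by simp
qed

lemma sqpar_straight: assumes "d \<in> dirs" shows "sqpar i (p + d) d = sqpar i p d"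
proof -
  obtain x y where p: "p = (x, y)" by (cases p)
  from assms show ?thesis unfolding p by (cases rule: dirs_cases) (simp_all add: sqpar_def)
qed

text \<open>A turn trades a row for a column, and on the diagonal each determines the other.\<close>

lemma sqpar_refl:
  assumes d: "d \<in> dirs" and i: "i \<in> {2, 3, 4}" "sq i p" and o: "opn p (- d)"
  shows "sqpar i p (rfl p d) = sqpar i p d"
proof -
  obtain x y where p: "p = (x, y)" by (cases p)
  consider "i = 2" "in2 x y" | "i = 3" "in3 x y" | "i = 4" "in4 x y"
    using i unfolding p by (auto simp: sq_def)
  then show ?thesis
  proof cases
    case 1
    note n = in_disjoint(1,3)[OF 1(2)]
    show ?thesis
    proof (cases "Lx - x = y - 1")
      case True
      then have y: "y = Lx - x + 1" by simp
      from d show ?thesis using 1 n o unfolding p y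
        by (cases rule: dirs_cases; simp add: refl_eq opn_def sqpar_def; presburger)
    next
      case False
      then show ?thesis using 1 n unfolding p by (cases d) (simp add: refl_eq)
    qed
  next
    case 2
    have n: "\<not> in2 x y" "\<not> in4 x y" using 2 in_disjoint by blast+
    show ?thesis
    proof (cases "Lx - x = Ly - y")
      case True
      then have y: "y = Ly - Lx + x" by simp
      from d show ?thesis using 2 n o unfolding p y
        by (cases rule: dirs_cases; simp add: refl_eq opn_def sqpar_def; presburger)
    next
      case False
      then show ?thesis using 2 n unfolding p by (cases d) (simp add: refl_eq)
    qed
  next
    case 3
    have n: "\<not> in2 x y" "\<not> in3 x y" using 3 in_disjoint by blast+
    show ?thesis
    proof (cases "x - 1 = Ly - y")
      case True
      then have y: "y = Ly - x + 1" by simp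
      from d show ?thesis using 3 n o unfolding p y
        by (cases rule: dirs_cases; simp add: refl_eq opn_def sqpar_def; presburger)
    next
      case False
      then show ?thesis using 3 n unfolding p by (cases d) (simp add: refl_eq)
    qed
  qed
qed

text \<open>A live edge leaves the square only through its two inner sides, each of which fixes one
  coordinate. The constants in \<open>sqpar\<close> come from these coordinates, chosen so that the
  parities inside and outside agree on the crossing edge.\<close>

lemma sqpar_cross:
  assumes d: "d \<in> dirs" and i: "i \<in> {2, 3, 4}" "sq i p" "\<not> sq i (p + d)" and o: "opn p d"
  shows "sqpar i p d = outpar (p + d) d" "sqpar i p (- d) = outpar p (- d)"
proof -
  obtain x y where p: "p = (x, y)" by (cases p)
  consider "i = 2" "in2 x y" "\<not> in2 (x + fst d) (y + snd d)"
    | "i = 3" "in3 x y" "\<not> in2 x y" "\<not> in3 (x + fst d) (y + snd d)"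
    | "i = 4" "in4 x y" "\<not> in2 x y" "\<not> in3 x y" "\<not> in4 (x + fst d) (y + snd d)"
  proof -
    have "i = 2 \<and> in2 x y \<and> \<not> in2 (x + fst d) (y + snd d) \<or> i = 3 \<and> in3 x y \<and> \<not> in3 (x + fst d) (y + snd d) \<or>
        i = 4 \<and> in4 x y \<and> \<not> in4 (x + fst d) (y + snd d)"
      using i unfolding p by (auto simp: sq_fst_snd)
    then show ?thesis using that in_disjoint by metis
  qed
  then have "sqpar i p d = outpar (p + d) d \<and> sqpar i p (- d) = outpar p (- d)"
  proof cases
    case 1
    from d have "d = (-1, 0) \<and> x = Lx - a 2 + 1 \<or> d = (0, 1) \<and> y = a 2"
      using 1 o unfolding p by (cases rule: dirs_cases; simp add: opn_def; simp add: in2_def)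
    then show ?thesis using 1(1) unfolding p
      by (elim disjE conjE; hypsubst; simp add: sqpar_def outpar_def; presburger?)
  next
    case 2
    from d have "d = (-1, 0) \<and> x = Lx - a 3 + 1 \<or> d = (0, -1) \<and> y = Ly - a 3 + 1"
      using 2 o unfolding p by (cases rule: dirs_cases; simp add: opn_def; simp add: in3_def)
    then show ?thesis using 2(1) unfolding p
      by (elim disjE conjE; hypsubst; simp add: sqpar_def outpar_def; presburger?)
  next
    case 3
    from d have "d = (1, 0) \<and> x = a 4 \<or> d = (0, -1) \<and> y = Ly - a 4 + 1"
      using 3 o unfolding p by (cases rule: dirs_cases; simp add: opn_def; simp add: in4_def)
    then show ?thesis using 3(1) unfolding p
      by (elim disjE conjE; hypsubst; simp add: sqpar_def outpar_def; presburger?)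
  qed
  then show "sqpar i p d = outpar (p + d) d" "sqpar i p (- d) = outpar p (- d)" by auto
qed

lemma nu_entry:
  assumes d: "d \<in> dirs" and o: "opn p (- d)" and n: "\<And>i. i \<in> {2, 3, 4} \<Longrightarrow> sq i p \<Longrightarrow> \<not> sq i (p - d)"
  shows "strand_parity (p, d) = outpar p d"
proof (cases "p \<in> Rm")
  case True
  then obtain i where i: "i \<in> {2, 3, 4}" "sq i p" by (rule Rm_sq)
  then show ?thesis using nu_sq[OF i(2,1)] sqpar_cross(2)[OF dirs_rot(2)[OF d] i _ o] n by simp
next
  case False then show ?thesis by (rule nu_out)
qed

lemma nu_step:
  assumes d: "d \<in> dirs" and p: "p \<in> Rm" and o: "opn p (- d)"
  shows "strand_parity (p + rfl p d, rfl p d) = strand_parity (p, d)"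
proof -
  let ?e = "rfl p d"
  obtain i where i: "i \<in> {2, 3, 4}" "sq i p" using p by (rule Rm_sq)
  have e: "?e \<in> dirs" "opn p ?e" using refl_dirs[OF d] opn_refl(1)[OF p d o] .
  have oe: "opn (p + ?e) (- ?e)"
  proof (cases "p + ?e \<in> R")
    case True then show ?thesis using opn_sym[OF e(1) Rm_R[OF p]] e(2) by blast
  next
    case False then show ?thesis using Rm_R opn_nonrem by blast
  qed
  have "strand_parity (p, d) = sqpar i p ?e" using nu_sq[OF i(2,1)] sqpar_refl[OF d i o] by simp
  moreover have "strand_parity (p + ?e, ?e) = sqpar i p ?e"
  proof (cases "sq i (p + ?e)")
    case True then show ?thesis using nu_sq[OF True i(1)] sqpar_straight[OF e(1)] by simp
  next
    case False
    have "\<not> sq j (p + ?e - ?e)" if "j \<in> {2, 3, 4}" "sq j (p + ?e)" for j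
      using that False i sq_disjoint[of p] by auto
    then have "strand_parity (p + ?e, ?e) = outpar (p + ?e) ?e" by (rule nu_entry[OF e(1) oe])
    then show ?thesis using sqpar_cross(1)[OF e(1) i False e(2)] by simp
  qed
  ultimately show ?thesis by simp
qed

lemma hpar_mate:
  assumes "q \<notin> Rm" "d \<in> dirs" "live (Half q d)"
  shows "hpar (mt (Half q d)) \<longleftrightarrow> \<not> hpar (Half q d)"
proof -
  have "lies h s \<Longrightarrow> live h \<Longrightarrow> strand_parity s \<longleftrightarrow> \<not> hpar h" for h s
  proof (induction rule: lies.induct)
    case (start q d)
    have o: "opn (q + d) (- d)" using start unfolding live_def by auto
    have "strand_parity (q + d, d) = outpar (q + d) d"
      by (rule nu_entry[OF start(2) o]) (use sq_Rm[of _ q] start(1) in \<open>simp, blast\<close>)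
    then show ?case using start(2) by (cases q) (auto simp: dirs_def outpar_def)
  next
    case (step h p d)
    have "d \<in> dirs" "opn p (- d)" using lies_dirs[OF step(1)] lies_live[OF step(1,4)] by auto
    then show ?case using nu_step[OF _ step(2)] step by simp
  qed
  note strand_parity = this
  obtain p e where pe: "lies (Half q d) (p, e)" "p \<notin> Rm" "e \<in> dirs" "mt (Half q d) = Half p (- e)"
    by (rule mate_half[OF assms(1,2)])
  have "strand_parity (p, e) = hpar (Half p (- e))"
    using nu_out[OF pe(2)] pe(3) by (cases p) (auto simp: outpar_def dirs_def)
  then show ?thesis using strand_parity[OF pe(1) assms(3)] pe(4) by simp
qed

end

lemma filter_next:
  assumes "k < k'" "k' < length xs" "P (xs ! k)" "P (xs ! k')" "\<And>i. k < i \<Longrightarrow> i < k' \<Longrightarrow> \<not> P (xs ! i)"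
  shows "\<exists>j. Suc j < length (filter P xs) \<and> filter P xs ! j = xs ! k \<and> filter P xs ! Suc j = xs ! k'"
proof -
  let ?A = "take k xs" and ?B = "drop (Suc k) (take k' xs)" and ?C = "drop (Suc k') xs"
  have "take k' xs = take k (take k' xs) @ take k' xs ! k # ?B" using assms by (intro id_take_nth_drop) auto
  also have "take k (take k' xs) = ?A" using assms by (simp add: min_def)
  finally have t: "take k' xs = ?A @ xs ! k # ?B" using assms by simp
  have "filter P xs = filter P (take k' xs @ xs ! k' # ?C)"
    by (rule arg_cong[OF id_take_nth_drop[OF assms(2)]])
  also have "\<dots> = filter P (take k' xs) @ filter P (xs ! k' # ?C)" by (rule filter_append)
  finally have f: "filter P xs = filter P (take k' xs) @ filter P (xs ! k' # ?C)" .
  have B: "filter P ?B = []"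
    using assms by (auto simp: filter_empty_conv in_set_conv_nth)
  have "filter P (take k' xs) = filter P (?A @ xs ! k # ?B)" by (rule arg_cong[OF t])
  also have "\<dots> = filter P ?A @ [xs ! k]" unfolding filter_append filter.simps B using assms(3) by simp
  finally have "filter P xs = filter P ?A @ xs ! k # xs ! k' # filter P ?C" using f assms(4) by simp
  then show ?thesis by (intro exI[of _ "length (filter P ?A)"]) (simp add: nth_append)
qed

context dihedral begin

section \<open>External edges\<close>

abbreviation "rp \<equiv> rectangle_pendants Lx Ly"

definition keep :: "half \<Rightarrow> bool" where
  "keep h \<longleftrightarrow> mt h \<in> grid_halves Lx Ly a"

lemma pendants_eq: "pendants Lx Ly a = filter keep rp"
  unfolding pendants_def keep_def ..

lemma set_rp: "Half q d \<in> set rp \<longleftrightarrow> q \<notin> R \<and> q + d \<in> R \<and> d \<in> dirs"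
proof -
  obtain x y u v where q: "q = (x, y)" "d = (u, v)" by (cases q; cases d)
  have "Half (x, y) (u, v) \<in> set rp \<longleftrightarrow>
      (1 \<le> x \<and> x \<le> Lx \<and> y = 0 \<and> u = 0 \<and> v = 1) \<or> (x = Lx + 1 \<and> 1 \<le> y \<and> y \<le> Ly \<and> u = -1 \<and> v = 0) \<or>
      (1 \<le> x \<and> x \<le> Lx \<and> y = Ly + 1 \<and> u = 0 \<and> v = -1) \<or> (x = 0 \<and> 1 \<le> y \<and> y \<le> Ly \<and> u = 1 \<and> v = 0)"
    unfolding rectangle_pendants_def
    by (simp only: set_append set_map set_rev set_upto Un_iff image_iff half.inject prod.inject Bex_def
        atLeastAtMost_iff) auto
  also have "\<dots> \<longleftrightarrow> (x, y) \<notin> R \<and> (x + u, y + v) \<in> R \<and> (u, v) \<in> dirs" (is "?A \<longleftrightarrow> ?B")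
  proof
    assume ?A then show ?B using bounds_a(1,2) unfolding R_iff dirs_def by (elim disjE conjE) simp_all
  next
    assume B: ?B
    then have "(u, v) \<in> dirs" by blast
    then show ?A
      by (cases rule: dirs_cases; use B in \<open>simp add: R_iff; linarith\<close>)
  qed
  finally show ?thesis unfolding q by simp
qed

lemma set_rp_half: "h \<in> set rp \<Longrightarrow> \<exists>q d. h = Half q d"
  by (auto simp: rectangle_pendants_def)

lemma length_rp: "length rp = nat (2 * Lx + 2 * Ly)"
  using bounds_a(1,2) by (simp add: rectangle_pendants_def)

lemma distinct_rp: "distinct rp"
proof -
  have inj: "inj_on (\<lambda>x. Half (x, k) d) A" "inj_on (\<lambda>y. Half (k, y) d) A" for k d A by (auto simp: inj_on_def)
  show ?thesis
    unfolding rectangle_pendants_def distinct_append distinct_map distinct_rev distinct_upto set_append set_map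
    by (intro conjI inj) (simp_all add: disjoint_iff image_iff, (intro allI impI, elim bexE, simp)+)
qed

text \<open>With the outside of the rectangle on the right of \<open>d\<close>, the position in
  \<open>rp\<close> of the pendant edge of \<open>p\<close> on that side. Following \<open>d\<close>
  along the border runs through the list in order.\<close>

definition border_index :: "int \<times> int \<Rightarrow> int \<times> int \<Rightarrow> int" where
  "border_index p d = (if d = (1, 0) then fst p - 1 else if d = (0, 1) then Lx + snd p - 1
     else if d = (-1, 0) then 2 * Lx + Ly - fst p else 2 * Lx + 2 * Ly - snd p)"

lemma rp_nth:
  assumes "p \<in> R" "d \<in> dirs" "p + rot d \<notin> R"
  shows "rp ! nat (border_index p d) = Half (p + rot d) (- rot d)" "0 \<le> border_index p d" "border_index p d < 2 * Lx + 2 * Ly"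
proof -
  obtain x y where p: "p = (x, y)" by (cases p)
  have r: "1 \<le> x" "x \<le> Lx" "1 \<le> y" "y \<le> Ly" using assms(1) unfolding p R_iff by auto
  have *: "rp ! nat (border_index p d) = Half (p + rot d) (- rot d) \<and> 0 \<le> border_index p d \<and> border_index p d < 2 * Lx + 2 * Ly"
    using assms(2)
  proof (cases rule: dirs_cases)
    case 1
    then have "x = 1" using assms(3) r unfolding p by (simp add: R_iff)
    have i: "nat (2 * Lx + 2 * Ly - y) = nat Lx + (nat Ly + (nat Lx + nat (Ly - y)))" using r by simp
    have "rp ! nat (2 * Lx + 2 * Ly - y) = Half (0, y) (1, 0)"
      unfolding rectangle_pendants_def i using r
      by (simp add: nth_append rev_nth del: One_nat_def)
    then show ?thesis using 1 r \<open>x = 1\<close> unfolding p border_index_def by simp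
  next
    case 2
    then have "y = 1" using assms(3) r unfolding p by (simp add: R_iff)
    have "rp ! nat (x - 1) = Half (x, 0) (0, 1)"
      unfolding rectangle_pendants_def using r by (simp add: nth_append)
    then show ?thesis using 2 r \<open>y = 1\<close> unfolding p border_index_def by simp
  next
    case 3
    then have "x = Lx" using assms(3) r unfolding p by (simp add: R_iff)
    have i: "nat (Lx + y - 1) = nat Lx + nat (y - 1)" using r by simp
    have "rp ! nat (Lx + y - 1) = Half (Lx + 1, y) (-1, 0)"
      unfolding rectangle_pendants_def i using r by (simp add: nth_append)
    then show ?thesis using 3 r \<open>x = Lx\<close> unfolding p border_index_def by simp
  next
    case 4
    then have "y = Ly" using assms(3) r unfolding p by (simp add: R_iff)
    have i: "nat (2 * Lx + Ly - x) = nat Lx + (nat Ly + nat (Lx - x))" using r by simp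
    have "rp ! nat (2 * Lx + Ly - x) = Half (x, Ly + 1) (0, -1)"
      unfolding rectangle_pendants_def i using r by (simp add: nth_append rev_nth)
    then show ?thesis using 4 r \<open>y = Ly\<close> unfolding p border_index_def by simp
  qed
  then show "rp ! nat (border_index p d) = Half (p + rot d) (- rot d)" "0 \<le> border_index p d" "border_index p d < 2 * Lx + 2 * Ly" by auto
qed

text \<open>The border is followed counter-clockwise and turns left at corners. The excluded
  direction is the arrival at the bottom-left corner, where the list wraps around.\<close>

lemma bi_step:
  assumes "p \<in> R" "d \<in> dirs" "p + rot d \<notin> R"
  shows "p + d \<in> R \<Longrightarrow> border_index (p + d) d = border_index p d + 1"
    "p + d \<notin> R \<Longrightarrow> d \<noteq> (0, -1) \<Longrightarrow> border_index p (- rot d) = border_index p d + 1"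
proof -
  obtain x y where p: "p = (x, y)" by (cases p)
  have r: "1 \<le> x" "x \<le> Lx" "1 \<le> y" "y \<le> Ly" using assms(1) unfolding p R_iff by auto
  from assms(2) show "p + d \<in> R \<Longrightarrow> border_index (p + d) d = border_index p d + 1"
    unfolding p by (cases rule: dirs_cases) (auto simp: border_index_def)
  from assms(2) show "p + d \<notin> R \<Longrightarrow> d \<noteq> (0, -1) \<Longrightarrow> border_index p (- rot d) = border_index p d + 1"
    using assms(3) r unfolding p by (cases rule: dirs_cases) (auto simp: border_index_def R_iff)
qed

lemma keep_opn: assumes "q \<notin> R" "d \<in> dirs" "keep (Half q d)" shows "opn (q + d) (- d)"
proof -
  have q: "q \<notin> Rm" using assms Rm_R by blast
  obtain p e where pe: "p \<notin> Rm" "e \<in> dirs" "mt (Half q d) = Half p (- e)" "lies (Half p (- e)) (q, - d)"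
    by (rule mate_half[OF q assms(2)])
  have "live (Half p (- e))" using assms(3) pe(3) grid_live unfolding keep_def by (metis grid_halves_iff)
  then show ?thesis using lies_live[OF pe(4)] by simp
qed

text \<open>Invariant of a strand that comes from outside the rectangle: it can only leave the squares into the
  grid.\<close>

definition inward :: "(int \<times> int) \<times> (int \<times> int) \<Rightarrow> bool" where
  "inward s \<longleftrightarrow> (let ((x, y), d) = s in
     in2 x y \<and> d \<in> {(-1, 0), (0, -1)} \<or> in4 x y \<and> d \<in> {(-1, 0), (0, -1)} \<or>
     in3 x y \<and> (a 3 = Lx \<and> d \<in> {(1, 0), (0, -1)} \<or> a 3 = Ly \<and> d \<in> {(0, 1), (-1, 0)}) \<or>
     (x, y) \<in> Gd)"

text \<open>The diagonals of squares 2 and 4 exchange west and south, so strands heading that way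
  never turn back. This settles the fate of strands from outside and also supplies the descent
  behind connectedness.\<close>

lemma south_west_step:
  assumes "in2 x y \<or> in4 x y" "d \<in> {(-1, 0), (0, -1)}" "opn (x, y) (- d)"
  shows "rfl (x, y) d = (-1, 0) \<and> (in2 (x - 1) y \<or> in4 (x - 1) y \<or> (x - 1, y) \<in> Gd) \<or>
    rfl (x, y) d = (0, -1) \<and> (in2 x (y - 1) \<or> in4 x (y - 1) \<or> (x, y - 1) \<in> Gd)"
  using assms(1)
proof
  assume i: "in2 x y"
  note n = in_disjoint(1,3)[OF i]
  have "(x - 1, y) \<in> R" "\<not> in3 (x - 1) y"
    using i bounds_a(6,7,13) unfolding R_iff in2_def in3_def by linarith+
  then have *: "in2 (x - 1) y \<or> in4 (x - 1) y \<or> (x - 1, y) \<in> Gd" unfolding Gd_iff Rm_iff by blast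
  have **: "in2 x (y - 1)" if "x + y > Lx + 1" using that i unfolding in2_def by linarith
  have "d = (-1, 0) \<or> d = (0, -1)" using assms(2) by blast
  then have "rfl (x, y) d = (-1, 0) \<or> rfl (x, y) d = (0, -1) \<and> x + y > Lx + 1"
    using i n assms(3) by (elim disjE; simp add: opn_def refl_eq; linarith)
  then show ?thesis using * ** by blast
next
  assume i: "in4 x y"
  have n: "\<not> in2 x y" "\<not> in3 x y" using i in_disjoint by blast+
  have "(x, y - 1) \<in> R" "\<not> in3 x (y - 1)"
    using i bounds_a(10,11,14) unfolding R_iff in4_def in3_def by linarith+
  then have *: "in2 x (y - 1) \<or> in4 x (y - 1) \<or> (x, y - 1) \<in> Gd" unfolding Gd_iff Rm_iff by blast
  have **: "in4 (x - 1) y" if "x + y > Ly + 1" using that i unfolding in4_def by linarith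
  have "d = (-1, 0) \<or> d = (0, -1)" using assms(2) by blast
  then have "rfl (x, y) d = (0, -1) \<or> rfl (x, y) d = (-1, 0) \<and> x + y > Ly + 1"
    using i n assms(3) by (elim disjE; simp add: opn_def refl_eq; linarith)
  then show ?thesis using * ** by blast
qed

lemma inward_step:
  assumes "inward (p, d)" "p \<in> Rm" "d \<in> dirs" "opn p (- d)" shows "inward (p + rfl p d, rfl p d)"
proof -
  obtain x y where p: "p = (x, y)" by (cases p)
  have nG: "(x, y) \<notin> Gd" using assms(2) p Gd_iff by blast
  consider "in2 x y" "\<not> in3 x y" "\<not> in4 x y" | "\<not> in2 x y" "in3 x y" "\<not> in4 x y"
    | "\<not> in2 x y" "\<not> in3 x y" "in4 x y" using assms(2) in_disjoint unfolding p Rm_iff by blast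
  then show ?thesis
  proof cases
    case 1
    have "d \<in> {(-1, 0), (0, -1)}" using assms(1) 1 nG unfolding p inward_def by auto
    note sw = south_west_step[of x y, OF _ this]
    have "in2 x y \<or> in4 x y" "opn (x, y) (- d)" using 1 assms(4) p by auto
    from sw[OF this] show ?thesis
      unfolding p by (elim disjE conjE; simp add: inward_def)
  next
    case 2
    consider "a 3 = Lx" "d = (1, 0) \<or> d = (0, -1)" | "a 3 = Ly" "d = (0, 1) \<or> d = (-1, 0)"
      using assms(1) 2 nG unfolding p inward_def by auto
    then show ?thesis
    proof cases
      case a: 1
      have "(x, y - 1) \<in> R" "\<not> in4 x (y - 1)"
        using 2(2) a(1) bounds_a(8,9,12,14) unfolding R_iff in4_def in3_def by linarith+
      then have *: "in3 x (y - 1) \<or> in2 x (y - 1) \<or> (x, y - 1) \<in> Gd" unfolding Gd_iff Rm_iff by blast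
      have **: "in3 (x + 1) y" if "x - y < Lx - Ly" using that 2(2) unfolding in3_def by linarith
      have "rfl p d = (0, -1) \<or> rfl p d = (1, 0) \<and> x - y < Lx - Ly"
        using a(2) 2 assms(4) unfolding p by (elim disjE; simp add: opn_def refl_eq; linarith)
      then show ?thesis
        by (elim disjE conjE; use * ** a(1) in \<open>simp add: p inward_def; blast?\<close>)
    next
      case a: 2
      have "(x - 1, y) \<in> R" "\<not> in2 (x - 1) y"
        using 2(2) a(1) bounds_a(8,9,12,13) unfolding R_iff in2_def in3_def by linarith+
      then have *: "in3 (x - 1) y \<or> in4 (x - 1) y \<or> (x - 1, y) \<in> Gd" unfolding Gd_iff Rm_iff by blast
      have **: "in3 x (y + 1)" if "x - y > Lx - Ly" using that 2(2) unfolding in3_def by linarith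
      have "rfl p d = (-1, 0) \<or> rfl p d = (0, 1) \<and> x - y > Lx - Ly"
        using a(2) 2 assms(4) unfolding p by (elim disjE; simp add: opn_def refl_eq; linarith)
      then show ?thesis
        by (elim disjE conjE; use * ** a(1) in \<open>simp add: p inward_def; blast?\<close>)
    qed
  next
    case 3
    have "d \<in> {(-1, 0), (0, -1)}" using assms(1) 3 nG unfolding p inward_def by auto
    note sw = south_west_step[of x y, OF _ this]
    have "in2 x y \<or> in4 x y" "opn (x, y) (- d)" using 3 assms(4) p by auto
    from sw[OF this] show ?thesis
      unfolding p by (elim disjE conjE; simp add: inward_def)
  qed
qed

lemma inward_start:
  assumes "q \<notin> R" "q + d \<in> R" "d \<in> dirs" "opn (q + d) (- d)" shows "inward (q + d, d)"
proof -
  obtain x y where p: "q + d = (x, y)" by (cases "q + d")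
  then have q: "q = (x - fst d, y - snd d)" by (cases q; cases d) auto
  have r: "1 \<le> x" "x \<le> Lx" "1 \<le> y" "y \<le> Ly" using assms(2) unfolding p R_iff by auto
  show ?thesis
  proof (cases "(x, y) \<in> Rm")
    case False then show ?thesis using assms(2) p Gd_iff unfolding inward_def by simp
  next
    case True
    consider "in2 x y" "\<not> in3 x y" "\<not> in4 x y" | "\<not> in2 x y" "in3 x y" "\<not> in4 x y"
      | "\<not> in2 x y" "\<not> in3 x y" "in4 x y" using True in_disjoint unfolding Rm_iff by blast
    then show ?thesis
    proof cases
      case 1
      from assms(3) show ?thesis using 1 assms(1,4) r bounds_a(6) unfolding p q inward_def
        by (cases rule: dirs_cases) (auto simp: opn_def R_iff in2_def)
    next
      case 2
      have o: "opn (x, y) (- d)" "(x - fst d, y - snd d) \<notin> R" using assms(1,4) p q by simp_all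
      have i: "Lx - a 3 + 1 \<le> x" "Ly - a 3 + 1 \<le> y" using 2(2) unfolding in3_def by auto
      \<comment> \<open>From above and from the right only dead directions lead into square 3; from
        the left or from below it can be entered only if it spans the rectangle.\<close>
      from assms(3) have "d = (1, 0) \<and> a 3 = Lx \<or> d = (0, 1) \<and> a 3 = Ly"
        by (cases rule: dirs_cases;
            use 2(1,2) o i r bounds_a(8,9) in \<open>simp add: opn_def R_iff; linarith\<close>)
      then show ?thesis using 2(2) unfolding p inward_def by auto
    next
      case 3
      from assms(3) show ?thesis using 3 assms(1,4) r bounds_a(11) unfolding p q inward_def
        by (cases rule: dirs_cases) (auto simp: opn_def R_iff in4_def)
    qed
  qed
qed

text \<open>A live strand from outside stays inward and must end at a vertex; whether a pendant is
  kept is thus decided at its first cell.\<close>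

lemma opn_keep:
  assumes q: "q \<notin> R" "q + d \<in> R" "d \<in> dirs" and o: "opn (q + d) (- d)" shows "keep (Half q d)"
proof -
  have qR: "q \<notin> Rm" using q Rm_R by blast
  have lv: "live (Half q d)" using qR q o unfolding live_def by blast
  have inw: "lies h s \<Longrightarrow> h = Half q d \<Longrightarrow> inward s" for h s
  proof (induction rule: lies.induct)
    case (start q' d') then show ?case using inward_start[OF q o] by simp
  next
    case (step h p e)
    then show ?case
      using inward_step[OF _ step(2)] lies_dirs[OF step(1)] lies_live[OF step(1)] lv by simp
  qed
  obtain p e where pe: "lies (Half q d) (p, e)" "p \<notin> Rm" "e \<in> dirs" "mt (Half q d) = Half p (- e)"
    by (rule mate_half[OF qR q(3)])
  have "inward (p, e)" using inw[OF pe(1)] by simp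
  then have "p \<in> Gd" using pe(2) by (cases p) (auto simp: inward_def Rm_iff)
  then show ?thesis unfolding keep_def pe(4) grid_halves_iff using dirs_rot pe(3) by blast
qed

lemma keep_iff: "q \<notin> R \<Longrightarrow> q + d \<in> R \<Longrightarrow> d \<in> dirs \<Longrightarrow> keep (Half q d) \<longleftrightarrow> opn (q + d) (- d)"
  using keep_opn opn_keep by blast

lemma keep_sides:
  "x \<in> {1..Lx} \<Longrightarrow> keep (Half (x, 0) (0, 1)) \<longleftrightarrow> x \<le> Lx - a 2"
  "y \<in> {1..Ly} \<Longrightarrow> keep (Half (Lx + 1, y) (-1, 0)) \<longleftrightarrow> a 2 < y \<and> y \<le> Ly - a 3"
  "x \<in> {1..Lx} \<Longrightarrow> keep (Half (x, Ly + 1) (0, -1)) \<longleftrightarrow> a 4 < x \<and> x \<le> Lx - a 3"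
  "y \<in> {1..Ly} \<Longrightarrow> keep (Half (0, y) (1, 0)) \<longleftrightarrow> y \<le> Ly - a 4"
proof -
  show "keep (Half (x, 0) (0, 1)) \<longleftrightarrow> x \<le> Lx - a 2" if x: "x \<in> {1..Lx}"
  proof -
    have "keep (Half (x, 0) (0, 1)) \<longleftrightarrow> opn (x, 1) (0, -1)"
      using keep_iff[of "(x, 0)" "(0, 1)"] x bounds_a(1,2) by (simp add: R_iff dirs_def)
    also have "\<dots> \<longleftrightarrow> x \<le> Lx - a 2"
      using x bounds_a unfolding opn_def in2_def in3_def in4_def Let_def prod.case atLeastAtMost_iff by (smt (verit))
    finally show ?thesis .
  qed
  show "keep (Half (Lx + 1, y) (-1, 0)) \<longleftrightarrow> a 2 < y \<and> y \<le> Ly - a 3" if y: "y \<in> {1..Ly}"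
  proof -
    have "keep (Half (Lx + 1, y) (-1, 0)) \<longleftrightarrow> opn (Lx, y) (1, 0)"
      using keep_iff[of "(Lx + 1, y)" "(-1, 0)"] y bounds_a(1,2) by (simp add: R_iff dirs_def)
    also have "\<dots> \<longleftrightarrow> a 2 < y \<and> y \<le> Ly - a 3"
      using y bounds_a unfolding opn_def in2_def in3_def in4_def Let_def prod.case atLeastAtMost_iff by (smt (verit))
    finally show ?thesis .
  qed
  show "keep (Half (x, Ly + 1) (0, -1)) \<longleftrightarrow> a 4 < x \<and> x \<le> Lx - a 3" if x: "x \<in> {1..Lx}"
  proof -
    have "keep (Half (x, Ly + 1) (0, -1)) \<longleftrightarrow> opn (x, Ly) (0, 1)"
      using keep_iff[of "(x, Ly + 1)" "(0, -1)"] x bounds_a(1,2) by (simp add: R_iff dirs_def)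
    also have "\<dots> \<longleftrightarrow> a 4 < x \<and> x \<le> Lx - a 3"
      using x bounds_a unfolding opn_def in2_def in3_def in4_def Let_def prod.case atLeastAtMost_iff by (smt (verit))
    finally show ?thesis .
  qed
  show "keep (Half (0, y) (1, 0)) \<longleftrightarrow> y \<le> Ly - a 4" if y: "y \<in> {1..Ly}"
  proof -
    have "keep (Half (0, y) (1, 0)) \<longleftrightarrow> opn (1, y) (-1, 0)"
      using keep_iff[of "(0, y)" "(1, 0)"] y bounds_a(1,2) by (simp add: R_iff dirs_def)
    also have "\<dots> \<longleftrightarrow> y \<le> Ly - a 4"
      using y bounds_a unfolding opn_def in2_def in3_def in4_def Let_def prod.case atLeastAtMost_iff by (smt (verit))
    finally show ?thesis .
  qed
qed

text \<open>The number of black external edges is given by the parameters, the external edges by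
  filtering a list. The kept pendants on each side form an interval, and the four lengths add
  up.\<close>

lemma length_pendants: "length (pendants Lx Ly a) = 2 * nat (Lx + Ly - (\<Sum>i=1..4. a i))"
  and nblack_ge: "1 \<le> nat (Lx + Ly - (\<Sum>i=1..4. a i))"
proof -
  have len: "length (filter P [1..n]) = nat (v - u + 1)"
    if "\<And>x. x \<in> {1..n} \<Longrightarrow> P x \<longleftrightarrow> u \<le> x \<and> x \<le> v" "1 \<le> u" "v \<le> n" for P and n u v :: int
  proof -
    have "{x. P x} \<inter> set [1..n] = {u..v}" using that by auto
    then show ?thesis using distinct_length_filter[of "[1..n]" P] by simp
  qed
  have lenr: "length (filter P (rev xs)) = length (filter P xs)" for P and xs :: "int list"
    by (metis length_rev rev_filter)
  have "length (pendants Lx Ly a) = nat (Lx - a 2) + (nat (Ly - a 3 - a 2) + (nat (Lx - a 3 - a 4) + nat (Ly - a 4)))"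
  proof -
    have "length (filter (\<lambda>x. keep (Half (x, 0) (0, 1))) [1..Lx]) = nat (Lx - a 2 - 1 + 1)"
      by (rule len) (use keep_sides(1) bounds_a in auto)
    moreover have "length (filter (\<lambda>y. keep (Half (Lx + 1, y) (-1, 0))) [1..Ly]) = nat (Ly - a 3 - (a 2 + 1) + 1)"
      by (rule len) (use keep_sides(2) bounds_a in auto)
    moreover have "length (filter (\<lambda>x. keep (Half (x, Ly + 1) (0, -1))) [1..Lx]) = nat (Lx - a 3 - (a 4 + 1) + 1)"
      by (rule len) (use keep_sides(3) bounds_a in auto)
    moreover have "length (filter (\<lambda>y. keep (Half (0, y) (1, 0))) [1..Ly]) = nat (Ly - a 4 - 1 + 1)"
      by (rule len) (use keep_sides(4) bounds_a in auto)
    ultimately show ?thesis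
      unfolding pendants_eq rectangle_pendants_def by (simp add: filter_map o_def lenr)
  qed
  moreover have s: "(\<Sum>i=1..4. a i) = a 2 + a 3 + a 4"
  proof -
    have "{1..4} = {1, 2, 3, 4 :: nat}" by auto
    then show ?thesis using a1 by simp
  qed
  moreover have n: "1 \<le> Lx + Ly - (a 2 + a 3 + a 4)" using bounds_a(6,10,11,13-15) bounds_a(1,2,3,4,5) by linarith
  moreover have "0 \<le> Lx - a 2" "0 \<le> Ly - a 3 - a 2" "0 \<le> Lx - a 3 - a 4" "0 \<le> Ly - a 4"
    using bounds_a(6,11,13,14) by linarith+
  ultimately have "int (length (pendants Lx Ly a)) = int (2 * nat (Lx + Ly - (\<Sum>i=1..4. a i)))" by simp
  then show "length (pendants Lx Ly a) = 2 * nat (Lx + Ly - (\<Sum>i=1..4. a i))" by (simp only: of_nat_eq_iff)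
  show "1 \<le> nat (Lx + Ly - (\<Sum>i=1..4. a i))" unfolding s using n by linarith
qed

section \<open>Domains of the first kind\<close>

abbreviation "FK \<equiv> first_kind Lx Ly a"
abbreviation "Hs \<equiv> half_edges FK"
abbreviation "Xs \<equiv> ext_halves FK"
abbreviation "fs \<equiv> face_step FK"
abbreviation "nb \<equiv> nat (Lx + Ly - (\<Sum>i=1..4. a i))"
abbreviation "Js \<equiv> {1..2 * nb}"

lemma FK_simps [simp]:
  "half_edges FK = grid_halves Lx Ly a \<union> set (pendants Lx Ly a)" "ccw FK = first_ccw Lx Ly a" "mate FK = mt"
  "nblack FK = nb" "ext FK = (\<lambda>j. pendants Lx Ly a ! (j - 1))"
  by (simp_all add: first_kind_def first_kind_map_def Let_def)

lemma X_eq: "Xs = set (pendants Lx Ly a)"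
proof -
  let ?xs = "pendants Lx Ly a"
  have "(\<lambda>j. ?xs ! (j - 1)) ` {1..2 * nb} = (!) ?xs ` {..<2 * nb}"
  proof
    show "(\<lambda>j. ?xs ! (j - 1)) ` {1..2 * nb} \<subseteq> (!) ?xs ` {..<2 * nb}" by (intro image_subsetI imageI) auto
    show "(!) ?xs ` {..<2 * nb} \<subseteq> (\<lambda>j. ?xs ! (j - 1)) ` {1..2 * nb}"
    proof (rule image_subsetI)
      fix k assume "k \<in> {..<2 * nb}"
      then show "?xs ! k \<in> (\<lambda>j. ?xs ! (j - 1)) ` {1..2 * nb}" by (intro image_eqI[of _ _ "Suc k"]) auto
    qed
  qed
  also have "\<dots> = set ?xs" using length_pendants by (auto simp: set_conv_nth)
  finally show ?thesis unfolding ext_halves_def FK_simps .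
qed

lemma X_iff: "Half q d \<in> Xs \<longleftrightarrow> d \<in> dirs \<and> q \<notin> R \<and> q + d \<in> R \<and> keep (Half q d)"
  unfolding X_eq pendants_eq set_filter using set_rp by blast

lemma H_iff: "Half q d \<in> Hs \<longleftrightarrow> d \<in> dirs \<and> (q \<in> Gd \<or> q \<notin> R \<and> q + d \<in> R \<and> keep (Half q d))"
  unfolding FK_simps Un_iff X_eq[symmetric] X_iff grid_halves_iff by blast

lemma X_sub_H: "h \<in> Xs \<Longrightarrow> h \<in> Hs"
  unfolding FK_simps X_eq by blast

lemma H_form:
  assumes "h \<in> Hs"
  obtains q d where "h = Half q d" "d \<in> dirs" "q \<notin> Rm" "live h" "q \<in> Gd \<or> q \<notin> R \<and> q + d \<in> R \<and> keep h"
proof -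
  obtain q d where h: "h = Half q d"
    using assms set_rp_half[of h] unfolding FK_simps pendants_eq grid_halves_def by auto
  then have i: "d \<in> dirs" "q \<in> Gd \<or> q \<notin> R \<and> q + d \<in> R \<and> keep h" using assms H_iff by metis+
  then have "q \<notin> Rm" using Gd_iff Rm_R by blast
  moreover have "live h"
  proof (cases "q \<in> Gd")
    case True then show ?thesis using grid_live i h by blast
  next
    case False
    then have "opn (q + d) (- d)" using keep_opn i h by blast
    then show ?thesis using h i \<open>q \<notin> Rm\<close> unfolding live_def by blast
  qed
  ultimately show thesis using that h i by blast
qed

lemma H_X: "h \<in> Hs \<Longrightarrow> h = Half q d \<Longrightarrow> h \<in> Xs \<longleftrightarrow> q \<notin> Gd"
  using H_iff[of q d] X_iff[of q d] Gd_iff by blast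

lemma lies_from_R: assumes "h \<in> Hs" "lies h (p, d)" "p \<notin> R" shows "p - d \<in> R"
proof -
  consider "h = Half (p - d) d" "p - d \<notin> Rm" | "p - d \<in> Rm" using lies_before[OF assms(2)] by blast
  then show ?thesis
  proof cases
    case 1
    then have "p - d \<in> Gd \<or> p - d + d \<in> R" using assms(1) H_iff by metis
    then show ?thesis using assms(3) Gd_iff by auto
  next
    case 2 then show ?thesis by (rule Rm_R)
  qed
qed

lemma H_mate:
  assumes "h \<in> Hs" shows "mt h \<in> Hs" "mt (mt h) = h" "h \<in> Xs \<Longrightarrow> mt h \<notin> Xs"
proof -
  obtain q d where h: "h = Half q d" "d \<in> dirs" "q \<notin> Rm" "live h" "q \<in> Gd \<or> q \<notin> R \<and> q + d \<in> R \<and> keep h"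
    by (rule H_form[OF assms])
  obtain p e where pe: "lies (Half q d) (p, e)" "p \<notin> Rm" "e \<in> dirs" "mt (Half q d) = Half p (- e)"
    "mt (Half p (- e)) = Half q d" by (rule mate_half[OF h(3,2)])
  show "mt (mt h) = h" using pe h by simp
  have H: "mt h \<in> Hs"
  proof (cases "q \<in> Gd")
    case True
    show ?thesis
    proof (cases "p \<in> R")
      case True
      then have "p \<in> Gd" using pe(2) Gd_iff by blast
      then show ?thesis using pe h dirs_rot H_iff by metis
    next
      case False
      have "p - e \<in> R" using lies_from_R[OF assms _ False] pe(1) h(1) by blast
      moreover have "keep (Half p (- e))" unfolding keep_def pe(5) grid_halves_iff using \<open>q \<in> Gd\<close> h(2) by blast
      ultimately show ?thesis using pe h dirs_rot(2)[OF pe(3)] False H_iff[of p "- e"] by simp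
    qed
  next
    case False
    then show ?thesis using h(5) unfolding keep_def FK_simps by blast
  qed
  then show "mt h \<in> Hs" .
  assume "h \<in> Xs"
  then have "q \<notin> Gd" using H_X[OF assms h(1)] by blast
  then have "mt h \<in> grid_halves Lx Ly a" using h(5) unfolding keep_def by blast
  then have "p \<in> Gd" using pe(4) h(1) grid_halves_iff by metis
  then show "mt h \<notin> Xs" using H_X[OF H] pe(4) h(1) by metis
qed

lemma ccw_grid: "p \<in> Gd \<Longrightarrow> first_ccw Lx Ly a (Half p d) = Half p (- rot d)"
  by (cases d) simp

lemma ccw_ext: assumes "h \<in> Xs" shows "first_ccw Lx Ly a h = h"
proof -
  obtain q d where h: "h = Half q d" "q \<notin> Gd"
    using H_form[OF X_sub_H[OF assms]] H_X[OF X_sub_H[OF assms]] assms by metis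
  then show ?thesis by (cases d) simp
qed

lemma f_grid:
  assumes "h \<in> Hs" "lies h (p, d)" "p \<in> Gd"
  shows "fs h = Half p (rot d)" "Half p (rot d) \<in> Hs" "lies (Half p (rot d)) (p + rot d, rot d)"
proof -
  have d: "d \<in> dirs" using lies_dirs[OF assms(2)] by simp
  have p: "p \<notin> Rm" using assms Gd_iff by blast
  have m: "mt h = Half p (- d)" by (rule lies_mate[OF assms(2) p])
  have "mt h \<notin> Xs" using H_X[OF H_mate(1)[OF assms(1)]] m assms(3) by blast
  then show "fs h = Half p (rot d)" using m ccw_grid[OF assms(3)] by (simp add: face_step_def turn_def)
  show "Half p (rot d) \<in> Hs" using H_iff assms(3) dirs_rot d by blast
  show "lies (Half p (rot d)) (p + rot d, rot d)" by (rule lies.start[OF p dirs_rot(1)[OF d]])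
qed

lemma nb_pos: "1 \<le> nb" by (rule nblack_ge)

lemma next_in: "next_ext FK j \<in> Js"
  using nb_pos by (simp add: next_ext_def Suc_le_eq)

lemma ext_X: "j \<in> Js \<Longrightarrow> ext FK j \<in> Xs"
  unfolding ext_halves_def FK_simps(4) by (rule imageI)

lemma inj_ext: "inj_on (ext FK) Js"
proof (rule inj_onI)
  fix i j assume ij: "i \<in> Js" "j \<in> Js" "ext FK i = ext FK j"
  have "distinct (pendants Lx Ly a)" unfolding pendants_eq using distinct_rp by (rule distinct_filter)
  moreover have "i - 1 < length (pendants Lx Ly a)" "j - 1 < length (pendants Lx Ly a)"
    using ij(1,2) length_pendants by auto
  ultimately have "i - 1 = j - 1" using ij(3) nth_eq_iff_index_eq unfolding FK_simps by blast
  then show "i = j" using ij by auto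
qed

lemma turn_next: assumes "j \<in> Js" shows "turn FK (ext FK (next_ext FK j)) = ext FK j"
proof -
  have "inv_into Js (ext FK) (ext FK (next_ext FK j)) = next_ext FK j" by (rule inv_into_f_f[OF inj_ext next_in])
  moreover have "prev_ext FK (next_ext FK j) = j"
    using assms by (cases "j = 2 * nb") (auto simp: next_ext_def prev_ext_def)
  ultimately show ?thesis using ext_X[OF next_in] unfolding turn_def FK_simps(4) by simp
qed

lemma ext_consecutive:
  assumes "0 \<le> k" "k < k'" "k' < 2 * Lx + 2 * Ly" "keep (rp ! nat k)" "keep (rp ! nat k')"
    "\<And>i. k < i \<Longrightarrow> i < k' \<Longrightarrow> \<not> keep (rp ! nat i)"
  shows "\<exists>j\<in>Js. ext FK j = rp ! nat k \<and> ext FK (next_ext FK j) = rp ! nat k'"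
proof -
  have "\<not> keep (rp ! i)" if "nat k < i" "i < nat k'" for i using assms(6)[of "int i"] that by simp
  then obtain j where j: "Suc j < length (pendants Lx Ly a)" "pendants Lx Ly a ! j = rp ! nat k"
    "pendants Lx Ly a ! Suc j = rp ! nat k'"
    using filter_next[of "nat k" "nat k'" rp keep] assms length_rp unfolding pendants_eq by auto
  have "next_ext FK (Suc j) = Suc (Suc j)" using j(1) length_pendants by (simp add: next_ext_def)
  then show ?thesis using j length_pendants by (intro bexI[of _ "Suc j"]) auto
qed

lemma ext_consecutive_unique:
  assumes "j \<in> Js" "ext FK j = rp ! nat k" "0 \<le> k" "k < k'" "k' < 2 * Lx + 2 * Ly" "keep (rp ! nat k')"
    "\<And>i. k < i \<Longrightarrow> i < k' \<Longrightarrow> \<not> keep (rp ! nat i)"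
  shows "ext FK (next_ext FK j) = rp ! nat k'"
proof -
  have "ext FK j \<in> Xs" by (rule ext_X[OF assms(1)])
  then have "keep (rp ! nat k)" using assms(2) unfolding X_eq pendants_eq by simp
  from ext_consecutive[OF assms(3-5) this assms(6,7)] obtain i where
    i: "i \<in> Js" "ext FK i = rp ! nat k" "ext FK (next_ext FK i) = rp ! nat k'" by blast
  then have "i = j" using inj_onD[OF inj_ext _ i(1) assms(1)] assms(2) by simp
  then show ?thesis using i by simp
qed

section \<open>Neighbouring strands and strands along the border\<close>

lemma refl_other:
  assumes "p \<in> Rm" "d \<in> dirs" "opn p (- d)" "d' \<in> dirs" "opn p d'" "d' \<noteq> - d" shows "rfl p d = d'"
  using opn_refl(3)[OF assms(1-4)] assms(5,6) by blast

lemma live_opn: "h \<in> Hs \<Longrightarrow> lies h (p, d) \<Longrightarrow> opn p (- d) \<and> d \<in> dirs"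
  using lies_live[of h "(p, d)"] lies_dirs[of h "(p, d)"] H_form by (metis fst_conv snd_conv)

text \<open>Neighbouring strands that leave the rectangle together end in consecutive pendants, and
  at an external vertex a face step turns to the preceding one.\<close>

lemma parallel_exit:
  assumes h: "h \<in> Hs" "lies h (p, d)" "p \<notin> R" and g: "g \<in> Hs" "lies g (p + rot d, d)" "p + rot d \<notin> R"
  shows "fs h = mt g"
proof -
  have d: "d \<in> dirs" using live_opn h by blast
  let ?r = "rot d"
  have R: "p - d \<in> R" "p + ?r - d \<in> R" using lies_from_R h g by blast+
  have mh: "mt h = Half p (- d)" "mt g = Half (p + ?r) (- d)" using lies_mate h g Rm_R by blast+
  have dr: "- ?r \<in> dirs" using d dirs_rot by blast
  have eq: "p + ?r - d + rot (- ?r) = p + ?r" "p - d + rot (- ?r) = p" "p + ?r - d + - ?r = p - d" by simp_all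
  have n1: "rp ! nat (border_index (p + ?r - d) (- ?r)) = Half (p + ?r) (- d)" "0 \<le> border_index (p + ?r - d) (- ?r)"
    using rp_nth[OF R(2) dr] g(3) unfolding eq by simp_all
  have n2: "rp ! nat (border_index (p - d) (- ?r)) = Half p (- d)" "border_index (p - d) (- ?r) < 2 * Lx + 2 * Ly"
    using rp_nth[OF R(1) dr] h(3) unfolding eq by simp_all
  have st: "border_index (p - d) (- ?r) = border_index (p + ?r - d) (- ?r) + 1"
    using bi_step(1)[OF R(2) dr] R(1) g(3) unfolding eq by blast
  have X: "mt h \<in> Xs" "mt g \<in> Xs" using H_X H_mate(1) h g mh Gd_iff by metis+
  then have "keep (Half p (- d))" "keep (Half (p + ?r) (- d))" using mh X_iff by metis+
  then obtain j where j: "j \<in> Js" "ext FK j = mt g" "ext FK (next_ext FK j) = mt h"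
    using ext_consecutive[of "border_index (p + ?r - d) (- ?r)" "border_index (p - d) (- ?r)"] n1 n2 st mh by auto
  then show ?thesis using turn_next[OF j(1)] unfolding face_step_def FK_simps by simp
qed

text \<open>If both strands pass straight on or bend together, induct; the walk along the face makes a turn only
  where one of them ends or where they meet head-on.\<close>

lemma parallel:
  assumes h: "h \<in> Hs" and g: "g \<in> Hs"
    and "lies h (p, d)" "lies g (p + rot d, d)" "p \<in> R \<longleftrightarrow> p + rot d \<in> R"
  shows "\<exists>n\<le>2. (fs ^^ n) h = mt g"
proof -
  obtain n where "fst ((T ^^ n) (p, d)) \<notin> Rm" using lies_exit[OF assms(3)] by blast
  then show ?thesis using assms(3-5)
  proof (induction n arbitrary: p d rule: less_induct)
    case (less n)
    note lh = less.prems(2) and lg = less.prems(3)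
    let ?r = "rot d"
    have oh: "opn p (- d)" "d \<in> dirs" and og: "opn (p + ?r) (- d)" using live_opn h g lh lg by blast+
    have dr: "?r \<in> dirs" "- ?r \<in> dirs" "- d \<in> dirs" using oh dirs_rot by blast+
    have dist: "?r \<noteq> - d" "- d \<noteq> - ?r" "- ?r \<noteq> - d" "d \<noteq> - d" using dirs_distinct[OF oh(2)] by auto
    have mg: "lies (mt g) (p + ?r - d, - d)" by (rule lies_mate_rev[OF lg])
    show ?case
    proof (cases "p \<in> R")
      case False
      then have "fs h = mt g" using parallel_exit[OF h lh False g lg] less.prems(4) by blast
      then show ?thesis by (intro exI[of _ 1]) simp
    next
      case True
      then have prR: "p + ?r \<in> R" using less.prems(4) by blast
      consider (gg) "p \<in> Gd" "p + ?r \<in> Gd" | (gr) "p \<in> Gd" "p + ?r \<in> Rm" | (rg) "p \<in> Rm" "p + ?r \<in> Gd"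
        | (rr) "p \<in> Rm" "p + ?r \<in> Rm" using True prR Gd_iff by blast
      then show ?thesis
      proof cases
        case gg
        note f1 = f_grid[OF h lh gg(1)]
        have "fs (fs h) = Half (p + ?r) (- d)" using f_grid(1)[OF f1(2,3) gg(2)] f1(1) by simp
        moreover have "mt g = Half (p + ?r) (- d)" using lies_mate[OF lg] gg(2) Gd_iff by blast
        ultimately show ?thesis by (intro exI[of _ 2]) (simp add: eval_nat_numeral)
      next
        case gr
        note f1 = f_grid[OF h lh gr(1)]
        have "opn (p + ?r) (- ?r)" using live_opn[OF f1(2,3)] by blast
        then have "rfl (p + ?r) ?r = - d" using refl_other[OF gr(2) dr(1) _ dr(3) og] dist by blast
        then have "lies (Half p ?r) (p + ?r - d, - d)" using lies.step[OF f1(3) gr(2)] by simp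
        then have "fs h = mt g" using lies_det[OF _ mg] f1(1) by metis
        then show ?thesis by (intro exI[of _ 1]) simp
      next
        case rg
        have "opn p ?r"
          using opn_sym[OF dr(2) prR, of ] opn_nonrem[of "p + ?r"] rg(2) Gd_iff True by simp
        then have "rfl p d = ?r" using refl_other[OF rg(1) oh(2,1) dr(1)] dist by blast
        then have "lies h (p + ?r, ?r)" using lies.step[OF lh rg(1)] by simp
        then have "fs h = Half (p + ?r) (- d)" using f_grid(1)[OF h _ rg(2)] by simp
        moreover have "mt g = Half (p + ?r) (- d)" using lies_mate[OF lg] rg(2) Gd_iff by blast
        ultimately show ?thesis by (intro exI[of _ 1]) simp
      next
        case rr
        have n: "n > 0" "fst ((T ^^ (n - 1)) (T (p, d))) \<notin> Rm"
          using less.prems(1) rr(1) by (cases n; simp add: funpow_swap1)+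
        have refd: "rfl p d \<in> {d, ?r, - ?r}"
          using refl_dirs[OF oh(2), of p] dirs_four[OF oh(2)] opn_refl(2)[OF rr(1) oh(2,1)] by auto
        have refd': "rfl (p + ?r) d \<in> {d, ?r, - ?r}"
          using refl_dirs[OF oh(2), of "p + ?r"] dirs_four[OF oh(2)] opn_refl(2)[OF rr(2) oh(2) og] by auto
        have o1: "opn p (rfl p d)" "opn (p + ?r) (rfl (p + ?r) d)"
          using opn_refl(1)[OF rr(1) oh(2,1)] opn_refl(1)[OF rr(2) oh(2) og] .
        note lh' = lies.step[OF lh rr(1)] and lg' = lies.step[OF lg rr(2)]
        consider (right) "rfl p d = ?r" | (left) "rfl p d = - ?r"
          | (straight) "rfl p d = d" "rfl (p + ?r) d = d"
          | (reverse) "rfl p d = d" "rfl (p + ?r) d = - ?r" | (bend) "rfl p d = d" "rfl (p + ?r) d = ?r"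
          using refd refd' by blast
        then show ?thesis
        proof cases
          \<comment> \<open>The left strand turns into the cell of the right one and meets it
            head-on: both are the same edge, seen from its two ends.\<close>
          case right
          then have l: "lies h (p + ?r, ?r)" using lh' by simp
          have "opn (p + ?r) (- ?r)" using live_opn[OF h l] by blast
          then have "rfl (p + ?r) ?r = - d" using refl_other[OF rr(2) dr(1) _ dr(3) og] dist by blast
          then have "lies h (p + ?r - d, - d)" using lies.step[OF l rr(2)] by simp
          then have "h = mt g" using lies_det mg by blast
          then show ?thesis by (intro exI[of _ 0]) simp
        next
          \<comment> \<open>The left strand is on the inside and advances by one cell while the
            right one advances by three; the remaining length of the left strand is the
            measure.\<close>
          case left
          then have ol: "opn p (- ?r)" using o1 by simp
          note bl = bend_left[OF oh(2) rr(1) prR oh(1) ol og]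
          have l1: "lies g (p + ?r + d, d)" using lg' bl(2) by simp
          have l2: "lies g (p + d, - ?r)" using lies.step[OF l1 bl(3)] bl(4) by (simp add: algebra_simps)
          have l3: "lies g (p - ?r + rot (- ?r), - ?r)" using lies.step[OF l2 bl(5)] bl(6) by (simp add: algebra_simps)
          have l4: "lies h (p - ?r, - ?r)" using lh' left by simp
          have "p + - ?r \<in> R \<longleftrightarrow> p + rot (- ?r) + - ?r \<in> R"
            by (rule R_parallel[OF dr(2) True]) (use bl(5) Rm_R in simp)
          then have "p - ?r \<in> R \<longleftrightarrow> p - ?r + rot (- ?r) \<in> R" by (simp add: algebra_simps)
          then show ?thesis using less.IH[of "n - 1", OF _ _ l4 l3] n left by simp
        next
          case straight
          have l1: "lies h (p + d, d)" "lies g (p + d + ?r, d)"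
            using lh' lg' straight by (simp_all add: algebra_simps)
          have "p + d \<in> R \<longleftrightarrow> p + d + ?r \<in> R" using R_parallel[OF oh(2) True prR] by (simp add: algebra_simps)
          then show ?thesis using less.IH[of "n - 1", OF _ _ l1] n straight by simp
        next
          \<comment> \<open>The right strand would leave through the edge towards the left one,
            which forces the left strand to turn right.\<close>
          case reverse
          then have "opn (p + ?r + - ?r) (- (- ?r))"
            using opn_sym[OF dr(2) prR] o1(2) True by simp
          then have "opn p ?r" by simp
          then have "rfl p d = ?r" using refl_other[OF rr(1) oh(2,1) dr(1)] dist by blast
          then show ?thesis using reverse dirs_distinct[OF oh(2)] by auto
        next
          \<comment> \<open>Now the left strand is on the outside and needs three cells to become
            parallel again, hence the induction at \<open>n - 3\<close>.\<close>
          case bend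
          have ob: "opn (p + ?r) ?r" using o1 bend by simp
          have pm: "p + ?r - ?r = p" by simp
          note br = bend_right[of d "p + ?r", OF oh(2) rr(2) _ og ob, unfolded pm, OF True oh(1)]
          have l1: "lies h (p + d, d)" using lh' bend by simp
          have l2: "lies h (p + d + ?r, ?r)" using lies.step[OF l1 br(3)] br(4) by simp
          have prd: "p + d + ?r \<in> Rm" using br(5) by (simp add: algebra_simps)
          have l3: "lies h (p + d + ?r + ?r, ?r)"
            using lies.step[OF l2 prd] br(6) by (simp add: algebra_simps)
          have l4: "lies g (p + d + ?r + ?r + rot ?r, ?r)" using lg' bend by (simp add: algebra_simps)
          have T3: "(T ^^ 3) (p, d) = (p + d + ?r + ?r, ?r)"
            using bend br(4,6) by (simp add: eval_nat_numeral algebra_simps)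
          have "n \<ge> 3"
          proof (rule ccontr)
            assume "\<not> n \<ge> 3"
            then consider "n = 0" | "n = 1" | "n = 2" by linarith
            then show False
              using less.prems(1) rr(1) br(3) prd bend br(4) by cases (simp_all add: eval_nat_numeral)
          qed
          then have "(T ^^ n) (p, d) = (T ^^ (n - 3)) ((T ^^ 3) (p, d))"
            by (metis funpow_add comp_apply le_add_diff_inverse2)
          then have n3: "fst ((T ^^ (n - 3)) (p + d + ?r + ?r, ?r)) \<notin> Rm" using less.prems(1) T3 by simp
          have "p + d + ?r + ?r \<in> R \<longleftrightarrow> p + d + ?r + ?r + rot ?r \<in> R"
          proof -
            have "p + d + ?r + ?r \<in> R \<longleftrightarrow> p + d + ?r + rot ?r + ?r \<in> R"
              by (rule R_parallel[OF dr(1) Rm_R[OF prd]]) (use prR in \<open>simp add: algebra_simps\<close>)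
            then show ?thesis by (simp add: algebra_simps)
          qed
          then show ?thesis using less.IH[of "n - 3", OF _ n3 l3 l4] \<open>n \<ge> 3\<close> by simp
        qed
      qed
    qed
  qed
qed

lemma kept_mate:
  assumes "h \<in> Hs" "lies h (q, - d)" "q \<notin> R"
  shows "keep (Half q d)" "mt (Half q d) = h" "mt h = Half q d"
proof -
  have "mt h = Half q d" using lies_mate[OF assms(2)] assms(3) Rm_R by fastforce
  moreover have X: "mt h \<in> Xs" using H_X[OF H_mate(1)[OF assms(1)]] calculation assms(3) Gd_iff by metis
  ultimately show "keep (Half q d)" "mt (Half q d) = h" "mt h = Half q d"
    using X_iff H_mate(2)[OF assms(1)] by metis+
qed

text \<open>The strand has the outside on its right and passes dropped pendants until it either ends
  at a vertex whose right-hand pendant is kept, which costs one face step, or itself leaves through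
  a kept pendant, which costs none.\<close>

lemma border:
  assumes h: "h \<in> Hs" and "lies h (p, d)" "p \<in> R" "p + rot d \<notin> R"
  shows "\<exists>k. border_index p d \<le> k \<and> k < 2 * Lx + 2 * Ly \<and> keep (rp ! nat k) \<and>
    (\<forall>i. border_index p d \<le> i \<and> i < k \<longrightarrow> \<not> keep (rp ! nat i)) \<and> (\<exists>n\<le>1. (fs ^^ n) h = mt (rp ! nat k))"
proof -
  have "fst (p, d) \<in> R \<and> fst (p, d) + rot (snd (p, d)) \<notin> R \<longrightarrow>
    (\<exists>k. border_index (fst (p, d)) (snd (p, d)) \<le> k \<and> k < 2 * Lx + 2 * Ly \<and> keep (rp ! nat k) \<and>
    (\<forall>i. border_index (fst (p, d)) (snd (p, d)) \<le> i \<and> i < k \<longrightarrow> \<not> keep (rp ! nat i)) \<and>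
    (\<exists>n\<le>1. (fs ^^ n) h = mt (rp ! nat k)))"
    using assms(2)
  proof (induction rule: lies_induct)
    case (exit p d)
    show ?case
    proof (intro impI)
      assume "fst (p, d) \<in> R \<and> fst (p, d) + rot (snd (p, d)) \<notin> R"
      then have R: "p \<in> R" "p + rot d \<notin> R" by auto
      have d: "d \<in> dirs" using lies_dirs[OF exit(1)] by simp
      have pG: "p \<in> Gd" using R exit(2) Gd_iff by blast
      note f1 = f_grid[OF h exit(1) pG]
      have k: "keep (Half (p + rot d) (- rot d))" "mt (Half (p + rot d) (- rot d)) = Half p (rot d)"
        using kept_mate[OF f1(2), of "p + rot d" "- rot d"] f1(3) R(2) by simp_all
      note nth = rp_nth[OF R(1) d R(2)]
      show "\<exists>k. border_index (fst (p, d)) (snd (p, d)) \<le> k \<and> k < 2 * Lx + 2 * Ly \<and> keep (rp ! nat k) \<and>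
        (\<forall>i. border_index (fst (p, d)) (snd (p, d)) \<le> i \<and> i < k \<longrightarrow> \<not> keep (rp ! nat i)) \<and>
        (\<exists>n\<le>1. (fs ^^ n) h = mt (rp ! nat k))"
        unfolding fst_conv snd_conv
      proof (intro exI[of _ "border_index p d"] conjI exI[of _ 1] allI impI)
        show "\<not> keep (rp ! nat i)" if "border_index p d \<le> i \<and> i < border_index p d" for i using that by linarith
        show "(fs ^^ 1) h = mt (rp ! nat (border_index p d))" unfolding nth(1) k(2) using f1(1) by simp
      qed (use nth k(1) in simp_all)
    qed
  next
    case (pass p d)
    show ?case
    proof (intro impI)
      assume "fst (p, d) \<in> R \<and> fst (p, d) + rot (snd (p, d)) \<notin> R"
      then have R: "p \<in> R" "p + rot d \<notin> R" by auto
      let ?r = "rot d"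
      let ?P = "\<lambda>p d. \<exists>k. border_index p d \<le> k \<and> k < 2 * Lx + 2 * Ly \<and> keep (rp ! nat k) \<and>
        (\<forall>i. border_index p d \<le> i \<and> i < k \<longrightarrow> \<not> keep (rp ! nat i)) \<and> (\<exists>n\<le>1. (fs ^^ n) h = mt (rp ! nat k))"
      have d: "d \<in> dirs" "opn p (- d)" using live_opn[OF h pass(1)] by auto
      have dr: "?r \<in> dirs" "- ?r \<in> dirs" "- d \<in> dirs" using d dirs_rot by blast+
      note nth = rp_nth[OF R(1) d(1) R(2)]
      \<comment> \<open>Keeps the strand away from the bottom-left corner, so that the list index
        never wraps.\<close>
      have p11: "p \<noteq> (1, 1)"
      proof
        assume "p = (1, 1)"
        moreover have "(1, 1) \<notin> Rm" using bounds_a unfolding Rm_iff in2_def in3_def in4_def by linarith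
        ultimately show False using pass(2) by simp
      qed
      have nd: "d \<noteq> (0, -1)" if "p + d \<notin> R"
      proof
        assume "d = (0, -1)"
        then have "p = (1, 1)" using that R by (cases p) (auto simp: R_iff)
        then show False using p11 by simp
      qed
      have skip: "?P p d" if P: "?P p' d'" and b: "border_index p' d' = border_index p d + 1" and nk: "\<not> keep (rp ! nat (border_index p d))" for p' d'
      proof -
        obtain k where k: "border_index p' d' \<le> k" "k < 2 * Lx + 2 * Ly" "keep (rp ! nat k)"
          "\<forall>i. border_index p' d' \<le> i \<and> i < k \<longrightarrow> \<not> keep (rp ! nat i)" "\<exists>n\<le>1. (fs ^^ n) h = mt (rp ! nat k)"
          using P by blast
        have "\<not> keep (rp ! nat i)" if "border_index p d \<le> i" "i < k" for i
          using k(4) nk that b by (cases "i = border_index p d") auto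
        then show ?thesis using k b by (intro exI[of _ k]) auto
      qed
      have outer: "?P p' d'" if l: "lies h (p' + rot d', rot d')" and p': "p' \<in> R" "d' \<in> dirs" "p' + rot d' \<notin> R" for p' d'
      proof -
        have "keep (Half (p' + rot d') (- rot d'))" "mt (Half (p' + rot d') (- rot d')) = h"
          using kept_mate[OF h, of "p' + rot d'" "- rot d'"] l p'(3) by simp_all
        note km = this and nth' = rp_nth[OF p']
        show ?thesis
        proof (intro exI[of _ "border_index p' d'"] conjI exI[of _ 0] allI impI)
          show "\<not> keep (rp ! nat i)" if "border_index p' d' \<le> i \<and> i < border_index p' d'" for i using that by linarith
          show "(fs ^^ 0) h = mt (rp ! nat (border_index p' d'))" unfolding nth'(1) km(2) by simp
        qed (use nth' km(1) in simp_all)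
      qed
      show "?P (fst (p, d)) (snd (p, d))"
        unfolding fst_conv snd_conv
      proof (cases "opn p ?r")
        case True
        then have "rfl p d = ?r" using refl_other[OF pass(2) d dr(1)] dirs_distinct[OF d(1)] by auto
        then show "?P p d" using outer[of p d] pass(3) R d by simp
      next
        case False
        have nk: "\<not> keep (rp ! nat (border_index p d))"
          using keep_opn[OF R(2) dr(2)] False unfolding nth(1) by auto
        have "rfl p d \<in> {d, - d, ?r, - ?r}" using refl_dirs[OF d(1), of p] dirs_four[OF d(1)] by metis
        moreover have "rfl p d \<noteq> ?r" using opn_refl(1)[OF pass(2) d] False by metis
        ultimately have "rfl p d = d \<or> rfl p d = - ?r" using opn_refl(2)[OF pass(2) d] by blast
        then show "?P p d"
        proof
          assume s: "rfl p d = d"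
          show "?P p d"
          proof (cases "p + d \<in> R")
            case True
            then have "p + d + ?r \<notin> R"
            proof -
              obtain x y where "p = (x, y)" by (cases p)
              with d(1) show ?thesis using R by (cases rule: dirs_cases) (auto simp: R_iff)
            qed
            then have "?P (p + d) d" using pass(4) s True by simp
            then show "?P p d" using skip[OF _ _ nk] bi_step(1)[OF R(1) d(1) R(2) True] by blast
          next
            case out: False
            have "?P p (- ?r)" using outer[of p "- ?r"] pass(3) s R(1) dr(2) out by simp
            then show "?P p d" using skip[OF _ _ nk] bi_step(2)[OF R(1) d(1) R(2) out nd[OF out]] by blast
          qed
        next
          \<comment> \<open>A left turn with the outside on the right happens only at a corner of
            the rectangle, so the border turns too; the pendants on both sides of that corner are
            dropped.\<close>
          assume s: "rfl p d = - ?r"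
          then have ol: "opn p (- ?r)" using opn_refl(1)[OF pass(2) d] by simp
          have out: "p + d \<notin> R" by (rule bend_corner[OF d(1) pass(2) d(2) ol R(2)])
          have b1: "border_index p (- ?r) = border_index p d + 1" by (rule bi_step(2)[OF R(1) d(1) R(2) out nd[OF out]])
          have out': "p + rot (- ?r) \<notin> R" using out by simp
          have nk': "\<not> keep (rp ! nat (border_index p (- ?r)))"
          proof
            assume "keep (rp ! nat (border_index p (- ?r)))"
            then have "keep (Half (p + d) (- d))" using rp_nth(1)[OF R(1) dr(2) out'] by simp
            then have "opn p d" using keep_opn[OF out dr(3)] by simp
            then show False
              using opn_refl(3)[OF pass(2) d d(1)] s dirs_distinct[OF d(1)] by auto
          qed
          have "?P p (- ?r)"
          proof (cases "p - ?r \<in> R")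
            case True
            then have "p + - ?r \<in> R" by simp
            have "p - ?r + rot (- ?r) \<notin> R"
            proof -
              obtain x y where "p = (x, y)" by (cases p)
              with d(1) show ?thesis using R out by (cases rule: dirs_cases) (auto simp: R_iff)
            qed
            then have "?P (p - ?r) (- ?r)" using pass(4) s True by simp
            moreover have "border_index (p + - ?r) (- ?r) = border_index p (- ?r) + 1"
              by (rule bi_step(1)[OF R(1) dr(2) out' \<open>p + - ?r \<in> R\<close>])
            ultimately obtain k where k: "border_index p (- ?r) + 1 \<le> k" "k < 2 * Lx + 2 * Ly" "keep (rp ! nat k)"
              "\<forall>i. border_index p (- ?r) + 1 \<le> i \<and> i < k \<longrightarrow> \<not> keep (rp ! nat i)" "\<exists>n\<le>1. (fs ^^ n) h = mt (rp ! nat k)"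
              by auto
            have "\<not> keep (rp ! nat i)" if "border_index p (- ?r) \<le> i" "i < k" for i
              using k(4) nk' that by (cases "i = border_index p (- ?r)") auto
            then show ?thesis using k by (intro exI[of _ k]) auto
          next
            case F: False
            then have F': "p + - ?r \<notin> R" by simp
            have nd': "- ?r \<noteq> (0, -1)"
            proof
              assume "- ?r = (0, -1)"
              then have "p = (1, 1)" using F' R out' by (cases p; cases d) (auto simp: R_iff)
              then show False using p11 by simp
            qed
            have "border_index p (- rot (- ?r)) = border_index p (- ?r) + 1" by (rule bi_step(2)[OF R(1) dr(2) out' F' nd'])
            then have b2: "border_index p (- d) = border_index p (- ?r) + 1" by simp
            have "?P p (- d)" using outer[of p "- d"] pass(3) s R(1) dr(3) F' by simp
            then obtain k where k: "border_index p (- d) \<le> k" "k < 2 * Lx + 2 * Ly" "keep (rp ! nat k)"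
              "\<forall>i. border_index p (- d) \<le> i \<and> i < k \<longrightarrow> \<not> keep (rp ! nat i)" "\<exists>n\<le>1. (fs ^^ n) h = mt (rp ! nat k)"
              by auto
            have "\<not> keep (rp ! nat i)" if "border_index p (- ?r) \<le> i" "i < k" for i
              using k(4) nk' that b2 by (cases "i = border_index p (- ?r)") auto
            then show ?thesis using k b2 by (intro exI[of _ k]) auto
          qed
          then show "?P p d" using skip[OF _ b1 nk] by blast
        qed
      qed
    qed
  qed
  then show ?thesis using assms(3,4) by simp
qed

text \<open>Along one outer side of a square either all pendants are live or none, so a change
  between neighbours shows that they do not lie in a common square.\<close>

lemma side_uniform:
  assumes d: "d \<in> dirs" and i: "i \<in> {2, 3, 4}" "sq i p" "sq i (p + rot d)" and out: "p - d \<notin> R"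
    and o: "opn p (- d)"
  shows "opn (p + rot d) (- d)"
proof -
  obtain x y where p: "p = (x, y)" by (cases p)
  consider "i = 2" "in2 x y" "in2 (x + snd d) (y - fst d)"
    | "i = 3" "in3 x y" "in3 (x + snd d) (y - fst d)" | "i = 4" "in4 x y" "in4 (x + snd d) (y - fst d)"
    using i unfolding p by (auto simp: sq_fst_snd rot_def)
  then show ?thesis
  proof cases
    case 1
    from d show ?thesis
      by (cases rule: dirs_cases; use 1(2,3) o out bounds_a(6,7) in \<open>simp add: p opn_def R_iff\<close>;
          use 1(2,3) in \<open>simp add: in2_def\<close>)
  next
    case 2
    have n: "\<not> in2 x y" "\<not> in2 (x + snd d) (y - fst d)" using 2 in_disjoint by blast+
    from d show ?thesis
      by (cases rule: dirs_cases; use 2(2,3) n o out bounds_a(8,9) in \<open>simp add: p opn_def R_iff\<close>;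
          use 2(2,3) bounds_a(8,9) in \<open>simp add: in3_def\<close>)
  next
    case 3
    have n: "\<not> in2 x y" "\<not> in2 (x + snd d) (y - fst d)" "\<not> in3 x y" "\<not> in3 (x + snd d) (y - fst d)"
      using 3 in_disjoint by blast+
    from d show ?thesis
      by (cases rule: dirs_cases; use 3(2,3) n o out bounds_a(10,11) in \<open>simp add: p opn_def R_iff\<close>;
          use 3(2,3) bounds_a(10,11) in \<open>simp add: in4_def\<close>)
  qed
qed

lemma one_one: "(1, 1) \<in> Gd" "(1, 1) \<in> R"
  using bounds_a unfolding Gd_iff Rm_iff R_iff in2_def in3_def in4_def by linarith+

lemma ext_first: "ext FK 1 = Half (1, 0) (0, 1)"
proof -
  have nth: "rp ! 0 = Half (1, 0) (0, 1)" using bounds_a(1) by (simp add: rectangle_pendants_def nth_append)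
  have "rp \<noteq> []" using length_rp bounds_a(1,2) by auto
  then obtain ys where ys: "rp = rp ! 0 # ys" by (cases rp) auto
  have "keep (Half (1, 0) (0, 1))" using keep_sides(1)[of 1] bounds_a by simp
  then have "pendants Lx Ly a = Half (1, 0) (0, 1) # filter keep ys"
    unfolding pendants_eq by (subst ys) (simp add: nth)
  then show ?thesis by simp
qed

lemma ext_last: "ext FK (2 * nb) = Half (0, 1) (1, 0)"
proof -
  have "rp \<noteq> []" using length_rp bounds_a(1,2) by auto
  have "last rp = Half (0, 1) (1, 0)"
    using bounds_a(2) unfolding rectangle_pendants_def by (simp add: last_append last_map last_rev hd_map upto_rec1)
  then obtain ys where ys: "rp = ys @ [Half (0, 1) (1, 0)]" using \<open>rp \<noteq> []\<close> by (metis append_butlast_last_id)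
  have "keep (Half (0, 1) (1, 0))" using keep_sides(4)[of 1] bounds_a by simp
  then have "pendants Lx Ly a = filter keep ys @ [Half (0, 1) (1, 0)]" unfolding pendants_eq by (subst ys) simp
  moreover from this have "2 * nb - 1 = length (filter keep ys)" using length_pendants by simp
  ultimately show ?thesis unfolding FK_simps by (metis nth_append_length)
qed

lemma grid_ext_mate:
  assumes "p \<in> Gd" "d \<in> dirs" "p - d \<notin> R" shows "mt (Half (p - d) d) = Half p (- d)"
proof -
  have "lies (Half (p - d) d) (p - d + d, d)" by (rule lies.start) (use assms Rm_R in blast)+
  then show ?thesis using lies_mate[of "Half (p - d) d" p d] assms(1) Gd_iff by (metis diff_add_cancel)
qed

text \<open>If the neighbouring pendant is kept, the two strands run in parallel. If it is dropped,
  or the border turns, the face follows a strand along the border up to the next kept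
  pendant.\<close>

lemma boundary_walk:
  assumes j: "j \<in> Js" shows "\<exists>n\<le>2. (fs ^^ n) (ext FK j) = mt (ext FK (next_ext FK j))"
proof -
  let ?h = "ext FK j"
  have X: "?h \<in> Xs" by (rule ext_X[OF j])
  have H: "?h \<in> Hs" by (rule X_sub_H[OF X])
  obtain q e where h: "?h = Half q e" "e \<in> dirs" "q \<notin> Rm" using H_form[OF H] by metis
  have q: "q \<notin> R" "q + e \<in> R" "keep (Half q e)" using X X_iff h by metis+
  define p where "p = q + e"
  let ?r = "rot e"
  have pR: "p \<in> R" "p - e \<notin> R" "q = p - e" using q unfolding p_def by auto
  have dr: "?r \<in> dirs" "- e \<in> dirs" "- ?r \<in> dirs" using h dirs_rot by blast+
  have lh: "lies ?h (p, e)" unfolding h(1) p_def by (rule lies.start[OF h(3,2)])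
  have oh: "opn p (- e)" using live_opn[OF H lh] by blast
  have pr: "p + rot ?r \<notin> R" using pR by simp
  note n0 = rp_nth[OF pR(1) dr(1) pr]
  have hk: "?h = rp ! nat (border_index p ?r)" using n0(1) h(1) pR(3) by simp
  have finish: ?thesis if "border_index p ?r < k" "k < 2 * Lx + 2 * Ly" "keep (rp ! nat k)"
      "\<And>i. border_index p ?r < i \<Longrightarrow> i < k \<Longrightarrow> \<not> keep (rp ! nat i)" "\<exists>n\<le>2. (fs ^^ n) ?h = mt (rp ! nat k)" for k
    using ext_consecutive_unique[OF j hk n0(2) that(1-4)] that(5) by simp
  have via_border: ?thesis if P: "\<exists>k. c0 \<le> k \<and> k < 2 * Lx + 2 * Ly \<and> keep (rp ! nat k) \<and>
      (\<forall>i. c0 \<le> i \<and> i < k \<longrightarrow> \<not> keep (rp ! nat i)) \<and> (\<exists>n\<le>1. (fs ^^ n) g = mt (rp ! nat k))"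
      and c0: "c0 = border_index p ?r + 1" and g: "g = ?h \<or> g = fs ?h" for c0 g
  proof -
    obtain k n where k: "c0 \<le> k" "k < 2 * Lx + 2 * Ly" "keep (rp ! nat k)"
      "\<forall>i. c0 \<le> i \<and> i < k \<longrightarrow> \<not> keep (rp ! nat i)" "n \<le> 1" "(fs ^^ n) g = mt (rp ! nat k)" using P by blast
    have "\<exists>n\<le>2. (fs ^^ n) ?h = mt (rp ! nat k)"
      using g
    proof
      assume "g = ?h" then show ?thesis using k(5,6) by (intro exI[of _ n]) simp
    next
      assume "g = fs ?h"
      then have "(fs ^^ Suc n) ?h = mt (rp ! nat k)" using k(6) by (simp add: funpow_swap1)
      then show ?thesis using k(5) by (intro exI[of _ "Suc n"]) simp
    qed
    then show ?thesis using finish[of k] k c0 by simp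
  qed
  show ?thesis
  proof (cases "p + ?r \<in> R")
    case False
    show ?thesis
    proof (cases "?r = (0, -1)")
      \<comment> \<open>At the last external edge the list wraps around to the first one; both are
        attached to the vertex \<open>(1, 1)\<close>.\<close>
      case True
      then have e: "e = (1, 0)" using h(2) by (auto simp: dirs_def)
      then have p1: "p = (1, 1)" using False pR by (cases p) (auto simp: R_iff)
      then have "?h = ext FK (2 * nb)" using h(1) pR(3) e ext_last by simp
      then have "j = 2 * nb" using inj_onD[OF inj_ext _ j, of "2 * nb"] nb_pos by simp
      then have "next_ext FK j = 1" using nb_pos by (simp add: next_ext_def)
      moreover have "mt (Half (1, 0) (0, 1)) = Half (1, 1) (0, -1)"
        using grid_ext_mate[OF one_one(1), of "(0, 1)"] by (simp add: dirs_def R_iff)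
      moreover have "fs ?h = Half (1, 1) (0, -1)" using f_grid(1)[OF H lh] one_one p1 e by simp
      ultimately show ?thesis using ext_first by (intro exI[of _ 1]) simp
    next
      case nd: False
      have "border_index p (- rot ?r) = border_index p ?r + 1" by (rule bi_step(2)[OF pR(1) dr(1) pr False nd])
      then have "border_index p e = border_index p ?r + 1" by simp
      then show ?thesis using via_border[OF border[OF H lh pR(1) False]] by blast
    qed
  next
    case True
    have b1: "border_index (p + ?r) ?r = border_index p ?r + 1" by (rule bi_step(1)[OF pR(1) dr(1) pr True])
    have out: "p + ?r - e \<notin> R"
    proof -
      obtain x y where "p = (x, y)" by (cases p)
      with h(2) show ?thesis using pR True by (cases rule: dirs_cases) (auto simp: R_iff)
    qed
    then have pr': "p + ?r + rot ?r \<notin> R" by simp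
    note n1 = rp_nth[OF True dr(1) pr']
    have n1': "rp ! nat (border_index (p + ?r) ?r) = Half (p + ?r - e) e" using n1(1) by simp
    show ?thesis
    proof (cases "keep (Half (p + ?r - e) e)")
      case k: True
      let ?g = "Half (p + ?r - e) e"
      have g: "?g \<in> Hs" using H_iff[of "p + ?r - e" e] h(2) out True k by simp
      have "lies ?g (p + ?r - e + e, e)" by (rule lies.start) (use out Rm_R h in blast)+
      then have lg: "lies ?g (p + ?r, e)" by simp
      have "\<exists>n\<le>2. (fs ^^ n) ?h = mt ?g" using parallel[OF H g lh lg] pR(1) True by blast
      then show ?thesis using finish[of "border_index (p + ?r) ?r"] n1' n1 b1 k by auto
    next
      case nk: False
      then have no: "\<not> opn (p + ?r) (- e)" using opn_keep[OF out _ h(2)] True by auto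
      then have rm: "p + ?r \<in> Rm" using opn_nonrem by blast
      show ?thesis
      proof (cases "p \<in> Gd")
        case G: True
        note f1 = f_grid[OF H lh G]
        have "Half p ?r = ?h \<or> Half p ?r = fs ?h" using f1(1) by metis
        then show ?thesis by (rule via_border[OF border[OF f1(2,3) True pr'] b1])
      next
        case False
        then have prm: "p \<in> Rm" using pR Gd_iff by blast
        \<comment> \<open>One pendant is live and the next is dead, so the two cells share no
          square; their common edge is then live and the strand turns right into it.\<close>
        have "opn p ?r"
        proof (rule opn_side[OF prm dr(1) True])
          show "\<not> (\<exists>i\<in>{2, 3, 4}. sq i p \<and> sq i (p + ?r))" using side_uniform[OF h(2) _ _ _ pR(2) oh] no by blast
        qed
        then have "rfl p e = ?r" using refl_other[OF prm h(2) oh dr(1)] dirs_distinct[OF h(2)] by auto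
        then have "lies ?h (p + ?r, ?r)" using lies.step[OF lh prm] by simp
        from via_border[OF border[OF H this True pr'] b1] show ?thesis by blast
      qed
    qed
  qed
qed

section \<open>Faces have at most four sides\<close>

lemma turn_grid: "Half p d \<in> Hs \<Longrightarrow> p \<in> Gd \<Longrightarrow> turn FK (Half p d) = Half p (- rot d)"
  using H_X[of "Half p d" p d] ccw_grid[of p d] unfolding turn_def FK_simps(2) by simp

lemma X_next: assumes "h \<in> Xs" obtains j where "j \<in> Js" "h = ext FK (next_ext FK j)"
proof -
  obtain i where i: "i \<in> Js" "h = ext FK i" using assms unfolding ext_halves_def FK_simps(4) by blast
  have "next_ext FK (prev_ext FK i) = i" "prev_ext FK i \<in> Js"
    using i(1) by (auto simp: next_ext_def prev_ext_def)
  then show thesis using that i by metis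
qed

lemma turn_X: assumes "h \<in> Xs" shows "turn FK h \<in> Xs"
proof -
  obtain j where j: "j \<in> Js" "h = ext FK (next_ext FK j)" by (rule X_next[OF assms])
  show ?thesis unfolding j(2) turn_next[OF j(1)] by (rule ext_X[OF j(1)])
qed

lemma turn_H:
  assumes "h \<in> Hs" shows "turn FK h \<in> Hs" "turn FK h \<in> Xs \<longleftrightarrow> h \<in> Xs"
proof -
  obtain q d where h: "h = Half q d" "d \<in> dirs" "q \<in> Gd \<or> q \<notin> R \<and> q + d \<in> R \<and> keep h"
    by (rule H_form[OF assms]) blast
  have "turn FK h \<in> Hs \<and> (turn FK h \<in> Xs \<longleftrightarrow> h \<in> Xs)"
  proof (cases "h \<in> Xs")
    case True then show ?thesis using turn_X X_sub_H by blast
  next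
    case False
    then have q: "q \<in> Gd" using H_X[OF assms h(1)] by blast
    have t: "turn FK h = Half q (- rot d)" using turn_grid[OF assms[unfolded h(1)] q] h(1) by metis
    have "- rot d \<in> dirs" using dirs_rot h(2) by blast
    then have "turn FK h \<in> Hs" using H_iff[of q "- rot d"] q t by metis
    then show ?thesis using H_X[OF _ t] q False by blast
  qed
  then show "turn FK h \<in> Hs" "turn FK h \<in> Xs \<longleftrightarrow> h \<in> Xs" by blast+
qed

lemma turn_inj: assumes "h \<in> Hs" "g \<in> Hs" "turn FK h = turn FK g" shows "h = g"
proof (cases "h \<in> Xs")
  case True
  then have gX: "g \<in> Xs" using turn_H(2) assms by metis
  obtain j where j: "j \<in> Js" "h = ext FK (next_ext FK j)" by (rule X_next[OF True])
  obtain k where k: "k \<in> Js" "g = ext FK (next_ext FK k)" by (rule X_next[OF gX])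
  have "ext FK j = ext FK k" using assms(3) turn_next j k by metis
  then have "j = k" using inj_onD[OF inj_ext] j(1) k(1) by blast
  then show ?thesis using j(2) k(2) by metis
next
  case False
  then have gX: "g \<notin> Xs" using turn_H(2) assms by metis
  obtain q d where h: "h = Half q d" by (rule H_form[OF assms(1)])
  obtain q' d' where g: "g = Half q' d'" by (rule H_form[OF assms(2)])
  have q: "q \<in> Gd" "q' \<in> Gd" using H_X[OF assms(1) h] H_X[OF assms(2) g] False gX by blast+
  have "Half q (- rot d) = Half q' (- rot d')"
    using turn_grid[OF assms(1)[unfolded h] q(1)] turn_grid[OF assms(2)[unfolded g] q(2)] assms(3) h g by metis
  then have "q = q'" "rot d = rot d'" by simp_all
  then show ?thesis using h g by (cases d; cases d') simp
qed

lemma fs_eq: "fs h = turn FK (mt h)"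
  unfolding face_step_def FK_simps ..

lemma fs_mate: "h \<in> Hs \<Longrightarrow> fs (mt h) = turn FK h"
  unfolding fs_eq using H_mate(2) by metis

lemma fs_H: "h \<in> Hs \<Longrightarrow> fs h \<in> Hs" "h \<in> Hs \<Longrightarrow> fs h \<in> Xs \<longleftrightarrow> mt h \<in> Xs"
  unfolding fs_eq using turn_H H_mate(1) by blast+

lemma fs_inj: assumes "h \<in> Hs" "g \<in> Hs" "fs h = fs g" shows "h = g"
  using turn_inj[OF H_mate(1)[OF assms(1)] H_mate(1)[OF assms(2)]] assms(3) H_mate(2) assms(1,2)
  unfolding fs_eq by metis

lemma fs_pow_H: "h \<in> Hs \<Longrightarrow> (fs ^^ n) h \<in> Hs"
  using fs_H(1) by (induction n) (simp_all del: FK_simps)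

definition short :: "half \<Rightarrow> bool" where
  "short h \<longleftrightarrow> (\<exists>n\<in>{1..4}. (fs ^^ n) h = h)"

lemma short_fs: assumes "h \<in> Hs" shows "short (fs h) \<longleftrightarrow> short h"
proof -
  have "(fs ^^ n) (fs h) = fs h \<longleftrightarrow> (fs ^^ n) h = h" for n
  proof
    assume "(fs ^^ n) (fs h) = fs h"
    then have "fs ((fs ^^ n) h) = fs h" by (simp add: funpow_swap1 del: FK_simps)
    then show "(fs ^^ n) h = h" by (rule fs_inj[OF fs_pow_H[OF assms] assms])
  next
    assume "(fs ^^ n) h = h"
    then have "fs ((fs ^^ n) h) = fs h" by metis
    then show "(fs ^^ n) (fs h) = fs h" by (simp add: funpow_swap1 del: FK_simps)
  qed
  then show ?thesis unfolding short_def by metis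
qed

lemma shortI: "(fs ^^ n) h = g \<Longrightarrow> n \<le> 2 \<Longrightarrow> fs g = h \<Longrightarrow> short h"
  unfolding short_def by (intro bexI[of _ "Suc n"]) simp_all

lemma shortI2: "(fs ^^ n) h = g \<Longrightarrow> n \<le> 2 \<Longrightarrow> fs (fs g) = h \<Longrightarrow> short h"
  unfolding short_def by (intro bexI[of _ "Suc (Suc n)"]) simp_all

lemma short_X: assumes "h \<in> Xs" shows "short h"
proof -
  obtain j where j: "j \<in> Js" "h = ext FK j" using assms unfolding ext_halves_def FK_simps(4) by blast
  obtain n where n: "n \<le> 2" "(fs ^^ n) h = mt (ext FK (next_ext FK j))"
    using boundary_walk[OF j(1)] j(2) by metis
  have "fs (mt (ext FK (next_ext FK j))) = h"
    using fs_mate[OF X_sub_H[OF ext_X[OF next_in]]] turn_next[OF j(1)] j(2) by metis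
  then show ?thesis by (rule shortI[OF n(2,1)])
qed

lemma grid_H: "p \<in> Gd \<Longrightarrow> d \<in> dirs \<Longrightarrow> Half p d \<in> Hs"
  using H_iff by blast

lemma grid_lies: "p \<in> Gd \<Longrightarrow> d \<in> dirs \<Longrightarrow> lies (Half p d) (p + d, d)"
  using lies.start Gd_iff by blast

text \<open>Strands leaving two neighbouring vertices in the same direction are joined by at most
  two face steps; two more lead along the edge between the vertices back to the start.\<close>

lemma short_side:
  assumes "p \<in> Gd" "d \<in> dirs" "p + rot d \<in> Gd" shows "short (Half p d)"
proof -
  let ?g = "Half (p + rot d) d"
  have dr: "- rot d \<in> dirs" using dirs_rot assms(2) by blast
  have g: "?g \<in> Hs" by (rule grid_H[OF assms(3,2)])
  have "p + d \<in> R \<longleftrightarrow> p + rot d + d \<in> R" by (rule R_parallel[OF assms(2)]) (use assms Gd_iff in blast)+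
  then have "p + d \<in> R \<longleftrightarrow> p + d + rot d \<in> R" by (simp add: algebra_simps)
  moreover have "lies ?g (p + d + rot d, d)" using grid_lies[OF assms(3,2)] by (simp add: algebra_simps)
  ultimately obtain n where n: "n \<le> 2" "(fs ^^ n) (Half p d) = mt ?g"
    using parallel[OF grid_H[OF assms(1,2)] g grid_lies[OF assms(1,2)]] by blast
  have "fs (mt ?g) = Half (p + rot d) (- rot d)" using fs_mate[OF g] turn_grid[OF g assms(3)] by metis
  moreover have "fs (Half (p + rot d) (- rot d)) = Half p d"
    using f_grid(1)[OF grid_H[OF assms(3) dr], of p "- rot d"] grid_lies[OF assms(3) dr] assms(1) by simp
  ultimately have "fs (fs (mt ?g)) = Half p d" by metis
  then show ?thesis by (rule shortI2[OF n(2,1)])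
qed

text \<open>The face touches the boundary, or contains an edge from \<open>p\<close> to a
  neighbouring vertex, or lies between two removed cells next to \<open>p\<close>. Then those cells
  belong to different squares, and one of the two strands turns so as to run beside the other, where
  \<open>parallel\<close> applies.\<close>

lemma short_grid:
  assumes p: "p \<in> Gd" and d: "d \<in> dirs" shows "short (Half p d)"
proof -
  let ?h = "Half p d" and ?r = "rot d"
  let ?g = "Half p ?r"
  have dr: "?r \<in> dirs" "- ?r \<in> dirs" "- d \<in> dirs" using dirs_rot d by blast+
  have ds: "d \<noteq> - ?r" "?r \<noteq> - d" using dirs_distinct[OF d] by auto
  have h: "?h \<in> Hs" "?g \<in> Hs" using grid_H p d dr by blast+
  have l: "lies ?h (p + d, d)" "lies ?g (p + ?r, ?r)" using grid_lies p d dr by blast+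
  have tg: "turn FK ?g = ?h" using turn_grid[OF h(2) p] by simp
  have pR: "p \<in> R" "p \<notin> Rm" using p Gd_iff by blast+
  consider "p + d \<notin> R" | "p + ?r \<notin> R" | "p + ?r \<in> Gd" | "p + d \<in> Gd" | "p + d \<in> Rm" "p + ?r \<in> Rm"
    using Gd_iff by blast
  then show ?thesis
  proof cases
    case 1
    then have m: "mt ?h = Half (p + d) (- d)" using lies_mate[OF l(1)] Rm_R by blast
    have "mt ?h \<in> Xs" using H_X[OF H_mate(1)[OF h(1)] m] 1 Gd_iff by blast
    then have "fs ?h \<in> Xs" using fs_H(2)[OF h(1)] by blast
    then show ?thesis using short_X short_fs[OF h(1)] by blast
  next
    case 2
    then have m: "mt ?g = Half (p + ?r) (- ?r)" using lies_mate[OF l(2)] Rm_R by blast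
    have X: "mt ?g \<in> Xs" using H_X[OF H_mate(1)[OF h(2)] m] 2 Gd_iff by blast
    have "fs (mt ?g) = ?h" using fs_mate[OF h(2)] tg by metis
    then show ?thesis using short_X[OF X] short_fs[OF H_mate(1)[OF h(2)]] by metis
  next
    case 3 then show ?thesis by (rule short_side[OF p d])
  next
    case 4
    have "p + d + rot ?r \<in> Gd" using p by simp
    then have "short (Half (p + d) ?r)" by (rule short_side[OF 4 dr(1)])
    then show ?thesis using f_grid(1)[OF h(1) l(1) 4] short_fs[OF h(1)] by metis
  next
    case 5
    have R: "p + d \<in> R" "p + ?r \<in> R" using 5 Rm_R by blast+
    then have "p + ?r + d \<in> R" using R_parallel[OF d pR(1)] by blast
    then have w: "p + d + ?r \<in> R" by (simp add: algebra_simps)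
    consider (one) "opn (p + ?r) d" | (two) "opn (p + d) ?r" | (none) "\<not> opn (p + ?r) d" "\<not> opn (p + d) ?r" by blast
    then have "\<exists>n\<le>2. (fs ^^ n) ?h = mt ?g"
    proof cases
      case one
      have "rfl (p + ?r) ?r = d" by (rule refl_other[OF 5(2) dr(1) _ d one ds(1)]) (use live_opn[OF h(2) l(2)] in blast)
      then have "lies ?g (p + d + ?r, d)" using lies.step[OF l(2) 5(2)] by (simp add: algebra_simps)
      then show ?thesis using parallel[OF h l(1)] R(1) w by blast
    next
      case two
      have "rfl (p + d) d = ?r" by (rule refl_other[OF 5(1) d _ dr(1) two ds(2)]) (use live_opn[OF h(1) l(1)] in blast)
      then have "lies ?h (p + d + ?r, ?r)" using lies.step[OF l(1) 5(1)] by simp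
      moreover have "p + d + ?r + rot ?r = p + ?r" by (simp add: algebra_simps)
      ultimately show ?thesis using parallel[OF h, of "p + d + ?r" ?r] l(2) R(2) w by metis
    next
      \<comment> \<open>The fourth cell of the block would share a square with each of the two
        removed neighbours, hence one square with both; squares being products, \<open>p\<close>
        would be removed too.\<close>
      case none
      have "p + ?r + d = p + d + ?r" by (simp add: algebra_simps)
      then have "p + ?r + d \<in> R" using w by metis
      then obtain i where i: "i \<in> {2, 3, 4}" "sq i (p + ?r)" "sq i (p + d + ?r)"
        using opn_side[OF 5(2) d] none(1) \<open>p + ?r + d = p + d + ?r\<close> by metis
      obtain j where j: "j \<in> {2, 3, 4}" "sq j (p + d)" "sq j (p + d + ?r)"
        using opn_side[OF 5(1) dr(1) w] none(2) by metis
      have "i = j" using i(1,3) j(1,3) sq_disjoint[of "p + d + ?r"] by auto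
      then have "sq i p" using sq_product[OF d] i(2) j(2) by blast
      then show ?thesis using sq_Rm pR(2) by blast
    qed
    then obtain n where n: "n \<le> 2" "(fs ^^ n) ?h = mt ?g" by blast
    have "fs (mt ?g) = ?h" using fs_mate[OF h(2)] tg by metis
    then show ?thesis by (rule shortI[OF n(2,1)])
  qed
qed

lemma face_short: assumes "h \<in> Hs" shows "\<exists>n\<in>{1..4}. (fs ^^ n) h = h"
proof -
  obtain q d where h: "h = Half q d" "d \<in> dirs" by (rule H_form[OF assms])
  have "short h"
  proof (cases "q \<in> Gd")
    case True then show ?thesis using short_grid h by metis
  next
    case False then show ?thesis using short_X H_X[OF assms h(1)] by blast
  qed
  then show ?thesis unfolding short_def .
qed

lemma FK_boundary_face:
  assumes j: "j \<in> Js"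
  shows "ccw FK (mt (ext FK j)) = mt (ext FK (next_ext FK j)) \<or>
    ccw FK (mt (ccw FK (mt (ext FK j)))) = mt (ext FK (next_ext FK j))"
proof -
  let ?e = "ext FK j" and ?w = "mt (ext FK (next_ext FK j))"
  have E: "?e \<in> Xs" "?e \<in> Hs" using ext_X[OF j] X_sub_H by blast+
  have me: "mt ?e \<notin> Xs" by (rule H_mate(3)[OF E(2,1)])
  have W: "ext FK (next_ext FK j) \<in> Xs" by (rule ext_X[OF next_in])
  have w: "?w \<notin> Xs" by (rule H_mate(3)[OF X_sub_H[OF W] W])
  obtain n where n: "n \<le> 2" "(fs ^^ n) ?e = ?w" using boundary_walk[OF j] by blast
  have f1: "fs ?e = ccw FK (mt ?e)" unfolding fs_eq turn_def using me by (rule if_not_P)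
  have "n = 0 \<or> n = 1 \<or> n = 2" using n(1) by linarith
  then consider "?e = ?w" | "fs ?e = ?w" | "fs (fs ?e) = ?w"
    using n(2) by (elim disjE; simp add: numeral_2_eq_2 del: FK_simps)
  then show ?thesis
  proof cases
    case 1 then show ?thesis using E(1) w by metis
  next
    case 2 then show ?thesis using f1 by metis
  next
    case 3
    have "mt (fs ?e) \<notin> Xs" using fs_H(2)[OF fs_H(1)[OF E(2)]] 3 w by metis
    then have "fs (fs ?e) = ccw FK (mt (fs ?e))" unfolding fs_eq[of "fs ?e"] turn_def by (rule if_not_P)
    then show ?thesis using f1 3 by metis
  qed
qed

end

section \<open>Connectedness and planarity\<close>

lemma even_card_four:
  assumes "distinct [w, x, y, z]"
  shows "even (card (C \<inter> {w, x, y, z})) \<longleftrightarrow> ((w \<in> C) = (x \<in> C)) = ((y \<in> C) = (z \<in> C))"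
proof -
  have e: "C \<inter> {w, x, y, z} = {g \<in> {w, x, y, z}. g \<in> C}" by blast
  show ?thesis
    using assms unfolding e card_filter[OF finite.insertI[OF finite.insertI[OF finite.insertI[OF
        finite.insertI[OF finite.emptyI]]]]]
    by (cases "w \<in> C"; cases "x \<in> C"; cases "y \<in> C"; cases "z \<in> C") simp_all
qed

lemma even_card_upto:
  fixes i :: int assumes "1 \<le> i"
  shows "even (card {x. 1 \<le> x \<and> x \<le> i \<and> P x}) \<longleftrightarrow> (even (card {x. 1 \<le> x \<and> x \<le> i - 1 \<and> P x}) \<noteq> P i)"
proof -
  have fin: "finite {x. 1 \<le> x \<and> x \<le> i - 1 \<and> P x}" by (rule finite_subset[of _ "{1..i}"]) auto
  have "{x. 1 \<le> x \<and> x \<le> i \<and> P x} =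
      (if P i then insert i {x. 1 \<le> x \<and> x \<le> i - 1 \<and> P x} else {x. 1 \<le> x \<and> x \<le> i - 1 \<and> P x})"
    using assms by (auto simp: order.order_iff_strict)
  then show ?thesis using fin by simp
qed

context dihedral begin

lemma quartic_grid: assumes "p \<in> Gd" "d \<in> dirs" shows "quartic FK (Half p d)"
proof -
  have "d \<noteq> - d" using dirs_distinct[OF assms(2)] by simp
  then show ?thesis unfolding quartic_def FK_simps(2) ccw_grid[OF assms(1)] by auto
qed

lemma H_grid: assumes "h \<in> Hs - Xs" obtains p d where "h = Half p d" "p \<in> Gd" "d \<in> dirs"
proof -
  obtain q d where h: "h = Half q d" "d \<in> dirs" by (rule H_form[of h]) (use assms in blast)
  then have "q \<in> Gd" using H_X[of h q d] assms by blast
  then show thesis using that h by blast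
qed

text \<open>Leave westwards, or southwards in the first column. West and south are preserved inside
  squares 2 and 4, so the strand ends at a vertex with a smaller coordinate sum.\<close>

lemma descent:
  assumes p: "(x, y) \<in> Gd" "(x, y) \<noteq> (1, 1)"
  obtains d x' y' d' where "d \<in> dirs" "(x', y') \<in> Gd" "d' \<in> dirs" "mt (Half (x, y) d) = Half (x', y') d'" "x' + y' < x + y"
proof -
  have r: "1 \<le> x" "x \<le> Lx" "1 \<le> y" "y \<le> Ly" "\<not> in2 x y" "\<not> in3 x y" "\<not> in4 x y"
    using p(1) unfolding Gd_iff R_iff Rm_iff by auto
  define d :: "int \<times> int" where "d = (if x = 1 then (0, -1) else (-1, 0))"
  have d: "d \<in> dirs" "d \<in> {(-1, 0), (0, -1)}" unfolding d_def by (simp_all add: dirs_def)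
  let ?h = "Half (x, y) d"
  let ?I = "\<lambda>s. (\<exists>x' y' e. s = ((x', y'), e) \<and> e \<in> {(-1, 0), (0, -1)} \<and> x' + y' < x + y \<and>
    (in2 x' y' \<or> in4 x' y' \<or> (x', y') \<in> Gd))"
  have h: "?h \<in> Hs" by (rule grid_H[OF p(1) d(1)])
  have l: "lies ?h ((x, y) + d, d)" by (rule grid_lies[OF p(1) d(1)])
  have "?I ((x, y) + d, d)"
  proof (cases "x = 1")
    case True
    have y: "y \<noteq> 1" using p(2) True by simp
    have "(1, y - 1) \<in> Gd"
      using y r True bounds_a unfolding Gd_iff R_iff Rm_iff in2_def in3_def in4_def by linarith
    then show ?thesis using True unfolding d_def by simp
  next
    case False
    have "(x - 1, y) \<in> R" "\<not> in3 (x - 1) y" using r False unfolding R_iff in3_def by linarith+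
    then have "in2 (x - 1) y \<or> in4 (x - 1) y \<or> (x - 1, y) \<in> Gd" unfolding Gd_iff Rm_iff by blast
    then show ?thesis using False unfolding d_def by simp
  qed
  moreover have "?I ((x, y) + d, d) \<longrightarrow>
      (\<exists>x' y' e. (x', y') \<in> Gd \<and> e \<in> dirs \<and> mt ?h = Half (x', y') e \<and> x' + y' < x + y)"
    using l
  proof (induction rule: lies_induct)
    case (exit p e)
    show ?case
    proof
      assume "?I (p, e)"
      then obtain x' y' where s: "p = (x', y')" "x' + y' < x + y" "in2 x' y' \<or> in4 x' y' \<or> (x', y') \<in> Gd" by auto
      then have G: "(x', y') \<in> Gd" using exit(2) unfolding s(1) Rm_iff by blast
      have "mt ?h = Half (x', y') (- e)" using lies_mate[OF exit] s(1) by metis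
      moreover have "- e \<in> dirs" using lies_dirs[OF exit(1)] dirs_rot by simp
      ultimately show "\<exists>x' y' e. (x', y') \<in> Gd \<and> e \<in> dirs \<and> mt ?h = Half (x', y') e \<and> x' + y' < x + y"
        using G s(2) by blast
    qed
  next
    case (pass p e)
    have "?I (p + rfl p e, rfl p e)" if I: "?I (p, e)"
    proof -
      obtain x' y' where s: "p = (x', y')" "e \<in> {(-1, 0), (0, -1)}" "x' + y' < x + y" "in2 x' y' \<or> in4 x' y' \<or> (x', y') \<in> Gd"
        using I by auto
      have i: "in2 x' y' \<or> in4 x' y'" using s(4) pass(2) Gd_iff unfolding s(1) by blast
      have o: "opn (x', y') (- e)" using live_opn[OF h pass(1)] s(1) by blast
      from south_west_step[OF i s(2) o] show ?thesis
        unfolding s(1) using s(3) by (elim disjE conjE; simp)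
    qed
    then show ?case using pass(4) by blast
  qed
  ultimately obtain x' y' e where "(x', y') \<in> Gd" "e \<in> dirs" "mt ?h = Half (x', y') e" "x' + y' < x + y" by blast
  then show thesis using that d(1) by blast
qed

lemma FK_connected:
  assumes inv: "\<And>h. h \<in> Hs \<Longrightarrow> \<chi> (mt h) = \<chi> h \<and> \<chi> (ccw FK h) = (\<chi> h :: bool)" and hg: "h \<in> Hs" "g \<in> Hs"
  shows "\<chi> g = \<chi> h"
proof -
  let ?o = "Half (1, 1) (0, -1)"
  have ro: "\<chi> (Half p (- rot d)) = \<chi> (Half p d)" if "p \<in> Gd" "d \<in> dirs" for p d
    using inv[OF grid_H[OF that]] ccw_grid[OF that(1)] unfolding FK_simps(2) by metis
  have vertex: "\<chi> (Half p d') = \<chi> (Half p d)" if p: "p \<in> Gd" and d: "d \<in> dirs" "d' \<in> dirs" for p d d'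
  proof -
    have dd: "- d \<in> dirs" "rot d \<in> dirs" using d dirs_rot by blast+
    have "\<chi> (Half p (- rot d)) = \<chi> (Half p d)" by (rule ro[OF p d(1)])
    moreover have "\<chi> (Half p d) = \<chi> (Half p (rot d))" using ro[OF p dd(2)] by simp
    moreover have "\<chi> (Half p (rot d)) = \<chi> (Half p (- d))" using ro[OF p dd(1)] by simp
    ultimately show ?thesis using d(2) dirs_four[OF d(1)] by auto
  qed
  have grid: "\<chi> (Half (x, y) d) = \<chi> ?o" if "(x, y) \<in> Gd" "d \<in> dirs" for x y d
    using that
  proof (induction "nat (x + y)" arbitrary: x y d rule: less_induct)
    case less
    show ?case
    proof (cases "(x, y) = (1, 1)")
      case True then show ?thesis using vertex[OF one_one(1) less.prems(2), of "(0, -1)"] by (simp add: dirs_def)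
    next
      case False
      obtain d1 x' y' d' where s: "d1 \<in> dirs" "(x', y') \<in> Gd" "d' \<in> dirs" "mt (Half (x, y) d1) = Half (x', y') d'"
        "x' + y' < x + y" by (rule descent[OF less.prems(1) False])
      have "0 < x + y" using less.prems(1) unfolding Gd_iff R_iff by linarith
      then have "\<chi> (Half (x', y') d') = \<chi> ?o" using less.hyps[OF _ s(2,3)] s(5) by simp
      then have "\<chi> (Half (x, y) d1) = \<chi> ?o" using inv[OF grid_H[OF less.prems(1) s(1)]] s(4) by metis
      then show ?thesis using vertex[OF less.prems(1,2) s(1)] by blast
    qed
  qed
  have all: "\<chi> h = \<chi> ?o" if hH: "h \<in> Hs" for h
  proof (cases "h \<in> Xs")
    case False
    then obtain p d where "h = Half p d" "p \<in> Gd" "d \<in> dirs" using H_grid hH by blast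
    then show ?thesis using grid by (cases p) metis
  next
    case True
    have "mt h \<in> Hs - Xs" using H_mate(1,3)[OF hH] True by blast
    then obtain p d where "mt h = Half p d" "p \<in> Gd" "d \<in> dirs" using H_grid by blast
    then have "\<chi> (mt h) = \<chi> ?o" using grid by (cases p) metis
    then show ?thesis using inv[OF hH] by blast
  qed
  show ?thesis using all hg by blast
qed

end

text \<open>A cycle is the boundary of a set of faces: extended by zero to the edges of the full rectangle, it
  is crossed an even number of times by every closed lattice path, so counting crossings from the
  bottom-left corner is well defined.\<close>

locale dihedral_cycle = dihedral +
  fixes C :: "half set"
  assumes C_sub: "C \<subseteq> Hs" and C_mate: "\<And>h. h \<in> C \<Longrightarrow> mt h \<in> C"
    and C_even: "\<And>h. h \<in> Hs - Xs \<Longrightarrow> even (card (C \<inter> vertex_of FK h))"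
begin

text \<open>The extension of the cycle to the unit edges of the lattice: those on a strand of
  \<open>C\<close> are crossed, dead edges and those on other strands are not.\<close>

definition crossed :: "int \<times> int \<Rightarrow> int \<times> int \<Rightarrow> bool" where
  "crossed p d \<longleftrightarrow> (\<exists>h\<in>C. lies h (p + d, d))"

lemma ct_sym: "crossed (p + d) (- d) \<longleftrightarrow> crossed p d"
proof -
  have *: "crossed (p + d) (- d)" if c: "crossed p d" for p d
  proof -
    obtain h where h: "h \<in> C" "lies h (p + d, d)" using c unfolding crossed_def by blast
    have "lies (mt h) (p + d + - d, - d)" using lies_mate_rev[OF h(2)] by simp
    then show ?thesis unfolding crossed_def using C_mate[OF h(1)] by blast
  qed
  show ?thesis using *[of p d] *[of "p + d" "- d"] by auto
qed

lemma ct_half: assumes "p \<notin> Rm" "d \<in> dirs" shows "crossed p d \<longleftrightarrow> Half p d \<in> C"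
proof
  assume "crossed p d"
  then obtain h where h: "h \<in> C" "lies h (p + d, d)" unfolding crossed_def by blast
  have "h = Half p d" using lies_before[OF h(2)] assms(1) by simp
  then show "Half p d \<in> C" using h(1) by simp
next
  assume "Half p d \<in> C" then show "crossed p d" unfolding crossed_def using lies.start[OF assms] by blast
qed

lemma ct_opn: assumes "crossed p d" shows "opn p d"
proof -
  obtain h where h: "h \<in> C" "lies h (p + d, d)" using assms unfolding crossed_def by blast
  have "live h" by (rule H_form[of h]) (use h(1) C_sub in blast)+
  then show ?thesis using lies_live[OF h(2)] by simp
qed

text \<open>At a vertex this is the hypothesis on \<open>C\<close>. In a removed cell the strand
  occupies both live directions, and dead directions carry nothing.\<close>

lemma ct_even:
  assumes "p \<in> R" shows "(crossed p (0, -1) = crossed p (1, 0)) = (crossed p (0, 1) = crossed p (-1, 0))"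
proof (cases "p \<in> Rm")
  case False
  then have G: "p \<in> Gd" using assms Gd_iff by blast
  have d: "(0, -1) \<in> dirs" "(1, 0) \<in> dirs" "(0, 1) \<in> dirs" "(-1, 0) \<in> dirs" by (simp_all add: dirs_def)
  let ?h = "Half p (0, -1)"
  have c: "ccw FK ?h = Half p (1, 0)" "ccw FK (Half p (1, 0)) = Half p (0, 1)" "ccw FK (Half p (0, 1)) = Half p (-1, 0)"
    "ccw FK (Half p (-1, 0)) = ?h"
    unfolding FK_simps(2) ccw_grid[OF G] by simp_all
  have "vertex_of FK ?h = {?h, Half p (1, 0), Half p (0, 1), Half p (-1, 0)}"
  proof
    have "(ccw FK ^^ n) ?h \<in> {?h, Half p (1, 0), Half p (0, 1), Half p (-1, 0)}" for n
      by (induction n) (auto simp: c simp del: FK_simps)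
    then show "vertex_of FK ?h \<subseteq> {?h, Half p (1, 0), Half p (0, 1), Half p (-1, 0)}" unfolding vertex_of_def by blast
    have "(ccw FK ^^ 0) ?h = ?h" "(ccw FK ^^ 1) ?h = Half p (1, 0)" "(ccw FK ^^ 2) ?h = Half p (0, 1)"
      "(ccw FK ^^ 3) ?h = Half p (-1, 0)"
      using c by (simp_all add: eval_nat_numeral del: FK_simps)
    then show "{?h, Half p (1, 0), Half p (0, 1), Half p (-1, 0)} \<subseteq> vertex_of FK ?h"
      unfolding vertex_of_def by (metis empty_subsetI insert_subset rangeI)
  qed
  moreover have "?h \<in> Hs - Xs" using grid_H[OF G d(1)] H_X[of ?h p "(0, -1)"] G by blast
  ultimately have "even (card (C \<inter> {?h, Half p (1, 0), Half p (0, 1), Half p (-1, 0)}))" using C_even by metis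
  then show ?thesis
    unfolding ct_half[OF False d(1)] ct_half[OF False d(2)] ct_half[OF False d(3)] ct_half[OF False d(4)]
    by (subst (asm) even_card_four) simp_all
next
  case True
  show ?thesis
  proof (cases "\<exists>d\<in>dirs. crossed p d")
    case False then show ?thesis by (simp add: dirs_def)
  next
    case ex: True
    then obtain d h where h: "d \<in> dirs" "h \<in> C" "lies h (p + d, d)" unfolding crossed_def by blast
    have "\<exists>d0. lies h (p + d - d, d0) \<and> p + d - d \<in> Rm \<and> rfl (p + d - d) d0 = d"
      using lies_inv[OF h(3)] True by simp
    then obtain d0 where d0: "lies h (p, d0)" "rfl p d0 = d" by auto
    have o: "d0 \<in> dirs" "opn p (- d0)" using live_opn[OF _ d0(1)] h(2) C_sub by blast+
    have c1: "crossed p d" using h unfolding crossed_def by blast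
    have "crossed (p - d0) d0" using h(2) d0(1) unfolding crossed_def by auto
    then have c2: "crossed p (- d0)" using ct_sym[of "p - d0" d0] by simp
    have iff: "crossed p e \<longleftrightarrow> e = - d0 \<or> e = d" if "e \<in> dirs" for e
      using ct_opn[of p e] opn_refl(3)[OF True o that] d0(2) c1 c2 by blast
    have ne: "d \<noteq> - d0" using opn_refl(2)[OF True o] d0(2) by blast
    have four: "crossed p (0, -1) \<longleftrightarrow> (0, -1) = - d0 \<or> (0, -1) = d" "crossed p (1, 0) \<longleftrightarrow> (1, 0) = - d0 \<or> (1, 0) = d"
      "crossed p (0, 1) \<longleftrightarrow> (0, 1) = - d0 \<or> (0, 1) = d" "crossed p (-1, 0) \<longleftrightarrow> (-1, 0) = - d0 \<or> (-1, 0) = d"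
      by (rule iff; simp add: dirs_def)+
    have "- d0 \<in> dirs" using o dirs_rot by blast
    then show ?thesis using h(1) ne unfolding four dirs_def by (elim insertE emptyE; simp)
  qed
qed

text \<open>Parity of the crossings on the way from the bottom-left cell straight up and from there
  to the right; \<open>(i, j)\<close> stands for the unit square with lower left corner at that
  lattice point.\<close>

definition cell_side :: "int \<Rightarrow> int \<Rightarrow> bool" where
  "cell_side i j \<longleftrightarrow> (even (card {x. 1 \<le> x \<and> x \<le> i \<and> crossed (x, j) (0, 1)}) =
    even (card {y. 1 \<le> y \<and> y \<le> j \<and> crossed (0, y) (1, 0)}))"

lemma xt_right: assumes "1 \<le> i" shows "cell_side (i - 1) j \<noteq> cell_side i j \<longleftrightarrow> crossed (i, j) (0, 1)"
  unfolding cell_side_def even_card_upto[OF assms, of "\<lambda>x. crossed (x, j) (0, 1)"] by blast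

text \<open>Independence of the way: the edges at a lattice point are crossed an even number of
  times in all, which carries the claim one column to the right.\<close>

lemma xt_up:
  assumes "0 \<le> i" "i \<le> Lx" "1 \<le> j" "j \<le> Ly" shows "cell_side i (j - 1) \<noteq> cell_side i j \<longleftrightarrow> crossed (i, j) (1, 0)"
  using assms(1,2)
proof (induction "nat i" arbitrary: i)
  case 0
  then have i: "i = 0" by simp
  have e: "{x. 1 \<le> x \<and> x \<le> (0 :: int) \<and> crossed (x, j') (0, 1)} = {}" for j' by auto
  show ?case unfolding i cell_side_def even_card_upto[OF assms(3), of "\<lambda>y. crossed (0, y) (1, 0)"] e by auto
next
  case (Suc n)
  have i: "1 \<le> i" using Suc(2) by linarith
  have IH: "cell_side (i - 1) (j - 1) \<noteq> cell_side (i - 1) j \<longleftrightarrow> crossed (i - 1, j) (1, 0)"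
    by (rule Suc(1)) (use Suc i in auto)
  have r: "cell_side (i - 1) (j - 1) \<noteq> cell_side i (j - 1) \<longleftrightarrow> crossed (i, j - 1) (0, 1)" "cell_side (i - 1) j \<noteq> cell_side i j \<longleftrightarrow> crossed (i, j) (0, 1)"
    by (rule xt_right[OF i])+
  have s: "crossed (i, j - 1) (0, 1) = crossed (i, j) (0, -1)" "crossed (i - 1, j) (1, 0) = crossed (i, j) (-1, 0)"
    using ct_sym[of "(i, j - 1)" "(0, 1)"] ct_sym[of "(i - 1, j)" "(1, 0)"] by simp_all
  have "(i, j) \<in> R" using i Suc.prems assms(3,4) R_iff by simp
  from ct_even[OF this] show ?case using IH r s by argo
qed

text \<open>The cell ahead and to the right of \<open>d\<close> at \<open>p\<close>; the divisions
  turn the four directions into offsets 0 or -1 of its lower left corner.\<close>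

definition chi :: "int \<times> int \<Rightarrow> int \<times> int \<Rightarrow> bool" where
  "chi p d = cell_side (fst p + (fst d + snd d - 1) div 2) (snd p + (snd d - fst d - 1) div 2)"

lemma chi_front: assumes "d \<in> dirs" shows "chi (p - d) d = chi p (rot d)"
  using assms by (cases rule: dirs_cases) (cases p; simp add: chi_def)+

lemma chi_turn: assumes "p \<in> R" "d \<in> dirs" shows "chi p d \<noteq> chi p (rot d) \<longleftrightarrow> crossed p (rot d)"
proof -
  obtain x y where p: "p = (x, y)" by (cases p)
  have r: "1 \<le> x" "x \<le> Lx" "1 \<le> y" "y \<le> Ly" using assms(1) unfolding p R_iff by auto
  have s: "crossed (x, y - 1) (0, 1) = crossed (x, y) (0, -1)" "crossed (x - 1, y) (1, 0) = crossed (x, y) (-1, 0)"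
    using ct_sym[of "(x, y - 1)" "(0, 1)"] ct_sym[of "(x - 1, y)" "(1, 0)"] by simp_all
  have u: "cell_side x (y - 1) \<noteq> cell_side x y \<longleftrightarrow> crossed (x, y) (1, 0)" "cell_side (x - 1) (y - 1) \<noteq> cell_side (x - 1) y \<longleftrightarrow> crossed (x - 1, y) (1, 0)"
    by (rule xt_up; use r in simp)+
  have v: "cell_side (x - 1) y \<noteq> cell_side x y \<longleftrightarrow> crossed (x, y) (0, 1)" "cell_side (x - 1) (y - 1) \<noteq> cell_side x (y - 1) \<longleftrightarrow> crossed (x, y - 1) (0, 1)"
    by (rule xt_right[OF r(1)])+
  from assms(2) show ?thesis
    by (cases rule: dirs_cases; use u v s in \<open>simp add: chi_def p\<close>; blast?)
qed

fun side :: "half \<Rightarrow> bool" where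
  "side (Half p d) = chi p d" | "side (Mid p d) = False"

text \<open>The edges that a strand leaves aside in a removed cell are dead and hence uncrossed, so
  the cells along its right all have one value.\<close>

lemma side_lies: assumes "h \<in> Hs" "lies h (p, d)" shows "chi p (rot d) = side h"
proof -
  have "chi (fst s) (rot (snd s)) = side h" if "lies h s" "h \<in> Hs" for h s
    using that
  proof (induction rule: lies.induct)
    case (start q d)
    then show ?case using chi_front[OF start(2), of "q + d"] by simp
  next
    case (step h p d)
    have o: "d \<in> dirs" "opn p (- d)" using live_opn[OF step(4,1)] by blast+
    have dr: "rot d \<in> dirs" "- rot d \<in> dirs" using o dirs_rot by blast+
    let ?e = "rfl p d"
    have pR: "p \<in> R" using step(2) Rm_R by blast
    have eD: "?e \<in> dirs" by (rule refl_dirs[OF o(1)])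
    have e: "?e \<in> {d, rot d, - rot d}"
      using eD dirs_four[OF o(1)] opn_refl(2)[OF step(2) o] by auto
    have no: "\<not> crossed p d'" if "d' \<in> dirs" "d' \<noteq> - d" "d' \<noteq> ?e" for d'
      using ct_opn[of p d'] opn_refl(3)[OF step(2) o that(1)] that by blast
    have ds: "distinct [d, - d, rot d, - rot d]" by (rule dirs_distinct[OF o(1)])
    have c1: "chi p d = chi p (rot d)" if "?e \<noteq> rot d"
      using chi_turn[OF pR o(1)] no[OF dr(1)] that ds by auto
    have c2: "chi p (- rot d) = chi p d" if "?e \<noteq> d"
      using chi_turn[OF pR dr(2)] no[OF o(1)] that ds by auto
    have "chi p ?e = chi p (rot d)"
      using e
    proof (elim insertE emptyE)
      assume e: "?e = d"
      then have "?e \<noteq> rot d" using ds by auto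
      then show ?thesis using c1 e by simp
    next
      assume e: "?e = - rot d"
      then have "?e \<noteq> d" "?e \<noteq> rot d" using ds by auto
      then show ?thesis using c1 c2 e by simp
    qed simp
    then show ?case using chi_front[OF eD, of "p + ?e"] step(3,4) by simp
  qed
  from this[OF assms(2,1)] show ?thesis by simp
qed

lemma side_mate:
  assumes h: "h \<in> Hs" and m: "mt h \<notin> Xs"
  shows "side (ccw FK (mt h)) = side h" "side (mt h) \<noteq> side h \<longleftrightarrow> h \<in> C"
proof -
  obtain q e where q: "h = Half q e" "e \<in> dirs" "q \<notin> Rm" by (rule H_form[OF h])
  have "lies h (q + e, e)" unfolding q(1) by (rule lies.start[OF q(3,2)])
  then obtain p d where p: "lies h (p, d)" "p \<notin> Rm" "d \<in> dirs" "mt h = Half p (- d)" by (rule lies_end)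
  have G: "p \<in> Gd" using H_X[OF H_mate(1)[OF h] p(4)] m by blast
  have s: "chi p (rot d) = side h" by (rule side_lies[OF h p(1)])
  show "side (ccw FK (mt h)) = side h" unfolding FK_simps(2) p(4) ccw_grid[OF G] using s by simp
  have dr: "rot d \<in> dirs" "- d \<in> dirs" using p(3) dirs_rot by blast+
  have "p \<in> R" using G Gd_iff by blast
  then have "chi p (rot d) \<noteq> chi p (- d) \<longleftrightarrow> crossed p (- d)" using chi_turn[OF _ dr(1)] by simp
  moreover have "crossed p (- d) \<longleftrightarrow> mt h \<in> C" unfolding p(4) by (rule ct_half[OF p(2) dr(2)])
  moreover have "mt h \<in> C \<longleftrightarrow> h \<in> C" using C_mate H_mate(2)[OF h] by metis
  ultimately show "side (mt h) \<noteq> side h \<longleftrightarrow> h \<in> C" using s unfolding p(4) by auto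
qed

lemma bounds_side: "bounds FK C side"
proof -
  have "side (mt h) \<noteq> side h \<longleftrightarrow> h \<in> C" if h: "h \<in> Hs" for h
  proof (cases "mt h \<in> Xs")
    case False then show ?thesis by (rule side_mate(2)[OF h])
  next
    case True
    have m: "mt h \<in> Hs" "mt (mt h) = h" by (rule H_mate[OF h])+
    have "mt (mt h) \<notin> Xs" by (rule H_mate(3)[OF m(1) True])
    from side_mate(2)[OF m(1) this] have "side h \<noteq> side (mt h) \<longleftrightarrow> mt h \<in> C" using m(2) by metis
    then show ?thesis using C_mate[of h] C_mate[of "mt h"] m(2) by metis
  qed
  then show ?thesis unfolding bounds_def FK_simps(3) using side_mate(1) by blast
qed

end

section \<open>Domains of the first kind are plane domains\<close>

context dihedral begin

lemma fs_pow_inj: "x \<in> Hs \<Longrightarrow> y \<in> Hs \<Longrightarrow> (fs ^^ i) x = (fs ^^ i) y \<Longrightarrow> x = y"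
proof (induction i)
  case (Suc i)
  then have "fs ((fs ^^ i) x) = fs ((fs ^^ i) y)" by (simp del: FK_simps)
  then have "(fs ^^ i) x = (fs ^^ i) y" by (rule fs_inj[OF fs_pow_H[OF Suc.prems(1)] fs_pow_H[OF Suc.prems(2)]])
  then show ?case using Suc by blast
qed simp

lemma finite_H: "finite Hs"
proof -
  have "grid_halves Lx Ly a \<subseteq> (\<lambda>(p, d). Half p d) ` (R \<times> dirs)"
    unfolding grid_halves_def dirs_def using Gd_iff by (auto 0 3)
  moreover have "finite R" "finite dirs" unfolding rectangle_def dirs_def by simp_all
  ultimately show ?thesis unfolding FK_simps(1) using finite_subset by blast
qed

text \<open>An inner face avoids the external vertices, so its plain orbit coincides with that of
  \<open>face_step\<close>. Among \<open>k + 1\<close> iterates two agree, and injectivity cancels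
  their common part.\<close>

lemma inner_face_period:
  assumes h: "h \<in> Hs" and inner: "inner_face FK (face_of FK h)" and k: "card (face_of FK h) \<le> k"
  shows "\<exists>n\<in>{1..k}. (fs ^^ n) h = h" "(fs ^^ n) h \<notin> Xs"
proof -
  let ?G = "ccw FK \<circ> mate FK"
  have G: "(?G ^^ n) h \<in> face_of FK h" for n unfolding face_of_def by (rule rangeI)
  have notX: "(?G ^^ n) h \<notin> Xs" for n using inner G[of n] unfolding inner_face_def by blast
  have eq: "(?G ^^ n) h = (fs ^^ n) h" for n
  proof (induction n)
    case (Suc n)
    let ?y = "(fs ^^ n) h"
    have s: "(?G ^^ Suc n) h = ccw FK (mt ?y)" using Suc unfolding FK_simps(3) funpow.simps comp_apply by metis
    then have n: "ccw FK (mt ?y) \<notin> Xs" using notX[of "Suc n"] by metis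
    have "mt ?y \<notin> Xs"
    proof
      assume X: "mt ?y \<in> Xs"
      then have "ccw FK (mt ?y) = mt ?y" unfolding FK_simps(2) by (rule ccw_ext)
      then show False using n X by metis
    qed
    then have "fs ?y = ccw FK (mt ?y)" unfolding fs_eq turn_def by (rule if_not_P)
    moreover have "(fs ^^ Suc n) h = fs ?y" unfolding funpow.simps comp_apply ..
    ultimately show ?case using s by metis
  qed simp
  show "(fs ^^ n) h \<notin> Xs" using notX[of n] eq[of n] by metis
  have face: "face_of FK h = range (\<lambda>n. (fs ^^ n) h)" unfolding face_of_def eq ..
  have fin: "finite (face_of FK h)" unfolding face
    by (rule finite_subset[OF image_subsetI finite_H]) (rule fs_pow_H[OF h])
  have "card ((\<lambda>n. (fs ^^ n) h) ` {..k}) \<le> card (face_of FK h)" 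
    by (rule card_mono[OF fin]) (unfold face, rule image_mono, rule subset_UNIV)
  then have "\<not> inj_on (\<lambda>n. (fs ^^ n) h) {..k}" using card_image[of "\<lambda>n. (fs ^^ n) h" "{..k}"] k by (metis Suc_n_not_le_n card_atMost le_trans)
  then obtain i j where "i \<le> k" "j \<le> k" "i \<noteq> j" "(fs ^^ i) h = (fs ^^ j) h" unfolding inj_on_def atMost_iff by blast
  then obtain i j where ij: "i < j" "j \<le> k" "(fs ^^ i) h = (fs ^^ j) h" by (metis linorder_neqE_nat)
  have "(fs ^^ j) h = (fs ^^ i) ((fs ^^ (j - i)) h)" 
    using funpow_add[of i "j - i" fs] ij(1) by (simp del: FK_simps)
  then have "h = (fs ^^ (j - i)) h" using fs_pow_inj[OF h fs_pow_H[OF h], of i "j - i"] ij(3) by metis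
  then show "\<exists>n\<in>{1..k}. (fs ^^ n) h = h" using ij by (intro bexI[of _ "j - i"]) auto
qed

lemma hpar_ccw: assumes "h \<in> Hs - Xs" shows "hpar (ccw FK h) \<longleftrightarrow> \<not> hpar h"
proof -
  obtain p d where h: "h = Half p d" "p \<in> Gd" "d \<in> dirs" by (rule H_grid[OF assms])
  obtain x y where p: "p = (x, y)" by (cases p)
  from h(3) show ?thesis using h(2) unfolding FK_simps(2) h(1) p by (cases rule: dirs_cases) simp_all
qed

lemma FK_corner: "ccw FK (mt (ext FK (2 * nb))) = mt (ext FK 1)"
proof -
  have "mt (Half (0, 1) (1, 0)) = Half (1, 1) (-1, 0)" "mt (Half (1, 0) (0, 1)) = Half (1, 1) (0, -1)"
    using grid_ext_mate[OF one_one(1), of "(1, 0)"] grid_ext_mate[OF one_one(1), of "(0, 1)"]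
    by (simp_all add: dirs_def R_iff del: first_mate.simps)
  then show ?thesis unfolding ext_first ext_last FK_simps(2) using ccw_grid[OF one_one(1), of "(-1, 0)"] by (simp del: first_mate.simps first_ccw.simps)
qed

lemma FK_puncture: "puncture_ok FK"
proof -
  have q: "\<forall>h\<in>Hs - Xs. quartic FK h" using H_grid quartic_grid by metis
  let ?M = "first_kind_map Lx Ly a"
  let ?S = "small_face_halves ?M"
  have pu: "puncture FK = (if ?S = {} then Unpunctured else In_Face (SOME h. h \<in> ?S))"
    by (simp add: first_kind_def Let_def)
  \<comment> \<open>Faces do not depend on the puncture field, so they are the same before and after
    it is set.\<close>
  have S: "h \<in> Hs \<and> inner_face FK (face_of FK h) \<and> card (face_of FK h) \<le> 2" if "h \<in> ?S" for h
    using that unfolding small_face_halves_def inner_face_def face_of_def ext_halves_def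
    by (simp add: first_kind_def first_kind_map_def Let_def)
  show ?thesis
  proof (cases "?S = {}")
    case True then show ?thesis unfolding puncture_ok_def pu using q by simp
  next
    case False
    define p where "p = (SOME h. h \<in> ?S)"
    have "p \<in> ?S" unfolding p_def using False by (simp add: some_in_eq)
    then have p: "p \<in> Hs" "inner_face FK (face_of FK p)" "card (face_of FK p) \<le> 2" using S by blast+
    obtain n where n: "n \<in> {1..2}" "(fs ^^ n) p = p" using inner_face_period(1)[OF p] by blast
    have "n = 1 \<or> n = 2" using n(1) by auto
    then have "fs (fs p) = p" using n(2) by (elim disjE; simp add: numeral_2_eq_2 del: FK_simps)
    moreover have "p \<notin> Xs" "fs p \<notin> Xs"
      using inner_face_period(2)[OF p, of 0] inner_face_period(2)[OF p, of 1] by (simp_all del: FK_simps)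
    moreover have "puncture FK = In_Face p" unfolding pu p_def using False by simp
    ultimately show ?thesis unfolding puncture_ok_def using q p(1) by (simp del: FK_simps)
  qed
qed

lemma FK_planar:
  assumes "C \<subseteq> Hs" "\<And>h. h \<in> C \<Longrightarrow> mt h \<in> C" "\<And>h. h \<in> Hs - Xs \<Longrightarrow> even (card (C \<inter> vertex_of FK h))"
  shows "\<exists>\<chi>. bounds FK C \<chi>"
proof -
  interpret dihedral_cycle Lx Ly a C by unfold_locales (use assms in blast)+
  show ?thesis using bounds_side by blast
qed

lemma FK_plane: "plane_domain FK hpar"
proof (rule plane_domain.intro)
  show "finite Hs" by (rule finite_H)
  show "mate FK h \<in> Hs" "mate FK (mate FK h) = h" if "h \<in> Hs" for h unfolding FK_simps(3) by (rule H_mate[OF that])+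
  show "ccw FK h \<in> Hs" if h: "h \<in> Hs" for h
  proof (cases "h \<in> Xs")
    case True then show ?thesis using ccw_ext h unfolding FK_simps(2) by metis
  next
    case False then show ?thesis using turn_H(1)[OF h] unfolding turn_def by (metis (full_types))
  qed
  show "1 \<le> nblack FK" unfolding FK_simps(4) by (rule nb_pos)
  show "ext FK j \<in> Hs" if "j \<in> {1..2 * nblack FK}" for j using X_sub_H[OF ext_X] that unfolding FK_simps(4) by blast
  show "inj_on (ext FK) {1..2 * nblack FK}" unfolding FK_simps(4) by (rule inj_ext)
  show "ccw FK h = h" if "h \<in> Xs" for h unfolding FK_simps(2) by (rule ccw_ext[OF that])
  show "quartic FK (mate FK h)" if h: "h \<in> Xs" for h
  proof -
    have "mt h \<in> Hs - Xs" using H_mate(1,3)[OF X_sub_H[OF h]] h by blast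
    then show ?thesis unfolding FK_simps(3) using H_grid quartic_grid by metis
  qed
  show "quartic FK h \<or> bivalent FK h" if "h \<in> Hs - Xs" for h using that H_grid quartic_grid by metis
  show "hpar (mate FK h) \<longleftrightarrow> \<not> hpar h" if h: "h \<in> Hs" for h
  proof -
    obtain q d where "h = Half q d" "d \<in> dirs" "q \<notin> Rm" "live h" by (rule H_form[OF h])
    then show ?thesis unfolding FK_simps(3) using hpar_mate by metis
  qed
  show "hpar (ccw FK h) \<longleftrightarrow> \<not> hpar h" if "h \<in> Hs - Xs" for h by (rule hpar_ccw[OF that])
  show "ccw FK (mate FK (ext FK j)) = mate FK (ext FK (next_ext FK j)) \<or>
      ccw FK (mate FK (ccw FK (mate FK (ext FK j)))) = mate FK (ext FK (next_ext FK j))"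
    if "j \<in> {1..2 * nblack FK}" for j
    using FK_boundary_face[of j] that unfolding FK_simps(3,4) by blast
  show "\<exists>n\<in>{1..4}. (fs ^^ n) h = h" if "h \<in> Hs" for h by (rule face_short[OF that])
  show "ccw FK (mate FK (ext FK (2 * nblack FK))) = mate FK (ext FK 1)" unfolding FK_simps(3,4) by (rule FK_corner)
  show "\<chi> g = \<chi> h" if "\<And>h. h \<in> Hs \<Longrightarrow> \<chi> (mate FK h) = \<chi> h \<and> \<chi> (ccw FK h) = \<chi> h" "h \<in> Hs" "g \<in> Hs"
    for \<chi> :: "half \<Rightarrow> bool" and h g
    by (rule FK_connected[OF that(1)[unfolded FK_simps(3)] that(2,3)])
  show "\<exists>\<chi>. bounds FK C \<chi>" if "C \<subseteq> Hs" "\<And>h. h \<in> C \<Longrightarrow> mate FK h \<in> C"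
    "\<And>h. h \<in> Hs - Xs \<Longrightarrow> even (card (C \<inter> vertex_of FK h))" for C
    by (rule FK_planar[OF that(1) that(2)[unfolded FK_simps(3)] that(3)])
  show "puncture_ok FK" by (rule FK_puncture)
qed

end

section \<open>Subdividing an edge between faces of at most three sides\<close>

locale subdivision = plane_domain +
  fixes h :: half
  assumes hH: "h \<in> H"
    and fresh: "mid h \<notin> H" "mid (m h) \<notin> H" "mid h \<noteq> mid (m h)"
    and par_mid: "par (mid h) \<longleftrightarrow> \<not> par h" "par (mid (m h)) \<longleftrightarrow> \<not> par (m h)"
    and all_quartic: "\<And>x. x \<in> H - X \<Longrightarrow> quartic \<Lambda> x"
    and inner: "\<And>n x. x \<in> {h, m h} \<Longrightarrow> (f ^^ n) x \<notin> X"
    and period3: "\<And>x. x \<in> {h, m h} \<Longrightarrow> \<exists>n\<in>{1..3}. (f ^^ n) x = x"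
begin

abbreviation "g \<equiv> m h"
abbreviation "a \<equiv> mid h"
abbreviation "b \<equiv> mid g"
abbreviation "\<Lambda>' \<equiv> subdivide \<Lambda> h"

lemma gH: "g \<in> H" "m g = h" "g \<noteq> h" "h \<notin> X" "g \<notin> X" "par g \<longleftrightarrow> \<not> par h"
  using mate_in[OF hH] mate_mate[OF hH] par_mate[OF hH] inner[of h 0] inner[of g 0] by auto

lemma fresh_ne: "a \<noteq> h" "a \<noteq> g" "b \<noteq> h" "b \<noteq> g" "h \<noteq> a" "g \<noteq> a" "h \<noteq> b" "g \<noteq> b" "b \<noteq> a"
  using fresh hH gH(1) by auto

lemma sub_simps:
  "half_edges \<Lambda>' = H \<union> {a, b}" "ccw \<Lambda>' = c(a := b, b := a)" "mate \<Lambda>' = m(h := a, a := h, g := b, b := g)"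
  "nblack \<Lambda>' = N" "ext \<Lambda>' = e" "puncture \<Lambda>' = At_Vertex a" "next_ext \<Lambda>' = nx" "ext_halves \<Lambda>' = X"
  "prev_ext \<Lambda>' = prev_ext \<Lambda>"
  by (auto simp: subdivide_def Let_def next_ext_def ext_halves_def prev_ext_def fun_eq_iff)

lemma c_old: "z \<in> H \<Longrightarrow> ccw \<Lambda>' z = c z"
  using fresh unfolding sub_simps by auto

lemma c_new: "ccw \<Lambda>' a = b" "ccw \<Lambda>' b = a"
  using fresh_ne unfolding sub_simps by auto

lemma m_old: "z \<in> H \<Longrightarrow> z \<noteq> h \<Longrightarrow> z \<noteq> g \<Longrightarrow> mate \<Lambda>' z = m z"
  using fresh unfolding sub_simps by auto

lemma m_new: "mate \<Lambda>' h = a" "mate \<Lambda>' a = h" "mate \<Lambda>' g = b" "mate \<Lambda>' b = g"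
  using fresh_ne gH(3) unfolding sub_simps by auto

lemma m_ne: assumes "z \<in> H" "z \<noteq> h" "z \<noteq> g" shows "m z \<in> H" "m z \<noteq> h" "m z \<noteq> g"
  using assms mate_in mate_mate gH(2) by metis+

lemma new_notX: "a \<notin> X" "b \<notin> X"
  using fresh X_sub by blast+

lemma H_split: assumes "z \<in> half_edges \<Lambda>'" obtains "z = a" | "z = b" | "z = h" | "z = g" | "z \<in> H" "z \<noteq> h" "z \<noteq> g"
  using assms unfolding sub_simps by blast

lemma X_old: assumes "z \<in> X" shows "z \<in> H" "z \<noteq> h" "z \<noteq> g" "mate \<Lambda>' z = m z"
proof -
  show *: "z \<in> H" "z \<noteq> h" "z \<noteq> g" using assms X_sub gH(4,5) by blast+
  show "mate \<Lambda>' z = m z" by (rule m_old[OF *])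
qed

lemma turn_old: "z \<in> H \<Longrightarrow> turn \<Lambda>' z = turn \<Lambda> z"
  unfolding turn_def sub_simps(4,5,8,9) using c_old by simp

lemma f_old: "z \<in> H \<Longrightarrow> z \<noteq> h \<Longrightarrow> z \<noteq> g \<Longrightarrow> face_step \<Lambda>' z = f z"
  unfolding face_step_def using m_old turn_old mate_in by metis

lemma f_new:
  "face_step \<Lambda>' h = b" "face_step \<Lambda>' b = f h" "face_step \<Lambda>' g = a" "face_step \<Lambda>' a = f g"
proof -
  show "face_step \<Lambda>' h = b" "face_step \<Lambda>' g = a"
    using new_notX c_new unfolding face_step_def m_new turn_def sub_simps(8) by simp_all
  show "face_step \<Lambda>' b = f h" unfolding face_step_def m_new by (rule turn_old[OF gH(1)])
  show "face_step \<Lambda>' a = f g" unfolding face_step_def m_new gH(2) by (rule turn_old[OF hH])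
qed

abbreviation "f' \<equiv> face_step \<Lambda>'"

lemma f_pow_in: "z \<in> H \<Longrightarrow> (f ^^ n) z \<in> H"
  using f_in by (induction n) simp_all

lemma f_pow_par: "z \<in> H \<Longrightarrow> par ((f ^^ n) z) = par z"
  using par_f f_pow_in by (induction n) simp_all

text \<open>The new vertex inserts one side directly after \<open>z\<close>, so all later points of
  the orbit are reached one step later and the period grows by one.\<close>

lemma split_orbit:
  assumes z: "z \<in> {h, g}"
  obtains n where "n \<in> {1..3}" "(f ^^ n) z = z" "(f' ^^ Suc n) z = z"
    "\<forall>k. 1 \<le> k \<and> k \<le> n \<longrightarrow> (f' ^^ Suc k) z = (f ^^ k) z"
proof -
  define n where "n = (LEAST n. 1 \<le> n \<and> (f ^^ n) z = z)"
  obtain n0 where n0: "n0 \<in> {1..3}" "(f ^^ n0) z = z" using period3[OF z] by blast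
  have ex: "1 \<le> n0 \<and> (f ^^ n0) z = z" using n0 by simp
  have n: "1 \<le> n" "(f ^^ n) z = z" using LeastI[of "\<lambda>n. 1 \<le> n \<and> (f ^^ n) z = z", OF ex] unfolding n_def by blast+
  have "n \<le> n0" unfolding n_def by (rule Least_le) (rule ex)
  then have n3: "n \<in> {1..3}" using n0(1) n(1) by simp
  have least: "(f ^^ k) z \<noteq> z" if "1 \<le> k" "k < n" for k
    using not_less_Least[of k "\<lambda>n. 1 \<le> n \<and> (f ^^ n) z = z"] that unfolding n_def by blast
  have xH: "z \<in> H" using z hH gH(1) by blast
  \<comment> \<open>The opposite half of the subdivided edge has the other parity and so lies on
    another face: only one side is inserted.\<close>
  have other: "(f ^^ k) z \<notin> {h, g} - {z}" for k
    using f_pow_par[OF xH, of k] z gH(6) by auto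
  have two: "f' (f' z) = f z" using z f_new by auto
  have k: "(f' ^^ Suc k) z = (f ^^ k) z" if "1 \<le> k" "k \<le> n" for k
    using that
  proof (induction k rule: dec_induct)
    case base then show ?case using two by simp
  next
    case (step k)
    have "(f ^^ k) z \<noteq> h" "(f ^^ k) z \<noteq> g" using other[of k] least[OF step(1)] step(4) z by auto
    then have "f' ((f ^^ k) z) = f ((f ^^ k) z)" using f_old[OF f_pow_in[OF xH]] by blast
    moreover have "(f' ^^ Suc k) z = (f ^^ k) z" using step(3,4) by simp
    moreover have "(f' ^^ Suc (Suc k)) z = f' ((f' ^^ Suc k) z)" "(f ^^ Suc k) z = f ((f ^^ k) z)" by simp_all
    ultimately show ?case by metis
  qed
  have "(f' ^^ Suc n) z = z" using k[OF n(1)] n(2) by simp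
  from that[OF n3 n(2) this] k show thesis by blast
qed

lemma pow_period: "(F ^^ n) z = z \<Longrightarrow> (F ^^ n) ((F ^^ k) z) = (F ^^ k) z"
  by (metis add.commute comp_apply funpow_add)

lemma sub_period: assumes z: "z \<in> half_edges \<Lambda>'" shows "\<exists>n\<in>{1..4}. (f' ^^ n) z = z"
proof -
  have orbit: "\<exists>n\<in>{1..4}. (f' ^^ n) ((f' ^^ k) y) = (f' ^^ k) y" if "y \<in> {h, g}" for y k
  proof -
    obtain n where n: "n \<in> {1..3}" "(f' ^^ Suc n) y = y" using split_orbit[OF \<open>y \<in> {h, g}\<close>] by metis
    have "(f' ^^ Suc n) ((f' ^^ k) y) = (f' ^^ k) y" by (rule pow_period[OF n(2)])
    then show ?thesis using n(1) by (intro bexI[of _ "Suc n"]) simp_all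
  qed
  show ?thesis
  proof (cases "z \<in> H")
    case False
    then have "z = a \<or> z = b" using z unfolding sub_simps by blast
    then show ?thesis using orbit[of h 1] orbit[of g 1] f_new by auto
  next
    case True
    show ?thesis
    proof (cases "\<exists>k. (f ^^ k) z \<in> {h, g}")
      case False
      have "(f' ^^ n) z = (f ^^ n) z" for n
      proof (induction n)
        case (Suc n)
        have "f' ((f ^^ n) z) = f ((f ^^ n) z)" using f_old[OF f_pow_in[OF True, of n]] False by blast
        then show ?case using Suc by simp
      qed simp
      then show ?thesis using face_period[OF True] by simp
    next
      case ex: True
      then obtain k where k: "(f ^^ k) z \<in> {h, g}" by blast
      let ?y = "(f ^^ k) z"
      obtain n where n: "n \<in> {1..3}" "(f ^^ n) ?y = ?y" "(f' ^^ Suc n) ?y = ?y"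
        "\<forall>k. 1 \<le> k \<and> k \<le> n \<longrightarrow> (f' ^^ Suc k) ?y = (f ^^ k) ?y" by (rule split_orbit[OF k])
      have "?y \<in> orb z" by (rule rangeI)
      then have "z \<in> orb ?y" using orb_eq[OF True] orb_self by metis
      then obtain i where i: "i < n" "z = (f ^^ i) ?y" using orb_period[OF n(2)] n(1) by auto
      show ?thesis
      proof (cases "i = 0")
        case True then show ?thesis using orbit[OF k, of 0] i by simp
      next
        case False
        then have "z = (f' ^^ Suc i) ?y" using n(4) i by simp
        then show ?thesis using orbit[OF k, of "Suc i"] by simp
      qed
    qed
  qed
qed

lemma quartic_old: assumes "quartic \<Lambda> z" "z \<in> H" shows "quartic \<Lambda>' z"
  using assms c_old ccw_in unfolding quartic_def by metis

lemma bivalent_new: "bivalent \<Lambda>' a" "bivalent \<Lambda>' b"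
  unfolding bivalent_def c_new using fresh(3) by auto

lemma sub_boundary_face:
  assumes j: "j \<in> J"
  shows "ccw \<Lambda>' (mate \<Lambda>' (e j)) = mate \<Lambda>' (e (nx j)) \<or>
    ccw \<Lambda>' (mate \<Lambda>' (ccw \<Lambda>' (mate \<Lambda>' (e j)))) = mate \<Lambda>' (e (nx j))"
proof -
  have E: "e j \<in> X" "e (nx j) \<in> X" using e_inX j nx_in by blast+
  have ms: "mate \<Lambda>' (e j) = m (e j)" "mate \<Lambda>' (e (nx j)) = m (e (nx j))" using X_old(4) E by blast+
  have mH: "m (e j) \<in> H" using mate_in[OF X_old(1)[OF E(1)]] .
  let ?y = "c (m (e j))"
  have y: "?y \<in> H" by (rule ccw_in[OF mH])
  from j show ?thesis
  proof (cases rule: boundary_cases)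
    case two then show ?thesis unfolding ms using c_old[OF mH] by metis
  next
    case three
    \<comment> \<open>This face touches the boundary, unlike those beside the subdivided edge, so
      its inner edge is not the subdivided one.\<close>
    have "(f ^^ 2) ?y \<in> X" using three E by (simp add: eval_nat_numeral)
    then have "?y \<noteq> h" "?y \<noteq> g" using inner[of h 2] inner[of g 2] by auto
    then have "mate \<Lambda>' ?y = m ?y" using m_old[OF y] by blast
    moreover have "m ?y \<in> H" by (rule mate_in[OF y])
    ultimately show ?thesis unfolding ms using c_old[OF mH] c_old[of "m ?y"] three(1) by metis
  qed
qed

text \<open>At the new vertex the cycle uses both half-edges or none, so it comes from a cycle of
  the original domain, whose bounding set of faces can be reused.\<close>

lemma sub_planar:
  assumes C: "C \<subseteq> half_edges \<Lambda>'" "\<And>x. x \<in> C \<Longrightarrow> mate \<Lambda>' x \<in> C"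
    "\<And>x. x \<in> half_edges \<Lambda>' - X \<Longrightarrow> even (card (C \<inter> vertex_of \<Lambda>' x))"
  shows "\<exists>\<chi>. bounds \<Lambda>' C \<chi>"
proof -
  have ha: "h \<in> C \<longleftrightarrow> a \<in> C" "g \<in> C \<longleftrightarrow> b \<in> C" using C(2) m_new by metis+
  have va: "vertex_of \<Lambda>' a = {a, b}"
  proof -
    have "(ccw \<Lambda>' ^^ n) a \<in> {a, b}" for n by (induction n) (auto simp: c_new)
    moreover have "(ccw \<Lambda>' ^^ 0) a = a" "(ccw \<Lambda>' ^^ 1) a = b" using c_new by simp_all
    then have "a \<in> vertex_of \<Lambda>' a" "b \<in> vertex_of \<Lambda>' a" unfolding vertex_of_def by (metis rangeI)+
    ultimately show ?thesis unfolding vertex_of_def by blast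
  qed
  have "even (card (C \<inter> {a, b}))" using C(3)[of a] new_notX va unfolding sub_simps by auto
  moreover have "C \<inter> {a, b} = {x \<in> {a, b}. x \<in> C}" by blast
  ultimately have "card {x \<in> {a, b}. x \<in> C} \<noteq> 1" by auto
  then have ab: "a \<in> C \<longleftrightarrow> b \<in> C" using card_filter_two[OF fresh(3), of "\<lambda>x. x \<in> C"] by blast
  define D where "D = C \<inter> H"
  have "m x \<in> D" if xD: "x \<in> D" for x
  proof -
    have x: "x \<in> C" "x \<in> H" using xD unfolding D_def by blast+
    show ?thesis
    proof (cases "x = h \<or> x = g")
      case True then show ?thesis using x ha ab gH(1,2) hH unfolding D_def by auto
    next
      case False then show ?thesis using C(2)[OF x(1)] m_old[OF x(2)] mate_in[OF x(2)] unfolding D_def by auto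
    qed
  qed
  moreover have "even (card (D \<inter> vertex_of \<Lambda> x))" if xH: "x \<in> H - X" for x
  proof -
    have pow: "(c ^^ n) x \<in> H \<and> (ccw \<Lambda>' ^^ n) x = (c ^^ n) x" for n
      using xH c_old ccw_in by (induction n) auto
    then have "vertex_of \<Lambda>' x = vertex_of \<Lambda> x" "vertex_of \<Lambda> x \<subseteq> H" unfolding vertex_of_def by auto
    then have "D \<inter> vertex_of \<Lambda> x = C \<inter> vertex_of \<Lambda>' x" unfolding D_def by blast
    moreover have "x \<in> half_edges \<Lambda>' - X" using xH unfolding sub_simps by blast
    ultimately show ?thesis using C(3) by metis
  qed
  moreover have "D \<subseteq> H" unfolding D_def by blast
  ultimately obtain \<chi> where \<chi>: "bounds \<Lambda> D \<chi>" using planar[of D] by blast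
  have b1: "\<chi> (c (m x)) = \<chi> x" if "x \<in> H" "m x \<notin> X" for x using \<chi> that unfolding bounds_def by blast
  have b2: "\<chi> (m x) \<noteq> \<chi> x \<longleftrightarrow> x \<in> D" if "x \<in> H" for x using \<chi> that unfolding bounds_def by blast
  \<comment> \<open>\<open>a\<close> runs along the edge in the direction of \<open>g\<close>, and
    \<open>b\<close> in that of \<open>h\<close>; each takes over the face on its right.\<close>
  define \<xi> where "\<xi> = \<chi>(a := \<chi> g, b := \<chi> h)"
  have old: "\<xi> x = \<chi> x" if "x \<in> H" for x using fresh that unfolding \<xi>_def by auto
  have new: "\<xi> a = \<chi> g" "\<xi> b = \<chi> h" unfolding \<xi>_def using fresh(3) by auto
  have hg: "\<xi> h = \<chi> h" "\<xi> g = \<chi> g" using old hH gH(1) by blast+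
  have cg: "\<xi> (ccw \<Lambda>' g) = \<chi> h" "\<xi> (ccw \<Lambda>' h) = \<chi> g"
    using b1[OF hH gH(5)] b1[OF gH(1)] gH(2,4) c_old[OF hH] c_old[OF gH(1)] old ccw_in[OF hH] ccw_in[OF gH(1)] by auto
  have D: "h \<in> D \<longleftrightarrow> h \<in> C" "g \<in> D \<longleftrightarrow> g \<in> C" unfolding D_def using hH gH(1) by blast+
  have cross: "\<chi> g \<noteq> \<chi> h \<longleftrightarrow> h \<in> C" using b2[OF hH] D by blast
  have "\<xi> (ccw \<Lambda>' (mate \<Lambda>' x)) = \<xi> x" if xH: "x \<in> half_edges \<Lambda>'" and mx: "mate \<Lambda>' x \<notin> X" for x
    using xH
  proof (cases rule: H_split)
    case 5
    have "m x \<in> H" by (rule mate_in[OF 5(1)])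
    then show ?thesis using b1[OF 5(1)] mx m_old[OF 5] c_old[of "m x"] old ccw_in[of "m x"] 5(1) by simp
  qed (simp_all add: m_new c_new new hg cg)
  moreover have "\<xi> (mate \<Lambda>' x) \<noteq> \<xi> x \<longleftrightarrow> x \<in> C" if xH: "x \<in> half_edges \<Lambda>'" for x
    using xH
  proof (cases rule: H_split)
    case 5
    have "m x \<in> H" by (rule mate_in[OF 5(1)])
    then show ?thesis using b2[OF 5(1)] m_old[OF 5] old 5(1) unfolding D_def by auto
  qed (use m_new new hg cross ha ab in auto)
  ultimately show ?thesis unfolding bounds_def sub_simps(8) by blast
qed

lemma sub_plane: "plane_domain \<Lambda>' par"
proof (rule plane_domain.intro, unfold sub_simps(4,5,7,8))
  show "finite (half_edges \<Lambda>')" unfolding sub_simps using finite_halves by simp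
  have HI: "x \<in> half_edges \<Lambda>'" if "x \<in> H \<or> x = a \<or> x = b" for x using that unfolding sub_simps by blast
  show "mate \<Lambda>' x \<in> half_edges \<Lambda>'" if "x \<in> half_edges \<Lambda>'" for x
    using that by (cases rule: H_split) (use m_new m_old mate_in hH gH(1) HI in auto)
  show "mate \<Lambda>' (mate \<Lambda>' x) = x" if "x \<in> half_edges \<Lambda>'" for x
    using that
  proof (cases rule: H_split)
    case 5 then show ?thesis using m_old[OF 5] m_old[OF m_ne[OF 5]] mate_mate by simp
  qed (simp_all add: m_new)
  show "ccw \<Lambda>' x \<in> half_edges \<Lambda>'" if "x \<in> half_edges \<Lambda>'" for x
    using that by (cases rule: H_split) (use c_new c_old ccw_in hH gH(1) HI in auto)
  show "1 \<le> N" by (rule nblack_pos)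
  show "e j \<in> half_edges \<Lambda>'" if "j \<in> J" for j using ext_in[OF that] HI by blast
  show "inj_on e J" by (rule inj_ext)
  show "ccw \<Lambda>' x = x" if "x \<in> X" for x using ccw_ext[OF that] c_old[OF X_sub[OF that]] by simp
  show "quartic \<Lambda>' (mate \<Lambda>' x)" if "x \<in> X" for x
    unfolding X_old(4)[OF that] by (rule quartic_old[OF quartic_mate_ext[OF that] mate_in[OF X_sub[OF that]]])
  show "quartic \<Lambda>' x \<or> bivalent \<Lambda>' x" if x: "x \<in> half_edges \<Lambda>' - X" for x
  proof (cases "x \<in> H")
    case True then show ?thesis using quartic_old[OF all_quartic] x by blast
  next
    case False then show ?thesis using x bivalent_new unfolding sub_simps by blast
  qed
  show "par (mate \<Lambda>' x) \<longleftrightarrow> \<not> par x" if "x \<in> half_edges \<Lambda>'" for x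
    using that by (cases rule: H_split) (use m_new m_old par_mate par_mid in auto)
  show "par (ccw \<Lambda>' x) \<longleftrightarrow> \<not> par x" if x: "x \<in> half_edges \<Lambda>' - X" for x
  proof (cases "x \<in> H")
    case True then show ?thesis using par_ccw[of x] c_old x by auto
  next
    case False then show ?thesis using x c_new par_mid gH(6) unfolding sub_simps(1) by auto
  qed
  show "ccw \<Lambda>' (mate \<Lambda>' (e j)) = mate \<Lambda>' (e (nx j)) \<or>
      ccw \<Lambda>' (mate \<Lambda>' (ccw \<Lambda>' (mate \<Lambda>' (e j)))) = mate \<Lambda>' (e (nx j))" if "j \<in> J" for j
    by (rule sub_boundary_face[OF that])
  show "\<exists>n\<in>{1..4}. (f' ^^ n) x = x" if "x \<in> half_edges \<Lambda>'" for x by (rule sub_period[OF that])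
  show "ccw \<Lambda>' (mate \<Lambda>' (e (2 * N))) = mate \<Lambda>' (e 1)"
  proof -
    have "e (2 * N) \<in> X" "e 1 \<in> X" using e_inX nblack_pos by auto
    then show ?thesis using X_old(4) corner c_old mate_in X_sub by metis
  qed
  show "\<chi> y = \<chi> x" if inv: "\<And>h. h \<in> half_edges \<Lambda>' \<Longrightarrow> \<chi> (mate \<Lambda>' h) = \<chi> h \<and> \<chi> (ccw \<Lambda>' h) = \<chi> h"
      and xy: "x \<in> half_edges \<Lambda>'" "y \<in> half_edges \<Lambda>'" for \<chi> :: "half \<Rightarrow> bool" and x y
  proof -
    have i: "h \<in> half_edges \<Lambda>'" "g \<in> half_edges \<Lambda>'" "a \<in> half_edges \<Lambda>'" using HI hH gH(1) by blast+
    have new: "\<chi> a = \<chi> h" "\<chi> b = \<chi> g" "\<chi> b = \<chi> a" using inv[OF i(1)] inv[OF i(2)] inv[OF i(3)] m_new c_new by auto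
    have old: "\<chi> (m z) = \<chi> z \<and> \<chi> (c z) = \<chi> z" if zH: "z \<in> H" for z
    proof -
      have "\<chi> (c z) = \<chi> z" using inv[OF HI] c_old[OF zH] zH by metis
      moreover have "\<chi> (m z) = \<chi> z"
      proof (cases "z = h \<or> z = g")
        case True then show ?thesis using new gH(2) by auto
      next
        case False then show ?thesis using inv[OF HI] m_old[OF zH] zH by metis
      qed
      ultimately show ?thesis by blast
    qed
    have "\<chi> z = \<chi> h" if zH: "z \<in> half_edges \<Lambda>'" for z
    proof (cases "z \<in> H")
      case True then show ?thesis using connected[OF old hH] by blast
    next
      case False then show ?thesis using zH new unfolding sub_simps(1) by auto
    qed
    then show ?thesis using xy by metis
  qed
  show "\<exists>\<chi>. bounds \<Lambda>' C \<chi>" if "C \<subseteq> half_edges \<Lambda>'" "\<And>h. h \<in> C \<Longrightarrow> mate \<Lambda>' h \<in> C"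
      "\<And>h. h \<in> half_edges \<Lambda>' - X \<Longrightarrow> even (card (C \<inter> vertex_of \<Lambda>' h))" for C
    by (rule sub_planar[OF that])
  show "puncture_ok \<Lambda>'"
  proof -
    have "a \<in> half_edges \<Lambda>' - X" using HI new_notX by blast
    moreover have "quartic \<Lambda>' x" if "x \<in> half_edges \<Lambda>' - X" "x \<notin> {a, b}" for x
      using that quartic_old[OF all_quartic] unfolding sub_simps(1) by blast
    ultimately show ?thesis unfolding puncture_ok_def sub_simps(6,8) using bivalent_new c_new by simp
  qed
qed

end

context dihedral begin

lemma subdivide_plane:
  assumes h: "h \<in> Hs" and faces: "\<forall>g\<in>edge_of FK h. inner_face FK (face_of FK g) \<and> card (face_of FK g) \<le> 3"
  shows "plane_domain (subdivide FK h) hpar"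
proof -
  interpret P: plane_domain FK hpar by (rule FK_plane)
  have mh: "mate FK h \<in> Hs" by (rule P.mate_in[OF h])
  have edge: "inner_face FK (face_of FK x)" "card (face_of FK x) \<le> 3" "x \<in> Hs" if "x \<in> {h, mate FK h}" for x
    using faces that h mh unfolding edge_of_def by blast+
  have form: "\<exists>p d. x = Half p d" if "x \<in> Hs" for x by (rule H_form[OF that]) blast
  have mid_fresh: "mid x \<notin> Hs" "hpar (mid x) \<longleftrightarrow> \<not> hpar x" if x: "x \<in> Hs" for x
  proof -
    obtain p d where e: "x = Half p d" using form[OF x] by blast
    show "mid x \<notin> Hs" using form[of "mid x"] e by auto
    show "hpar (mid x) \<longleftrightarrow> \<not> hpar x" unfolding e by (cases p; cases d) simp
  qed
  have "h \<noteq> mate FK h" using P.par_mate[OF h] by auto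
  then have ne: "mid h \<noteq> mid (mate FK h)" using form[OF h] form[OF mh] by auto
  interpret subdivision FK hpar h
  proof
    show "h \<in> Hs" by (rule h)
    show "mid h \<notin> Hs" "mid (mate FK h) \<notin> Hs" "mid h \<noteq> mid (mate FK h)" "hpar (mid h) \<longleftrightarrow> \<not> hpar h"
      "hpar (mid (mate FK h)) \<longleftrightarrow> \<not> hpar (mate FK h)" using mid_fresh h mh ne by blast+
    show "quartic FK x" if "x \<in> Hs - Xs" for x using that H_grid quartic_grid by metis
    show "(fs ^^ n) x \<notin> Xs" if "x \<in> {h, mate FK h}" for n x by (rule inner_face_period(2)[OF edge(3,1,2)[OF that]])
    show "\<exists>n\<in>{1..3}. (fs ^^ n) x = x" if "x \<in> {h, mate FK h}" for x by (rule inner_face_period(1)[OF edge(3,1,2)[OF that]])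
  qed
  show ?thesis by (rule sub_plane)
qed

end

theorem theorem3:
  fixes \<Lambda> :: fpl_domain and t :: complex
  assumes "dihedral_domain \<Lambda>"
  shows "Sym \<Lambda> (Psi' \<Lambda> t) = Sym \<Lambda> (Psi \<Lambda> t)"
  using assms
proof cases
  case (first Lx Ly a)
  interpret dihedral Lx Ly a by unfold_locales (rule first(2))
  show ?thesis unfolding first(1) by (rule plane_domain.symmetrised_refinement[OF FK_plane])
next
  case (second Lx Ly a \<Lambda>' h)
  interpret dihedral Lx Ly a by unfold_locales (rule second(2))
  have "plane_domain \<Lambda> hpar"
    unfolding second(1,3) by (rule subdivide_plane) (use second in simp_all)
  then show ?thesis by (rule plane_domain.symmetrised_refinement)
qed

end
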